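(* Let $\mathfrak a_m(\tau)=ma(\mathfrak a(\tau))$. Then $\mathfrak a_m(\tau)$ is alternal, and $dar^{-1}(\mathfrak a_m(\tau))$ is push-neutral in every depth $r>1$.
   Context: Let $\mathfrak f_2$ be the completed free Lie algebra over $\mathbb{Q}$ on $a,b$, $c_i=\mathrm{ad}(a)^{i-1}(b)$; by Lazard elimination $\mathfrak f_2=\mathbb{Q}a\oplus\mathrm{Lie}[[c_1,c_2,\dots]]$, and $ma$ is applied to the component in $\mathrm{Lie}[[c_1,c_2,\dots]]$ (the $a$-component is of depth $0$). Put $\mathrm{Ber}_x(y)=\frac{\mathrm{ad}(x)}{e^{\mathrm{ad}(x)}-1}(y)$, $t_{01}=\mathrm{Ber}_b(-a)$, $t_{12}=[a,b]$. Let $\overline{\mathcal Z}=\mathcal Z/\langle(2\pi i)^2\rangle$, $\mathcal Z$ the algebra of multiple zeta values, and $\overline\Phi_{KZ}$ the reduction of the Drinfeld associator $\Phi_{KZ}(x,y)$ (coefficients shuffle-regularized MZVs, coefficient of $xy$ equal to $-\zeta(2)$). Set $\mathfrak a=\overline\Phi_{KZ}(t_{01},t_{12})\,t_{01}\,\overline\Phi_{KZ}(t_{01},t_{12})^{-1}$ and $\mathfrak a(\tau)=g(\tau)(\mathfrak a)$, where $g(\tau)=\sum_{\underline k}\mathcal G_{\underline k}(\tau)\tilde\varepsilon_{2k_1}\circ\cdots\circ\tilde\varepsilon_{2k_n}$ with $\varepsilon_{2n}$ the derivation with $\varepsilon_{2n}(b)=\mathrm{ad}(b)^{2n}(a)$,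 $\varepsilon_{2n}([b,a])=0$ ($\varepsilon_0(a)=0$), $\tilde\varepsilon_{2k}=\frac2{(2k-2)!}\varepsilon_{2k}$ ($k>0$), $\tilde\varepsilon_0=-\varepsilon_0$, and $\mathcal G_{\underline k}(\tau)$ the regularized iterated integrals $I(G_{2k_1},\dots,G_{2k_n};\tau)$ of Eisenstein series $G_0=-1$, $G_{2k}=-\frac{B_{2k}}{4k}+\sum_{n\ge1}\sigma_{2k-1}(n)q^n$, $q=e^{2\pi i\tau}$ (with $I(f_1,\dots,f_n;\tau)=(2\pi i)^n\sum_{i=0}^n\int_\tau^{i\infty}R[f_1|\cdots|f_i]\int_\tau^0[f^\infty_{i+1}|\cdots|f^\infty_n]$, $R[f_1|\cdots|f_n]=\sum_i(-1)^{n-i}[f_1|\cdots|f_i]\,\text{ш}\,[f^\infty_n|\cdots|f^\infty_{i+1}]$, $f^\infty$ the constant term). Moulds are families of rational functions $P(u_1,\dots,u_r)$, $r\ge0$ (here with coefficients in a commutative $\mathbb{Q}$-algebra). $ma$ sends $c_{k_1}\cdots c_{k_r}$ to $(-1)^{k_1+\cdots+k_r-r}u_1^{k_1-1}\cdots u_r^{k_r-1}$, extended linearly. A mould $P$ is alternal if for all $r>1$ and $1\le i\le\lfloor r/2\rfloor$, the sum of $P(\mathbf u)$ over all shuffles $\mathbf u$ of $(u_1,\dots,u_i)$ and $(u_{i+1},\dots,u_r)$ vanishes. $dar(P)(u_1,\dots,u_r)=u_1\cdots u_rP(u_1,\dots,u_r)$. $push(B)(u_1,\dots,u_r)=B(u_2,\dots,u_r,-u_1-\cdots-u_r)$.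 $B$ is push-neutral in depth $r$ if $\sum_{j=0}^r push^j(B)(u_1,\dots,u_r)=0$. *)

theory Defs
  imports
    "HOL-Library.Poly_Mapping"
    "HOL-Library.Multiset"
    "HOL-Computational_Algebra.Formal_Power_Series"
    "HOL-Complex_Analysis.Complex_Analysis"
begin

section \<open>Commutative \<open>\<rat>\<close>-algebras\<close>

text \<open>
  The degenerate case \<open>0 = 1\<close> is admitted: it is not known to fail for the algebra of multiple
  zeta values modulo \<open>(2\<pi>\<i>)\<^sup>2\<close>, which therefore cannot be made an instance of
  \<^class>\<open>comm_ring_1\<close>.
\<close>

class comm_rat_algebra = comm_ring + comm_monoid_mult +
  fixes scaleQ :: "rat \<Rightarrow> 'a \<Rightarrow> 'a" (infixr "*\<^sub>Q" 75)
  assumes scaleQ_add_right: "q *\<^sub>Q (x + y) = q *\<^sub>Q x + q *\<^sub>Q y"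
    and scaleQ_add_left: "(p + q) *\<^sub>Q x = p *\<^sub>Q x + q *\<^sub>Q x"
    and scaleQ_scaleQ: "p *\<^sub>Q (q *\<^sub>Q x) = (p * q) *\<^sub>Q x"
    and scaleQ_one: "1 *\<^sub>Q x = x"
    and mult_scaleQ_left: "(q *\<^sub>Q x) * y = q *\<^sub>Q (x * y)"
begin

lemma scaleQ_zero_left [simp]: "0 *\<^sub>Q x = 0"
  using scaleQ_add_left[of 0 0 x] by simp

lemma scaleQ_zero_right [simp]: "q *\<^sub>Q 0 = 0"
  using scaleQ_add_right[of q 0 0] by simp

end

instantiation rat :: comm_rat_algebra
begin
definition "q *\<^sub>Q x = q * (x :: rat)"
instance by standard (simp_all add: scaleQ_rat_def algebra_simps)
end

instantiation complex :: comm_rat_algebra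
begin
definition "q *\<^sub>Q x = of_rat q * (x :: complex)"
instance by standard (simp_all add: scaleQ_complex_def algebra_simps of_rat_add of_rat_mult)
end


subsection \<open>Tensor products over \<open>\<rat>\<close>\<close>

text \<open>
  A multiset of pairs \<open>(a, b)\<close> stands for the formal sum of the tensors \<open>a \<otimes> b\<close>.
\<close>

inductive tensor_eq ::
  "('a::comm_rat_algebra \<times> 'b::comm_rat_algebra) multiset \<Rightarrow> ('a \<times> 'b) multiset \<Rightarrow> bool"
where
  refl: "tensor_eq M M"
| sym: "tensor_eq M N \<Longrightarrow> tensor_eq N M"
| trans: "tensor_eq M N \<Longrightarrow> tensor_eq N P \<Longrightarrow> tensor_eq M P"
| cong: "tensor_eq M N \<Longrightarrow> tensor_eq (M + P) (N + P)"
| zero: "tensor_eq {#(0, b)#} {#}"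
| add_left: "tensor_eq {#(a + a', b)#} {#(a, b), (a', b)#}"
| add_right: "tensor_eq {#(a, b + b')#} {#(a, b), (a, b')#}"
| scale: "tensor_eq {#(q *\<^sub>Q a, b)#} {#(a, q *\<^sub>Q b)#}"

lemma tensor_eq_cong2:
  assumes "tensor_eq M M'" "tensor_eq N N'"
  shows "tensor_eq (M + N) (M' + N')"
proof -
  have "tensor_eq (M + N) (M' + N)" by (rule tensor_eq.cong[OF assms(1)])
  moreover have "tensor_eq (M' + N) (M' + N')"
    using tensor_eq.cong[OF assms(2), of M'] by (simp add: add.commute)
  ultimately show ?thesis by (rule tensor_eq.trans)
qed

quotient_type (overloaded) ('a, 'b) tensor =
  "('a::comm_rat_algebra \<times> 'b::comm_rat_algebra) multiset" / tensor_eq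
  by (intro equivpI reflpI sympI transpI) (auto intro: tensor_eq.intros)

definition tensor_times1 ::
  "'a::comm_rat_algebra \<times> 'b::comm_rat_algebra \<Rightarrow> 'a \<times> 'b \<Rightarrow> 'a \<times> 'b" where
  "tensor_times1 x y = (fst x * fst y, snd x * snd y)"

definition tensor_times ::
  "('a::comm_rat_algebra \<times> 'b::comm_rat_algebra) multiset \<Rightarrow> ('a \<times> 'b) multiset \<Rightarrow> ('a \<times> 'b) multiset"
where
  "tensor_times M N = (\<Sum>x\<in>#M. image_mset (tensor_times1 x) N)"

lemma tensor_times_empty [simp]: "tensor_times {#} N = {#}" "tensor_times M {#} = {#}"
  by (simp_all add: tensor_times_def)

lemma tensor_times_add_left: "tensor_times (M + M') N = tensor_times M N + tensor_times M' N"
  by (simp add: tensor_times_def)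

lemma tensor_times_single: "tensor_times {#x#} N = image_mset (tensor_times1 x) N"
  by (simp add: tensor_times_def)

lemma tensor_times_insert:
  "tensor_times (add_mset x M) N = image_mset (tensor_times1 x) N + tensor_times M N"
  by (simp add: tensor_times_def)

lemma tensor_times1_commute: "tensor_times1 x y = tensor_times1 y x"
  by (simp add: tensor_times1_def mult.commute)

lemma tensor_times_commute: "tensor_times M N = tensor_times N M"
proof (induction M)
  case empty
  then show ?case by simp
next
  case (add x M)
  have "tensor_times N (add_mset x M) = image_mset (tensor_times1 x) N + tensor_times N M" for N
    by (induction N)
      (simp_all add: tensor_times_insert tensor_times1_commute[of x] add_ac)
  then show ?case using add by (simp add: tensor_times_insert)
qed

lemma tensor_times_assoc: "tensor_times (tensor_times M N) P = tensor_times M (tensor_times N P)"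
proof (induction M)
  case empty
  then show ?case by simp
next
  case (add x M)
  have 1: "tensor_times (image_mset (tensor_times1 x) N) P = image_mset (tensor_times1 x) (tensor_times N P)" for N
  proof (induction N)
    case empty
    then show ?case by simp
  next
    case (add y N)
    have "tensor_times1 (tensor_times1 x y) = tensor_times1 x \<circ> tensor_times1 y"
      by (auto simp: tensor_times1_def fun_eq_iff mult.assoc)
    then show ?case using add by (simp add: tensor_times_insert multiset.map_comp)
  qed
  show ?case using add by (simp add: tensor_times_insert tensor_times_add_left 1)
qed

lemma mult_scaleQ_right: "x * (q *\<^sub>Q y) = q *\<^sub>Q (x * (y :: 'a :: comm_rat_algebra))"
  by (metis mult.commute mult_scaleQ_left)

lemma tensor_eq_image:
  assumes "tensor_eq M M'"
  shows "tensor_eq (image_mset (tensor_times1 x) M) (image_mset (tensor_times1 x) M')"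
  using assms
proof (induction rule: tensor_eq.induct)
  case (scale q a b)
  then show ?case
    by (simp add: tensor_times1_def mult_scaleQ_right tensor_eq.scale)
qed (auto intro: tensor_eq.intros simp: tensor_times1_def distrib_left)

lemma tensor_eq_times_right:
  assumes "tensor_eq N N'"
  shows "tensor_eq (tensor_times M N) (tensor_times M N')"
  by (induction M) (auto intro: tensor_eq.refl tensor_eq_cong2 tensor_eq_image[OF assms] simp: tensor_times_insert)

lemma tensor_eq_times:
  assumes "tensor_eq M M'" "tensor_eq N N'"
  shows "tensor_eq (tensor_times M N) (tensor_times M' N')"
  using tensor_eq_times_right[OF assms(2), of M] tensor_eq_times_right[OF assms(1), of N']
  by (metis tensor_times_commute tensor_eq.trans)

lemma tensor_eq_scale_image:
  assumes "tensor_eq M M'"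
  shows "tensor_eq (image_mset (apfst (scaleQ q)) M) (image_mset (apfst (scaleQ q)) M')"
  using assms
proof (induction rule: tensor_eq.induct)
  case (scale p a b)
  have "q *\<^sub>Q p *\<^sub>Q a = p *\<^sub>Q q *\<^sub>Q a" by (simp add: scaleQ_scaleQ mult.commute)
  then show ?case by (simp add: tensor_eq.scale)
qed (auto intro: tensor_eq.intros simp: scaleQ_add_right)

lemma tensor_eq_uminus_image:
  assumes "tensor_eq M M'"
  shows "tensor_eq (image_mset (apfst uminus) M) (image_mset (apfst uminus) M')"
  using assms
proof (induction rule: tensor_eq.induct)
  case (scale p a b)
  have "- (p *\<^sub>Q a) = p *\<^sub>Q (- a)"
    using scaleQ_add_right[of p a "- a"] by (metis add.right_inverse minus_unique scaleQ_zero_right)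
  then show ?case by (simp add: tensor_eq.scale)
qed (auto intro: tensor_eq.intros simp: tensor_eq.add_left[of "- a" "- b" for a b, simplified])

instantiation tensor :: (comm_rat_algebra, comm_rat_algebra) comm_rat_algebra
begin

lift_definition zero_tensor :: "('a, 'b) tensor" is "{#}" .
lift_definition one_tensor :: "('a, 'b) tensor" is "{#(1, 1)#}" .
lift_definition plus_tensor :: "('a, 'b) tensor \<Rightarrow> ('a, 'b) tensor \<Rightarrow> ('a, 'b) tensor" is "(+)"
  by (rule tensor_eq_cong2)
lift_definition uminus_tensor :: "('a, 'b) tensor \<Rightarrow> ('a, 'b) tensor"
  is "image_mset (apfst uminus)" by (rule tensor_eq_uminus_image)
lift_definition times_tensor :: "('a, 'b) tensor \<Rightarrow> ('a, 'b) tensor \<Rightarrow> ('a, 'b) tensor"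
  is tensor_times by (rule tensor_eq_times)
lift_definition scaleQ_tensor :: "rat \<Rightarrow> ('a, 'b) tensor \<Rightarrow> ('a, 'b) tensor"
  is "\<lambda>q. image_mset (apfst (scaleQ q))" by (rule tensor_eq_scale_image)
definition minus_tensor :: "('a, 'b) tensor \<Rightarrow> ('a, 'b) tensor \<Rightarrow> ('a, 'b) tensor" where
  "minus_tensor x y = x + - y"

instance
proof
  fix x y z :: "('a, 'b) tensor" and p q :: rat
  show "x + y + z = x + (y + z)" by transfer (simp add: add.assoc tensor_eq.refl)
  show "x + y = y + x" by transfer (simp add: add.commute tensor_eq.refl)
  show "0 + x = x" by transfer (simp add: tensor_eq.refl)
  show "- x + x = 0"
  proof (transfer)
    fix M :: "('a \<times> 'b) multiset"
    show "tensor_eq (image_mset (apfst uminus) M + M) {#}"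
    proof (induction M)
      case empty
      then show ?case by (simp add: tensor_eq.refl)
    next
      case (add u M)
      obtain a b where u: "u = (a, b)" by (cases u)
      have "tensor_eq {#(- a, b), (a, b)#} {#}"
        by (rule tensor_eq.trans[OF tensor_eq.sym[OF tensor_eq.add_left]])
          (simp add: tensor_eq.zero)
      from tensor_eq_cong2[OF this add] show ?case by (simp add: u add_mset_commute)
    qed
  qed
  show "x - y = x + - y" by (rule minus_tensor_def)
  show "x * y * z = x * (y * z)" by transfer (simp add: tensor_times_assoc tensor_eq.refl)
  show "x * y = y * x" by transfer (subst tensor_times_commute, rule tensor_eq.refl)
  show "(x + y) * z = x * z + y * z" by transfer (simp add: tensor_times_add_left tensor_eq.refl)
  show "1 * x = x"
  proof transfer
    fix M :: "('a \<times> 'b) multiset"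
    have "tensor_times1 (1, 1) = (id :: 'a \<times> 'b \<Rightarrow> _)"
      by (auto simp: fun_eq_iff tensor_times1_def)
    then show "tensor_eq (tensor_times {#(1, 1)#} M) M"
      by (simp add: tensor_times_single tensor_eq.refl)
  qed
  show "q *\<^sub>Q (x + y) = q *\<^sub>Q x + q *\<^sub>Q y" by transfer (simp add: tensor_eq.refl)
  show "(p + q) *\<^sub>Q x = p *\<^sub>Q x + q *\<^sub>Q x"
  proof transfer
    fix p q :: rat and M :: "('a \<times> 'b) multiset"
    show "tensor_eq (image_mset (apfst (scaleQ (p + q))) M)
      (image_mset (apfst (scaleQ p)) M + image_mset (apfst (scaleQ q)) M)"
    proof (induction M)
      case empty
      then show ?case by (simp add: tensor_eq.refl)
    next
      case (add u M)
      obtain a b where u: "u = (a, b)" by (cases u)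
      from tensor_eq_cong2[OF tensor_eq.add_left[of "p *\<^sub>Q a" "q *\<^sub>Q a" b] add]
      show ?case by (simp add: u scaleQ_add_left add_mset_commute)
    qed
  qed
  show "p *\<^sub>Q q *\<^sub>Q x = (p * q) *\<^sub>Q x"
  proof transfer
    fix p q :: rat and M :: "('a \<times> 'b) multiset"
    have "apfst (scaleQ p) \<circ> apfst (scaleQ q) = (apfst (scaleQ (p * q)) :: 'a \<times> 'b \<Rightarrow> _)"
      by (auto simp: fun_eq_iff scaleQ_scaleQ)
    then show "tensor_eq (image_mset (apfst (scaleQ p)) (image_mset (apfst (scaleQ q)) M))
      (image_mset (apfst (scaleQ (p * q))) M)"
      by (simp add: multiset.map_comp tensor_eq.refl)
  qed
  show "1 *\<^sub>Q x = x"
  proof transfer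
    fix M :: "('a \<times> 'b) multiset"
    have "apfst (scaleQ 1) = (id :: 'a \<times> 'b \<Rightarrow> _)" by (auto simp: fun_eq_iff scaleQ_one)
    then show "tensor_eq (image_mset (apfst (scaleQ 1)) M) M" by (simp add: tensor_eq.refl)
  qed
  show "q *\<^sub>Q x * y = q *\<^sub>Q (x * y)"
  proof transfer
    fix q :: rat and M N :: "('a \<times> 'b) multiset"
    have "tensor_times1 (apfst (scaleQ q) u) = apfst (scaleQ q) \<circ> tensor_times1 (u :: 'a \<times> 'b)" for u
      by (cases u) (auto simp: fun_eq_iff tensor_times1_def mult_scaleQ_left)
    then have "tensor_times (image_mset (apfst (scaleQ q)) M) N = image_mset (apfst (scaleQ q)) (tensor_times M N)"
      by (induction M) (simp_all add: tensor_times_insert multiset.map_comp)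
    then show "tensor_eq (tensor_times (image_mset (apfst (scaleQ q)) M) N)
      (image_mset (apfst (scaleQ q)) (tensor_times M N))"
      by (simp add: tensor_eq.refl)
  qed
qed

end

lift_definition pure_tensor :: "'a::comm_rat_algebra \<Rightarrow> 'b::comm_rat_algebra \<Rightarrow> ('a, 'b) tensor"
  (infixl "\<otimes>\<^sub>Q" 70) is "\<lambda>a b. {#(a, b)#}" .


section \<open>Multiple zeta values\<close>

text \<open>Shuffles with multiplicity; \<^const>\<open>shuffles\<close> only yields a set.\<close>

fun shuffle :: "'a list \<Rightarrow> 'a list \<Rightarrow> 'a list list" where
  "shuffle [] ys = [ys]"
| "shuffle xs [] = [xs]"
| "shuffle (x # xs) (y # ys) =
    map ((#) x) (shuffle xs (y # ys)) @ map ((#) y) (shuffle (x # xs) ys)"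

definition admissible :: "nat list \<Rightarrow> bool" where
  "admissible ks \<longleftrightarrow> 0 \<notin> set ks \<and> (ks \<noteq> [] \<longrightarrow> hd ks \<ge> 2)"

text \<open>\<open>\<zeta>(k\<^sub>1, \<dots>, k\<^sub>r)\<close>, summed over \<open>n\<^sub>1 > \<dots> > n\<^sub>r > 0\<close>.\<close>

definition mzv :: "nat list \<Rightarrow> real" where
  "mzv ks =
    (\<Sum>\<^sub>\<infinity> ns \<in> {ns. length ns = length ks \<and> sorted_wrt (>) ns \<and> 0 \<notin> set ns}.
      \<Prod>i<length ks. 1 / real (ns ! i) ^ (ks ! i))"

inductive_set mzv_algebra :: "complex set" where
  of_rat: "of_rat q \<in> mzv_algebra"
| mzv: "admissible ks \<Longrightarrow> of_real (mzv ks) \<in> mzv_algebra"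
| add: "x \<in> mzv_algebra \<Longrightarrow> y \<in> mzv_algebra \<Longrightarrow> x + y \<in> mzv_algebra"
| mult: "x \<in> mzv_algebra \<Longrightarrow> y \<in> mzv_algebra \<Longrightarrow> x * y \<in> mzv_algebra"

lemma mzv_algebra_uminus: "x \<in> mzv_algebra \<Longrightarrow> - x \<in> mzv_algebra"
  using mzv_algebra.mult[OF mzv_algebra.of_rat[of "-1"]] by simp

definition zbar_rel :: "complex \<Rightarrow> complex \<Rightarrow> bool" where
  "zbar_rel x y \<longleftrightarrow> x \<in> mzv_algebra \<and> y \<in> mzv_algebra \<and>
     (\<exists>z\<in>mzv_algebra. x - y = z * (2 * pi * \<i>)\<^sup>2)"

quotient_type zbar = complex / partial: zbar_rel
proof (rule part_equivpI)
  have "(0 :: complex) \<in> mzv_algebra" using mzv_algebra.of_rat[of 0] by simp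
  then show "\<exists>x. zbar_rel x x" by (auto simp: zbar_rel_def intro!: exI[of _ 0] bexI[of _ 0])
  show "symp zbar_rel"
  proof (rule sympI)
    fix x y assume "zbar_rel x y"
    then obtain z where "x \<in> mzv_algebra" "y \<in> mzv_algebra" "z \<in> mzv_algebra"
      "x - y = z * (2 * pi * \<i>)\<^sup>2" by (auto simp: zbar_rel_def)
    moreover from this have "y - x = (- z) * (2 * pi * \<i>)\<^sup>2" by (simp add: algebra_simps)
    ultimately show "zbar_rel y x"
      unfolding zbar_rel_def using mzv_algebra_uminus by blast
  qed
  show "transp zbar_rel"
  proof (rule transpI)
    fix x y w assume "zbar_rel x y" "zbar_rel y w"
    then obtain z z' where "x \<in> mzv_algebra" "w \<in> mzv_algebra" "z \<in> mzv_algebra" "z' \<in> mzv_algebra"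
      "x - y = z * (2 * pi * \<i>)\<^sup>2" "y - w = z' * (2 * pi * \<i>)\<^sup>2" by (auto simp: zbar_rel_def)
    moreover from this have "x - w = (z + z') * (2 * pi * \<i>)\<^sup>2" by (simp add: algebra_simps)
    ultimately show "zbar_rel x w"
      unfolding zbar_rel_def using mzv_algebra.add by blast
  qed
qed

lemma zbar_relI:
  "x \<in> mzv_algebra \<Longrightarrow> y \<in> mzv_algebra \<Longrightarrow> z \<in> mzv_algebra \<Longrightarrow> x - y = z * (2 * pi * \<i>)\<^sup>2 \<Longrightarrow> zbar_rel x y"
  by (auto simp: zbar_rel_def)

lemma zbar_rel_refl: "x \<in> mzv_algebra \<Longrightarrow> zbar_rel x x"
  using mzv_algebra.of_rat[of 0] by (auto intro: zbar_relI[of _ _ 0])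

instantiation zbar :: comm_rat_algebra
begin

lift_definition zero_zbar :: zbar is 0
  using mzv_algebra.of_rat[of 0] by (simp add: zbar_rel_refl)
lift_definition one_zbar :: zbar is 1
  using mzv_algebra.of_rat[of 1] by (simp add: zbar_rel_refl)
lift_definition plus_zbar :: "zbar \<Rightarrow> zbar \<Rightarrow> zbar" is "(+)"
proof -
  fix x x' y y' assume "zbar_rel x x'" "zbar_rel y y'"
  then obtain z z' where *: "x \<in> mzv_algebra" "x' \<in> mzv_algebra" "y \<in> mzv_algebra" "y' \<in> mzv_algebra"
    "z \<in> mzv_algebra" "z' \<in> mzv_algebra"
    "x - x' = z * (2 * pi * \<i>)\<^sup>2" "y - y' = z' * (2 * pi * \<i>)\<^sup>2" by (auto simp: zbar_rel_def)
  have "x + y - (x' + y') = (x - x') + (y - y')" by simp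
  also have "\<dots> = (z + z') * (2 * pi * \<i>)\<^sup>2"
    unfolding *(7,8) by (rule distrib_right[symmetric])
  finally show "zbar_rel (x + y) (x' + y')"
    using * by (intro zbar_relI[of _ _ "z + z'"] mzv_algebra.intros)
qed
lift_definition times_zbar :: "zbar \<Rightarrow> zbar \<Rightarrow> zbar" is "(*)"
proof -
  fix x x' y y' assume "zbar_rel x x'" "zbar_rel y y'"
  then obtain z z' where *: "x \<in> mzv_algebra" "x' \<in> mzv_algebra" "y \<in> mzv_algebra" "y' \<in> mzv_algebra"
    "z \<in> mzv_algebra" "z' \<in> mzv_algebra"
    "x - x' = z * (2 * pi * \<i>)\<^sup>2" "y - y' = z' * (2 * pi * \<i>)\<^sup>2" by (auto simp: zbar_rel_def)
  have "x * y - x' * y' = (x - x') * y + x' * (y - y')"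
    by (simp add: algebra_simps)
  also have "\<dots> = (z * y + x' * z') * (2 * pi * \<i>)\<^sup>2"
    unfolding *(7,8) by (simp add: algebra_simps)
  finally show "zbar_rel (x * y) (x' * y')"
    using * by (intro zbar_relI[of _ _ "z * y + x' * z'"] mzv_algebra.intros)
qed
lift_definition uminus_zbar :: "zbar \<Rightarrow> zbar" is uminus
proof -
  fix x x' assume "zbar_rel x x'"
  then obtain z where *: "x \<in> mzv_algebra" "x' \<in> mzv_algebra" "z \<in> mzv_algebra"
    "x - x' = z * (2 * pi * \<i>)\<^sup>2" by (auto simp: zbar_rel_def)
  have "- x - - x' = - (x - x')" by simp
  also have "\<dots> = (- z) * (2 * pi * \<i>)\<^sup>2" unfolding *(4) by simp
  finally show "zbar_rel (- x) (- x')"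
    using * by (intro zbar_relI[of _ _ "- z"] mzv_algebra_uminus)
qed
definition minus_zbar :: "zbar \<Rightarrow> zbar \<Rightarrow> zbar" where "minus_zbar x y = x + - y"
lift_definition scaleQ_zbar :: "rat \<Rightarrow> zbar \<Rightarrow> zbar" is "\<lambda>q x. of_rat q * x"
proof -
  fix q x x' assume "zbar_rel x x'"
  then obtain z where *: "x \<in> mzv_algebra" "x' \<in> mzv_algebra" "z \<in> mzv_algebra"
    "x - x' = z * (2 * pi * \<i>)\<^sup>2" by (auto simp: zbar_rel_def)
  have "of_rat q * x - of_rat q * x' = of_rat q * (x - x')" by (simp add: algebra_simps)
  also have "\<dots> = (of_rat q * z) * (2 * pi * \<i>)\<^sup>2" unfolding *(4) by simp
  finally show "zbar_rel (of_rat q * x) (of_rat q * x')"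
    using * by (intro zbar_relI[of _ _ "of_rat q * z"] mzv_algebra.intros)
qed

instance
proof
  fix x y z :: zbar and p q :: rat
  have R: "zbar_rel u u \<Longrightarrow> v = u \<Longrightarrow> zbar_rel v u" for u v by simp
  have M: "zbar_rel u u \<longleftrightarrow> u \<in> mzv_algebra" for u
    using zbar_rel_refl by (auto simp: zbar_rel_def)
  note i = mzv_algebra.add mzv_algebra.mult mzv_algebra.of_rat mzv_algebra_uminus
  show "x + y + z = x + (y + z)" by transfer (rule R; simp add: M i add.assoc)
  show "x + y = y + x" by transfer (rule R; simp add: M i)
  show "0 + x = x" by transfer (rule R; simp add: M i)
  show "- x + x = 0"
    using mzv_algebra.of_rat[of 0] by transfer (rule R; simp add: M i)
  show "x - y = x + - y" by (rule minus_zbar_def)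
  show "x * y * z = x * (y * z)" by transfer (rule R; simp add: M i)
  show "x * y = y * x" by transfer (rule R; simp add: M i)
  show "(x + y) * z = x * z + y * z" by transfer (rule R; simp add: M i algebra_simps)
  show "1 * x = x" by transfer (rule R; simp add: M i)
  show "q *\<^sub>Q (x + y) = q *\<^sub>Q x + q *\<^sub>Q y" by transfer (rule R; simp add: M i algebra_simps)
  show "(p + q) *\<^sub>Q x = p *\<^sub>Q x + q *\<^sub>Q x"
    by transfer (rule R; simp add: M i algebra_simps of_rat_add)
  show "p *\<^sub>Q q *\<^sub>Q x = (p * q) *\<^sub>Q x"
    by transfer (rule R; simp add: M i of_rat_mult flip: of_rat_mult)
  show "1 *\<^sub>Q x = x" by transfer (rule R; simp add: M i)
  show "q *\<^sub>Q x * y = q *\<^sub>Q (x * y)" by transfer (rule R; simp add: M i algebra_simps)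
qed

end

text \<open>The class of \<open>x\<close>; only meaningful for \<open>x \<in> mzv_algebra\<close>.\<close>

definition zbar_of :: "complex \<Rightarrow> zbar" where
  "zbar_of = abs_zbar"


subsection \<open>Shuffle regularization and the Drinfeld associator\<close>

datatype xy = X | Y

definition mzv_word :: "nat list \<Rightarrow> xy list" where
  "mzv_word ks = concat (map (\<lambda>k. replicate (k - 1) X @ [Y]) ks)"

definition zeta_reg :: "xy list \<Rightarrow> real" where
  "zeta_reg = (THE z.
      z [] = 1 \<and>
      (\<forall>u v. z u * z v = sum_list (map z (shuffle u v))) \<and>
      z [X] = 0 \<and> z [Y] = 0 \<and>
      (\<forall>ks. admissible ks \<longrightarrow> z (mzv_word ks) = mzv ks))"

definition Phi_KZ :: "xy list \<Rightarrow> complex" where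
  "Phi_KZ w = (- 1) ^ count_list w Y * of_real (zeta_reg w)"

definition Phi_KZ_bar :: "xy list \<Rightarrow> zbar" where
  "Phi_KZ_bar w = zbar_of (Phi_KZ w)"


section \<open>Noncommutative power series\<close>

text \<open>
  A series is the family of its coefficients, indexed by words.  Formal sums of series are taken
  with \<^const>\<open>Sum_any\<close>: wherever it is used, only finitely many terms contribute to the coefficient
  of a given word.
\<close>

type_synonym ('l, 'k) series = "'l list \<Rightarrow> 'k"

definition nc_one :: "('l, 'k::comm_rat_algebra) series" where
  "nc_one w = (if w = [] then 1 else 0)"

definition letter :: "'l \<Rightarrow> ('l, 'k::comm_rat_algebra) series" where
  "letter x w = (if w = [x] then 1 else 0)"

definition nc_zero :: "('l, 'k::comm_rat_algebra) series" where
  "nc_zero w = 0"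

definition nc_add :: "('l, 'k::comm_rat_algebra) series \<Rightarrow> ('l, 'k) series \<Rightarrow> ('l, 'k) series" where
  "nc_add f g w = f w + g w"

definition nc_smult :: "'k::comm_rat_algebra \<Rightarrow> ('l, 'k) series \<Rightarrow> ('l, 'k) series" where
  "nc_smult c f w = c * f w"

definition nc_uminus :: "('l, 'k::comm_rat_algebra) series \<Rightarrow> ('l, 'k) series" where
  "nc_uminus f w = - f w"

definition nc_mult :: "('l, 'k::comm_rat_algebra) series \<Rightarrow> ('l, 'k) series \<Rightarrow> ('l, 'k) series"
  (infixl "\<star>" 70) where
  "(f \<star> g) w = (\<Sum>i\<le>length w. f (take i w) * g (drop i w))"

definition nc_prod :: "('l, 'k::comm_rat_algebra) series list \<Rightarrow> ('l, 'k) series" where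
  "nc_prod fs = foldr (\<star>) fs nc_one"

definition nc_inverse :: "('l, 'k::comm_rat_algebra) series \<Rightarrow> ('l, 'k) series" where
  "nc_inverse f = (THE g. f \<star> g = nc_one \<and> g \<star> f = nc_one)"

definition ad :: "('l, 'k::comm_rat_algebra) series \<Rightarrow> ('l, 'k) series \<Rightarrow> ('l, 'k) series" where
  "ad f g = nc_add (f \<star> g) (nc_uminus (g \<star> f))"

definition nc_subst :: "('m \<Rightarrow> ('l, 'k::comm_rat_algebra) series) \<Rightarrow> ('m, 'k) series \<Rightarrow> ('l, 'k) series" where
  "nc_subst s f w = Sum_any (\<lambda>v. f v * nc_prod (map s v) w)"

text \<open>The continuous derivation with prescribed values \<open>d x\<close> (without constant term) on the letters \<open>x\<close>.\<close>

definition nc_deriv :: "('l \<Rightarrow> ('l, 'k::comm_rat_algebra) series) \<Rightarrow> ('l, 'k) series \<Rightarrow> ('l, 'k) series" where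
  "nc_deriv d f w = Sum_any (\<lambda>v. f v *
     (\<Sum>i<length v. (nc_prod (map letter (take i v)) \<star> d (v ! i) \<star> nc_prod (map letter (drop (Suc i) v))) w))"


subsection \<open>Lie series\<close>

inductive_set lie_poly :: "'l set \<Rightarrow> ('l, 'k::comm_rat_algebra) series set" for A :: "'l set" where
  letter: "x \<in> A \<Longrightarrow> letter x \<in> lie_poly A"
| zero: "nc_zero \<in> lie_poly A"
| add: "f \<in> lie_poly A \<Longrightarrow> g \<in> lie_poly A \<Longrightarrow> nc_add f g \<in> lie_poly A"
| smult: "f \<in> lie_poly A \<Longrightarrow> nc_smult c f \<in> lie_poly A"
| bracket: "f \<in> lie_poly A \<Longrightarrow> g \<in> lie_poly A \<Longrightarrow> ad f g \<in> lie_poly A"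

text \<open>The degree of a word is the sum of the degrees \<open>wt x\<close> of its letters \<open>x\<close>.\<close>

definition hom_part :: "('l \<Rightarrow> nat) \<Rightarrow> nat \<Rightarrow> ('l, 'k::comm_rat_algebra) series \<Rightarrow> ('l, 'k) series" where
  "hom_part wt d f w = (if sum_list (map wt w) = d then f w else 0)"

text \<open>The degree completion of the free Lie algebra over \<open>'k\<close> on the letters in \<open>A\<close>.\<close>

definition lie_series :: "'l set \<Rightarrow> ('l \<Rightarrow> nat) \<Rightarrow> ('l, 'k::comm_rat_algebra) series set" where
  "lie_series A wt = {f. \<forall>d. hom_part wt d f \<in> lie_poly A}"


subsection \<open>Lazard elimination\<close>

datatype ab = A | B

abbreviation ser_a :: "(ab, 'k::comm_rat_algebra) series" where "ser_a \<equiv> letter A"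
abbreviation ser_b :: "(ab, 'k::comm_rat_algebra) series" where "ser_b \<equiv> letter B"

definition f2 :: "(ab, 'k::comm_rat_algebra) series set" where
  "f2 = lie_series UNIV (\<lambda>_. 1)"

definition c_ser :: "nat \<Rightarrow> (ab, 'k::comm_rat_algebra) series" where
  "c_ser i = (ad ser_a ^^ (i - 1)) ser_b"

text \<open>\<open>Lie[[c\<^sub>1, c\<^sub>2, \<dots>]]\<close>, with \<open>i\<close> standing for \<open>c\<^sub>i\<close>; the letter \<open>0\<close> is not used.\<close>

definition lie_c :: "(nat, 'k::comm_rat_algebra) series set" where
  "lie_c = lie_series {1..} (\<lambda>i. i)"

text \<open>
  The component of \<open>f\<close> in \<open>Lie[[c\<^sub>1, c\<^sub>2, \<dots>]]\<close>; as every \<open>c\<^sub>i\<close> has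
  degree at least 1 in \<open>b\<close>, the component in \<open>'k a\<close> is given by the coefficient of the word \<open>a\<close>.
\<close>

definition c_component :: "(ab, 'k::comm_rat_algebra) series \<Rightarrow> (nat, 'k) series" where
  "c_component f = (THE F. F \<in> lie_c \<and>
     f = nc_add (nc_smult (f [A]) ser_a) (nc_subst c_ser F))"


section \<open>The series \<open>\<aa>(\<tau>)\<close>\<close>

definition ber_coeff :: "nat \<Rightarrow> rat" where
  "ber_coeff n = fps_nth (fps_X / (fps_exp 1 - 1)) n"

definition Ber :: "('l, 'k::comm_rat_algebra) series \<Rightarrow> ('l, 'k) series \<Rightarrow> ('l, 'k) series" where
  "Ber x y w = Sum_any (\<lambda>n. ber_coeff n *\<^sub>Q (ad x ^^ n) y w)"

definition t01 :: "(ab, 'k::comm_rat_algebra) series" where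
  "t01 = Ber ser_b (nc_uminus ser_a)"

definition t12 :: "(ab, 'k::comm_rat_algebra) series" where
  "t12 = ad ser_a ser_b"

text \<open>
  \<open>\<epsilon>\<^bsub>2n\<^esub>(a)\<close> is determined by \<open>\<epsilon>\<^bsub>2n\<^esub>(b)\<close> and
  \<open>\<epsilon>\<^bsub>2n\<^esub>([b,a]) = 0\<close> up to a multiple of \<open>b\<close>, which is normalized to zero.  For
  \<open>n > 0\<close> this amounts to \<open>\<epsilon>\<^bsub>2n\<^esub>\<close> being homogeneous of degree \<open>2n\<close>, for
  \<open>n = 0\<close> to \<open>\<epsilon>\<^sub>0(a) = 0\<close>.
\<close>

definition eps_on :: "nat \<Rightarrow> (ab, 'k::comm_rat_algebra) series \<Rightarrow> ab \<Rightarrow> (ab, 'k) series" where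
  "eps_on n s x = (case x of A \<Rightarrow> s | B \<Rightarrow> (ad ser_b ^^ (2 * n)) ser_a)"

definition eps :: "nat \<Rightarrow> (ab, 'k::comm_rat_algebra) series \<Rightarrow> (ab, 'k) series" where
  "eps n = nc_deriv (eps_on n (THE s. s \<in> f2 \<and> s [B] = 0 \<and>
     nc_deriv (eps_on n s) (ad ser_b ser_a) = nc_zero))"

definition eps_tilde :: "nat \<Rightarrow> (ab, 'k::comm_rat_algebra) series \<Rightarrow> (ab, 'k) series" where
  "eps_tilde k f = (if k = 0 then nc_uminus (eps 0 f)
     else (\<lambda>w. (2 / fact (2 * k - 2)) *\<^sub>Q eps k f w))"


subsection \<open>Iterated Eisenstein integrals\<close>

text \<open>\<open>bernoulli n\<close> is the Bernoulli number \<open>B\<^sub>n\<close>, and \<open>eisenstein k\<close> is \<open>G\<^bsub>2k\<^esub>\<close>.\<close>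

definition bernoulli :: "nat \<Rightarrow> rat" where
  "bernoulli n = fact n * ber_coeff n"

definition eisenstein_const :: "nat \<Rightarrow> complex" where
  "eisenstein_const k = (if k = 0 then - 1 else - of_rat (bernoulli (2 * k)) / (4 * of_nat k))"

definition eisenstein :: "nat \<Rightarrow> complex \<Rightarrow> complex" where
  "eisenstein k \<tau> = (if k = 0 then - 1 else
     eisenstein_const k +
     suminf (\<lambda>n. of_nat (\<Sum>d | d dvd Suc n. d ^ (2 * k - 1)) * exp (2 * pi * \<i> * \<tau>) ^ Suc n))"

text \<open>
  \<open>iter_int [f\<^sub>1, \<dots>, f\<^sub>n] p q\<close> is the integral of
  \<open>f\<^sub>1(s\<^sub>1) \<cdots> f\<^sub>n(s\<^sub>n) ds\<^sub>1 \<cdots> ds\<^sub>n\<close> over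
  \<open>p \<le> s\<^sub>1 \<le> \<dots> \<le> s\<^sub>n \<le> q\<close> on the segment from \<open>p\<close> to \<open>q\<close>.
\<close>

fun iter_int :: "(complex \<Rightarrow> complex) list \<Rightarrow> complex \<Rightarrow> complex \<Rightarrow> complex" where
  "iter_int [] p q = 1"
| "iter_int (f # fs) p q = contour_integral (linepath p q) (\<lambda>s. f s * iter_int fs s q)"

text \<open>Below, an integrand \<open>f\<close> comes as the pair of \<open>f\<close> and its constant term \<open>f\<^sup>\<infinity>\<close>.\<close>

type_synonym integrand = "(complex \<Rightarrow> complex) \<times> complex"

definition const_terms :: "integrand list \<Rightarrow> (complex \<Rightarrow> complex) list" where
  "const_terms fs = map (\<lambda>f _. snd f) fs"

text \<open>
  The linear combination \<open>R[f\<^sub>1|\<dots>|f\<^sub>n]\<close> as a list of signs and words.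
\<close>

definition reg_words :: "integrand list \<Rightarrow> (complex \<times> (complex \<Rightarrow> complex) list) list" where
  "reg_words fs = concat (map (\<lambda>i.
     map (Pair ((- 1) ^ (length fs - i)))
       (shuffle (map fst (take i fs)) (rev (const_terms (drop i fs)))))
     [0..<Suc (length fs)])"

definition reg_int :: "integrand list \<Rightarrow> complex \<Rightarrow> complex" where
  "reg_int fs \<tau> = Lim at_top (\<lambda>T::real.
     \<Sum>(c, w)\<leftarrow>reg_words fs. c * iter_int w \<tau> (\<tau> + of_real T * \<i>))"

definition eichler_int :: "integrand list \<Rightarrow> complex \<Rightarrow> complex" where
  "eichler_int fs \<tau> = (2 * pi * \<i>) ^ length fs *
     (\<Sum>i\<le>length fs. reg_int (take i fs) \<tau> * iter_int (const_terms (drop i fs)) \<tau> 0)"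

definition eis_int :: "nat list \<Rightarrow> complex \<Rightarrow> complex" where
  "eis_int ks \<tau> = eichler_int (map (\<lambda>k. (eisenstein k, eisenstein_const k)) ks) \<tau>"


subsection \<open>The automorphism \<open>g(\<tau>)\<close> and \<open>\<aa>(\<tau>)\<close>\<close>

text \<open>
  Only the multiple zeta values are reduced modulo \<open>(2\<pi>\<i>)\<^sup>2\<close>; the values at \<open>\<tau>\<close> of the
  iterated integrals are kept in \<open>\<complex>\<close>, so that the coefficients lie in
  \<open>\<complex> \<otimes>\<^sub>\<rat> zbar\<close>.
\<close>

type_synonym coeff = "(complex, zbar) tensor"

definition frak_a :: "(ab, coeff) series" where
  "frak_a = (let \<Phi> = nc_subst (\<lambda>x. case x of X \<Rightarrow> t01 | Y \<Rightarrow> t12) (\<lambda>w. 1 \<otimes>\<^sub>Q Phi_KZ_bar w)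
     in \<Phi> \<star> t01 \<star> nc_inverse \<Phi>)"

definition g_aut :: "complex \<Rightarrow> (ab, coeff) series \<Rightarrow> (ab, coeff) series" where
  "g_aut \<tau> f w = Sum_any (\<lambda>ks. (eis_int ks \<tau> \<otimes>\<^sub>Q 1) * foldr eps_tilde ks f w)"

definition frak_a_tau :: "complex \<Rightarrow> (ab, coeff) series" where
  "frak_a_tau \<tau> = g_aut \<tau> frak_a"


section \<open>Moulds\<close>

subsection \<open>Rational functions with coefficients in a \<open>\<rat>\<close>-algebra\<close>

type_synonym 'k mpol = "(nat \<Rightarrow>\<^sub>0 nat) \<Rightarrow>\<^sub>0 'k"

definition mpol_of :: "rat mpol \<Rightarrow> 'k::comm_rat_algebra mpol" where
  "mpol_of p = Poly_Mapping.map (\<lambda>c. c *\<^sub>Q 1) p"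

lemma lookup_mpol_of: "Poly_Mapping.lookup (mpol_of p) m = Poly_Mapping.lookup p m *\<^sub>Q 1"
  unfolding mpol_of_def by transfer (simp add: when_def)

lemma mpol_of_add: "mpol_of (p + q) = mpol_of p + mpol_of q"
  by (rule poly_mapping_eqI) (simp add: lookup_mpol_of lookup_add scaleQ_add_left)

lemma mpol_of_0 [simp]: "mpol_of 0 = 0"
  by (rule poly_mapping_eqI) (simp add: lookup_mpol_of)

lemma mpol_of_single: "mpol_of (Poly_Mapping.single m c) = Poly_Mapping.single m (c *\<^sub>Q 1)"
  by (rule poly_mapping_eqI) (simp add: lookup_mpol_of lookup_single when_def)

lemma mpol_induct [case_names zero single_add]:
  assumes "P 0" and step: "\<And>m c p. P p \<Longrightarrow> P (Poly_Mapping.single m c + p)"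
  shows "P (p :: 'a \<Rightarrow>\<^sub>0 'b::comm_monoid_add)"
proof -
  have "P (\<Sum>m\<in>S. Poly_Mapping.single m (Poly_Mapping.lookup p m))" if "finite S" for S
    using that by (induction rule: finite_induct) (auto intro: assms)
  then have "P (\<Sum>m\<in>Poly_Mapping.keys p. Poly_Mapping.single m (Poly_Mapping.lookup p m))" by simp
  also have "(\<Sum>m\<in>Poly_Mapping.keys p. Poly_Mapping.single m (Poly_Mapping.lookup p m)) = p"
    by (rule poly_mapping_eqI)
      (auto simp: lookup_sum lookup_single when_def in_keys_iff sum.delta)
  finally show ?thesis .
qed

lemma mpol_of_mult: "mpol_of (p * q) = mpol_of p * (mpol_of q :: 'k::comm_rat_algebra mpol)"
proof (induction p rule: mpol_induct)
  case zero
  then show ?case by simp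
next
  case (single_add m c p)
  have "mpol_of (Poly_Mapping.single m c * q) =
    Poly_Mapping.single m (c *\<^sub>Q 1) * (mpol_of q :: 'k mpol)"
  proof (induction q rule: mpol_induct)
    case zero
    then show ?case by simp
  next
    case (single_add m' c' q)
    then show ?case
      by (simp add: distrib_left mpol_of_add mpol_of_single mult_single
          mult_scaleQ_left mult_scaleQ_right scaleQ_scaleQ mult.commute)
  qed
  then show ?case using single_add by (simp add: distrib_right mpol_of_add mpol_of_single)
qed

lemma mpol_of_1_mult [simp]: "mpol_of 1 * p = (p :: 'k::comm_rat_algebra mpol)"
proof -
  have 1: "(mpol_of 1 :: 'k mpol) = Poly_Mapping.single 0 1"
    by (metis mpol_of_single single_one scaleQ_one)
  show ?thesis
    by (induction p rule: mpol_induct) (simp_all add: 1 distrib_left mult_single)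
qed

text \<open>
  The localization of \<open>'k[u\<^sub>1, u\<^sub>2, \<dots>]\<close> at the nonzero elements of
  \<open>\<rat>[u\<^sub>1, u\<^sub>2, \<dots>]\<close>, that is, \<open>'k \<otimes>\<^sub>\<rat> \<rat>(u\<^sub>1, u\<^sub>2, \<dots>)\<close>.
\<close>

definition ratfun_rel :: "'k::comm_rat_algebra mpol \<times> rat mpol \<Rightarrow> 'k mpol \<times> rat mpol \<Rightarrow> bool" where
  "ratfun_rel x y \<longleftrightarrow> snd x \<noteq> 0 \<and> snd y \<noteq> 0 \<and>
     (\<exists>t. t \<noteq> 0 \<and> mpol_of t * (mpol_of (snd y) * fst x) = mpol_of t * (mpol_of (snd x) * fst y))"

lemma ratfun_relI:
  assumes "s \<noteq> 0" "s' \<noteq> 0" "t \<noteq> 0" "mpol_of t * (mpol_of s' * p) = mpol_of t * (mpol_of s * p')"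
  shows "ratfun_rel (p, s) (p', s')"
  using assms by (auto simp: ratfun_rel_def)

quotient_type (overloaded) 'k ratfun = "'k::comm_rat_algebra mpol \<times> rat mpol" / partial: ratfun_rel
proof (rule part_equivpI)
  show "\<exists>x. ratfun_rel x (x :: 'k mpol \<times> rat mpol)"
    by (rule exI[of _ "(0, 1)"]) (auto simp: ratfun_rel_def intro: exI[of _ 1])
  show "symp (ratfun_rel :: 'k mpol \<times> rat mpol \<Rightarrow> _)"
    by (rule sympI) (auto simp: ratfun_rel_def)
  show "transp (ratfun_rel :: 'k mpol \<times> rat mpol \<Rightarrow> _)"
  proof (rule transpI)
    fix x y z :: "'k mpol \<times> rat mpol"
    assume "ratfun_rel x y" "ratfun_rel y z"
    moreover obtain p s where x: "x = (p, s)" by (cases x)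
    moreover obtain p' s' where y: "y = (p', s')" by (cases y)
    moreover obtain p'' s'' where z: "z = (p'', s'')" by (cases z)
    ultimately obtain t t' where nz: "s \<noteq> 0" "s' \<noteq> 0" "s'' \<noteq> 0" "t \<noteq> 0" "t' \<noteq> 0"
      and 1: "mpol_of t * (mpol_of s' * p) = mpol_of t * (mpol_of s * p')"
      and 2: "mpol_of t' * (mpol_of s'' * p') = mpol_of t' * (mpol_of s' * p'')"
      by (auto simp: ratfun_rel_def)
    have "mpol_of (t * t' * s') * (mpol_of s'' * p)
        = mpol_of t' * mpol_of s'' * (mpol_of t * (mpol_of s' * p))"
      by (simp add: mpol_of_mult mult_ac)
    also have "\<dots> = mpol_of t * mpol_of s * (mpol_of t' * (mpol_of s'' * p'))"
      unfolding 1 by (simp add: mult_ac)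
    also have "\<dots> = mpol_of (t * t' * s') * (mpol_of s * p'')"
      unfolding 2 by (simp add: mpol_of_mult mult_ac)
    finally show "ratfun_rel x z"
      unfolding x z using nz by (intro ratfun_relI[where t = "t * t' * s'"]) auto
  qed
qed

lemma ratfun_relE:
  assumes "ratfun_rel x y"
  obtains p s p' s' t where "x = (p, s)" "y = (p', s')" "s \<noteq> 0" "s' \<noteq> 0" "t \<noteq> 0"
    "mpol_of t * (mpol_of s' * p) = mpol_of t * (mpol_of s * p')"
  using assms by (cases x; cases y) (auto simp: ratfun_rel_def)

lemma ratfun_rel_eqI:
  "s \<noteq> 0 \<Longrightarrow> s' \<noteq> 0 \<Longrightarrow> mpol_of s' * p = mpol_of s * p' \<Longrightarrow> ratfun_rel (p, s) (p', s')"
  by (rule ratfun_relI[of _ _ 1]) auto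

lemma ratfun_rel_refl: "ratfun_rel x x \<longleftrightarrow> snd x \<noteq> 0"
  by (auto simp: ratfun_rel_def intro: exI[of _ 1])

definition ratfrac :: "'k::comm_rat_algebra mpol \<Rightarrow> rat mpol \<Rightarrow> 'k ratfun" where
  "ratfrac p s = abs_ratfun (p, s)"

instantiation ratfun :: (comm_rat_algebra) "{comm_ring, comm_monoid_mult}"
begin

lift_definition zero_ratfun :: "'a ratfun" is "(0, 1)"
  by (simp add: ratfun_rel_refl)
lift_definition one_ratfun :: "'a ratfun" is "(mpol_of 1, 1)"
  by (simp add: ratfun_rel_refl)
lift_definition plus_ratfun :: "'a ratfun \<Rightarrow> 'a ratfun \<Rightarrow> 'a ratfun"
  is "\<lambda>x y. (mpol_of (snd y) * fst x + mpol_of (snd x) * fst y, snd x * snd y)"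
proof (elim ratfun_relE, goal_cases)
  case (1 x x' y y' p s p' s' t q r q' r' v)
  have "mpol_of (t * v) * (mpol_of (s' * r') * (mpol_of r * p + mpol_of s * q)) =
    mpol_of v * mpol_of r' * mpol_of r * (mpol_of t * (mpol_of s' * p)) +
    mpol_of t * mpol_of s' * mpol_of s * (mpol_of v * (mpol_of r' * q))"
    by (simp add: mpol_of_mult algebra_simps)
  also have "\<dots> = mpol_of (t * v) * (mpol_of (s * r) * (mpol_of r' * p' + mpol_of s' * q'))"
    unfolding 1(6) 1(12) by (simp add: mpol_of_mult algebra_simps)
  finally show ?case using 1 by (auto intro!: ratfun_relI[of _ _ "t * v"])
qed
lift_definition times_ratfun :: "'a ratfun \<Rightarrow> 'a ratfun \<Rightarrow> 'a ratfun"
  is "\<lambda>x y. (fst x * fst y, snd x * snd y)"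
proof (elim ratfun_relE, goal_cases)
  case (1 x x' y y' p s p' s' t q r q' r' v)
  have "mpol_of (t * v) * (mpol_of (s' * r') * (p * q)) =
    (mpol_of t * (mpol_of s' * p)) * (mpol_of v * (mpol_of r' * q))"
    by (simp add: mpol_of_mult mult_ac)
  also have "\<dots> = mpol_of (t * v) * (mpol_of (s * r) * (p' * q'))"
    unfolding 1(6) 1(12) by (simp add: mpol_of_mult mult_ac)
  finally show ?case using 1 by (auto intro!: ratfun_relI[of _ _ "t * v"])
qed
lift_definition uminus_ratfun :: "'a ratfun \<Rightarrow> 'a ratfun" is "\<lambda>x. (- fst x, snd x)"
  by (auto simp: ratfun_rel_def)
definition minus_ratfun :: "'a ratfun \<Rightarrow> 'a ratfun \<Rightarrow> 'a ratfun" where "minus_ratfun x y = x + - y"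

instance
proof
  fix x y z :: "'a ratfun"
  note s = ratfun_rel_refl mpol_of_mult algebra_simps
  show "x + y + z = x + (y + z)" by transfer (auto intro!: ratfun_rel_eqI simp: s)
  show "x + y = y + x" by transfer (auto intro!: ratfun_rel_eqI simp: s)
  show "0 + x = x" by transfer (auto intro!: ratfun_rel_eqI simp: s)
  show "- x + x = 0" by transfer (auto intro!: ratfun_rel_eqI simp: s)
  show "x - y = x + - y" by (rule minus_ratfun_def)
  show "x * y * z = x * (y * z)" by transfer (auto intro!: ratfun_rel_eqI simp: s)
  show "x * y = y * x" by transfer (auto intro!: ratfun_rel_eqI simp: s)
  show "(x + y) * z = x * z + y * z" by transfer (auto intro!: ratfun_rel_eqI simp: s)
  show "1 * x = x" by transfer (auto intro!: ratfun_rel_eqI simp: s)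
qed

end

definition var_u :: "nat \<Rightarrow> rat mpol" where
  "var_u i = Poly_Mapping.single (Poly_Mapping.single i 1) 1"

definition mpol_subst :: "(nat \<Rightarrow> rat mpol) \<Rightarrow> 'k::comm_rat_algebra mpol \<Rightarrow> 'k mpol" where
  "mpol_subst \<sigma> p = (\<Sum>m\<in>Poly_Mapping.keys p.
     Poly_Mapping.single 0 (Poly_Mapping.lookup p m) * mpol_of (\<Prod>j\<in>Poly_Mapping.keys m. \<sigma> j ^ Poly_Mapping.lookup m j))"

text \<open>Substitution into a rational function, defined if some denominator does not become zero.\<close>

definition ratfun_subst :: "(nat \<Rightarrow> rat mpol) \<Rightarrow> 'k::comm_rat_algebra ratfun \<Rightarrow> 'k ratfun" where
  "ratfun_subst \<sigma> x = (THE y. \<exists>p s. s \<noteq> 0 \<and> mpol_subst \<sigma> s \<noteq> 0 \<and>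
     x = ratfrac p s \<and> y = ratfrac (mpol_subst \<sigma> p) (mpol_subst \<sigma> s))"

text \<open>
  \<open>P(l\<^sub>1, \<dots>, l\<^sub>r)\<close> for \<open>P = P(u\<^sub>1, \<dots>, u\<^sub>r)\<close>.
\<close>

definition at_args :: "'k::comm_rat_algebra ratfun \<Rightarrow> rat mpol list \<Rightarrow> 'k ratfun" where
  "at_args P ls = ratfun_subst (\<lambda>j. if 1 \<le> j \<and> j \<le> length ls then ls ! (j - 1) else var_u j) P"


subsection \<open>Operations on moulds\<close>

text \<open>The value of a mould at \<open>r\<close> is a rational function of \<open>u\<^sub>1, \<dots>, u\<^sub>r\<close>.\<close>

type_synonym 'k mould = "nat \<Rightarrow> 'k ratfun"

definition alternal :: "'k::comm_rat_algebra mould \<Rightarrow> bool" where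
  "alternal P \<longleftrightarrow> (\<forall>r>1. \<forall>i\<in>{1..r div 2}.
     (\<Sum>w\<leftarrow>shuffle [1..<Suc i] [Suc i..<Suc r]. at_args (P r) (map var_u w)) = 0)"

definition dar :: "'k::comm_rat_algebra mould \<Rightarrow> 'k mould" where
  "dar P r = ratfrac (mpol_of (\<Prod>j=1..r. var_u j)) 1 * P r"

definition dar_inv :: "'k::comm_rat_algebra mould \<Rightarrow> 'k mould" where
  "dar_inv P r = ratfrac (mpol_of 1) (\<Prod>j=1..r. var_u j) * P r"

lemma prod_var_u_nonzero: "(\<Prod>j=1..r. var_u j) \<noteq> 0"
proof -
  have "var_u j \<noteq> 0" for j
    unfolding var_u_def by (metis lookup_single_eq lookup_zero one_neq_zero)
  then show ?thesis by simp
qed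

lemma ratfrac_mult:
  assumes "s \<noteq> 0" "s' \<noteq> 0"
  shows "ratfrac p s * ratfrac p' s' = ratfrac (p * p') (s * s')"
  unfolding ratfrac_def using assms by (subst times_ratfun.abs_eq) (simp_all add: ratfun_rel_refl)

lemma ratfrac_mult_inverse:
  assumes "s \<noteq> 0"
  shows "ratfrac (mpol_of s) 1 * ratfrac (mpol_of 1) s = (1 :: 'k::comm_rat_algebra ratfun)"
proof -
  have "ratfun_rel (mpol_of s * mpol_of 1, 1 * s) (mpol_of 1 :: 'k mpol, 1)"
    using assms by (intro ratfun_rel_eqI) (auto simp: mult.commute)
  then have "ratfrac (mpol_of s * mpol_of 1) (1 * s) = (1 :: 'k ratfun)"
    unfolding ratfrac_def one_ratfun_def by (rule Quotient3_rel_abs[OF Quotient3_ratfun])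
  then show ?thesis by (simp only: ratfrac_mult[OF one_neq_zero assms])
qed

lemma dar_dar_inv: "dar (dar_inv P) = P"
proof (rule ext)
  fix r
  show "dar (dar_inv P) r = P r"
    unfolding dar_def dar_inv_def mult.assoc[symmetric]
      ratfrac_mult_inverse[OF prod_var_u_nonzero] by (rule mult_1_left)
qed

lemma dar_inv_dar: "dar_inv (dar P) = P"
proof (rule ext)
  fix r
  have "dar_inv (dar P) r = dar (dar_inv P) r"
    unfolding dar_def dar_inv_def by (rule mult.left_commute)
  then show "dar_inv (dar P) r = P r" by (simp only: dar_dar_inv)
qed

definition push :: "'k::comm_rat_algebra mould \<Rightarrow> 'k mould" where
  "push P r = at_args (P r)
     (map (\<lambda>j. if j < r then var_u (Suc j) else - (\<Sum>i=1..r. var_u i)) [1..<Suc r])"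

definition push_neutral :: "nat \<Rightarrow> 'k::comm_rat_algebra mould \<Rightarrow> bool" where
  "push_neutral r P \<longleftrightarrow> (\<Sum>j\<le>r. (push ^^ j) P r) = 0"

text \<open>
  \<open>ma_c d F\<close> is the mould attached to the part of \<open>F\<close> of degree \<open>d\<close>, where \<open>c\<^sub>k\<close> has degree
  \<open>k\<close>.  An element of the completed algebra has infinitely many words
  \<open>c\<^bsub>k\<^sub>1\<^esub> \<cdots> c\<^bsub>k\<^sub>r\<^esub> \<close> of each length, so that only its
  homogeneous parts have rational functions as values; the completed \<open>ma\<close> is the family of the
  \<open>ma_c d\<close>, and \<open>push\<close>, \<open>dar\<close> and the shuffle sums preserve homogeneity.
\<close>

definition ma_c :: "nat \<Rightarrow> (nat, 'k::comm_rat_algebra) series \<Rightarrow> 'k mould" where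
  "ma_c d F r = ratfrac
     (\<Sum>ks | length ks = r \<and> 0 \<notin> set ks \<and> sum_list ks = d.
        Poly_Mapping.single (\<Sum>i=1..r. Poly_Mapping.single i (ks ! (i - 1) - 1)) ((- 1) ^ (d - r) * F ks))
     1"

definition ma :: "nat \<Rightarrow> (ab, 'k::comm_rat_algebra) series \<Rightarrow> 'k mould" where
  "ma d f = ma_c d (c_component f)"

end

theory Submission
  imports Defs "HOL-Library.Function_Algebras"
begin

text \<open>
  For \<open>f \<in> \<ff>\<^sub>2\<close> let \<open>cyc (f t\<^sub>1\<^sub>2)\<close> be the sum of \<open>f t\<^sub>1\<^sub>2\<close> over all rotations of words.
  Alternality holds because \<open>ma\<close> turns the shuffle relations of a Lie series into those of moulds;
  push-neutrality of \<open>dar\<^sup>-\<^sup>1 (ma f)\<close> in depth \<open>r\<close> follows when \<open>cyc (f t\<^sub>1\<^sub>2)\<close> vanishes on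
  words with \<open>r + 1\<close> letters \<open>b\<close>.  The derivations \<open>\<epsilon>\<^bsub>2n\<^esub>\<close> kill \<open>t\<^sub>1\<^sub>2\<close>, so it suffices that
  \<open>cyc (\<aa> t\<^sub>1\<^sub>2)\<close> is a multiple of \<open>cyc (t\<^sub>1\<^sub>2 t\<^sub>1\<^sub>2)\<close>, whose words have two letters \<open>b\<close>.  This is
  true of \<open>t\<^sub>0\<^sub>1\<close> in place of \<open>\<aa>\<close>, and \<open>cyc (\<aa> t\<^sub>1\<^sub>2) = cyc (t\<^sub>0\<^sub>1 t\<^sub>1\<^sub>2)\<close> follows by substitution from
  \<open>cyc (\<Phi> x \<Phi>\<^sup>-\<^sup>1 y) = cyc (x y)\<close> modulo \<open>(2\<pi>\<i>)\<^sup>2\<close> for the Drinfeld associator \<open>\<Phi>\<close>.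

  For the latter, the monodromy of \<open>G' = (x / t + y / (t - 1)) G\<close> shows that the product of
  \<open>e\<^bsup>2\<pi>\<i>y\<^esup>\<close> and \<open>\<Phi> e\<^bsup>2\<pi>\<i>x\<^esup> \<Phi>\<^sup>-\<^sup>1\<close> has the same cyclic sums as
  \<open>e\<^bsup>2\<pi>\<i>(x + y)\<^esup>\<close>.  The coefficients of \<open>\<Phi>\<close> are real, so that in real parts only the even powers
  of \<open>2\<pi>\<i>\<close> survive, and the terms of order two give the claim.
\<close>

section \<open>Noncommutative series\<close>

text \<open>The factor \<open>t12\<close> is dictated by denominators. With u_0 = - u_1 - ... - u_r
  the product u_0 u_1 ... u_r is invariant under push, and over this common denominator the j-th
  push of dar^-1 (ma f) acquires the numerator u_j. When b is read as a cyclic shift of r + 1 sites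
  and a as multiplication by a variable attached to the site, \<open>t12\<close> evaluates, up to
  sign, to just such a factor. Two obstacles shape the rest. The coefficient ring may have zero
  divisors or even be zero, and only nonzero integers can be divided by; so Lie series are
  recognized by shuffle relations, and cyclic sums are averaged over rotations. Moreover (2 pi i)^2
  becomes 0 in that ring, while the comparison of second-order terms has to divide by it. This
  division takes place in the complex numbers, with every remainder shown to be (2 pi i)^4 times an
  element of the algebra of multiple zeta values. Hence the associator is constructed analytically,
  and its coefficients are placed in that algebra before anything is reduced. The same construction
  supplies the existence behind the definite description \<open>zeta_reg\<close>.\<close>

lemma scaleQ_minus_left: "(- q) *\<^sub>Q x = - (q *\<^sub>Q (x::'a::comm_rat_algebra))"
  using scaleQ_add_left[of "- q" q x] by (simp add: eq_neg_iff_add_eq_0)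

lemma scaleQ_minus_right: "q *\<^sub>Q (- x) = - (q *\<^sub>Q (x::'a::comm_rat_algebra))"
  using scaleQ_add_right[of q "- x" x] by (simp add: eq_neg_iff_add_eq_0)

lemma scaleQ_sum_right: "q *\<^sub>Q (\<Sum>i\<in>I. f i) = (\<Sum>i\<in>I. q *\<^sub>Q (f i :: 'a::comm_rat_algebra))"
  by (induction I rule: infinite_finite_induct) (auto simp: scaleQ_add_right)

text \<open>Multiplication by the reciprocal of a nonzero rational excludes torsion. This replaces
  cancellation in a domain wherever a sum is divided by a word length or a multiplicity.\<close>

lemma scaleQ_eq_0_iff [simp]: "q *\<^sub>Q x = 0 \<longleftrightarrow> q = 0 \<or> x = (0::'a::comm_rat_algebra)"
  by (metis left_inverse scaleQ_one scaleQ_scaleQ scaleQ_zero_left scaleQ_zero_right)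

lemma sum_const_scaleQ: "(\<Sum>i<n. x) = of_nat n *\<^sub>Q (x :: 'a::comm_rat_algebra)"
  by (induction n) (simp_all add: scaleQ_add_left scaleQ_one add.commute)

lemma scaleQ_alt: "q *\<^sub>Q x = (q *\<^sub>Q 1) * (x :: 'a::comm_rat_algebra)"
  by (simp add: mult_scaleQ_left)

lemma sum_fun_app: "(\<Sum>i\<in>I. f i) w = (\<Sum>i\<in>I. (f i w :: 'a::comm_monoid_add))"
  by (induction I rule: infinite_finite_induct) auto

subsection \<open>The algebra of noncommutative series\<close>

lemma nc_add_eq [simp]: "nc_add f g = f + g"
  by (simp add: fun_eq_iff nc_add_def)

lemma nc_zero_eq [simp]: "nc_zero = 0"
  by (simp add: fun_eq_iff nc_zero_def)

lemma nc_uminus_eq [simp]: "nc_uminus f = - f"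
  by (simp add: fun_eq_iff nc_uminus_def)

lemma ad_eq: "ad f g = f \<star> g - g \<star> f"
  by (simp add: ad_def)

lemma nc_mult_Nil [simp]: "(f \<star> g) [] = f [] * g []"
  by (simp add: nc_mult_def)

text \<open>Only the empty prefix keeps the first letter away from \<open>f\<close>. Convolution
  thus becomes a recursion over the quotients \<open>\<lambda>v. f (x # v)\<close>, on which
  inductions over words can run.\<close>

lemma nc_mult_Cons: "(f \<star> g) (x # w) = f [] * g (x # w) + ((\<lambda>v. f (x # v)) \<star> g) w"
  unfolding nc_mult_def length_Cons sum.atMost_Suc_shift by simp

lemma nc_mult_add_left: "(f + g) \<star> h = f \<star> h + g \<star> h"
  by (simp add: fun_eq_iff nc_mult_def distrib_right sum.distrib)

lemma nc_mult_add_right: "f \<star> (g + h) = f \<star> g + f \<star> h"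
  by (simp add: fun_eq_iff nc_mult_def distrib_left sum.distrib)

lemma nc_mult_zero [simp]: "0 \<star> f = 0" "f \<star> 0 = 0"
  by (simp_all add: fun_eq_iff nc_mult_def)

lemma nc_mult_uminus [simp]: "(- f) \<star> g = - (f \<star> g)" "f \<star> (- g) = - (f \<star> g)"
  by (simp_all add: fun_eq_iff nc_mult_def sum_negf)

lemma nc_mult_diff_left: "(f - g) \<star> h = f \<star> h - g \<star> h"
  using nc_mult_add_left[of f "- g" h] by simp

lemma nc_mult_diff_right: "f \<star> (g - h) = f \<star> g - f \<star> h"
  using nc_mult_add_right[of f g "- h"] by simp

lemma nc_smult_mult_left: "nc_smult c f \<star> g = nc_smult c (f \<star> g)"
  by (simp add: fun_eq_iff nc_mult_def nc_smult_def sum_distrib_left mult.assoc)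

lemma nc_smult_mult_right: "f \<star> nc_smult c g = nc_smult c (f \<star> g)"
  by (simp add: fun_eq_iff nc_mult_def nc_smult_def sum_distrib_left mult.left_commute)

lemma nc_mult_sum_left: "(\<Sum>i\<in>I. f i) \<star> g = (\<Sum>i\<in>I. f i \<star> g)"
  by (induction I rule: infinite_finite_induct) (simp_all only: sum.infinite sum.empty sum.insert nc_mult_add_left nc_mult_zero not_False_eq_True)

lemma nc_mult_sum_right: "g \<star> (\<Sum>i\<in>I. f i) = (\<Sum>i\<in>I. g \<star> f i)"
  by (induction I rule: infinite_finite_induct) (simp_all only: sum.infinite sum.empty sum.insert nc_mult_add_right nc_mult_zero not_False_eq_True)

lemma nc_smult_add: "nc_smult c (f + g) = nc_smult c f + nc_smult c g"
  by (simp add: fun_eq_iff nc_smult_def distrib_left)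

lemma nc_smult_diff: "nc_smult c (f - g) = nc_smult c f - nc_smult c g"
  by (simp add: fun_eq_iff nc_smult_def right_diff_distrib)

lemma nc_smult_zero [simp]: "nc_smult c 0 = 0" "nc_smult 0 f = 0"
  by (simp_all add: fun_eq_iff nc_smult_def)

lemma nc_smult_one [simp]: "nc_smult 1 f = f"
  by (simp add: fun_eq_iff nc_smult_def)

lemma nc_mult_assoc: "(f \<star> g) \<star> h = f \<star> (g \<star> h)"
proof
  fix w show "((f \<star> g) \<star> h) w = (f \<star> (g \<star> h)) w"
  proof (induction w arbitrary: f)
    case (Cons x w)
    have "(\<lambda>v. (f \<star> g) (x # v)) = nc_smult (f []) (\<lambda>v. g (x # v)) + (\<lambda>v. f (x # v)) \<star> g"
      by (simp add: fun_eq_iff nc_mult_Cons nc_smult_def)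
    then show ?case
      by (simp add: nc_mult_Cons[of _ _ x w] nc_mult_add_left nc_smult_mult_left Cons)
        (simp add: nc_smult_def distrib_left mult.assoc add_ac)
  qed (simp add: mult.assoc)
qed

lemma nc_mult_one_left [simp]: "nc_one \<star> f = (f :: ('a, 'b::comm_rat_algebra) series)"
proof
  fix w show "(nc_one \<star> f) w = f w"
  proof (cases w)
    case (Cons x v)
    have "(\<lambda>v. nc_one (x # v)) = (0 :: _ \<Rightarrow> 'b)" by (simp add: fun_eq_iff nc_one_def)
    then show ?thesis by (simp add: Cons nc_mult_Cons) (simp add: nc_one_def)
  qed (simp add: nc_one_def)
qed

lemma nc_mult_one_right [simp]: "f \<star> nc_one = f"
proof
  fix w show "(f \<star> nc_one) w = f w"
    by (induction w arbitrary: f) (simp_all add: nc_mult_Cons, simp_all add: nc_one_def)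
qed

lemma nc_inverse_unique:
  assumes "f \<star> g = nc_one" "g \<star> f = nc_one"
  shows "nc_inverse f = g"
  unfolding nc_inverse_def
proof (rule the_equality)
  fix g' assume "f \<star> g' = nc_one \<and> g' \<star> f = nc_one"
  then have "g' \<star> (f \<star> g) = g" by (simp flip: nc_mult_assoc)
  then show "g' = g" using assms by simp
qed (use assms in simp)

lemma letter_mult_Cons: "(letter x \<star> f) (y # w) = (if x = y then f w else 0)"
proof -
  have "(\<lambda>v. letter x (y # v)) = (if x = y then nc_one else (0 :: _ \<Rightarrow> 'a))"
    by (auto simp: fun_eq_iff letter_def nc_one_def)
  then show ?thesis by (simp add: nc_mult_Cons) (simp add: letter_def)
qed

lemma nc_prod_simps [simp]:
  "nc_prod [] = nc_one" "nc_prod (f # fs) = f \<star> nc_prod fs"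
  by (simp_all add: nc_prod_def)

lemma nc_prod_append: "nc_prod (fs @ gs) = nc_prod fs \<star> nc_prod gs"
  by (induction fs) (simp_all add: nc_mult_assoc)

lemma nc_prod_letters: "nc_prod (map letter v) w = (if v = w then 1 else 0)"
proof (induction v arbitrary: w)
  case (Cons x v)
  then show ?case by (cases w) (auto simp: letter_mult_Cons, simp add: letter_def)
qed (auto simp: nc_one_def)

lemma Jacobi: "ad f (ad g h) = ad (ad f g) h + ad g (ad f h)"
  by (simp add: ad_eq nc_mult_diff_left nc_mult_diff_right nc_mult_assoc algebra_simps)

lemma ad_add: "ad f (g + h) = ad f g + ad f h" "ad (f + g) h = ad f h + ad g h"
  by (simp_all add: ad_eq nc_mult_add_left nc_mult_add_right)

lemma ad_smult: "ad f (nc_smult c g) = nc_smult c (ad f g)" "ad (nc_smult c f) g = nc_smult c (ad f g)"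
  by (simp_all add: ad_eq nc_smult_mult_left nc_smult_mult_right nc_smult_diff)

lemma ad_zero [simp]: "ad f 0 = 0" "ad 0 f = 0" "ad f f = 0"
  by (simp_all add: ad_eq)

lemma ad_uminus: "ad f (- g) = - ad f g" "ad (- f) g = - ad f g" "ad f g = - ad g f"
  by (simp_all add: ad_eq)

subsection \<open>Linear extensions\<close>

definition bounded_words :: "('m \<Rightarrow> nat) \<Rightarrow> nat \<Rightarrow> 'm list set" where
  "bounded_words wt n = {v. sum_list (map wt v) \<le> n}"

definition finite_bounded :: "('m \<Rightarrow> nat) \<Rightarrow> bool" where
  "finite_bounded wt \<longleftrightarrow> (\<forall>n. finite (bounded_words wt n))"

definition nc_linear :: "('m list \<Rightarrow> ('l, 'k::comm_rat_algebra) series) \<Rightarrow> ('m, 'k) series \<Rightarrow> ('l, 'k) series" where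
  "nc_linear M f w = Sum_any (\<lambda>v. f v * M v w)"

text \<open>Continuity of the linear extension of \<open>M\<close>: a coefficient of the image
  depends only on the finitely many words of bounded weight. General weights serve the two-letter
  alphabets as well as the infinite alphabet of the \<open>c_ser i\<close>.\<close>

definition adapted :: "('m \<Rightarrow> nat) \<Rightarrow> ('m list \<Rightarrow> ('l, 'k::comm_rat_algebra) series) \<Rightarrow> bool" where
  "adapted wt M \<longleftrightarrow> finite_bounded wt \<and> (\<forall>v w. M v w \<noteq> 0 \<longrightarrow> sum_list (map wt v) \<le> length w)"

lemma nc_linear_eq:
  assumes "adapted wt M" "length w \<le> n"
  shows "nc_linear M f w = (\<Sum>v\<in>bounded_words wt n. f v * M v w)"
  unfolding nc_linear_def
proof (rule Sum_any.expand_superset)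
  show "finite (bounded_words wt n)"
    using assms(1) by (auto simp: adapted_def finite_bounded_def)
  show "{v. f v * M v w \<noteq> 0} \<subseteq> bounded_words wt n"
  proof
    fix v assume "v \<in> {v. f v * M v w \<noteq> 0}"
    then have "M v w \<noteq> 0" by auto
    then show "v \<in> bounded_words wt n"
      using assms by (fastforce simp: adapted_def bounded_words_def)
  qed
qed

lemma nc_linear_add: "adapted wt M \<Longrightarrow> nc_linear M (f + g) = nc_linear M f + nc_linear M g"
  by (simp add: fun_eq_iff nc_linear_eq[OF _ order_refl] distrib_right sum.distrib)

lemma nc_linear_smult: "adapted wt M \<Longrightarrow> nc_linear M (nc_smult c f) = nc_smult c (nc_linear M f)"
  by (simp add: fun_eq_iff nc_linear_eq[OF _ order_refl] nc_smult_def sum_distrib_left mult.assoc)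

lemma nc_linear_zero [simp]: "nc_linear M 0 = 0"
  by (simp add: fun_eq_iff nc_linear_def)

lemma nc_linear_uminus: "adapted wt M \<Longrightarrow> nc_linear M (- f) = - nc_linear M f"
  by (simp add: fun_eq_iff nc_linear_eq[OF _ order_refl] sum_negf)

lemma nc_linear_diff: "adapted wt M \<Longrightarrow> nc_linear M (f - g) = nc_linear M f - nc_linear M g"
  using nc_linear_add[of wt M f "- g"] by (simp add: nc_linear_uminus)

lemma nc_linear_cong_bounded:
  assumes "adapted wt M" "\<And>v. sum_list (map wt v) \<le> n \<Longrightarrow> f v = g v" "length w \<le> n"
  shows "nc_linear M f w = nc_linear M g w"
  unfolding nc_linear_eq[OF assms(1,3)] by (rule sum.cong) (auto simp: assms(2) bounded_words_def)

lemma nc_mult_sum_splits: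
  assumes T: "T = bounded_words wt n" "finite T"
  shows "(\<Sum>v\<in>T. (f \<star> g) v * M v) =
    (\<Sum>(v1, v2)\<in>{(v1, v2). v1 @ v2 \<in> T}. f v1 * g v2 * (M (v1 @ v2) :: 'k::comm_rat_algebra))"
proof -
  have "(\<Sum>v\<in>T. (f \<star> g) v * M v) = (\<Sum>v\<in>T. \<Sum>i\<le>length v. f (take i v) * g (drop i v) * M v)"
    by (simp add: nc_mult_def sum_distrib_right)
  also have "\<dots> = (\<Sum>(v, i)\<in>(SIGMA v:T. {..length v}). f (take i v) * g (drop i v) * M v)"
    using T by (simp add: sum.Sigma)
  also have "\<dots> = (\<Sum>(v1, v2)\<in>{(v1, v2). v1 @ v2 \<in> T}. f v1 * g v2 * M (v1 @ v2))"
    by (rule sum.reindex_bij_witness[of _ "\<lambda>(v1, v2). (v1 @ v2, length v1)" "\<lambda>(v, i). (take i v, drop i v)"])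
      auto
  finally show ?thesis .
qed

text \<open>Two products on the right cover both uses: an algebra homomorphism has the second one
  equal to 0, and a derivation has one product for each factor differentiated.\<close>

lemma nc_linear_mult:
  fixes f g :: "('m, 'k::comm_rat_algebra) series" and M M1 M2 N1 N2 :: "'m list \<Rightarrow> ('l, 'k) series"
  assumes ad: "adapted wt M" "adapted wt M1" "adapted wt M2" "adapted wt N1" "adapted wt N2"
    and M: "\<And>v1 v2. M (v1 @ v2) = M1 v1 \<star> M2 v2 + N1 v1 \<star> N2 v2"
  shows "nc_linear M (f \<star> g) = nc_linear M1 f \<star> nc_linear M2 g + nc_linear N1 f \<star> nc_linear N2 g"
proof
  fix w :: "'l list"
  define n where "n = length w"
  define T where "T = bounded_words wt n"
  have fin: "finite T" using ad(1) by (auto simp: adapted_def finite_bounded_def T_def)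
  have swap: "(\<Sum>v1\<in>T. \<Sum>v2\<in>T. \<Sum>j\<le>n. (f v1 * A v1 (take j w)) * (g v2 * B v2 (drop j w))) =
      (\<Sum>j\<le>n. (\<Sum>v1\<in>T. f v1 * A v1 (take j w)) * (\<Sum>v2\<in>T. g v2 * B v2 (drop j w)))"
    for A B :: "'m list \<Rightarrow> ('l, 'k) series"
    unfolding sum_product sum.swap[of _ T "{..n}"] ..
  have sub: "{(v1, v2). v1 @ v2 \<in> T} \<subseteq> T \<times> T"
    by (auto simp: T_def bounded_words_def)
  have "nc_linear M (f \<star> g) w = (\<Sum>v\<in>T. (f \<star> g) v * M v w)"
    by (simp add: nc_linear_eq[OF ad(1)] n_def T_def)
  also have "\<dots> = (\<Sum>(v1, v2)\<in>{(v1, v2). v1 @ v2 \<in> T}. f v1 * g v2 * M (v1 @ v2) w)"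
    by (rule nc_mult_sum_splits[OF T_def fin])
  also have "\<dots> = (\<Sum>(v1, v2)\<in>T \<times> T. f v1 * g v2 * M (v1 @ v2) w)"
  proof -
    have "M (v1 @ v2) w = 0" if "v1 @ v2 \<notin> T" for v1 v2
      using ad(1) that unfolding adapted_def T_def bounded_words_def n_def by blast
    then show ?thesis
      using fin sub by (intro sum.mono_neutral_left) (auto, metis mult_zero_right)
  qed
  also have "\<dots> = (\<Sum>v1\<in>T. \<Sum>v2\<in>T. f v1 * g v2 * M (v1 @ v2) w)"
    by (simp add: sum.cartesian_product)
  also have "\<dots> = (\<Sum>v1\<in>T. \<Sum>v2\<in>T. \<Sum>j\<le>n. (f v1 * M1 v1 (take j w)) * (g v2 * M2 v2 (drop j w)))
     + (\<Sum>v1\<in>T. \<Sum>v2\<in>T. \<Sum>j\<le>n. (f v1 * N1 v1 (take j w)) * (g v2 * N2 v2 (drop j w)))"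
    by (simp add: M nc_mult_def n_def sum_distrib_left distrib_left sum.distrib mult_ac)
  also have "\<dots> = (\<Sum>j\<le>n. (\<Sum>v1\<in>T. f v1 * M1 v1 (take j w)) * (\<Sum>v2\<in>T. g v2 * M2 v2 (drop j w)))
     + (\<Sum>j\<le>n. (\<Sum>v1\<in>T. f v1 * N1 v1 (take j w)) * (\<Sum>v2\<in>T. g v2 * N2 v2 (drop j w)))"
    unfolding swap ..
  finally show "nc_linear M (f \<star> g) w = (nc_linear M1 f \<star> nc_linear M2 g + nc_linear N1 f \<star> nc_linear N2 g) w"
    by (simp add: nc_mult_def[of "nc_linear _ _"] n_def T_def nc_linear_eq[OF ad(2), of _ n] nc_linear_eq[OF ad(3), of _ n]
        nc_linear_eq[OF ad(4), of _ n] nc_linear_eq[OF ad(5), of _ n])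
qed

lemma adapted_zero: "finite_bounded wt \<Longrightarrow> adapted wt (\<lambda>v. 0)"
  by (simp add: adapted_def)

lemma nc_linear_letter_0: "nc_linear (\<lambda>v. 0) f = 0"
  by (simp add: fun_eq_iff nc_linear_def)

lemma nc_mult_length_le:
  assumes "\<And>w. f w \<noteq> 0 \<Longrightarrow> m \<le> length w" "\<And>w. g w \<noteq> 0 \<Longrightarrow> n \<le> length w" "(f \<star> g) w \<noteq> 0"
  shows "m + n \<le> length w"
proof (rule ccontr)
  assume *: "\<not> m + n \<le> length w"
  have "f (take i w) * g (drop i w) = 0" if "i \<le> length w" for i
  proof (cases "f (take i w) = 0")
    case False
    then have "m \<le> i" using assms(1)[OF False] by simp
    then have "\<not> n \<le> length (drop i w)" using * that by simp
    then have "g (drop i w) = 0" using assms(2)[of "drop i w"] by blast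
    then show ?thesis by simp
  qed simp
  then show False using assms(3) by (simp add: nc_mult_def)
qed

lemma nc_linear_single:
  fixes M :: "'m list \<Rightarrow> ('l, 'k::comm_rat_algebra) series"
  assumes "adapted wt M"
  shows "nc_linear M (\<lambda>w. if w = v then 1 else 0) = M v"
proof
  fix w :: "'l list"
  have fin: "finite (bounded_words wt (max (length w) (sum_list (map wt v))))"
    using assms by (auto simp: adapted_def finite_bounded_def)
  then show "nc_linear M (\<lambda>w. if w = v then 1 else 0) w = M v w"
    by (subst nc_linear_eq[OF assms, of w "max (length w) (sum_list (map wt v))"])
      (simp_all add: if_distrib[of "\<lambda>x. x * _"] bounded_words_def cong: if_cong)
qed

lemma nc_linear_one: "adapted wt M \<Longrightarrow> nc_linear M nc_one = M []"
  using nc_linear_single[of wt M "[]"] by (simp add: nc_one_def[abs_def] cong: if_cong)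

lemma nc_linear_letter: "adapted wt M \<Longrightarrow> nc_linear M (letter x) = M [x]"
  using nc_linear_single[of wt M "[x]"] by (simp add: letter_def[abs_def] cong: if_cong)

lemma finite_bounded_const: "finite (UNIV :: 'm set) \<Longrightarrow> finite_bounded (\<lambda>_::'m. 1)"
  unfolding finite_bounded_def bounded_words_def
  using finite_lists_length_le[of "UNIV :: 'm set"] by (auto simp: sum_list_triv)

subsection \<open>Substitution\<close>

lemma nc_subst_linear: "nc_subst s = nc_linear (\<lambda>v. nc_prod (map s v))"
  by (simp add: fun_eq_iff nc_subst_def nc_linear_def)

lemma nc_prod_length_le:
  assumes "\<And>x w. x \<in> set v \<Longrightarrow> s x w \<noteq> 0 \<Longrightarrow> wt x \<le> length w" "nc_prod (map s v) w \<noteq> 0"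
  shows "sum_list (map wt v) \<le> length w"
  using assms
proof (induction v arbitrary: w)
  case (Cons x v)
  then have "(s x \<star> nc_prod (map s v)) w \<noteq> 0" by simp
  from nc_mult_length_le[OF _ _ this, of "wt x" "sum_list (map wt v)"] Cons show ?case by auto
qed simp

definition subst_adapted :: "('m \<Rightarrow> nat) \<Rightarrow> ('m \<Rightarrow> ('l, 'k::comm_rat_algebra) series) \<Rightarrow> bool" where
  "subst_adapted wt s \<longleftrightarrow> finite_bounded wt \<and> (\<forall>x w. s x w \<noteq> 0 \<longrightarrow> wt x \<le> length w)"

lemma subst_adapted: "subst_adapted wt s \<Longrightarrow> adapted wt (\<lambda>v. nc_prod (map s v))"
  unfolding adapted_def subst_adapted_def
  by (intro conjI allI impI, blast) (rule nc_prod_length_le[of _ s], blast, assumption)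

lemma nc_subst_mult:
  assumes "subst_adapted wt s"
  shows "nc_subst s (f \<star> g) = nc_subst s f \<star> nc_subst s g"
proof -
  note ad = subst_adapted[OF assms]
  have "adapted wt (\<lambda>v. 0)" using assms by (simp add: adapted_zero subst_adapted_def)
  from nc_linear_mult[OF ad ad ad this this] show ?thesis
    by (simp add: nc_subst_linear nc_prod_append nc_linear_letter_0)
qed

lemma
  assumes "subst_adapted wt s"
  shows nc_subst_add: "nc_subst s (f + g) = nc_subst s f + nc_subst s g"
    and nc_subst_diff: "nc_subst s (f - g) = nc_subst s f - nc_subst s g"
    and nc_subst_smult: "nc_subst s (nc_smult c f) = nc_smult c (nc_subst s f)"
    and nc_subst_one: "nc_subst s nc_one = nc_one"
    and nc_subst_letter: "nc_subst s (letter x) = s x"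
    and nc_subst_ad: "nc_subst s (ad f g) = ad (nc_subst s f) (nc_subst s g)"
proof -
  note ad = subst_adapted[OF assms]
  show "nc_subst s (f + g) = nc_subst s f + nc_subst s g"
    "nc_subst s (nc_smult c f) = nc_smult c (nc_subst s f)"
    "nc_subst s nc_one = nc_one" "nc_subst s (letter x) = s x"
    and diff: "nc_subst s (f - g) = nc_subst s f - nc_subst s g" for f g
    by (simp_all add: nc_subst_linear nc_linear_diff[OF ad] nc_linear_smult[OF ad] nc_linear_one[OF ad]
      nc_linear_letter[OF ad] nc_linear_add[OF ad])
  show "nc_subst s (ad f g) = ad (nc_subst s f) (nc_subst s g)"
    by (simp add: ad_eq diff nc_subst_mult[OF assms])
qed

lemma nc_subst_zero [simp]: "nc_subst s 0 = 0"
  by (simp add: nc_subst_linear)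

subsection \<open>Derivations\<close>

definition deriv_word :: "('l \<Rightarrow> ('l, 'k::comm_rat_algebra) series) \<Rightarrow> 'l list \<Rightarrow> ('l, 'k) series" where
  "deriv_word d v = (\<Sum>i<length v. nc_prod (map letter (take i v)) \<star> d (v ! i) \<star> nc_prod (map letter (drop (Suc i) v)))"

lemma nc_deriv_linear: "nc_deriv d = nc_linear (deriv_word d)"
  by (simp add: fun_eq_iff nc_deriv_def nc_linear_def deriv_word_def sum_fun_app)

lemma deriv_word_append:
  fixes d :: "'a \<Rightarrow> ('a, 'b::comm_rat_algebra) series"
  shows "deriv_word d (v1 @ v2) = deriv_word d v1 \<star> nc_prod (map letter v2) + nc_prod (map letter v1) \<star> deriv_word d v2"
proof -
  let ?t = "\<lambda>v i. nc_prod (map letter (take i v)) \<star> d (v ! i) \<star> nc_prod (map letter (drop (Suc i) v))"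
  have split: "(\<Sum>i<m + n. F i) = (\<Sum>i<m. F i) + (\<Sum>i<n. F (m + i))" for m n and F :: "nat \<Rightarrow> ('a, 'b) series"
    by (induction n) (simp_all only: add_0_right add_Suc_right sum.lessThan_Suc lessThan_0 sum.empty add.assoc)
  have "deriv_word d (v1 @ v2) = (\<Sum>i<length v1. ?t (v1 @ v2) i) + (\<Sum>i<length v2. ?t (v1 @ v2) (length v1 + i))"
    unfolding deriv_word_def length_append split ..
  then show ?thesis
    by (simp add: deriv_word_def nth_append nc_prod_append nc_mult_sum_left nc_mult_sum_right nc_mult_assoc)
qed

lemma nc_prod_letters_adapted: "finite (UNIV :: 'l set) \<Longrightarrow> adapted (\<lambda>_::'l. 1) (\<lambda>v. nc_prod (map letter v))"
  using finite_bounded_const[where 'm = 'l]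
  by (auto simp: adapted_def nc_prod_letters sum_list_triv split: if_splits)

lemma deriv_word_adapted:
  assumes "finite (UNIV :: 'l set)" "\<forall>x. d x [] = (0::'k::comm_rat_algebra)"
  shows "adapted (\<lambda>_::'l. 1) (deriv_word d)"
  unfolding adapted_def
proof (intro conjI allI impI)
  show "finite_bounded (\<lambda>_::'l. 1)" by (rule finite_bounded_const[OF assms(1)])
  fix v w assume "deriv_word d v w \<noteq> 0"
  then obtain i where i: "i < length v"
    and nz: "(nc_prod (map letter (take i v)) \<star> d (v ! i) \<star> nc_prod (map letter (drop (Suc i) v))) w \<noteq> 0"
    unfolding deriv_word_def sum_fun_app by (auto elim: sum.not_neutral_contains_not_neutral)
  have p: "nc_prod (map letter u) w \<noteq> (0::'k) \<Longrightarrow> length u \<le> length w" for u w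
    by (auto simp: nc_prod_letters split: if_splits)
  \<comment> \<open>Without a constant term, replacing a letter by its image under \<open>d\<close>
    never shortens a word.\<close>
  have d: "d x w \<noteq> 0 \<Longrightarrow> 1 \<le> length w" for x w
    using assms(2) by (cases w) auto
  have "(length (take i v) + 1) + length (drop (Suc i) v) \<le> length w"
    by (rule nc_mult_length_le[OF _ p nz], rule nc_mult_length_le[OF p d])
  with i show "sum_list (map (\<lambda>_. 1) v) \<le> length w" by (simp add: sum_list_triv)
qed

lemma nc_linear_letters:
  "finite (UNIV :: 'l set) \<Longrightarrow> nc_linear (\<lambda>v. nc_prod (map letter v)) f = (f :: ('l, _) series)"
proof
  fix w :: "'l list" assume fin: "finite (UNIV :: 'l set)"
  note ad = nc_prod_letters_adapted[OF fin]
  have "finite (bounded_words (\<lambda>_::'l. 1) (length w))"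
    using finite_bounded_const[OF fin] by (simp add: finite_bounded_def)
  then show "nc_linear (\<lambda>v. nc_prod (map letter v)) f w = f w"
    by (simp add: nc_linear_eq[OF ad order_refl] nc_prod_letters bounded_words_def sum_list_triv
       if_distrib[of "\<lambda>x. _ * x"] cong: if_cong)
qed

lemma
  assumes "finite (UNIV :: 'l set)" "\<forall>x. d x [] = (0::'k::comm_rat_algebra)"
  shows nc_deriv_mult: "nc_deriv d (f \<star> g) = nc_deriv d f \<star> g + f \<star> nc_deriv d (g :: ('l, 'k) series)"
    and nc_deriv_add: "nc_deriv d (f + g) = nc_deriv d f + nc_deriv d g"
    and nc_deriv_diff: "nc_deriv d (f - g) = nc_deriv d f - nc_deriv d g"
    and nc_deriv_smult: "nc_deriv d (nc_smult c f) = nc_smult c (nc_deriv d f)"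
    and nc_deriv_letter: "nc_deriv d (letter x) = d x"
proof -
  note dw = deriv_word_adapted[where d = d, OF assms]
  note ad = dw nc_prod_letters_adapted[OF assms(1)]
  show "nc_deriv d (f \<star> g) = nc_deriv d f \<star> g + f \<star> nc_deriv d g"
    using nc_linear_mult[OF ad(1,1,2,2,1) deriv_word_append, of f g]
    by (simp add: nc_deriv_linear nc_linear_letters[OF assms(1)])
  show "nc_deriv d (letter x) = d x"
    by (simp add: nc_deriv_linear nc_linear_letter[OF dw] deriv_word_def)
qed (simp_all add: nc_deriv_linear nc_linear_add[OF deriv_word_adapted[where d = d, OF assms]]
  nc_linear_diff[OF deriv_word_adapted[where d = d, OF assms]] nc_linear_smult[OF deriv_word_adapted[where d = d, OF assms]])

lemma nc_deriv_ad:
  assumes "finite (UNIV :: 'l set)" "\<forall>x. d x [] = (0::'k::comm_rat_algebra)"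
  shows "nc_deriv d (ad f g) = ad (nc_deriv d f) g + ad f (nc_deriv d (g :: ('l, 'k) series))"
  by (simp add: ad_eq nc_deriv_diff[where d = d, OF assms] nc_deriv_mult[where d = d, OF assms])

lemma nc_deriv_zero [simp]: "nc_deriv d 0 = 0"
  by (simp add: nc_deriv_linear)

section \<open>Shuffles\<close>

text \<open>The functional \<open>g\<close> evaluated on the shuffle product, with multiplicities.
  Only addition is required of its values, so that moulds can be shuffled with values in rational
  functions.\<close>

definition sh :: "('l list \<Rightarrow> 'k::comm_monoid_add) \<Rightarrow> 'l list \<Rightarrow> 'l list \<Rightarrow> 'k" where
  "sh g u v = sum_list (map g (shuffle u v))"

lemma sh_Nil [simp]: "sh g [] v = g v" "sh g u [] = g u"
  by (simp_all add: sh_def) (cases u; simp)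

lemma sh_Cons: "sh g (x # u) (y # v) = sh (\<lambda>w. g (x # w)) u (y # v) + sh (\<lambda>w. g (y # w)) (x # u) v"
  by (simp add: sh_def o_def)

lemma sh_add: "sh (\<lambda>w. f w + g w) u v = sh f u v + sh g u v"
  by (induction u v arbitrary: f g rule: shuffle.induct) (simp_all add: sh_Cons add_ac)

lemma sh_zero [simp]: "sh (\<lambda>w. 0) u v = 0"
  by (induction u v rule: shuffle.induct) (simp_all add: sh_Cons)

lemma sh_sum: "sh (\<lambda>w. \<Sum>i\<in>I. f i w) u v = (\<Sum>i\<in>I. sh (f i) u v)"
  by (induction I rule: infinite_finite_induct) (simp_all add: sh_add)

lemma sh_mult_left: "sh (\<lambda>w. c * f w) u v = c * sh f u (v :: _ list)" for c :: "'k::comm_ring"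
  by (induction u v arbitrary: f rule: shuffle.induct) (simp_all add: sh_Cons distrib_left)

lemma sh_mult_right: "sh (\<lambda>w. f w * c) u v = sh f u (v :: _ list) * c" for c :: "'k::comm_ring"
  by (induction u v arbitrary: f rule: shuffle.induct) (simp_all add: sh_Cons distrib_right)

lemma sh_cong:
  "(\<And>w. mset w = mset u + mset v \<Longrightarrow> f w = g w) \<Longrightarrow> sh f u v = sh g u v"
proof (induction u v arbitrary: f g rule: shuffle.induct)
  case (3 x xs y ys)
  have "sh (\<lambda>w. f (x # w)) xs (y # ys) = sh (\<lambda>w. g (x # w)) xs (y # ys)"
    by (rule 3(1)) (simp add: 3(3))
  moreover have "sh (\<lambda>w. f (y # w)) (x # xs) ys = sh (\<lambda>w. g (y # w)) (x # xs) ys"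
    by (rule 3(2)) (simp add: 3(3))
  ultimately show ?case by (simp add: sh_Cons)
qed simp_all

text \<open>Shuffling is symmetric under reversal, although its recursion is written at the first
  letters. The form at the last letters serves \<open>rev\<close> and multiplication by a letter
  from the right.\<close>

lemma sh_snoc: "sh g (u @ [x]) (v @ [y]) = sh (\<lambda>w. g (w @ [x])) u (v @ [y]) + sh (\<lambda>w. g (w @ [y])) (u @ [x]) v"
proof (induction u v arbitrary: g rule: shuffle.induct)
  case (1 ys)
  show ?case by (induction ys arbitrary: g) (simp_all add: sh_Cons add_ac)
next
  case (2 z zs)
  show ?case
  proof (induction zs arbitrary: g z)
    case Nil
    show ?case by (simp add: sh_Cons add_ac)
  next
    case (Cons z' zs)
    from Cons[of "\<lambda>w. g (z # w)" z'] show ?case by (simp add: sh_Cons add_ac)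
  qed
next
  case (3 z zs z' zs')
  then show ?case by (simp add: sh_Cons add_ac)
qed

lemma sh_map: "sh g (map f u) (map f v) = sh (\<lambda>w. g (map f w)) u v"
  by (induction u v arbitrary: g rule: shuffle.induct) (simp_all add: sh_Cons)

lemma sh_rev: "sh g (rev u) (rev v) = sh (\<lambda>w. g (rev w)) u v"
  by (induction u v arbitrary: g rule: shuffle.induct) (simp_all add: sh_Cons sh_snoc[simplified])

text \<open>Antipode identity of the shuffle Hopf algebra. Sorting the shuffles in each term by
  their first letter makes the alternating sum telescope.\<close>

lemma sh_antipode:
  fixes g :: "'l list \<Rightarrow> 'k::comm_rat_algebra"
  assumes "v \<noteq> []"
  shows "(\<Sum>i\<le>length v. (-1) ^ i *\<^sub>Q sh g (rev (take i v)) (drop i v)) = 0"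
proof -
  let ?n = "length v"
  \<comment> \<open>\<open>S i\<close> collects the shuffles that begin with the \<open>i\<close>-th
    letter of \<open>v\<close>. They occur in term \<open>i\<close>, where this letter ends the
    prefix, and in term \<open>i - 1\<close>, where it starts the suffix. Both boundary values are
    0.\<close>
  define S where "S i = (if 1 \<le> i \<and> i \<le> ?n then sh (\<lambda>w. g (v ! (i - 1) # w)) (rev (take (i - 1) v)) (drop i v) else 0)" for i
  have split: "sh g (rev (take i v)) (drop i v) = S i + S (Suc i)" if "i \<le> ?n" for i
  proof -
    have d: "drop i v = v ! i # drop (Suc i) v" if "i < ?n" using that by (simp add: Cons_nth_drop_Suc)
    show ?thesis
    proof (cases i)
      case 0
      then show ?thesis using assms d by (simp add: S_def Suc_le_eq)
    next
      case (Suc j)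
      then have t: "rev (take i v) = v ! j # rev (take j v)" using that by (simp add: take_Suc_conv_app_nth)
      show ?thesis
      proof (cases "i < ?n")
        case True
        then show ?thesis using that Suc d t by (simp add: S_def sh_Cons)
      next
        case False
        then have "drop i v = []" by simp
        moreover from this have "length v = Suc j" using that Suc by simp
        ultimately show ?thesis unfolding t S_def using Suc by simp
      qed
    qed
  qed
  have "(\<Sum>i\<le>m. (-1) ^ i *\<^sub>Q (S i + S (Suc i))) = (-1) ^ m *\<^sub>Q S (Suc m)" for m
    by (induction m) (simp_all add: S_def[of 0] scaleQ_add_right scaleQ_minus_left)
  from this[of ?n] show ?thesis by (simp add: split S_def[of "Suc _"])
qed

definition dec :: "('l list \<Rightarrow> 'l list \<Rightarrow> 'k::comm_monoid_add) \<Rightarrow> 'l list \<Rightarrow> 'k" where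
  "dec h w = (\<Sum>k\<le>length w. h (take k w) (drop k w))"

lemma dec_simps [simp]: "dec h [] = h [] []" "dec h (x # w) = h [] (x # w) + dec (\<lambda>p q. h (x # p) q) w"
  by (simp add: dec_def) (unfold dec_def length_Cons sum.atMost_Suc_shift, simp)

text \<open>Deconcatenation is multiplicative for the shuffle product.\<close>

lemma sh_dec:
  "sh (dec h) u v = (\<Sum>i\<le>length u. \<Sum>j\<le>length v.
     sh (\<lambda>p. sh (h p) (drop i u) (drop j v)) (take i u) (take j v))"
proof (induction u v arbitrary: h rule: shuffle.induct)
  case (3 x xs y ys)
  let ?E = "\<lambda>h i j. sh (\<lambda>p. sh (h p) (drop i (x # xs)) (drop j (y # ys))) (take i (x # xs)) (take j (y # ys))"
  let ?hx = "\<lambda>p. h (x # p)" and ?hy = "\<lambda>p. h (y # p)"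
  let ?L = "\<lambda>i j. sh (\<lambda>p. sh (?hx p) (drop i xs) (drop j (y # ys))) (take i xs) (take j (y # ys))"
  let ?R = "\<lambda>i j. sh (\<lambda>p. sh (?hy p) (drop i (x # xs)) (drop j ys)) (take i (x # xs)) (take j ys)"
  have "sh (dec h) (x # xs) (y # ys) = sh (h []) (x # xs) (y # ys)
     + (\<Sum>i\<le>length xs. \<Sum>j\<le>length (y # ys). ?L i j) + (\<Sum>i\<le>length (x # xs). \<Sum>j\<le>length ys. ?R i j)"
    by (simp only: sh_Cons[of "dec h"] sh_Cons[of "h []"] dec_simps sh_add 3 add_ac)
  also have "(\<Sum>i\<le>length xs. \<Sum>j\<le>length (y # ys). ?L i j) =
      (\<Sum>i\<le>length xs. ?L i 0) + (\<Sum>i\<le>length xs. \<Sum>j\<le>length ys. ?L i (Suc j))"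
    by (simp only: length_Cons sum.atMost_Suc_shift sum.distrib)
  also have "(\<Sum>i\<le>length (x # xs). \<Sum>j\<le>length ys. ?R i j) =
      (\<Sum>j\<le>length ys. ?R 0 j) + (\<Sum>i\<le>length xs. \<Sum>j\<le>length ys. ?R (Suc i) j)"
    by (simp only: length_Cons sum.atMost_Suc_shift[of _ "length xs"])
  finally have "sh (dec h) (x # xs) (y # ys) = sh (h []) (x # xs) (y # ys)
     + (\<Sum>i\<le>length xs. ?L i 0) + (\<Sum>j\<le>length ys. ?R 0 j)
     + (\<Sum>i\<le>length xs. \<Sum>j\<le>length ys. ?L i (Suc j) + ?R (Suc i) j)"
    by (simp only: sum.distrib add_ac)
  also have "\<dots> = (\<Sum>i\<le>length (x # xs). \<Sum>j\<le>length (y # ys). ?E h i j)"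
    by (simp only: length_Cons sum.atMost_Suc_shift sum.distrib) (simp add: sh_Cons sum.distrib add_ac)
  finally show ?case .
qed (simp_all add: dec_def del: dec_simps)

lemma sh_nc_mult:
  "sh (f \<star> g) u v = (\<Sum>i\<le>length u. \<Sum>j\<le>length v.
     sh f (take i u) (take j v) * sh g (drop i u) (drop j v))"
proof -
  have "f \<star> g = dec (\<lambda>p q. f p * g q)" by (simp add: fun_eq_iff nc_mult_def dec_def)
  then show ?thesis by (simp add: sh_dec sh_mult_left sh_mult_right)
qed

lemma sum_tensor: "(\<Sum>i\<le>length u. \<Sum>j\<le>length v.
     (f (take i u) * f' (take j v)) * (g (drop i u) * g' (drop j v))) = (f \<star> g) u * (f' \<star> g') v"
  by (simp add: nc_mult_def sum_product mult_ac)

section \<open>Group-like and primitive series\<close>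

definition group_like :: "('l, 'k::comm_rat_algebra) series \<Rightarrow> bool" where
  "group_like f \<longleftrightarrow> f [] = 1 \<and> (\<forall>u v. sh f u v = f u * f v)"

text \<open>Dual form of \<open>\<Delta> f = f \<otimes> 1 + 1 \<otimes> f\<close>. Empty words are
  included; taking both of them empty forces the constant term to be 0.\<close>

definition primitive :: "('l, 'k::comm_rat_algebra) series \<Rightarrow> bool" where
  "primitive f \<longleftrightarrow> (\<forall>u v. sh f u v = f u * nc_one v + nc_one u * f v)"

lemma primitiveD:
  assumes "primitive f"
  shows "f [] = 0" "u \<noteq> [] \<Longrightarrow> v \<noteq> [] \<Longrightarrow> sh f u v = 0"
  using assms[unfolded primitive_def, rule_format, of "[]" "[]"] assms[unfolded primitive_def, rule_format, of u v]
  by (auto simp: nc_one_def)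

lemma group_like_mult: "group_like f \<Longrightarrow> group_like g \<Longrightarrow> group_like (f \<star> g)"
  by (simp add: group_like_def sh_nc_mult sum_tensor)

definition antipode :: "('l, 'k::comm_rat_algebra) series \<Rightarrow> ('l, 'k) series" where
  "antipode f w = (-1) ^ length w *\<^sub>Q f (rev w)"

lemma sh_length_cong: "(\<And>w. length w = length u + length v \<Longrightarrow> f w = g w) \<Longrightarrow> sh f u v = sh g u v"
  by (rule sh_cong) (metis size_mset size_union)

lemma group_like_antipode:
  assumes "group_like f"
  shows "group_like (antipode f)"
  unfolding group_like_def
proof (intro conjI allI)
  show "antipode f [] = 1" using assms by (simp add: antipode_def group_like_def scaleQ_one)
  fix u v
  have "sh (antipode f) u v = sh (\<lambda>w. ((-1) ^ (length u + length v) *\<^sub>Q 1) * f (rev w)) u v"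
    by (rule sh_length_cong) (simp add: antipode_def flip: scaleQ_alt)
  also have "\<dots> = (-1) ^ (length u + length v) *\<^sub>Q sh f (rev u) (rev v)"
    unfolding sh_mult_left sh_rev by (simp flip: scaleQ_alt)
  also have "\<dots> = antipode f u * antipode f v"
    using assms by (simp add: group_like_def antipode_def mult_scaleQ_left mult_scaleQ_right scaleQ_scaleQ power_add mult.commute)
  finally show "sh (antipode f) u v = antipode f u * antipode f v" .
qed

lemma antipode_antipode [simp]: "antipode (antipode f) = f"
  by (simp add: fun_eq_iff antipode_def scaleQ_scaleQ scaleQ_one flip: power_add mult_2)

lemma antipode_mult_left:
  assumes "group_like f"
  shows "antipode f \<star> f = nc_one"
proof
  fix w
  show "(antipode f \<star> f) w = nc_one w"
  proof (cases "w = []")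
    case False
    have "(antipode f \<star> f) w = (\<Sum>i\<le>length w. (-1) ^ i *\<^sub>Q (f (rev (take i w)) * f (drop i w)))"
      by (simp add: nc_mult_def antipode_def mult_scaleQ_left min_absorb2)
    also have "\<dots> = 0" using sh_antipode[OF False, of f] assms by (simp add: group_like_def)
    finally show ?thesis using False by (simp add: nc_one_def)
  qed (use assms in \<open>simp add: nc_one_def antipode_def group_like_def scaleQ_one\<close>)
qed

lemma antipode_mult_right: "group_like f \<Longrightarrow> f \<star> antipode f = nc_one"
  using antipode_mult_left[OF group_like_antipode] by fastforce

text \<open>The coproduct of \<open>f \<star> p\<close> is the sum of its tensors with
  \<open>f\<close> on either side; multiplication by the group-like inverse turns each of these
  \<open>f\<close> into 1.\<close>

lemma primitive_conj:
  assumes "group_like f" "primitive p"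
  shows "primitive (f \<star> p \<star> antipode f)"
proof -
  let ?g = "antipode f"
  note g = group_like_antipode[OF assms(1)] and inv = antipode_mult_right[OF assms(1)]
  have fp: "sh (f \<star> p) u v = (f \<star> p) u * f v + f u * (f \<star> p) v" for u v
  proof -
    have "sh (f \<star> p) u v = (\<Sum>i\<le>length u. \<Sum>j\<le>length v.
      (f (take i u) * f (take j v)) * (p (drop i u) * nc_one (drop j v))) + (\<Sum>i\<le>length u. \<Sum>j\<le>length v.
      (f (take i u) * f (take j v)) * (nc_one (drop i u) * p (drop j v)))"
      using assms by (simp add: sh_nc_mult primitive_def group_like_def distrib_left sum.distrib)
    then show ?thesis by (simp only: sum_tensor nc_mult_one_right)
  qed
  have "sh (f \<star> p \<star> ?g) u v = (f \<star> p \<star> ?g) u * nc_one v + nc_one u * (f \<star> p \<star> ?g) v" for u v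
  proof -
    have "sh (f \<star> p \<star> ?g) u v = (\<Sum>i\<le>length u. \<Sum>j\<le>length v.
      ((f \<star> p) (take i u) * f (take j v)) * (?g (drop i u) * ?g (drop j v))) + (\<Sum>i\<le>length u. \<Sum>j\<le>length v.
      (f (take i u) * (f \<star> p) (take j v)) * (?g (drop i u) * ?g (drop j v)))"
      using g by (simp add: sh_nc_mult[of "f \<star> p"] fp group_like_def distrib_right sum.distrib)
    then show ?thesis by (simp only: sum_tensor inv)
  qed
  then show ?thesis by (simp add: primitive_def)
qed

lemma primitive_letter: "primitive (letter x)"
  unfolding primitive_def
proof (intro allI)
  fix u v
  show "sh (letter x) u v = letter x u * nc_one v + nc_one u * (letter x v :: 'b)"
  proof (cases "u = [] \<or> v = []")
    case False
    then have "length u + length v \<noteq> 1" by (cases u; cases v) auto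
    then have "sh (letter x) u v = sh (\<lambda>w. 0 :: 'b) u v"
      by (intro sh_length_cong) (auto simp: letter_def)
    then show ?thesis using False by (simp add: nc_one_def)
  qed (auto simp: nc_one_def letter_def)
qed

lemma primitive_add: "primitive f \<Longrightarrow> primitive g \<Longrightarrow> primitive (f + g)"
  by (simp add: primitive_def plus_fun_def sh_add algebra_simps)

lemma primitive_smult: "primitive f \<Longrightarrow> primitive (nc_smult c f)"
  by (simp add: primitive_def nc_smult_def[abs_def] sh_mult_left algebra_simps)

lemma primitive_zero: "primitive 0"
  by (simp add: primitive_def zero_fun_def)

text \<open>In the coproduct of a product of two primitive series the mixed terms are symmetric in
  the factors, so they cancel in the commutator.\<close>

lemma primitive_ad:
  assumes f: "primitive f" and g: "primitive g"
  shows "primitive (ad f g)"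
proof -
  have *: "sh (f \<star> g) u v = (f \<star> g) u * nc_one v + f u * g v + g u * f v + nc_one u * (f \<star> g) v"
    if "primitive f" "primitive g" for u v and f g :: "('a, 'b) series"
  proof -
    have "sh (f \<star> g) u v =
       (\<Sum>i\<le>length u. \<Sum>j\<le>length v. (f (take i u) * nc_one (take j v)) * (g (drop i u) * nc_one (drop j v)))
     + (\<Sum>i\<le>length u. \<Sum>j\<le>length v. (f (take i u) * nc_one (take j v)) * (nc_one (drop i u) * g (drop j v)))
     + (\<Sum>i\<le>length u. \<Sum>j\<le>length v. (nc_one (take i u) * f (take j v)) * (g (drop i u) * nc_one (drop j v)))
     + (\<Sum>i\<le>length u. \<Sum>j\<le>length v. (nc_one (take i u) * f (take j v)) * (nc_one (drop i u) * g (drop j v)))"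
      using that by (simp add: sh_nc_mult primitive_def distrib_left distrib_right sum.distrib add_ac)
    then show ?thesis by (simp only: sum_tensor nc_mult_one_left nc_mult_one_right)
  qed
  have "sh (ad f g) u v = sh (f \<star> g) u v - sh (g \<star> f) u v" for u v
    using sh_add[of "ad f g" "g \<star> f" u v] by (simp add: ad_eq)
  then show ?thesis
    by (simp add: primitive_def *[OF f g] *[OF g f]) (simp add: ad_eq algebra_simps)
qed

section \<open>Lie series\<close>

lemma lie_poly_zero: "0 \<in> lie_poly S"
  unfolding nc_zero_eq[symmetric] by (rule lie_poly.zero)

lemma lie_poly_letter: "x \<in> S \<Longrightarrow> letter x \<in> lie_poly S"
  by (rule lie_poly.letter)

lemma lie_poly_add: "f \<in> lie_poly S \<Longrightarrow> g \<in> lie_poly S \<Longrightarrow> f + g \<in> lie_poly S"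
  unfolding nc_add_eq[symmetric] by (rule lie_poly.add)

lemma lie_poly_smult: "f \<in> lie_poly S \<Longrightarrow> nc_smult c f \<in> lie_poly S"
  by (rule lie_poly.smult)

lemma lie_poly_ad: "f \<in> lie_poly S \<Longrightarrow> g \<in> lie_poly S \<Longrightarrow> ad f g \<in> lie_poly S"
  by (rule lie_poly.bracket)

lemma lie_poly_induct [consumes 1, case_names letter zero add smult ad]:
  assumes "f \<in> lie_poly S" "\<And>x. x \<in> S \<Longrightarrow> P (letter x)" "P 0"
    "\<And>f g. f \<in> lie_poly S \<Longrightarrow> P f \<Longrightarrow> g \<in> lie_poly S \<Longrightarrow> P g \<Longrightarrow> P (f + g)"
    "\<And>c f. f \<in> lie_poly S \<Longrightarrow> P f \<Longrightarrow> P (nc_smult c f)"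
    "\<And>f g. f \<in> lie_poly S \<Longrightarrow> P f \<Longrightarrow> g \<in> lie_poly S \<Longrightarrow> P g \<Longrightarrow> P (ad f g)"
  shows "P f"
  using assms(1)
proof (induction rule: lie_poly.induct)
  case zero
  show ?case using assms(3) by (simp flip: nc_zero_eq)
next
  case (add f g)
  then have "P (nc_add f g)" using assms(4) by simp
  then show ?case .
qed (use assms in auto)

lemma lie_poly_sum: "(\<And>i. i \<in> I \<Longrightarrow> f i \<in> lie_poly S) \<Longrightarrow> (\<Sum>i\<in>I. f i) \<in> lie_poly S"
  by (induction I rule: infinite_finite_induct) (auto intro: lie_poly_add simp: lie_poly_zero)

lemma lie_poly_uminus: "f \<in> lie_poly S \<Longrightarrow> - f \<in> lie_poly S"
proof -
  assume f: "f \<in> lie_poly S"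
  have "- f = nc_smult (- 1) f" by (simp add: fun_eq_iff nc_smult_def)
  then show ?thesis using lie_poly_smult[OF f, of "- 1"] by simp
qed

lemma lie_poly_diff: "f \<in> lie_poly S \<Longrightarrow> g \<in> lie_poly S \<Longrightarrow> f - g \<in> lie_poly S"
  using lie_poly_add[OF _ lie_poly_uminus, of f S g] by simp

lemma lie_poly_primitive: "f \<in> lie_poly S \<Longrightarrow> primitive f"
  by (erule lie_poly_induct)
    (rule primitive_letter primitive_zero primitive_add primitive_smult primitive_ad; assumption)+

lemma lie_poly_ad_power: "f \<in> lie_poly S \<Longrightarrow> g \<in> lie_poly S \<Longrightarrow> (ad f ^^ n) g \<in> lie_poly S"
  by (induction n) (auto intro: lie_poly_ad)

section \<open>The Dynkin operator: primitive polynomials are Lie polynomials\<close>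

definition bracketing :: "'l list \<Rightarrow> ('l, 'k::comm_rat_algebra) series" where
  "bracketing w = (if w = [] then 0 else foldl ad (letter (hd w)) (map letter (tl w)))"

lemma bracketing_single: "bracketing [x] = letter x"
  by (simp add: bracketing_def)

lemma bracketing_snoc: "w \<noteq> [] \<Longrightarrow> bracketing (w @ [x]) = ad (bracketing w) (letter x)"
  by (cases w) (simp_all add: bracketing_def)

lemma bracketing_lie: "set w \<subseteq> S \<Longrightarrow> (bracketing w :: ('l, 'k::comm_rat_algebra) series) \<in> lie_poly S"
proof (induction w rule: rev_induct)
  case Nil
  show "(bracketing [] :: ('l, 'k) series) \<in> lie_poly S" by (simp add: bracketing_def lie_poly_zero)
next
  case (snoc x w)
  have x: "(letter x :: ('l, 'k) series) \<in> lie_poly S" using snoc by (intro lie_poly_letter) simp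
  show "(bracketing (w @ [x]) :: ('l, 'k) series) \<in> lie_poly S"
  proof (cases "w = []")
    case False
    have "(bracketing w :: ('l, 'k) series) \<in> lie_poly S" using snoc by simp
    then show ?thesis unfolding bracketing_snoc[OF False] by (rule lie_poly_ad[OF _ x])
  qed (use x in \<open>simp add: bracketing_single\<close>)
qed

lemma mult_letter_right: "(f \<star> letter x) (w @ [y]) = (if x = y then f w else 0)" "(f \<star> letter x) [] = 0"
proof -
  show "(f \<star> letter x) (w @ [y]) = (if x = y then f w else 0)"
    by (induction w arbitrary: f) (auto simp: nc_mult_Cons, simp_all add: letter_def)
qed (simp add: letter_def)

text \<open>
  The coefficients of the left-normed brackets are those of the operator
  \<open>v \<mapsto> \<Sum> (-1)\<^sup>i (n - i) rev(v\<^sub>1 \<dots> v\<^sub>i) \<squnion> v\<^bsub>i+1\<^esub> \<dots> v\<^sub>n\<close>, which is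
  \<open>n\<close> modulo shuffles.
\<close>

lemma bracketing_coeff:
  assumes "w \<noteq> []"
  shows "bracketing w v = (\<Sum>i\<le>length v. ((-1) ^ i * of_nat (length v - i)) *\<^sub>Q
     sh (\<lambda>z. if z = w then 1 else 0 :: 'k::comm_rat_algebra) (rev (take i v)) (drop i v))"
  using assms
proof (induction w arbitrary: v rule: rev_nonempty_induct)
  case (single x)
  show ?case
  proof (cases "length v = 1")
    case True
    then obtain y where "v = [y]" by (cases v) auto
    then show ?thesis by (auto simp: bracketing_single letter_def scaleQ_one)
  next
    case False
    have "sh (\<lambda>z. if z = [x] then 1 else 0 :: 'k) (rev (take i v)) (drop i v) = sh (\<lambda>_. 0) (rev (take i v)) (drop i v)"
      if "i \<le> length v" for i
      by (rule sh_length_cong) (use False that in auto)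
    then show ?thesis using False by (auto simp: bracketing_single letter_def)
  qed
next
  case (snoc x w)
  let ?\<delta> = "\<lambda>w z. if z = w then 1 else 0 :: 'k"
  show ?case
  proof (cases "length v \<le> 1")
    case True
    have "sh (?\<delta> (w @ [x])) (rev (take i v)) (drop i v) = sh (\<lambda>_. 0) (rev (take i v)) (drop i v)"
      if "i \<le> length v" for i
      by (rule sh_length_cong) (use True that snoc(1) in \<open>cases w; auto\<close>)
    moreover have "bracketing w [] = (0::'k)"
      using primitiveD(1)[OF lie_poly_primitive[OF bracketing_lie[OF subset_UNIV]]] .
    then have "ad (bracketing w) (letter x) v = (0 :: 'k)"
      using True by (cases v) (simp_all add: ad_eq nc_mult_Cons, simp add: letter_def)
    ultimately show ?thesis using snoc(1) by (simp add: bracketing_snoc)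
  next
    case False
    define n where "n = length v - 1"
    have n: "length v = Suc n" "n \<ge> 1" using False by (auto simp: n_def)
    obtain a v1 where v1: "v = a # v1" using n by (cases v) auto
    obtain b v2 where v2: "v = v2 @ [b]" using n by (cases v rule: rev_cases) auto
    have l: "length v1 = n" "length v2 = n" using n v1 arg_cong[OF v2, of length] by auto
    let ?c = "\<lambda>m i. (-1) ^ i * of_nat (m - i) :: rat"
    let ?S = "\<lambda>v i. sh (?\<delta> w) (rev (take i v)) (drop i v)"
    \<comment> \<open>Every shuffle in question ends in the first or in the last letter of
      \<open>v\<close>; \<open>p\<close> and \<open>q\<close> record whether that letter is the
      appended \<open>x\<close>.\<close>
    define p where "p = (if a = x then 1 else 0 :: 'k)"
    define q where "q = (if b = x then 1 else 0 :: 'k)"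
    have \<delta>: "?\<delta> (w @ [x]) (z @ [y]) = (if y = x then 1 else 0) * ?\<delta> w z" for z y by auto
    have 0: "sh (?\<delta> (w @ [x])) (rev (take 0 v)) (drop 0 v) = q * ?S v2 0"
      using \<delta>[of v2 b] by (simp add: v2 q_def)
    have step: "sh (?\<delta> (w @ [x])) (rev (take (Suc i) v)) (drop (Suc i) v) = p * ?S v1 i + q * ?S v2 (Suc i)"
      if "i < n" for i
    proof -
      have "take (Suc i) v = a # take i v1" by (simp add: v1)
      moreover have "drop (Suc i) v = drop (Suc i) v2 @ [b]" "take (Suc i) v = take (Suc i) v2" using that l by (simp_all add: v2)
      moreover have "drop (Suc i) v = drop i v1" by (simp add: v1)
      ultimately have "sh (?\<delta> (w @ [x])) (rev (take (Suc i) v)) (drop (Suc i) v) =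
         sh (\<lambda>z. ?\<delta> (w @ [x]) (z @ [a])) (rev (take i v1)) (drop i v1) +
         sh (\<lambda>z. ?\<delta> (w @ [x]) (z @ [b])) (rev (take (Suc i) v2)) (drop (Suc i) v2)"
        using sh_snoc[of "?\<delta> (w @ [x])" "rev (take i v1)" a "drop (Suc i) v2" b] by (metis rev.simps(2))
      then show ?thesis unfolding \<delta> sh_mult_left by (simp add: p_def q_def)
    qed
    have v2_0: "(\<Sum>i\<le>n. (-1) ^ i *\<^sub>Q ?S v2 i) = 0" 
    proof -
      have "v2 \<noteq> []" using l n by auto
      from sh_antipode[OF this, of "?\<delta> w"] show ?thesis unfolding l .
    qed
    have "(\<Sum>i\<le>length v. ?c (length v) i *\<^sub>Q sh (?\<delta> (w @ [x])) (rev (take i v)) (drop i v)) =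
       (\<Sum>i\<le>n. ?c (Suc n) i *\<^sub>Q sh (?\<delta> (w @ [x])) (rev (take i v)) (drop i v))"
      by (simp add: n)
    also have "\<dots> = ?c (Suc n) 0 *\<^sub>Q (q * ?S v2 0) + (\<Sum>i<n. ?c (Suc n) (Suc i) *\<^sub>Q (p * ?S v1 i + q * ?S v2 (Suc i)))"
      unfolding sum.atMost_shift 0 by (simp add: step)
    also have "\<dots> = (\<Sum>i<n. ?c (Suc n) (Suc i) *\<^sub>Q (p * ?S v1 i)) + (\<Sum>i\<le>n. ?c (Suc n) i *\<^sub>Q (q * ?S v2 i))"
      unfolding sum.atMost_shift[of _ n] by (simp only: scaleQ_add_right sum.distrib add_ac)
    also have "(\<Sum>i<n. ?c (Suc n) (Suc i) *\<^sub>Q (p * ?S v1 i)) = - (\<Sum>i\<le>n. ?c n i *\<^sub>Q (p * ?S v1 i))"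
      by (simp add: scaleQ_minus_left sum_negf flip: lessThan_Suc_atMost)
    \<comment> \<open>The weight exceeds the one belonging to the shorter word \<open>v2\<close> by
      a sign \<open>(-1) ^ i\<close>; this excess sums to the antipode identity and
      vanishes.\<close>
    also have "(\<Sum>i\<le>n. ?c (Suc n) i *\<^sub>Q (q * ?S v2 i)) = (\<Sum>i\<le>n. ?c n i *\<^sub>Q (q * ?S v2 i)) + q * (\<Sum>i\<le>n. (-1) ^ i *\<^sub>Q ?S v2 i)"
      unfolding sum_distrib_left sum.distrib[symmetric]
    proof (rule sum.cong[OF HOL.refl])
      fix i assume "i \<in> {..n}"
      then have "?c (Suc n) i = ?c n i + (-1) ^ i" by (simp add: Suc_diff_le distrib_left)
      then show "?c (Suc n) i *\<^sub>Q (q * ?S v2 i) = ?c n i *\<^sub>Q (q * ?S v2 i) + q * (-1) ^ i *\<^sub>Q ?S v2 i"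
        by (simp only: scaleQ_add_left mult_scaleQ_right)
    qed
    also have "- (\<Sum>i\<le>n. ?c n i *\<^sub>Q (p * ?S v1 i)) + ((\<Sum>i\<le>n. ?c n i *\<^sub>Q (q * ?S v2 i)) + q * (\<Sum>i\<le>n. (-1) ^ i *\<^sub>Q ?S v2 i))
       = q * bracketing w v2 - p * bracketing w v1"
      by (simp add: v2_0 snoc(2) l sum_distrib_left mult_scaleQ_right)
    also have "\<dots> = ad (bracketing w) (letter x) v"
    proof -
      have "(letter x \<star> bracketing w) v = p * bracketing w v1"
        by (simp add: v1 letter_mult_Cons p_def)
      moreover have "(bracketing w \<star> letter x) v = q * bracketing w v2"
        by (simp add: v2 mult_letter_right q_def)
      ultimately show ?thesis by (simp add: ad_eq)
    qed
    finally show ?thesis using snoc(1) by (simp add: bracketing_snoc)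
  qed
qed

text \<open>Dynkin-Specht-Wever: inserted into the coefficient formula of the left-normed brackets,
  a primitive series kills every proper shuffle, and \<open>n\<close> times its degree
  \<open>n\<close> part remains. Division by \<open>n\<close> exhibits that part as a combination of
  brackets.\<close>

lemma primitive_hom_part_lie:
  fixes f :: "('l, 'k::comm_rat_algebra) series"
  assumes "finite (UNIV :: 'l set)" "primitive f"
  shows "hom_part (\<lambda>_. 1) n f \<in> lie_poly UNIV"
proof (cases "n = 0")
  case True
  then have "hom_part (\<lambda>_. 1) n f = 0"
    using primitiveD(1)[OF assms(2)] by (auto simp: fun_eq_iff hom_part_def sum_list_triv)
  then show ?thesis by (simp add: lie_poly_zero)
next
  case n: False
  let ?W = "{w :: 'l list. length w = n}"
  let ?g = "\<Sum>w\<in>?W. nc_smult ((1 / of_nat n) *\<^sub>Q f w) (bracketing w)"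
  have fin: "finite ?W" using finite_lists_length_eq[OF assms(1), of n] by simp
  have "hom_part (\<lambda>_. 1) n f = ?g"
  proof
    fix v :: "'l list"
    let ?\<delta> = "\<lambda>w z. if z = w then 1 else 0 :: 'k"
    have "(\<Sum>w\<in>?W. f w * bracketing w v) =
       (\<Sum>w\<in>?W. f w * (\<Sum>i\<le>length v. ((-1) ^ i * of_nat (length v - i)) *\<^sub>Q sh (?\<delta> w) (rev (take i v)) (drop i v)))"
      using n by (intro sum.cong HOL.refl arg_cong2[of _ _ _ _ "(*)"] bracketing_coeff) auto
    also have "\<dots> = (\<Sum>i\<le>length v. ((-1) ^ i * of_nat (length v - i)) *\<^sub>Q
       sh (\<lambda>z. \<Sum>w\<in>?W. f w * ?\<delta> w z) (rev (take i v)) (drop i v))"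
      unfolding sh_sum sh_mult_left sum_distrib_left mult_scaleQ_right scaleQ_sum_right
      by (rule sum.swap)
    also have "(\<lambda>z. \<Sum>w\<in>?W. f w * ?\<delta> w z) = (\<lambda>z. if length z = n then f z else 0)"
      using fin by (simp add: fun_eq_iff if_distrib[of "\<lambda>x. _ * x"] cong: if_cong)
    also have "(\<Sum>i\<le>length v. ((-1) ^ i * of_nat (length v - i)) *\<^sub>Q
       sh (\<lambda>z. if length z = n then f z else 0) (rev (take i v)) (drop i v)) = 
       (if length v = n then of_nat n *\<^sub>Q f v else 0)"
    proof (cases "length v = n")
      case True
      have "sh (\<lambda>z. if length z = n then f z else 0) (rev (take i v)) (drop i v) =
         (if i = 0 then f v else if i = n then f (rev v) else 0)" if "i \<le> n" for i
      proof -
        have "sh (\<lambda>z. if length z = n then f z else 0) (rev (take i v)) (drop i v) = sh f (rev (take i v)) (drop i v)"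
          by (rule sh_length_cong) (use True that in simp)
        then show ?thesis using True that n primitiveD(2)[OF assms(2), of "rev (take i v)" "drop i v"] by auto
      qed
      \<comment> \<open>Of the two improper shuffles, the one with \<open>i = n\<close>, which would
        give \<open>f (rev v)\<close>, has weight 0.\<close>
      then have "(\<Sum>i\<le>n. ((-1) ^ i * of_nat (n - i)) *\<^sub>Q sh (\<lambda>z. if length z = n then f z else 0) (rev (take i v)) (drop i v))
        = (\<Sum>i\<le>n. if i = 0 then of_nat n *\<^sub>Q f v else 0)"
        using n by (intro sum.cong) auto
      then show ?thesis using True by simp
    next
      case False
      have "sh (\<lambda>z. if length z = n then f z else 0) (rev (take i v)) (drop i v) = sh (\<lambda>_. 0) (rev (take i v)) (drop i v)"
        if "i \<le> length v" for i by (rule sh_length_cong) (use False that in auto)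
      then show ?thesis using False by simp
    qed
    finally have *: "(\<Sum>w\<in>?W. f w * bracketing w v) = (if length v = n then of_nat n *\<^sub>Q f v else 0)" .
    have "?g v = (1 / of_nat n) *\<^sub>Q (\<Sum>w\<in>?W. f w * bracketing w v)"
      by (simp add: sum_fun_app nc_smult_def mult_scaleQ_left scaleQ_sum_right)
    then show "hom_part (\<lambda>_. 1) n f v = ?g v"
      using n by (simp add: * hom_part_def sum_list_triv scaleQ_scaleQ scaleQ_one)
  qed
  moreover have "?g \<in> lie_poly UNIV"
    by (intro lie_poly_sum lie_poly_smult bracketing_lie) auto
  ultimately show ?thesis by simp
qed

section \<open>Homogeneous parts and approximation of Lie series\<close>

lemma hom_part_mult: "hom_part wt d (f \<star> g) = (\<Sum>i\<le>d. hom_part wt i f \<star> hom_part wt (d - i) g)"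
proof
  fix w
  let ?s = "\<lambda>w. sum_list (map wt w)"
  have s: "?s (take j w) + ?s (drop j w) = ?s w" for j
    by (metis append_take_drop_id map_append sum_list_append)
  have "(\<Sum>i\<le>d. hom_part wt i f \<star> hom_part wt (d - i) g) w =
    (\<Sum>j\<le>length w. \<Sum>i\<le>d. hom_part wt i f (take j w) * hom_part wt (d - i) g (drop j w))"
    unfolding sum_fun_app nc_mult_def by (rule sum.swap)
  also have "\<dots> = (\<Sum>j\<le>length w. \<Sum>i\<le>d. if i = ?s (take j w) then (if ?s w = d then f (take j w) * g (drop j w) else 0) else 0)"
    (is "_ = (\<Sum>j\<le>_. \<Sum>i\<le>d. ?t j i)")
  proof (intro sum.cong HOL.refl)
    fix i j assume "i \<in> {..d}"
    then show "hom_part wt i f (take j w) * hom_part wt (d - i) g (drop j w) = ?t j i"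
      using s[of j] by (cases "i = ?s (take j w)"; cases "?s (drop j w) = d - i") (auto simp: hom_part_def)
  qed
  also have "\<dots> = (\<Sum>j\<le>length w. if ?s w = d then f (take j w) * g (drop j w) else 0)"
  proof (intro sum.cong HOL.refl)
    fix j
    show "(\<Sum>i\<le>d. if i = ?s (take j w) then (if ?s w = d then f (take j w) * g (drop j w) else 0) else 0)
      = (if ?s w = d then f (take j w) * g (drop j w) else 0)"
      using s[of j] by (simp add: sum.delta')
  qed
  finally show "hom_part wt d (f \<star> g) w = (\<Sum>i\<le>d. hom_part wt i f \<star> hom_part wt (d - i) g) w"
    by (simp add: hom_part_def nc_mult_def)
qed

lemma hom_part_add: "hom_part wt d (f + g) = hom_part wt d f + hom_part wt d g"
  by (auto simp: fun_eq_iff hom_part_def)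

lemma hom_part_diff: "hom_part wt d (f - g) = hom_part wt d f - hom_part wt d g"
  by (auto simp: fun_eq_iff hom_part_def)

lemma hom_part_smult: "hom_part wt d (nc_smult c f) = nc_smult c (hom_part wt d f)"
  by (auto simp: fun_eq_iff hom_part_def nc_smult_def)

lemma hom_part_ad: "hom_part wt d (ad f g) = (\<Sum>i\<le>d. ad (hom_part wt i f) (hom_part wt (d - i) g))"
proof -
  have "hom_part wt d (g \<star> f) = (\<Sum>i\<le>d. hom_part wt (d - i) g \<star> hom_part wt i f)"
    unfolding hom_part_mult
    by (rule sum.reindex_bij_witness[of _ "\<lambda>i. d - i" "\<lambda>i. d - i"]) auto
  then show ?thesis by (simp add: ad_eq hom_part_diff hom_part_mult[of _ _ f] sum_subtractf)
qed

lemma hom_part_lie_poly: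
  fixes f :: "('a, 'b::comm_rat_algebra) series"
  shows "f \<in> lie_poly S \<Longrightarrow> hom_part wt d f \<in> lie_poly S"
proof -
  assume "f \<in> lie_poly S"
  then have "\<forall>d. hom_part wt d f \<in> lie_poly S"
  proof (rule lie_poly_induct)
    fix x assume "x \<in> S"
    have eq: "hom_part wt d (letter x) = (if wt x = d then letter x else 0 :: ('a, 'b) series)" for d
      by (auto simp: fun_eq_iff hom_part_def letter_def)
    show "\<forall>d. (hom_part wt d (letter x) :: ('a, 'b) series) \<in> lie_poly S"
      unfolding eq using lie_poly_letter[OF \<open>x \<in> S\<close>] lie_poly_zero by auto
  next
    have "hom_part wt d 0 = (0 :: ('a, 'b) series)" for d by (auto simp: fun_eq_iff hom_part_def)
    then show "\<forall>d. (hom_part wt d 0 :: ('a, 'b) series) \<in> lie_poly S" by (simp add: lie_poly_zero)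
  next
    fix f g :: "('a, 'b) series"
    assume fg: "\<forall>d. hom_part wt d f \<in> lie_poly S" "\<forall>d. hom_part wt d g \<in> lie_poly S"
    then show "\<forall>d. hom_part wt d (f + g) \<in> lie_poly S"
      by (simp add: hom_part_add lie_poly_add)
    show "\<forall>d. hom_part wt d (ad f g) \<in> lie_poly S"
      unfolding hom_part_ad by (intro allI lie_poly_sum lie_poly_ad) (use fg in auto)
  next
    fix c and f :: "('a, 'b) series" assume "\<forall>d. hom_part wt d f \<in> lie_poly S"
    then show "\<forall>d. hom_part wt d (nc_smult c f) \<in> lie_poly S"
      by (simp add: hom_part_smult lie_poly_smult)
  qed
  then show ?thesis ..
qed

text \<open>Homogeneous parts of Lie polynomials are again Lie polynomials, so approximation up to
  each degree suffices. Infinite sums, substitutions and derivations are handled in this way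
  below.\<close>

lemma lie_seriesI:
  assumes "\<And>d. \<exists>g\<in>lie_poly S. \<forall>w. sum_list (map wt w) \<le> d \<longrightarrow> f w = g w"
  shows "f \<in> lie_series S wt"
  unfolding lie_series_def
proof (intro CollectI allI)
  fix d
  obtain g where g: "g \<in> lie_poly S" "\<forall>w. sum_list (map wt w) \<le> d \<longrightarrow> f w = g w" using assms by blast
  then have "hom_part wt d f = hom_part wt d g" by (auto simp: fun_eq_iff hom_part_def)
  then show "hom_part wt d f \<in> lie_poly S" using hom_part_lie_poly[OF g(1)] by simp
qed

lemma lie_seriesD:
  assumes "f \<in> lie_series S wt"
  shows "\<exists>g\<in>lie_poly S. \<forall>w. sum_list (map wt w) \<le> d \<longrightarrow> f w = g w"
proof
  show "(\<Sum>i\<le>d. hom_part wt i f) \<in> lie_poly S"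
    using assms by (intro lie_poly_sum) (auto simp: lie_series_def)
qed (auto simp: sum_fun_app hom_part_def)

lemma lie_poly_series: "f \<in> lie_poly S \<Longrightarrow> f \<in> lie_series S wt"
  by (intro lie_seriesI) blast

text \<open>All shuffles of \<open>u\<close> and \<open>v\<close> have the same weight, so a single
  approximating Lie polynomial decides the relation.\<close>

lemma lie_series_primitive: "f \<in> lie_series S wt \<Longrightarrow> primitive f"
  unfolding primitive_def
proof (intro allI)
  fix u v assume f: "f \<in> lie_series S wt"
  let ?d = "sum_list (map wt u) + sum_list (map wt v)"
  obtain g where g: "g \<in> lie_poly S" "\<forall>w. sum_list (map wt w) \<le> ?d \<longrightarrow> f w = g w"
    using lie_seriesD[OF f, of ?d] by blast
  have wt: "sum_list (map wt w) = ?d" if "mset w = mset u + mset v" for w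
    using that by (metis mset_append mset_map map_append sum_list_append sum_mset_sum_list)
  have "sh f u v = sh g u v" by (rule sh_cong) (use g(2) wt in simp)
  also have "\<dots> = g u * nc_one v + nc_one u * g v"
    using lie_poly_primitive[OF g(1)] by (simp add: primitive_def)
  finally show "sh f u v = f u * nc_one v + nc_one u * f v" using g(2) by simp
qed

lemma lie_series_add: "f \<in> lie_series S wt \<Longrightarrow> g \<in> lie_series S wt \<Longrightarrow> f + g \<in> lie_series S wt"
  by (simp add: lie_series_def hom_part_add lie_poly_add)

lemma lie_series_smult: "f \<in> lie_series S wt \<Longrightarrow> nc_smult c f \<in> lie_series S wt"
  by (simp add: lie_series_def hom_part_smult lie_poly_smult)

lemma lie_series_diff: "f \<in> lie_series S wt \<Longrightarrow> g \<in> lie_series S wt \<Longrightarrow> f - g \<in> lie_series S wt"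
  by (simp add: lie_series_def hom_part_diff lie_poly_diff)

lemma lie_poly_support: "f \<in> lie_poly S \<Longrightarrow> \<not> set w \<subseteq> S \<Longrightarrow> f w = 0"
proof -
  assume "f \<in> lie_poly S"
  then have "\<forall>w. \<not> set w \<subseteq> S \<longrightarrow> f w = 0"
  proof (rule lie_poly_induct)
    fix f g :: "('a, 'b) series"
    assume *: "\<forall>w. \<not> set w \<subseteq> S \<longrightarrow> f w = 0" "\<forall>w. \<not> set w \<subseteq> S \<longrightarrow> g w = 0"
    have "f (take i w) * g (drop i w) = 0 \<and> g (take i w) * f (drop i w) = 0" if "\<not> set w \<subseteq> S" for w i
    proof -
      have "\<not> set (take i w) \<subseteq> S \<or> \<not> set (drop i w) \<subseteq> S"
        using that by (metis append_take_drop_id le_sup_iff set_append)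
      then show ?thesis using * by auto
    qed
    then show "\<forall>w. \<not> set w \<subseteq> S \<longrightarrow> ad f g w = 0" by (simp add: ad_eq nc_mult_def)
  qed (auto simp: letter_def nc_smult_def)
  then show "\<not> set w \<subseteq> S \<Longrightarrow> f w = 0" by blast
qed

lemma lie_series_support: "f \<in> lie_series S wt \<Longrightarrow> \<not> set w \<subseteq> S \<Longrightarrow> f w = 0"
  using lie_seriesD[of f S wt "sum_list (map wt w)"] lie_poly_support by (metis order_refl)

lemma nc_subst_lie_poly:
  assumes "f \<in> lie_poly S" "\<And>x. x \<in> S \<Longrightarrow> s x \<in> lie_poly S'" "subst_adapted wt s"
  shows "nc_subst s f \<in> lie_poly S'"
  using assms(1)
  by (rule lie_poly_induct[where P = "\<lambda>f. nc_subst s f \<in> lie_poly S'"])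
    (simp_all add: nc_subst_letter[OF assms(3)] nc_subst_add[OF assms(3)] nc_subst_smult[OF assms(3)]
      nc_subst_ad[OF assms(3)] assms(2) lie_poly_zero lie_poly_add lie_poly_smult lie_poly_ad)

lemma nc_mult_cong_length:
  assumes "\<And>v. length v \<le> n \<Longrightarrow> f v = f' v" "\<And>v. length v \<le> n \<Longrightarrow> g v = g' v" "length w \<le> n"
  shows "(f \<star> g) w = (f' \<star> g') w"
  unfolding nc_mult_def by (intro sum.cong HOL.refl) (use assms in auto)

lemma nc_prod_cong_length:
  assumes "\<And>x v. length v \<le> n \<Longrightarrow> s x v = s' x v" "length w \<le> n"
  shows "nc_prod (map s u) w = nc_prod (map s' u) w"
  using assms(2)
proof (induction u arbitrary: w)
  case (Cons x u)
  have "(s x \<star> nc_prod (map s u)) w = (s' x \<star> nc_prod (map s' u)) w"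
    by (rule nc_mult_cong_length[of n]) (use assms Cons in auto)
  then show ?case by simp
qed simp

lemma subst_adapted_const:
  assumes "finite (UNIV :: 'm set)" "\<forall>x :: 'm. s x [] = 0"
  shows "subst_adapted (\<lambda>_. 1) s"
  unfolding subst_adapted_def
proof (intro conjI allI impI)
  fix x w assume "s x w \<noteq> 0"
  then show "1 \<le> length w" using assms(2) by (cases w) auto
qed (rule finite_bounded_const[OF assms(1)])

lemma nc_subst_lie_series:
  assumes fin: "finite (UNIV :: 'm set)" and f: "f \<in> lie_series (UNIV :: 'm set) (\<lambda>_. 1)"
    and s: "\<And>x. s x \<in> lie_series S (\<lambda>_. 1)"
  shows "nc_subst s f \<in> lie_series S (\<lambda>_. 1)"
proof (rule lie_seriesI)
  fix d
  obtain g where g: "g \<in> lie_poly UNIV" "\<And>w. length w \<le> d \<Longrightarrow> f w = g w"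
    using lie_seriesD[OF f, of d] by (auto simp: sum_list_triv)
  have "\<exists>s'. \<forall>x :: 'm. s' x \<in> lie_poly S \<and> (\<forall>w. length w \<le> d \<longrightarrow> s x w = s' x w)"
    using lie_seriesD[OF s, of d] by (intro choice allI) (auto simp: sum_list_triv)
  then obtain s' where s': "\<And>x. s' x \<in> lie_poly S" "\<And>x w. length w \<le> d \<Longrightarrow> s x w = s' x w" by blast
  have ad: "subst_adapted (\<lambda>_. 1) s" "subst_adapted (\<lambda>_. 1) s'"
    by (rule subst_adapted_const[OF fin], intro allI primitiveD(1) lie_series_primitive[OF s] lie_poly_primitive[OF s'(1)])+
  have "nc_subst s f w = nc_subst s' g w" if "length w \<le> d" for w
    unfolding nc_subst_linear nc_linear_eq[OF subst_adapted[OF ad(1)] that] nc_linear_eq[OF subst_adapted[OF ad(2)] that]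
    using g(2) nc_prod_cong_length[of d s s', OF s'(2) that]
    by (intro sum.cong HOL.refl) (auto simp: bounded_words_def sum_list_triv)
  moreover have "nc_subst s' g \<in> lie_poly S" by (rule nc_subst_lie_poly[OF g(1) s'(1) ad(2)])
  ultimately show "\<exists>g\<in>lie_poly S. \<forall>w. sum_list (map (\<lambda>_. 1) w) \<le> d \<longrightarrow> nc_subst s f w = g w"
    by (auto simp: sum_list_triv)
qed

lemma nc_deriv_lie_poly:
  assumes "finite (UNIV :: 'l set)" "\<And>x. d x \<in> lie_poly S" "f \<in> lie_poly (S :: 'l set)"
  shows "nc_deriv d f \<in> lie_poly S"
proof -
  have d: "\<forall>x. d x [] = 0" using primitiveD(1)[OF lie_poly_primitive[OF assms(2)]] by blast
  show ?thesis
    using assms(3)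
    by (rule lie_poly_induct[where P = "\<lambda>f. nc_deriv d f \<in> lie_poly S"])
      (simp_all add: nc_deriv_letter[where d = d, OF assms(1) d] nc_deriv_add[where d = d, OF assms(1) d]
        nc_deriv_smult[where d = d, OF assms(1) d] nc_deriv_ad[where d = d, OF assms(1) d]
        assms(2) lie_poly_zero lie_poly_add lie_poly_smult lie_poly_ad)
qed

lemma nc_deriv_lie_series:
  assumes "finite (UNIV :: 'l set)" "\<And>x. d x \<in> lie_poly S" "f \<in> lie_series (S :: 'l set) (\<lambda>_. 1)"
  shows "nc_deriv d f \<in> lie_series S (\<lambda>_. 1)"
proof (rule lie_seriesI)
  fix n
  have d: "\<forall>x. d x [] = 0" using primitiveD(1)[OF lie_poly_primitive[OF assms(2)]] by blast
  obtain g where g: "g \<in> lie_poly S" "\<And>w. length w \<le> n \<Longrightarrow> f w = g w"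
    using lie_seriesD[OF assms(3), of n] by (auto simp: sum_list_triv)
  have "nc_deriv d f w = nc_deriv d g w" if "length w \<le> n" for w
    unfolding nc_deriv_linear using g(2) that
    by (intro nc_linear_cong_bounded[OF deriv_word_adapted[where d = d, OF assms(1) d], of n]) (auto simp: sum_list_triv)
  with nc_deriv_lie_poly[OF assms(1,2) g(1)]
  show "\<exists>g\<in>lie_poly S. \<forall>w. sum_list (map (\<lambda>_. 1) w) \<le> n \<longrightarrow> nc_deriv d f w = g w"
    by (auto simp: sum_list_triv)
qed

subsection \<open>Homogeneous series\<close>

definition homogeneous :: "('l \<Rightarrow> nat) \<Rightarrow> nat \<Rightarrow> ('l, 'k::comm_rat_algebra) series \<Rightarrow> bool" where
  "homogeneous wt n f \<longleftrightarrow> (\<forall>w. f w \<noteq> 0 \<longrightarrow> sum_list (map wt w) = n)"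

lemma homogeneous_mult: "homogeneous wt m f \<Longrightarrow> homogeneous wt n g \<Longrightarrow> homogeneous wt (m + n) (f \<star> g)"
  unfolding homogeneous_def
proof (intro allI impI)
  fix w assume *: "\<forall>w. f w \<noteq> 0 \<longrightarrow> sum_list (map wt w) = m" "\<forall>w. g w \<noteq> 0 \<longrightarrow> sum_list (map wt w) = n"
    "(f \<star> g) w \<noteq> 0"
  then obtain i where "f (take i w) * g (drop i w) \<noteq> 0"
    unfolding nc_mult_def by (auto elim: sum.not_neutral_contains_not_neutral)
  then have "f (take i w) \<noteq> 0" "g (drop i w) \<noteq> 0" by auto
  then have "sum_list (map wt (take i w)) = m" "sum_list (map wt (drop i w)) = n" using * by auto
  then show "sum_list (map wt w) = m + n"
    by (metis append_take_drop_id map_append sum_list_append)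
qed

lemma homogeneous_letter: "homogeneous wt (wt x) (letter x)"
  by (simp add: homogeneous_def letter_def)

lemma homogeneous_diff: "homogeneous wt n f \<Longrightarrow> homogeneous wt n g \<Longrightarrow> homogeneous wt n (f - g)"
  unfolding homogeneous_def by (metis diff_self fun_diff_def)

lemma homogeneous_sum: "(\<And>i. i \<in> I \<Longrightarrow> homogeneous wt n (f i)) \<Longrightarrow> homogeneous wt n (\<Sum>i\<in>I. f i)"
  unfolding homogeneous_def sum_fun_app by (meson sum.not_neutral_contains_not_neutral)

lemma homogeneous_ad: "homogeneous wt m f \<Longrightarrow> homogeneous wt n g \<Longrightarrow> homogeneous wt (m + n) (ad f g)"
  unfolding ad_eq using homogeneous_mult[of wt m f n g] homogeneous_mult[of wt n g m f]
  by (simp add: homogeneous_diff add.commute)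

lemma homogeneous_ad_power:
  "homogeneous wt m f \<Longrightarrow> homogeneous wt n g \<Longrightarrow> homogeneous wt (k * m + n) ((ad f ^^ k) g)"
  by (induction k) (auto dest: homogeneous_ad simp: add.assoc)

lemma homogeneous_nc_prod:
  "(\<And>x. x \<in> set v \<Longrightarrow> homogeneous wt (wt' x) (s x)) \<Longrightarrow> homogeneous wt (sum_list (map wt' v)) (nc_prod (map s v))"
proof (induction v)
  case Nil
  show ?case by (simp add: homogeneous_def nc_one_def)
next
  case (Cons x v)
  then show ?case by (simp add: homogeneous_mult)
qed

lemma deriv_word_homogeneous:
  assumes "\<And>x. homogeneous wt (wt x + n) (d x)"
  shows "homogeneous wt (sum_list (map wt v) + n) (deriv_word d v)"
  unfolding deriv_word_def
proof (rule homogeneous_sum)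
  fix i assume "i \<in> {..<length v}"
  then have v: "v = take i v @ v ! i # drop (Suc i) v" by (simp add: id_take_nth_drop)
  have "sum_list (map wt v) + n =
     sum_list (map wt (take i v)) + (wt (v ! i) + n) + sum_list (map wt (drop (Suc i) v))"
    by (subst v) simp
  then show "homogeneous wt (sum_list (map wt v) + n)
     (nc_prod (map letter (take i v)) \<star> d (v ! i) \<star> nc_prod (map letter (drop (Suc i) v)))"
    using assms by (simp only:) (intro homogeneous_mult homogeneous_nc_prod homogeneous_letter)
qed

lemma nc_deriv_support:
  assumes "\<And>x. homogeneous wt (wt x + n) (d x)" "nc_deriv d f w \<noteq> 0"
  shows "\<exists>v. f v \<noteq> 0 \<and> sum_list (map wt w) = sum_list (map wt v) + n"
proof -
  have "\<exists>v. f v * deriv_word d v w \<noteq> 0"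
  proof (rule ccontr)
    assume "\<nexists>v. f v * deriv_word d v w \<noteq> 0"
    then have "nc_deriv d f w = 0" by (simp add: nc_deriv_linear nc_linear_def)
    then show False using assms(2) by simp
  qed
  then obtain v where nz: "f v * deriv_word d v w \<noteq> 0" by blast
  then have "f v \<noteq> 0" "deriv_word d v w \<noteq> 0" by (metis mult_zero_left, metis mult_zero_right)
  moreover from this have "sum_list (map wt w) = sum_list (map wt v) + n"
  proof -
    have "homogeneous wt (sum_list (map wt v) + n) (deriv_word d v)"
      by (rule deriv_word_homogeneous) (rule assms(1))
    then show ?thesis using \<open>deriv_word d v w \<noteq> 0\<close> by (simp add: homogeneous_def)
  qed
  ultimately show ?thesis by (intro exI[of _ v] conjI)
qed

section \<open>Cyclic sums\<close>

text \<open>A series enters only modulo commutators. A word of length \<open>n\<close> has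
  \<open>n\<close> terms even if it is periodic, and the empty word has none; this uniform count
  permits averaging over rotations.\<close>

definition cyc :: "('l, 'k::comm_rat_algebra) series \<Rightarrow> ('l, 'k) series" where
  "cyc f w = (\<Sum>i<length w. f (rotate i w))"

lemma cyc_add: "cyc (f + g) = cyc f + cyc g"
  by (simp add: fun_eq_iff cyc_def sum.distrib)

lemma cyc_diff: "cyc (f - g) = cyc f - cyc g"
  by (simp add: fun_eq_iff cyc_def sum_subtractf)

lemma cyc_smult: "cyc (nc_smult c f) = nc_smult c (cyc f)"
  by (simp add: fun_eq_iff cyc_def nc_smult_def sum_distrib_left)

lemma cyc_zero [simp]: "cyc 0 = 0"
  by (simp add: fun_eq_iff cyc_def)

lemma cyc_sum: "cyc (\<Sum>i\<in>I. f i) = (\<Sum>i\<in>I. cyc (f i))"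
  by (induction I rule: infinite_finite_induct) (simp_all only: sum.infinite sum.empty sum.insert cyc_zero cyc_add not_False_eq_True)

lemma cyc_one [simp]: "cyc nc_one = 0"
  by (auto simp: fun_eq_iff cyc_def nc_one_def)

lemma cyc_rotate: "cyc f (rotate j w) = cyc f w"
proof (induction j)
  case (Suc j)
  have "cyc f (rotate1 w) = cyc f w" for w
  proof -
    have "(\<Sum>i<length w. f (rotate (Suc i) w)) + f w = f w + (\<Sum>i<length w. f (rotate i w))"
      using sum.lessThan_Suc_shift[of "\<lambda>i. f (rotate i w)" "length w"]
      by (simp add: rotate_id add.commute)
    then show ?thesis by (simp add: cyc_def rotate1_rotate_swap)
  qed
  then show ?case using Suc by simp
qed simp

lemma rotate_le: "j \<le> length v \<Longrightarrow> rotate j v = drop j v @ take j v"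
  by (cases "j = length v") (simp_all add: rotate_drop_take)

text \<open>Rotation by \<open>j\<close> exchanges the two parts of a word cut after
  \<open>j\<close> letters, and \<open>cyc\<close> does not see rotations.\<close>

lemma cyc_mult_commute: "cyc (f \<star> g) = cyc ((g :: ('a, 'b::comm_rat_algebra) series) \<star> f)"
proof
  fix w :: "'a list"
  define n where "n = length w"
  let ?F = "\<lambda>j v. f (take j v) * g (drop j v)" and ?G = "\<lambda>j v. g (take j v) * f (drop j v)"
  have "cyc (f \<star> g) w = (\<Sum>j\<le>n. cyc (?F j) w)"
    unfolding cyc_def nc_mult_def n_def by (simp add: sum.swap[of _ "{..length w}"])
  also have "\<dots> = (\<Sum>j\<le>n. cyc (?G (n - j)) (rotate j w))"
  proof (intro sum.cong HOL.refl)
    fix j assume "j \<in> {..n}"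
    then have j: "j \<le> n" by simp
    have "?F j (rotate i w) = ?G (n - j) (rotate i (rotate j w))" for i
    proof -
      have "rotate i (rotate j w) = rotate j (rotate i w)" by (simp add: rotate_rotate add.commute)
      also have "\<dots> = drop j (rotate i w) @ take j (rotate i w)"
        using j by (intro rotate_le) (simp add: n_def)
      finally show ?thesis using j by (simp add: n_def mult.commute)
    qed
    then show "cyc (?F j) w = cyc (?G (n - j)) (rotate j w)" by (simp add: cyc_def)
  qed
  also have "\<dots> = (\<Sum>j\<le>n. cyc (?G (n - j)) w)" by (simp add: cyc_rotate)
  also have "\<dots> = (\<Sum>j\<le>n. cyc (?G j) w)"
    by (rule sum.reindex_bij_witness[of _ "\<lambda>j. n - j" "\<lambda>j. n - j"]) auto
  also have "\<dots> = cyc (g \<star> f) w"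
    unfolding cyc_def nc_mult_def n_def by (simp add: sum.swap[of _ "{..length w}"])
  finally show "cyc (f \<star> g) w = cyc (g \<star> f) w" .
qed

lemma cyc_ad: "cyc (ad h f \<star> g) = - cyc (f \<star> ad h g)"
proof -
  have "cyc (ad h f \<star> g) + cyc (f \<star> ad h g) = cyc (h \<star> (f \<star> g)) - cyc ((f \<star> g) \<star> h)"
    by (simp add: ad_eq nc_mult_diff_left nc_mult_diff_right nc_mult_assoc cyc_diff)
  also have "\<dots> = 0" by (simp add: cyc_mult_commute[of h])
  finally show ?thesis by (simp add: eq_neg_iff_add_eq_0)
qed

text \<open>As \<open>D\<close> is constant on rotation orbits, averaging over the \<open>n\<close>
  rotations replaces \<open>h\<close> by its cyclic sum; the rational scalars permit the division by
  \<open>n\<close>.\<close>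

lemma sum_cyc_zero:
  fixes h D :: "'l list \<Rightarrow> 'k::comm_rat_algebra"
  assumes "\<And>v. v \<in> W \<Longrightarrow> length v = n" "n > 0" "\<And>v. v \<in> W \<Longrightarrow> rotate1 v \<in> W"
    and D: "\<And>v. v \<in> W \<Longrightarrow> D (rotate1 v) = D v" and h: "\<And>v. v \<in> W \<Longrightarrow> cyc h v = 0"
  shows "(\<Sum>v\<in>W. h v * D v) = 0"
proof -
  have rot: "rotate i v \<in> W \<and> D (rotate i v) = D v" if "v \<in> W" for i v
    using that assms(3) D by (induction i) auto
  have "of_nat n *\<^sub>Q (\<Sum>v\<in>W. h v * D v) = (\<Sum>i<n. \<Sum>v\<in>W. h v * D v)"
    by (rule sum_const_scaleQ[symmetric])
  also have "\<dots> = (\<Sum>i<n. \<Sum>v\<in>W. h (rotate i v) * D v)"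
  proof (rule sum.cong[OF HOL.refl])
    fix i assume i: "i \<in> {..<n}"
    show "(\<Sum>v\<in>W. h v * D v) = (\<Sum>v\<in>W. h (rotate i v) * D v)"
      by (rule sum.reindex_bij_witness[of _ "rotate i" "rotate (n - i)"])
        (use i rot assms(1) in \<open>auto simp: rotate_rotate rotate_id\<close>)
  qed
  also have "\<dots> = (\<Sum>v\<in>W. cyc h v * D v)"
    by (subst sum.swap) (simp add: assms(1) cyc_def sum_distrib_right)
  also have "\<dots> = 0" using h by simp
  finally show ?thesis using assms(2) by simp
qed

text \<open>A linear extension whose traces are rotation invariant descends to cyclic words: the
  words of each length form a rotation-stable set, and the averaging argument applies to each set.
  Substitutions and derivations are both of this kind.\<close>

lemma cyc_nc_linear_zero:
  fixes M :: "'m list \<Rightarrow> ('l, 'k::comm_rat_algebra) series"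
  assumes ad: "adapted (\<lambda>_. 1) M" and M: "\<And>v. cyc (M (rotate1 v)) = cyc (M v)" "cyc (M []) = 0" and h: "cyc h = 0"
  shows "cyc (nc_linear M h) = 0"
proof
  fix w :: "'l list"
  define n where "n = length w"
  have bw: "bounded_words (\<lambda>_::'m. 1) n = (\<Union>k\<le>n. {v. length v = k})"
    by (auto simp: bounded_words_def sum_list_triv)
  have fin: "finite (bounded_words (\<lambda>_::'m. 1) n)" using ad by (simp add: adapted_def finite_bounded_def)
  have "cyc (nc_linear M h) w = (\<Sum>v\<in>bounded_words (\<lambda>_. 1) n. h v * cyc (M v) w)"
    unfolding cyc_def by (simp add: nc_linear_eq[OF ad, of _ n] n_def sum_distrib_left sum.swap[of _ "{..<length w}"])
  also have "\<dots> = (\<Sum>k\<le>n. \<Sum>v\<in>{v. length v = k}. h v * cyc (M v) w)"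
    unfolding bw by (rule sum.UNION_disjoint) (use fin bw in \<open>auto intro: finite_subset\<close>)
  also have "\<dots> = 0"
  proof (rule sum.neutral, rule ballI)
    fix k
    show "(\<Sum>v\<in>{v. length v = k}. h v * cyc (M v) w) = 0"
    proof (cases "k = 0")
      case True
      then show ?thesis using M(2) by simp
    next
      case False
      then show ?thesis by (intro sum_cyc_zero[of _ k]) (simp_all add: M(1) h)
    qed
  qed
  finally show "cyc (nc_linear M h) w = 0 w" by simp
qed

lemma cyc_nc_subst_zero:
  assumes "subst_adapted (\<lambda>_. 1) s" "cyc h = 0"
  shows "cyc (nc_subst s h) = 0"
  unfolding nc_subst_linear
proof (rule cyc_nc_linear_zero[OF subst_adapted[OF assms(1)] _ _ assms(2)])
  show "cyc (nc_prod (map s (rotate1 v))) = cyc (nc_prod (map s v))" for v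
    by (cases v) (simp_all add: nc_prod_append cyc_mult_commute)
qed simp

lemma cyc_nc_deriv_zero:
  assumes "finite (UNIV :: 'l set)" "\<forall>x. d x [] = (0 :: 'k::comm_rat_algebra)" "cyc h = 0"
  shows "cyc (nc_deriv d (h :: ('l, 'k) series)) = 0"
  unfolding nc_deriv_linear
proof (rule cyc_nc_linear_zero[OF deriv_word_adapted[where d = d, OF assms(1,2)] _ _ assms(3)])
  show "cyc (deriv_word d (rotate1 v)) = cyc (deriv_word d v)" for v
  proof (cases v)
    case (Cons x u)
    have "cyc (deriv_word d (u @ [x])) = cyc (deriv_word d ([x] @ u))"
      unfolding deriv_word_append cyc_add
      by (simp add: cyc_mult_commute[of "nc_prod _"] cyc_mult_commute[of "deriv_word d u"] add.commute)
    then show ?thesis by (simp add: Cons)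
  qed simp
qed (simp add: deriv_word_def)

section \<open>Lazard elimination\<close>

lemma UNIV_ab: "UNIV = {A, B}"
  using ab.exhaust by auto

lemma finite_ab: "finite (UNIV :: ab set)"
  by (simp add: UNIV_ab)

abbreviation degB :: "ab \<Rightarrow> nat" where "degB x \<equiv> (if x = B then 1 else 0)"

abbreviation degA :: "ab \<Rightarrow> nat" where "degA x \<equiv> (if x = A then 1 else 0)"

lemma c_ser_simps: "c_ser 0 = ser_b" "c_ser (Suc 0) = ser_b" "i > 0 \<Longrightarrow> c_ser (Suc i) = ad ser_a (c_ser i)"
  by (simp_all add: c_ser_def) (cases i; simp)

text \<open>The maximum concerns the letter 0, which \<open>c_ser\<close> sends to b: a positive
  weight keeps the number of words of bounded weight finite.\<close>

definition c_deg :: "nat \<Rightarrow> nat" where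
  "c_deg i = max i 1"

lemma c_ser_homogeneous:
  shows "homogeneous (\<lambda>_. 1) (c_deg i) (c_ser i :: (ab, 'k::comm_rat_algebra) series)"
    and "homogeneous degB 1 (c_ser i :: (ab, 'k) series)"
proof -
  have "homogeneous (\<lambda>_. 1) ((i - 1) * 1 + 1) (c_ser i :: (ab, 'k) series)"
    unfolding c_ser_def by (intro homogeneous_ad_power homogeneous_letter[of "\<lambda>_. 1"])
  moreover have "(i - 1) * 1 + 1 = c_deg i" by (simp add: c_deg_def max_def)
  ultimately show "homogeneous (\<lambda>_. 1) (c_deg i) (c_ser i :: (ab, 'k) series)" by simp
  have "homogeneous degB ((i - 1) * degB A + degB B) (c_ser i :: (ab, 'k) series)"
    unfolding c_ser_def by (intro homogeneous_ad_power homogeneous_letter)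
  then show "homogeneous degB 1 (c_ser i :: (ab, 'k) series)" by simp
qed

text \<open>The word ends in b, so right multiplication by a does not reach it. The leading
  coefficient 1 makes substitution of the \<open>c_ser i\<close> triangular.\<close>

lemma c_ser_leading: "k > 0 \<Longrightarrow> c_ser k (replicate (k - 1) A @ [B]) = (1 :: 'k::comm_rat_algebra)"
proof (induction k rule: nat_induct_non_zero)
  case 1
  then show ?case by (simp add: c_ser_simps letter_def)
next
  case (Suc k)
  then obtain j where k: "k = Suc j" by (cases k) auto
  have "(letter A \<star> c_ser k) (A # replicate j A @ [B]) = (1 :: 'k)"
    using Suc by (simp add: letter_mult_Cons k)
  moreover have "(c_ser k \<star> letter A) ((A # replicate j A) @ [B]) = (0 :: 'k)"
    by (simp only: mult_letter_right) simp
  ultimately show ?case using Suc by (simp add: c_ser_simps ad_eq k)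
qed

lemma finite_bounded_c_deg: "finite_bounded c_deg"
  unfolding finite_bounded_def
proof
  fix n
  have "bounded_words c_deg n \<subseteq> {v. set v \<subseteq> {..n} \<and> length v \<le> n}"
  proof
    fix v assume "v \<in> bounded_words c_deg n"
    then have v: "sum_list (map c_deg v) \<le> n" by (simp add: bounded_words_def)
    have "length v \<le> sum_list (map c_deg v)" by (induction v) (auto simp: c_deg_def)
    moreover have "x \<le> sum_list (map c_deg v)" if "x \<in> set v" for x
      using member_le_sum_list[of "c_deg x" "map c_deg v"] that by (fastforce simp: c_deg_def)
    ultimately show "v \<in> {v. set v \<subseteq> {..n} \<and> length v \<le> n}" using v by fastforce
  qed
  then show "finite (bounded_words c_deg n)"
    using finite_lists_length_le[of "{..n}" n] finite_subset by blast
qed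

lemma c_ser_adapted: "subst_adapted c_deg (c_ser :: nat \<Rightarrow> (ab, 'k::comm_rat_algebra) series)"
  using c_ser_homogeneous(1)[where 'k = 'k] finite_bounded_c_deg
  by (auto simp: subst_adapted_def homogeneous_def sum_list_triv)

lemma c_prod_homogeneous:
  shows "homogeneous (\<lambda>_. 1) (sum_list (map c_deg ks)) (nc_prod (map c_ser ks) :: (ab, 'k::comm_rat_algebra) series)"
    and "homogeneous degB (length ks) (nc_prod (map c_ser ks) :: (ab, 'k) series)"
  using homogeneous_nc_prod[where v = ks and wt' = c_deg and s = c_ser, OF c_ser_homogeneous(1)[where 'k = 'k]]
    homogeneous_nc_prod[where v = ks and wt' = "\<lambda>_. 1" and s = c_ser, OF c_ser_homogeneous(2)[where 'k = 'k]]
  by (simp_all add: sum_list_triv)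

lemmas c_subst = nc_subst_letter[OF c_ser_adapted] nc_subst_add[OF c_ser_adapted]
  nc_subst_smult[OF c_ser_adapted] nc_subst_ad[OF c_ser_adapted] nc_subst_diff[OF c_ser_adapted]

text \<open>On the algebra generated by the \<open>c_ser i\<close>, bracketing with a is the
  derivation that raises each index by 1. The Lie algebra they generate is therefore an ideal, which
  closes the bracket case of the elimination.\<close>

lemma ad_a_c_subst:
  fixes G :: "(nat, 'k::comm_rat_algebra) series"
  assumes "G \<in> lie_poly {1..}"
  shows "\<exists>G'\<in>lie_poly {1..}. ad ser_a (nc_subst c_ser G) = nc_subst c_ser G'"
  using assms
proof (rule lie_poly_induct[where P = "\<lambda>G. \<exists>G'\<in>lie_poly {1..}. ad ser_a (nc_subst c_ser G) = nc_subst c_ser G'"])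
  fix i :: nat assume "i \<in> {1..}"
  then show "\<exists>G'\<in>lie_poly {1..}. ad ser_a (nc_subst c_ser (letter i)) = nc_subst c_ser (G' :: (nat, 'k) series)"
    by (intro bexI[of _ "letter (Suc i)"]) (simp_all add: c_subst c_ser_simps lie_poly_letter)
next
  show "\<exists>G'\<in>lie_poly {1..}. ad ser_a (nc_subst c_ser 0) = nc_subst c_ser (G' :: (nat, 'k) series)"
    by (intro bexI[of _ 0]) (simp_all add: lie_poly_zero)
next
  fix F G :: "(nat, 'k) series"
  assume FG: "F \<in> lie_poly {1..}" "G \<in> lie_poly {1..}"
    and "\<exists>G'\<in>lie_poly {1..}. ad ser_a (nc_subst c_ser F) = nc_subst c_ser G'"
    and "\<exists>G'\<in>lie_poly {1..}. ad ser_a (nc_subst c_ser G) = nc_subst c_ser G'"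
  then obtain F' G' where *: "F' \<in> lie_poly {1..}" "ad ser_a (nc_subst c_ser F) = nc_subst c_ser F'"
    "G' \<in> lie_poly {1..}" "ad ser_a (nc_subst c_ser G) = nc_subst c_ser G'" by blast
  show "\<exists>G'\<in>lie_poly {1..}. ad ser_a (nc_subst c_ser (F + G)) = nc_subst c_ser G'"
    by (intro bexI[of _ "F' + G'"]) (use * in \<open>simp_all add: c_subst ad_add lie_poly_add\<close>)
  show "\<exists>G'\<in>lie_poly {1..}. ad ser_a (nc_subst c_ser (ad F G)) = nc_subst c_ser G'"
  proof (intro bexI[of _ "ad F' G + ad F G'"])
    show "ad ser_a (nc_subst c_ser (ad F G)) = nc_subst c_ser (ad F' G + ad F G')"
      unfolding c_subst Jacobi[of ser_a] *(2,4) ..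
  qed (intro lie_poly_add lie_poly_ad FG *)
next
  fix c and F :: "(nat, 'k) series"
  assume "\<exists>G'\<in>lie_poly {1..}. ad ser_a (nc_subst c_ser F) = nc_subst c_ser G'"
  then obtain F' where *: "F' \<in> lie_poly {1..}" "ad ser_a (nc_subst c_ser F) = nc_subst c_ser F'" by blast
  show "\<exists>G'\<in>lie_poly {1..}. ad ser_a (nc_subst c_ser (nc_smult c F)) = nc_subst c_ser G'"
    by (intro bexI[of _ "nc_smult c F'"]) (use * in \<open>simp_all add: c_subst ad_smult lie_poly_smult\<close>)
qed

lemma ad_coeff_letter: "f [] = 0 \<Longrightarrow> g [] = 0 \<Longrightarrow> ad f g [x] = 0"
  by (simp add: ad_eq nc_mult_Cons)

lemma lazard_poly:
  fixes f :: "(ab, 'k::comm_rat_algebra) series"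
  assumes "f \<in> lie_poly UNIV"
  shows "\<exists>F\<in>lie_poly {1..}. f = nc_smult (f [A]) ser_a + nc_subst c_ser F"
  using assms
proof (rule lie_poly_induct[where P = "\<lambda>f. \<exists>F\<in>lie_poly {1..}. f = nc_smult (f [A]) ser_a + nc_subst c_ser F"])
  fix x :: ab
  show "\<exists>F\<in>lie_poly {1..}. (letter x :: (ab, 'k) series) = nc_smult (letter x [A]) ser_a + nc_subst c_ser F"
  proof (cases x)
    case A
    have "(ser_a :: (ab, 'k) series) = nc_smult (ser_a [A]) ser_a + nc_subst c_ser 0"
      by (simp add: letter_def[of A "[A]"])
    then show ?thesis unfolding A using lie_poly_zero by blast
  next
    case B
    have "(ser_b :: (ab, 'k) series) = nc_smult (ser_b [A]) ser_a + nc_subst c_ser (letter 1)"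
      by (simp add: letter_def[of B "[A]"] c_subst c_ser_simps)
    moreover have "(letter 1 :: (nat, 'k) series) \<in> lie_poly {1..}" by (rule lie_poly_letter) simp
    ultimately show ?thesis unfolding B by blast
  qed
next
  have "(0 :: (ab, 'k) series) = nc_smult (0 [A]) ser_a + nc_subst c_ser 0" by simp
  then show "\<exists>F\<in>lie_poly {1..}. (0 :: (ab, 'k) series) = nc_smult (0 [A]) ser_a + nc_subst c_ser F"
    using lie_poly_zero by blast
next
  fix f g :: "(ab, 'k) series"
  assume fg: "f \<in> lie_poly UNIV" "g \<in> lie_poly UNIV"
    and "\<exists>F\<in>lie_poly {1..}. f = nc_smult (f [A]) ser_a + nc_subst c_ser F"
    and "\<exists>F\<in>lie_poly {1..}. g = nc_smult (g [A]) ser_a + nc_subst c_ser F"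
  then obtain F G where *: "F \<in> lie_poly {1..}" "f = nc_smult (f [A]) ser_a + nc_subst c_ser F"
    "G \<in> lie_poly {1..}" "g = nc_smult (g [A]) ser_a + nc_subst c_ser G" by blast
  define \<alpha> \<beta> where ab: "\<alpha> = f [A]" "\<beta> = g [A]"
  have f: "f = nc_smult \<alpha> ser_a + nc_subst c_ser F" and g: "g = nc_smult \<beta> ser_a + nc_subst c_ser G"
    unfolding ab by (rule *)+
  have "f + g = nc_smult (\<alpha> + \<beta>) ser_a + nc_subst c_ser (F + G)"
    unfolding c_subst by (subst f, subst g) (simp add: fun_eq_iff nc_smult_def distrib_right add_ac)
  then have "f + g = nc_smult ((f + g) [A]) ser_a + nc_subst c_ser (F + G)"
    unfolding plus_fun_apply[of f g "[A]"] ab .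
  then show "\<exists>F\<in>lie_poly {1..}. f + g = nc_smult ((f + g) [A]) ser_a + nc_subst c_ser F"
    by (rule bexI[OF _ lie_poly_add[OF *(1,3)]])
  obtain F' G' where *: "F' \<in> lie_poly {1..}" "ad ser_a (nc_subst c_ser F) = nc_subst c_ser F'"
    "G' \<in> lie_poly {1..}" "ad ser_a (nc_subst c_ser G) = nc_subst c_ser G'" "F \<in> lie_poly {1..}" "G \<in> lie_poly {1..}"
    using ad_a_c_subst[OF *(1)] ad_a_c_subst[OF *(3)] *(1,3) by blast
  have fa: "ad (nc_subst c_ser F) ser_a = - nc_subst c_ser F'" 
    unfolding ad_uminus(3)[of "nc_subst c_ser F" ser_a] *(2) ..
  \<comment> \<open>Bracket of \<open>\<alpha> a + F\<close> and \<open>\<beta> a + G\<close>: since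
    a commutes with itself, no multiple of a is left.\<close>
  have "ad f g = nc_subst c_ser (nc_smult \<alpha> G' - nc_smult \<beta> F' + ad F G)"
    unfolding c_subst
    by (subst f, subst g) (simp add: ad_add ad_smult fa *(4), simp add: fun_eq_iff nc_smult_def)
  moreover have "nc_smult \<alpha> G' - nc_smult \<beta> F' + ad F G \<in> lie_poly {1..}"
    by (intro lie_poly_add lie_poly_diff lie_poly_smult lie_poly_ad *)
  moreover have "ad f g [A] = 0"
    by (intro ad_coeff_letter primitiveD(1) lie_poly_primitive[OF fg(1)] lie_poly_primitive[OF fg(2)])
  ultimately show "\<exists>F\<in>lie_poly {1..}. ad f g = nc_smult (ad f g [A]) ser_a + nc_subst c_ser F" by auto
next
  fix c and f :: "(ab, 'k) series"
  assume "\<exists>F\<in>lie_poly {1..}. f = nc_smult (f [A]) ser_a + nc_subst c_ser F"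
  then obtain F where *: "F \<in> lie_poly {1..}" "f = nc_smult (f [A]) ser_a + nc_subst c_ser F" by blast
  have "nc_smult c f = nc_smult (nc_smult c f [A]) ser_a + nc_subst c_ser (nc_smult c F)"
    by (subst *(2)) (simp add: c_subst nc_smult_add, simp add: fun_eq_iff nc_smult_def mult.assoc)
  then show "\<exists>F\<in>lie_poly {1..}. nc_smult c f = nc_smult (nc_smult c f [A]) ser_a + nc_subst c_ser F"
    using lie_poly_smult[OF *(1)] by blast
qed

lemma c_subst_coeff:
  "nc_subst c_ser F w = (\<Sum>ks\<in>bounded_words c_deg (length w). F ks * nc_prod (map c_ser ks) w)"
  unfolding nc_subst_linear by (rule nc_linear_eq[OF subst_adapted[OF c_ser_adapted] order_refl])

lemma c_prod_support:
  assumes "nc_prod (map c_ser ks) w \<noteq> (0 :: 'k::comm_rat_algebra)" "0 \<notin> set ks"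
  shows "sum_list ks = length w" "length ks = sum_list (map degB w)"
proof -
  have "map c_deg ks = ks" using assms(2) by (induction ks) (auto simp: c_deg_def)
  then show "sum_list ks = length w" "length ks = sum_list (map degB w)"
    using c_prod_homogeneous[of ks, where 'k = 'k] assms(1) by (auto simp: homogeneous_def sum_list_triv)
qed

lemma lazard_exists:
  fixes f :: "(ab, 'k::comm_rat_algebra) series"
  assumes "f \<in> f2"
  shows "\<exists>F\<in>lie_c. f = nc_smult (f [A]) ser_a + nc_subst c_ser F"
proof -
  have h: "hom_part (\<lambda>_. 1) d f \<in> lie_poly UNIV" for d
    using assms by (simp add: f2_def lie_series_def)
  have "\<exists>Fd. \<forall>d. Fd d \<in> lie_poly {1..} \<and>
     hom_part (\<lambda>_. 1) d f = nc_smult (hom_part (\<lambda>_. 1) d f [A]) ser_a + nc_subst c_ser (Fd d)"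
    using lazard_poly[OF h] by (intro choice) blast
  then obtain Fd where Fd: "\<And>d. Fd d \<in> lie_poly {1..}"
     "\<And>d. hom_part (\<lambda>_. 1) d f = nc_smult (hom_part (\<lambda>_. 1) d f [A]) ser_a + nc_subst c_ser (Fd d)" by blast
  \<comment> \<open>The product of the \<open>c_ser\<close> with indices \<open>ks\<close> is
    homogeneous of degree \<open>sum_list ks\<close> in a and b, so the solutions in the single
    degrees glue without overlap.\<close>
  define F where "F ks = Fd (sum_list ks) ks" for ks
  have "hom_part (\<lambda>i. i) d F = hom_part (\<lambda>i. i) d (Fd d)" for d
    by (auto simp: fun_eq_iff hom_part_def F_def)
  then have "F \<in> lie_c"
    using hom_part_lie_poly[OF Fd(1)] by (simp add: lie_c_def lie_series_def)
  moreover have "f w = (nc_smult (f [A]) ser_a + nc_subst c_ser F) w" for w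
  proof -
    have "F ks * nc_prod (map c_ser ks) w = Fd (length w) ks * nc_prod (map c_ser ks) w" for ks
    proof (cases "0 \<in> set ks")
      case True
      then have "\<not> set ks \<subseteq> {1..}" by auto
      then show ?thesis using lie_poly_support[OF Fd(1)] by (simp add: F_def)
    next
      case False
      then show ?thesis using c_prod_support(1)[OF _ False, of w, where 'k = 'k]
        by (cases "nc_prod (map c_ser ks) w = (0 :: 'k)") (auto simp: F_def)
    qed
    then have "nc_subst c_ser F w = nc_subst c_ser (Fd (length w)) w" by (simp add: c_subst_coeff)
    moreover have "f w = (nc_smult (hom_part (\<lambda>_. 1) (length w) f [A]) ser_a + nc_subst c_ser (Fd (length w))) w"
      unfolding Fd(2)[symmetric] by (simp add: hom_part_def sum_list_triv)
    moreover have "nc_smult (hom_part (\<lambda>_. 1) (length w) f [A]) ser_a w = nc_smult (f [A]) ser_a w"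
      by (auto simp: hom_part_def nc_smult_def letter_def)
    ultimately show ?thesis by simp
  qed
  ultimately show ?thesis by blast
qed

section \<open>Freeness of the elements \<open>c_ser i\<close>\<close>

lemma c_subst_Cons:
  fixes H :: "(nat, 'k::comm_rat_algebra) series"
  assumes "length w \<le> n"
  shows "nc_subst c_ser H w = H [] * nc_one w + (\<Sum>k\<le>n. (c_ser k \<star> nc_subst c_ser (\<lambda>v. H (k # v))) w)"
proof -
  let ?T = "bounded_words c_deg n"
  let ?P = "\<lambda>ks. nc_prod (map c_ser ks) :: (ab, 'k) series"
  note ad = subst_adapted[OF c_ser_adapted[where 'k = 'k]]
  have fin: "finite ?T" using finite_bounded_c_deg by (simp add: finite_bounded_def)
  have inj: "inj_on (\<lambda>(k, v). k # v) S" for S :: "(nat \<times> nat list) set" by (auto simp: inj_on_def)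
  have sub: "?T \<subseteq> insert [] ((\<lambda>(k, v). k # v) ` ({..n} \<times> ?T))"
  proof
    fix v assume v: "v \<in> ?T"
    show "v \<in> insert [] ((\<lambda>(k, v). k # v) ` ({..n} \<times> ?T))"
    proof (cases v)
      case (Cons k u)
      then have "k \<le> n" "u \<in> ?T" using v by (auto simp: bounded_words_def c_deg_def)
      then show ?thesis using Cons by auto
    qed simp
  qed
  have out: "?P v w = 0" if "v \<notin> ?T" for v
    using ad that assms by (fastforce simp: adapted_def bounded_words_def)
  have "nc_subst c_ser H w = (\<Sum>v\<in>?T. H v * ?P v w)"
    unfolding nc_subst_linear by (rule nc_linear_eq[OF ad assms])
  also have "\<dots> = (\<Sum>v\<in>insert [] ((\<lambda>(k, v). k # v) ` ({..n} \<times> ?T)). H v * ?P v w)"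
    by (rule sum.mono_neutral_left) (use fin sub out in auto)
  also have "\<dots> = H [] * nc_one w + (\<Sum>v\<in>(\<lambda>(k, v). k # v) ` ({..n} \<times> ?T). H v * ?P v w)"
    using fin by (subst sum.insert) auto
  also have "(\<Sum>v\<in>(\<lambda>(k, v). k # v) ` ({..n} \<times> ?T). H v * ?P v w) =
     (\<Sum>k\<le>n. \<Sum>v\<in>?T. H (k # v) * (c_ser k \<star> ?P v) w)"
    unfolding sum.cartesian_product by (subst sum.reindex[OF inj]) (simp add: case_prod_unfold)
  also have "\<dots> = (\<Sum>k\<le>n. (c_ser k \<star> nc_subst c_ser (\<lambda>v. H (k # v))) w)"
  proof (rule sum.cong[OF HOL.refl])
    fix k
    have "(c_ser k \<star> nc_subst c_ser (\<lambda>v. H (k # v))) w = (\<Sum>i\<le>length w. c_ser k (take i w) * (\<Sum>v\<in>?T. H (k # v) * ?P v (drop i w)))"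
      unfolding nc_mult_def nc_subst_linear using assms by (simp add: nc_linear_eq[OF ad, of _ n])
    also have "\<dots> = (\<Sum>v\<in>?T. H (k # v) * (c_ser k \<star> ?P v) w)"
      unfolding nc_mult_def sum_distrib_left by (subst sum.swap) (simp add: mult.left_commute)
    finally show "(\<Sum>v\<in>?T. H (k # v) * (c_ser k \<star> ?P v) w) = (c_ser k \<star> nc_subst c_ser (\<lambda>v. H (k # v))) w" ..
  qed
  finally show ?thesis .
qed

lemma c_ser_mult_coeff:
  assumes "k > 0"
  shows "(c_ser k \<star> g) w = (if k \<le> length w then c_ser k (take k w) * g (drop k w) else 0 :: 'k::comm_rat_algebra)"
proof -
  have "c_ser k (take i w) * g (drop i w) = (if i = k then c_ser k (take k w) * g (drop k w) else 0)" if "i \<le> length w" for i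
    using c_ser_homogeneous(1)[of k, where 'k = 'k] that assms
    by (cases "c_ser k (take i w) = (0::'k)") (auto simp: homogeneous_def c_deg_def sum_list_triv)
  then show ?thesis by (simp add: nc_mult_def)
qed

text \<open>Triangularity in the leading words. In \<open>a^(k-1) b u\<close>, a first factor
  \<open>c_ser k'\<close> with \<open>k' < k\<close> would have to match a power of a, one with
  \<open>k' > k\<close> leaves a rest shorter than \<open>u\<close>, and \<open>k' = k\<close>
  contributes the coefficient sought.\<close>

lemma c_subst_inj:
  fixes H :: "(nat, 'k::comm_rat_algebra) series"
  assumes "nc_subst c_ser H = 0" "\<And>v. 0 \<in> set v \<Longrightarrow> H v = 0"
  shows "H v = 0"
  using assms
proof (induction v arbitrary: H)
  case Nil
  from Nil(1) c_subst_Cons[of "[]" 0 H] show ?case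
    by (simp add: nc_one_def) (simp add: c_ser_simps letter_def)
next
  case (Cons k v)
  define f where "f k = nc_subst c_ser (\<lambda>v. H (k # v))" for k
  have f0: "f 0 = 0" 
  proof -
    have "(\<lambda>v. H (0 # v)) = 0" using Cons.prems(2) by (simp add: fun_eq_iff)
    then show ?thesis by (simp add: f_def)
  qed
  have key: "f k u = 0" if "k > 0" for k u
    using that
  proof (induction "length u" arbitrary: k u rule: less_induct)
    case less
    define w where "w = replicate (k - 1) A @ B # u"
    have lw: "length w = k + length u" using less by (simp add: w_def)
    have "0 = nc_subst c_ser H w" using Cons.prems(1) by simp
    also have "\<dots> = (\<Sum>k'\<le>length w. (c_ser k' \<star> f k') w)"
      unfolding f_def by (subst c_subst_Cons[OF order_refl]) (simp add: nc_one_def w_def)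
    also have "\<dots> = (\<Sum>k'\<le>length w. if k' = k then f k u else 0)"
    proof (rule sum.cong[OF HOL.refl])
      fix k' assume k': "k' \<in> {..length w}"
      consider "k' = 0" | "0 < k'" "k' < k" | "k' = k" | "k' > k" by linarith
      then show "(c_ser k' \<star> f k') w = (if k' = k then f k u else 0)"
      proof cases
        case 1
        then show ?thesis using less f0 by simp
      next
        case 2
        then have "take k' w = replicate k' A" by (simp add: w_def min_def)
        moreover have "c_ser k' (replicate k' A) = (0 :: 'k)"
          using c_ser_homogeneous(2)[of k', where 'k = 'k] by (auto simp: homogeneous_def sum_list_replicate)
        ultimately show ?thesis using 2 by (simp add: c_ser_mult_coeff)
      next
        case 3
        have "take k w = replicate (k - 1) A @ [B]" "drop k w = u" using less by (auto simp: w_def)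
        then show ?thesis using 3 less c_ser_leading[of k, where 'k = 'k] k' by (simp add: c_ser_mult_coeff)
      next
        case 4
        then have "length (drop k' w) < length u" using lw k' by auto
        from less(1)[OF this] 4 show ?thesis by (simp add: c_ser_mult_coeff)
      qed
    qed
    also have "\<dots> = f k u" using lw by simp
    finally show ?case ..
  qed
  show ?case
  proof (cases "k = 0")
    case False
    then have "nc_subst c_ser (\<lambda>v. H (k # v)) = 0" using key by (auto simp: fun_eq_iff f_def)
    from Cons.IH[OF this] Cons.prems(2) show ?thesis by simp
  qed (use Cons.prems(2) in simp)
qed

lemma lazard_unique:
  fixes F G :: "(nat, 'k::comm_rat_algebra) series"
  assumes "F \<in> lie_c" "G \<in> lie_c" "nc_subst c_ser F = nc_subst c_ser G"
  shows "F = G"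
proof -
  have "F - G \<in> lie_c" using assms(1,2) unfolding lie_c_def by (rule lie_series_diff)
  then have "(F - G) v = 0" if "0 \<in> set v" for v
    using lie_series_support[of "F - G" "{1..}" "\<lambda>i. i" v] that by (force simp: lie_c_def)
  moreover have "nc_subst c_ser (F - G) = 0" by (simp add: c_subst assms(3))
  ultimately have "(F - G) v = 0" for v using c_subst_inj[of "F - G"] by blast
  then show ?thesis by (simp add: fun_eq_iff)
qed

text \<open>Existence and uniqueness of the elimination give the definite description its meaning;
  \<open>c_component\<close> is used only through these two facts.\<close>

lemma c_component:
  assumes "f \<in> f2"
  shows "c_component f \<in> lie_c" "f = nc_smult (f [A]) ser_a + nc_subst c_ser (c_component f)"
proof -
  have "\<exists>!F. F \<in> lie_c \<and> f = nc_add (nc_smult (f [A]) ser_a) (nc_subst c_ser F)"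
  proof (rule ex_ex1I)
    show "\<exists>F. F \<in> lie_c \<and> f = nc_add (nc_smult (f [A]) ser_a) (nc_subst c_ser F)"
      using lazard_exists[OF assms] by auto
    fix F G
    assume "F \<in> lie_c \<and> f = nc_add (nc_smult (f [A]) ser_a) (nc_subst c_ser F)"
      "G \<in> lie_c \<and> f = nc_add (nc_smult (f [A]) ser_a) (nc_subst c_ser G)"
    then show "F = G" using lazard_unique by (metis add_left_cancel nc_add_eq)
  qed
  from theI'[OF this] show "c_component f \<in> lie_c" "f = nc_smult (f [A]) ser_a + nc_subst c_ser (c_component f)"
    by (auto simp: c_component_def)
qed

lemma ad_diff: "ad f (g - h) = ad f g - ad f h"
  using ad_add(1)[of f g "- h"] by (simp add: ad_uminus(1))

lemma two_scaleQ: "2 *\<^sub>Q x = x + (x :: 'k::comm_rat_algebra)"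
  using scaleQ_add_left[of 1 1 x] by (simp add: scaleQ_one)

lemma lie_series_sum: "(\<And>i. i \<in> I \<Longrightarrow> f i \<in> lie_series S wt) \<Longrightarrow> (\<Sum>i\<in>I. f i) \<in> lie_series S wt"
  by (induction I rule: infinite_finite_induct) (auto intro: lie_series_add lie_poly_series lie_poly_zero)

section \<open>The derivations \<open>\<epsilon>\<^bsub>2n\<^esub>\<close>\<close>

definition ad_b_a :: "nat \<Rightarrow> (ab, 'k::comm_rat_algebra) series" where
  "ad_b_a j = (ad ser_b ^^ j) ser_a"

lemma ad_b_a_simps: "ad_b_a 0 = ser_a" "ad_b_a (Suc j) = ad ser_b (ad_b_a j)"
  by (simp_all add: ad_b_a_def)

lemma ad_b_a_lie: "ad_b_a j \<in> lie_poly UNIV"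
  unfolding ad_b_a_def by (intro lie_poly_ad_power lie_poly_letter) auto

lemma ad_b_a_homogeneous:
  shows "homogeneous (\<lambda>_. 1) (Suc j) (ad_b_a j :: (ab, 'k::comm_rat_algebra) series)"
    and "homogeneous degA 1 (ad_b_a j :: (ab, 'k) series)"
proof -
  have "homogeneous (\<lambda>_. 1) (j * 1 + 1) (ad_b_a j :: (ab, 'k) series)"
    unfolding ad_b_a_def by (intro homogeneous_ad_power homogeneous_letter[of "\<lambda>_. 1"])
  then show "homogeneous (\<lambda>_. 1) (Suc j) (ad_b_a j :: (ab, 'k) series)" by simp
  have "homogeneous degA (j * degA B + degA A) (ad_b_a j :: (ab, 'k) series)"
    unfolding ad_b_a_def by (intro homogeneous_ad_power homogeneous_letter)
  then show "homogeneous degA 1 (ad_b_a j :: (ab, 'k) series)" by simp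
qed

text \<open>For \<open>N = 2n\<close> and \<open>m = n\<close> this is the value of the derivation
  on a, the solution \<open>s\<close> of \<open>[b, s] = [a, ad(b)^(2n)(a)]\<close>. The free upper
  limit \<open>m\<close> lets the telescoping run by induction.\<close>

definition eps_a :: "nat \<Rightarrow> nat \<Rightarrow> (ab, 'k::comm_rat_algebra) series" where
  "eps_a N m = (\<Sum>j<m. if even j then ad (ad_b_a j) (ad_b_a (N - 1 - j)) else - ad (ad_b_a j) (ad_b_a (N - 1 - j)))"

lemma eps_a_Suc: "eps_a N (Suc m) = eps_a N m +
  (if even m then ad (ad_b_a m) (ad_b_a (N - 1 - m)) else - ad (ad_b_a m) (ad_b_a (N - 1 - m)))"
  by (simp only: eps_a_def sum.lessThan_Suc)

lemma eps_a_0 [simp]: "eps_a N 0 = 0"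
  by (simp only: eps_a_def lessThan_0 sum.empty)

lemma eps_a_lie: "eps_a N m \<in> lie_poly UNIV"
  unfolding eps_a_def by (intro lie_poly_sum) (auto intro: lie_poly_uminus lie_poly_ad ad_b_a_lie)

lemma homogeneous_uminus: "homogeneous wt n f \<Longrightarrow> homogeneous wt n (- f)"
  by (simp add: homogeneous_def)

lemma eps_a_homogeneous:
  assumes "m \<le> N"
  shows "homogeneous (\<lambda>_. 1) (N + 1) (eps_a N m :: (ab, 'k::comm_rat_algebra) series)"
    and "homogeneous degA 2 (eps_a N m :: (ab, 'k) series)"
proof -
  have "homogeneous (\<lambda>_. 1) (N + 1) (ad (ad_b_a j) (ad_b_a (N - 1 - j)) :: (ab, 'k) series)" if "j < m" for j
    using homogeneous_ad[OF ad_b_a_homogeneous(1)[of j] ad_b_a_homogeneous(1)[of "N - 1 - j"], where 'b = 'k]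
      that assms by simp
  then show "homogeneous (\<lambda>_. 1) (N + 1) (eps_a N m :: (ab, 'k) series)"
    unfolding eps_a_def by (intro homogeneous_sum) (auto intro: homogeneous_uminus)
  have "homogeneous degA 2 (ad (ad_b_a j) (ad_b_a (N - 1 - j)) :: (ab, 'k) series)" for j
    using homogeneous_ad[OF ad_b_a_homogeneous(2)[of j] ad_b_a_homogeneous(2)[of "N - 1 - j"], where 'b = 'k]
    by (simp add: numeral_2_eq_2)
  then show "homogeneous degA 2 (eps_a N m :: (ab, 'k) series)"
    unfolding eps_a_def by (intro homogeneous_sum) (auto intro: homogeneous_uminus)
qed

text \<open>The sum telescopes under \<open>ad b\<close>.\<close>

lemma ad_b_eps_a:
  "m \<le> N \<Longrightarrow> ad ser_b (eps_a N m :: (ab, 'k::comm_rat_algebra) series) = ad ser_a (ad_b_a N) -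
     (if even m then ad (ad_b_a m) (ad_b_a (N - m)) else - ad (ad_b_a m) (ad_b_a (N - m)))"
proof (induction m)
  case 0
  show "ad ser_b (eps_a N 0 :: (ab, 'k) series) = ad ser_a (ad_b_a N) -
     (if even (0 :: nat) then ad (ad_b_a 0) (ad_b_a (N - 0)) else - ad (ad_b_a 0) (ad_b_a (N - 0)))"
    by (simp add: ad_b_a_simps)
next
  case (Suc m)
  then have "Suc (N - 1 - m) = N - m" by simp
  then have "ad_b_a (N - m) = (ad ser_b (ad_b_a (N - 1 - m)) :: (ab, 'k) series)" by (metis ad_b_a_simps(2))
  then have "ad ser_b (ad (ad_b_a m) (ad_b_a (N - 1 - m)) :: (ab, 'k) series) =
      ad (ad_b_a (Suc m)) (ad_b_a (N - Suc m)) + ad (ad_b_a m) (ad_b_a (N - m))"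
    by (simp add: Jacobi[of ser_b] ad_b_a_simps)
  moreover have "ad ser_b (eps_a N m :: (ab, 'k) series) = ad ser_a (ad_b_a N) -
     (if even m then ad (ad_b_a m) (ad_b_a (N - m)) else - ad (ad_b_a m) (ad_b_a (N - m)))"
    by (rule Suc.IH) (use Suc.prems in simp)
  ultimately show "ad ser_b (eps_a N (Suc m) :: (ab, 'k) series) = ad ser_a (ad_b_a N) -
     (if even (Suc m) then ad (ad_b_a (Suc m)) (ad_b_a (N - Suc m)) else - ad (ad_b_a (Suc m)) (ad_b_a (N - Suc m)))"
    by (simp add: eps_a_Suc ad_add ad_uminus(1))
qed

lemma eps_on_no_const:
  assumes "s [] = 0"
  shows "\<forall>x. eps_on n s x [] = (0 :: 'k::comm_rat_algebra)"
proof -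
  have "ad_b_a (2 * n) [] = (0 :: 'k)" by (rule primitiveD(1)[OF lie_poly_primitive[OF ad_b_a_lie]])
  then show ?thesis using assms by (simp add: eps_on_def ad_b_a_def split: ab.splits)
qed

lemma eps_on_ad_b_a:
  assumes "s [] = (0 :: 'k::comm_rat_algebra)"
  shows "nc_deriv (eps_on n s) (ad ser_b ser_a) = ad ser_b s - ad ser_a (ad_b_a (2 * n))"
proof -
  note d = eps_on_no_const[where s = s and n = n, OF assms]
  show ?thesis
    by (simp add: nc_deriv_ad[where d = "eps_on n s", OF finite_ab d] nc_deriv_letter[where d = "eps_on n s", OF finite_ab d])
      (simp add: eps_on_def ad_b_a_def ad_uminus(3)[of _ ser_a])
qed

lemma sh_replicate: "sh g [x] (replicate m x) = of_nat (Suc m) *\<^sub>Q (g (replicate (Suc m) x) :: 'k::comm_rat_algebra)"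
  by (induction m arbitrary: g) (simp_all add: scaleQ_one sh_Cons scaleQ_add_left two_scaleQ add_ac)

text \<open>Comparing the two products with b kills words that begin or end with a and moves a final
  b to the front, which disposes of every word containing a. Higher powers of b vanish by
  primitivity, since b shuffled with \<open>b^m\<close> is \<open>m + 1\<close> times
  \<open>b^(m+1)\<close>.\<close>

lemma commute_b_zero:
  assumes "primitive t" "ad ser_b t = 0" "t [B] = (0 :: 'k::comm_rat_algebra)"
  shows "t = 0"
proof
  fix w
  have comm: "(letter B \<star> t) w = (t \<star> letter B) w" for w
    using fun_cong[OF assms(2), of w] by (simp add: ad_eq)
  have front: "t (A # v) = 0" for v
    using comm[of "A # v @ [B]"] mult_letter_right(1)[of t B "A # v" B] by (simp add: letter_mult_Cons)
  have move: "t (v @ [y]) = (if y = B then t (B # v) else 0)" for v y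
    using comm[of "B # v @ [y]"] mult_letter_right(1)[of t B "B # v" y] by (auto simp: letter_mult_Cons)
  have withA: "t (replicate k B @ A # v) = 0" for k v
  proof (induction "length v" arbitrary: k v rule: less_induct)
    case less
    show ?case
    proof (cases v rule: rev_cases)
      case Nil
      then show ?thesis using move[of "replicate k B" A] by simp
    next
      case (snoc u y)
      then show ?thesis using move[of "replicate k B @ A # u" y] less[of u "Suc k"] by simp
    qed
  qed
  have onlyB: "t (replicate k B) = 0" for k
  proof (cases "k \<le> 1")
    case True
    then show ?thesis using assms(3) primitiveD(1)[OF assms(1)] by (cases k) auto
  next
    case False
    then obtain m where k: "k = Suc m" "m > 0" by (cases k) auto
    have "sh t [B] (replicate m B) = 0" using k by (intro primitiveD(2)[OF assms(1)]) auto
    then show ?thesis by (simp only: sh_replicate k scaleQ_eq_0_iff of_nat_eq_0_iff) simp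
  qed
  show "t w = 0 w"
  proof (cases "A \<in> set w")
    case True
    then obtain u v where w: "w = u @ A # v" "A \<notin> set u" by (meson split_list_first)
    then have "u = replicate (length u) B"
      by (metis ab.exhaust replicate_length_same)
    then show ?thesis using withA w by (metis zero_fun_apply)
  next
    case False
    then have "w = replicate (length w) B" by (metis ab.exhaust replicate_length_same)
    then show ?thesis using onlyB by (metis zero_fun_apply)
  qed
qed

text \<open>Two solutions of the defining condition differ by a Lie series that commutes with b and
  has no coefficient at b, hence by 0.\<close>

lemma eps_eq: "eps n = nc_deriv (eps_on n (eps_a (2 * n) n) :: ab \<Rightarrow> (ab, 'k::comm_rat_algebra) series)"
proof -
  let ?s = "eps_a (2 * n) n :: (ab, 'k) series"
  have nil: "s [] = 0" if "s \<in> f2" for s :: "(ab, 'k) series"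
    using that unfolding f2_def by (intro primitiveD(1) lie_series_primitive)
  have s: "?s \<in> f2" unfolding f2_def by (intro lie_poly_series eps_a_lie)
  \<comment> \<open>At \<open>m = n\<close> the boundary term of the telescoping sum is the bracket
    of \<open>ad(b)^n(a)\<close> with itself.\<close>
  have b: "ad ser_b ?s = ad ser_a (ad_b_a (2 * n))"
    by (simp add: ad_b_eps_a)
  have sB: "?s [B] = 0"
    using eps_a_homogeneous(2)[of n "2 * n", where 'k = 'k] by (force simp: homogeneous_def)
  have "(THE s. s \<in> f2 \<and> s [B] = 0 \<and> nc_deriv (eps_on n s) (ad ser_b ser_a) = nc_zero) = ?s"
  proof (rule the_equality)
    show "?s \<in> f2 \<and> ?s [B] = 0 \<and> nc_deriv (eps_on n ?s) (ad ser_b ser_a) = nc_zero"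
      using s sB by (simp add: eps_on_ad_b_a[where s = ?s, OF nil[OF s]] b)
  next
    fix s :: "(ab, 'k) series"
    assume *: "s \<in> f2 \<and> s [B] = 0 \<and> nc_deriv (eps_on n s) (ad ser_b ser_a) = nc_zero"
    then have "ad ser_b s = ad ser_a (ad_b_a (2 * n))"
      using eps_on_ad_b_a[where s = s and n = n, OF nil[of s]] by simp
    then have d1: "ad ser_b (s - ?s) = 0" by (simp add: ad_diff b)
    have d2: "primitive (s - ?s)"
      using * s unfolding f2_def by (intro lie_series_primitive[OF lie_series_diff]) auto
    have d3: "(s - ?s) [B] = 0"
      using conjunct1[OF conjunct2[OF *]] sB by simp
    have "s - ?s = 0" by (rule commute_b_zero[OF d2 d1 d3])
    then show "s = ?s" by simp
  qed
  then show ?thesis by (simp add: eps_def)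
qed

lemma eps_on_lie: "eps_on n (eps_a (2 * n) n) x \<in> lie_poly UNIV"
  using eps_a_lie ad_b_a_lie by (cases x) (simp_all add: eps_on_def flip: ad_b_a_def)

lemma eps_on_const: "\<forall>x. eps_on n (eps_a (2 * n) n) x [] = (0 :: 'k::comm_rat_algebra)"
  using primitiveD(1)[OF lie_poly_primitive[OF eps_on_lie]] by blast

lemma eps_a_b: "eps n (ad ser_b ser_a) = (0 :: (ab, 'k::comm_rat_algebra) series)"
proof -
  have "eps_a (2 * n) n [] = (0 :: 'k)" by (rule primitiveD(1)[OF lie_poly_primitive[OF eps_a_lie]])
  moreover have "ad ser_b (eps_a (2 * n) n) = ad ser_a (ad_b_a (2 * n) :: (ab, 'k) series)"
    by (simp add: ad_b_eps_a)
  ultimately show ?thesis by (simp add: eps_eq eps_on_ad_b_a)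
qed

lemma t12_eq: "t12 = - ad ser_b ser_a"
  by (simp add: t12_def ad_eq)

lemma
  fixes f g :: "(ab, 'k::comm_rat_algebra) series"
  shows eps_mult: "eps n (f \<star> g) = eps n f \<star> g + f \<star> eps n g"
    and eps_diff: "eps n (f - g) = eps n f - eps n g"
    and eps_smult: "eps n (nc_smult c f) = nc_smult c (eps n f)"
    and eps_t12: "eps n t12 = (0 :: (ab, 'k) series)"
    and eps_f2: "f \<in> f2 \<Longrightarrow> eps n f \<in> f2"
    and eps_cyc: "cyc f = 0 \<Longrightarrow> cyc (eps n f) = 0"
proof -
  let ?d = "eps_on n (eps_a (2 * n) n) :: ab \<Rightarrow> (ab, 'k) series"
  note d = eps_on_const[of n, where 'k = 'k]
  show "eps n (f \<star> g) = eps n f \<star> g + f \<star> eps n g"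
    "eps n (nc_smult c f) = nc_smult c (eps n f)"
    and diff: "eps n (f - g) = eps n f - eps n g" for f g
    unfolding eps_eq
    by (rule nc_deriv_mult[where d = ?d, OF finite_ab d] nc_deriv_smult[where d = ?d, OF finite_ab d]
        nc_deriv_diff[where d = ?d, OF finite_ab d])+
  have "eps n (0 - ad ser_b ser_a) = (0 :: (ab, 'k) series)"
    unfolding diff eps_a_b by (simp add: eps_eq)
  then show "eps n t12 = (0 :: (ab, 'k) series)" by (simp add: t12_eq)
  show "f \<in> f2 \<Longrightarrow> eps n f \<in> f2"
    unfolding eps_eq f2_def by (rule nc_deriv_lie_series[OF finite_ab eps_on_lie])
  show "cyc f = 0 \<Longrightarrow> cyc (eps n f) = 0"
    unfolding eps_eq by (rule cyc_nc_deriv_zero[where d = ?d, OF finite_ab d])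
qed

lemma eps_tilde_eq:
  "eps_tilde k f = nc_smult ((if k = 0 then - 1 else 2 / fact (2 * k - 2)) *\<^sub>Q 1) (eps k f)"
  by (auto simp: eps_tilde_def fun_eq_iff nc_smult_def scaleQ_minus_left scaleQ_one simp flip: scaleQ_alt)

lemma eps_support:
  fixes f :: "(ab, 'k::comm_rat_algebra) series"
  assumes "eps k f w \<noteq> 0"
  shows "\<exists>v. f v \<noteq> 0 \<and> length w = length v + 2 * k"
    and "\<exists>v. f v \<noteq> 0 \<and> sum_list (map degA w) = sum_list (map degA v) + 1"
proof -
  let ?d = "eps_on k (eps_a (2 * k) k) :: ab \<Rightarrow> (ab, 'k) series"
  have "homogeneous (\<lambda>_. 1) (1 + 2 * k) (?d x)" for x
    using eps_a_homogeneous(1)[of k "2 * k", where 'k = 'k] ad_b_a_homogeneous(1)[of "2 * k", where 'k = 'k]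
    by (cases x) (simp_all add: eps_on_def flip: ad_b_a_def)
  from nc_deriv_support[of "\<lambda>_. 1" "2 * k" ?d, OF this] assms
  show "\<exists>v. f v \<noteq> 0 \<and> length w = length v + 2 * k"
    by (simp add: eps_eq sum_list_triv)
  have "homogeneous degA (degA x + 1) (?d x)" for x
    using eps_a_homogeneous(2)[of k "2 * k", where 'k = 'k] ad_b_a_homogeneous(2)[of "2 * k", where 'k = 'k]
    by (cases x) (simp_all add: eps_on_def numeral_2_eq_2 flip: ad_b_a_def)
  from nc_deriv_support[of degA 1 ?d, OF this] assms
  show "\<exists>v. f v \<noteq> 0 \<and> sum_list (map degA w) = sum_list (map degA v) + 1"
    by (simp add: eps_eq)
qed

text \<open>Each factor raises the total degree by twice its index and the degree in a by 1. The
  second grading bounds the number of factors of index 0, which preserve the total degree.\<close>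

lemma eps_tilde_support:
  fixes f :: "(ab, 'k::comm_rat_algebra) series"
  assumes "foldr eps_tilde ks f w \<noteq> 0"
  shows "sum_list ks \<le> length w" "length ks \<le> length w"
proof -
  have e: "eps_tilde k g w \<noteq> 0 \<Longrightarrow> eps k g w \<noteq> 0" for k w and g :: "(ab, 'k) series"
    by (auto simp: eps_tilde_eq nc_smult_def)
  show "sum_list ks \<le> length w"
    using assms
  proof (induction ks arbitrary: w)
    case (Cons k ks)
    then have "eps_tilde k (foldr eps_tilde ks f) w \<noteq> 0" by simp
    from eps_support(1)[OF e[OF this]] Cons.IH show ?case by fastforce
  qed simp
  have "length ks \<le> sum_list (map degA w)"
    using assms
  proof (induction ks arbitrary: w)
    case (Cons k ks)
    then have "eps_tilde k (foldr eps_tilde ks f) w \<noteq> 0" by simp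
    from eps_support(2)[OF e[OF this]] Cons.IH show ?case by fastforce
  qed simp
  also have "\<dots> \<le> length w" by (induction w) auto
  finally show "length ks \<le> length w" .
qed

section \<open>The automorphism \<open>g(\<tau>)\<close>\<close>

definition index_words :: "nat \<Rightarrow> nat list set" where
  "index_words n = {ks. set ks \<subseteq> {..n} \<and> length ks \<le> n}"

lemma finite_index_words: "finite (index_words n)"
  unfolding index_words_def by (rule finite_lists_length_le) simp

lemma g_aut_eq:
  assumes "length w \<le> n"
  shows "g_aut \<tau> f w = (\<Sum>ks\<in>index_words n. (eis_int ks \<tau> \<otimes>\<^sub>Q 1) * foldr eps_tilde ks f w)"
  unfolding g_aut_def
proof (rule Sum_any.expand_superset[OF finite_index_words])
  show "{ks. (eis_int ks \<tau> \<otimes>\<^sub>Q 1) * foldr eps_tilde ks f w \<noteq> 0} \<subseteq> index_words n"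
  proof
    fix ks assume "ks \<in> {ks. (eis_int ks \<tau> \<otimes>\<^sub>Q 1) * foldr eps_tilde ks f w \<noteq> 0}"
    then have "foldr eps_tilde ks f w \<noteq> 0" by (auto simp del: foldr.simps)
    from eps_tilde_support[OF this] show "ks \<in> index_words n"
      using assms member_le_sum_list[of _ ks] by (fastforce simp: index_words_def)
  qed
qed

lemma eps_tilde_f2: "f \<in> f2 \<Longrightarrow> eps_tilde k f \<in> f2"
  unfolding eps_tilde_eq f2_def by (intro lie_series_smult eps_f2[unfolded f2_def])

lemma g_aut_f2:
  assumes "f \<in> f2"
  shows "g_aut \<tau> f \<in> f2"
  unfolding f2_def
proof (rule lie_seriesI)
  fix d
  define g where "g = (\<Sum>ks\<in>index_words d. nc_smult (eis_int ks \<tau> \<otimes>\<^sub>Q 1) (foldr eps_tilde ks f))"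
  have "foldr eps_tilde ks f \<in> f2" for ks
    using assms by (induction ks) (simp_all add: eps_tilde_f2)
  then have "nc_smult (eis_int ks \<tau> \<otimes>\<^sub>Q 1) (foldr eps_tilde ks f) \<in> lie_series UNIV (\<lambda>_. 1)" for ks
    unfolding f2_def by (intro lie_series_smult)
  then have "g \<in> lie_series UNIV (\<lambda>_. 1)" unfolding g_def by (rule lie_series_sum)
  from lie_seriesD[OF this, of d]
  show "\<exists>h\<in>lie_poly UNIV. \<forall>w. sum_list (map (\<lambda>_. 1) w) \<le> d \<longrightarrow> g_aut \<tau> f w = h w"
    by (simp add: sum_list_triv g_aut_eq g_def sum_fun_app nc_smult_def)
qed

text \<open>
  \<open>\<epsilon>\<^bsub>2n\<^esub>\<close> annihilates \<open>t\<^sub>1\<^sub>2\<close>, hence commutes with \<open>f \<mapsto> cyc (f t\<^sub>1\<^sub>2)\<close>.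
\<close>

lemma foldr_eps_cyc:
  fixes f :: "(ab, 'k::comm_rat_algebra) series"
  assumes "cyc (f \<star> t12) = nc_smult c (cyc (t12 \<star> t12))"
  shows "\<exists>c. cyc (foldr eps_tilde ks f \<star> t12) = nc_smult c (cyc (t12 \<star> t12))"
proof (induction ks)
  case Nil
  show ?case using assms by auto
next
  case (Cons k ks)
  define g where "g = foldr eps_tilde ks f"
  obtain c where "cyc (g \<star> t12) = nc_smult c (cyc (t12 \<star> t12))" using Cons by (auto simp: g_def)
  then have "cyc (g \<star> t12 - nc_smult c (t12 \<star> t12)) = 0" by (simp add: cyc_diff cyc_smult)
  from eps_cyc[OF this, of k] have "cyc (eps k g \<star> t12) = 0"
    by (simp add: eps_diff eps_mult eps_smult eps_t12)
  \<comment> \<open>The derivation also kills the correction term \<open>t12 \<star> t12\<close>, so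
    a single application already brings the multiple down to 0.\<close>
  then have "cyc (eps_tilde k g \<star> t12) = nc_smult 0 (cyc (t12 \<star> t12))"
    by (simp add: eps_tilde_eq nc_smult_mult_left cyc_smult)
  then show ?case unfolding g_def foldr.simps o_apply by blast
qed

lemma t12_homogeneous:
  shows "homogeneous (\<lambda>_. 1) 2 (t12 :: (ab, 'k::comm_rat_algebra) series)"
    and "homogeneous degB 1 (t12 :: (ab, 'k) series)"
proof -
  have "homogeneous (\<lambda>_. 1) 1 (letter x :: (ab, 'k) series)" "homogeneous degB (degB x) (letter x :: (ab, 'k) series)" for x
    by (auto simp: homogeneous_def letter_def)
  note h = this
  have "homogeneous (\<lambda>_. 1) (1 + 1) (t12 :: (ab, 'k) series)"
    unfolding t12_def by (rule homogeneous_ad[OF h(1) h(1)])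
  then show "homogeneous (\<lambda>_. 1) 2 (t12 :: (ab, 'k) series)" by (simp add: numeral_2_eq_2)
  have "homogeneous degB (0 + 1) (t12 :: (ab, 'k) series)"
    unfolding t12_def by (rule homogeneous_ad) (use h(2)[of A] h(2)[of B] in simp_all)
  then show "homogeneous degB 1 (t12 :: (ab, 'k) series)" by simp
qed

lemma degB_rotate: "sum_list (map degB (rotate i w)) = sum_list (map degB w)"
proof (induction i)
  case (Suc i)
  have "sum_list (map degB (rotate1 w)) = sum_list (map degB w)" for w
    by (cases w) simp_all
  then show ?case using Suc by simp
qed simp

lemma cyc_t12_t12:
  assumes "sum_list (map degB w) \<noteq> 2"
  shows "cyc (t12 \<star> t12) w = (0 :: 'k::comm_rat_algebra)"
proof -
  have "homogeneous degB 2 (t12 \<star> t12 :: (ab, 'k) series)"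
    using homogeneous_mult[OF t12_homogeneous(2)[where 'k = 'k] t12_homogeneous(2)] by (simp add: numeral_2_eq_2)
  note hom = this
  have "(t12 \<star> t12) (rotate i w) = (0 :: 'k)" for i
  proof (rule ccontr)
    assume "(t12 \<star> t12) (rotate i w) \<noteq> (0 :: 'k)"
    then have "sum_list (map degB (rotate i w)) = 2"
      using hom unfolding homogeneous_def by blast
    then show False using assms by (simp only: degB_rotate)
  qed
  then show ?thesis by (simp add: cyc_def)
qed

lemma g_aut_cyc:
  assumes "cyc (f \<star> t12) = nc_smult c (cyc (t12 \<star> t12))" "sum_list (map degB w) \<noteq> 2"
  shows "cyc (g_aut \<tau> f \<star> t12) w = 0"
proof -
  define n where "n = length w"
  define g where "g = (\<Sum>ks\<in>index_words n. nc_smult (eis_int ks \<tau> \<otimes>\<^sub>Q 1) (foldr eps_tilde ks f))"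
  have "(g_aut \<tau> f \<star> t12) v = (g \<star> t12) v" if "length v = n" for v
    by (rule nc_mult_cong_length[of n])
      (use that in \<open>simp_all add: g_aut_eq g_def sum_fun_app nc_smult_def\<close>)
  then have "cyc (g_aut \<tau> f \<star> t12) w = cyc (g \<star> t12) w" by (simp add: cyc_def n_def)
  also have "\<dots> = (\<Sum>ks\<in>index_words n. (eis_int ks \<tau> \<otimes>\<^sub>Q 1) * cyc (foldr eps_tilde ks f \<star> t12) w)"
    by (simp only: g_def nc_mult_sum_left cyc_sum sum_fun_app nc_smult_mult_left cyc_smult) (simp add: nc_smult_def)
  also have "\<dots> = 0"
  proof (intro sum.neutral ballI)
    fix ks
    obtain c where "cyc (foldr eps_tilde ks f \<star> t12) = nc_smult c (cyc (t12 \<star> t12))"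
      using foldr_eps_cyc[OF assms(1)] by blast
    then show "(eis_int ks \<tau> \<otimes>\<^sub>Q 1) * cyc (foldr eps_tilde ks f \<star> t12) w = 0"
      by (simp add: nc_smult_def cyc_t12_t12[OF assms(2)])
  qed
  finally show ?thesis .
qed

section \<open>The series \<open>t\<^sub>0\<^sub>1\<close>\<close>

text \<open>With \<open>Q = X / (e^X - 1)\<close> one has \<open>Q(-X) = Q(X) + X\<close>, so that
  \<open>Q + X / 2\<close> is even.\<close>

lemma ber_coeff_odd:
  assumes "odd n"
  shows "ber_coeff n = (if n = 1 then - 1 / 2 else 0)"
proof -
  define E where "E = fps_exp (1::rat) - 1"
  define Q where "Q = fps_X / E"
  have E0: "E \<noteq> 0" and sub: "subdegree E = 1"
  proof -
    have "fps_nth E 0 = 0" "fps_nth E 1 = 1" by (simp_all add: E_def)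
    then show "E \<noteq> 0" "subdegree E = 1" by (auto intro: subdegreeI)
  qed
  have QE: "Q * E = fps_X"
    unfolding Q_def using E0 sub by (intro dvd_div_mult_self) (simp add: fps_dvd_iff)
  define Q' where "Q' = Q oo (- fps_X)"
  have "Q' * (E oo (- fps_X)) = - fps_X"
    using arg_cong[OF QE, of "\<lambda>F. F oo (- fps_X)"] by (simp add: Q'_def fps_compose_mult_distrib)
  moreover have "E oo (- fps_X) = fps_exp (- 1) - 1"
    using fps_exp_compose_linear[of "1::rat" "-1"] by (simp add: E_def fps_compose_sub_distrib)
  ultimately have "Q' * (fps_exp (- 1) - 1) * fps_exp 1 = - fps_X * fps_exp 1" by simp
  moreover have "(fps_exp (- 1) - 1) * fps_exp 1 = - E"
    by (simp add: E_def algebra_simps flip: fps_exp_add_mult)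
  ultimately have "Q' * E = fps_X * fps_exp 1" by (simp add: mult.assoc)
  also have "\<dots> = (Q + fps_X) * E" using QE by (simp add: E_def algebra_simps)
  finally have "Q' = Q + fps_X" using E0 by simp
  then have "fps_nth Q' n = fps_nth Q n + fps_nth fps_X n" by simp
  moreover have "fps_nth Q' n = - fps_nth Q n"
    using assms by (simp add: Q'_def fps_compose_uminus')
  ultimately show ?thesis by (auto simp: ber_coeff_def Q_def E_def fps_X_def)
qed

lemma t01_eq:
  assumes "length w \<le> n"
  shows "t01 w = ( - (\<Sum>i\<le>n. nc_smult (ber_coeff i *\<^sub>Q 1) (ad_b_a i)) w :: 'k::comm_rat_algebra)"
proof -
  have ad: "(ad ser_b ^^ i) (- ser_a) = (- ad_b_a i :: (ab, 'k) series)" for i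
    unfolding ad_b_a_def
    by (induction i) (simp_all only: funpow.simps o_apply id_apply ad_uminus(1))
  have "t01 w = (\<Sum>i\<le>n. ber_coeff i *\<^sub>Q (ad ser_b ^^ i) (- ser_a) w :: 'k)"
    unfolding t01_def Ber_def nc_uminus_eq
  proof (rule Sum_any.expand_superset)
    show "{i. ber_coeff i *\<^sub>Q (ad ser_b ^^ i) (- ser_a) w \<noteq> (0 :: 'k)} \<subseteq> {..n}"
    proof
      fix i assume "i \<in> {i. ber_coeff i *\<^sub>Q (ad ser_b ^^ i) (- ser_a) w \<noteq> (0 :: 'k)}"
      then have "ad_b_a i w \<noteq> (0 :: 'k)" by (auto simp: ad)
      then show "i \<in> {..n}"
        using ad_b_a_homogeneous(1)[of i, where 'k = 'k] assms by (auto simp: homogeneous_def sum_list_triv)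
    qed
  qed simp
  then show ?thesis
    by (simp add: ad sum_fun_app nc_smult_def scaleQ_minus_right sum_negf flip: scaleQ_alt)
qed

lemma t01_f2: "t01 \<in> f2"
  unfolding f2_def
proof (rule lie_seriesI)
  fix d :: nat
  show "\<exists>g\<in>lie_poly UNIV. \<forall>w. sum_list (map (\<lambda>_. 1) w) \<le> d \<longrightarrow> t01 w = g w"
    by (rule bexI[of _ "- (\<Sum>i\<le>d. nc_smult (ber_coeff i *\<^sub>Q 1) (ad_b_a i))"])
      (auto simp: t01_eq sum_list_triv intro!: lie_poly_uminus lie_poly_sum lie_poly_smult ad_b_a_lie)
qed

lemma t12_f2: "t12 \<in> f2"
  unfolding f2_def t12_def by (intro lie_poly_series lie_poly_ad lie_poly_letter) auto

lemma cyc_ad_b_a_shift: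
  "cyc (ad_b_a (i + j) \<star> ad_b_a k :: (ab, 'k::comm_rat_algebra) series) = (if even j then cyc (ad_b_a i \<star> ad_b_a (j + k)) else - cyc (ad_b_a i \<star> ad_b_a (j + k)))"
proof (induction j arbitrary: k)
  case (Suc j)
  have "cyc (ad_b_a (i + Suc j) \<star> ad_b_a k :: (ab, 'k) series) = - cyc (ad_b_a (i + j) \<star> ad_b_a (Suc k))"
    by (simp add: ad_b_a_simps cyc_ad)
  then show ?case unfolding Suc[of "Suc k"] by simp
qed simp

lemma neg_self_zero: "x = - x \<Longrightarrow> x = (0 :: 'k::comm_rat_algebra)"
proof -
  assume "x = - x"
  then have "x + x = 0" by (metis add.right_inverse)
  then have "2 *\<^sub>Q x = 0" by (simp only: two_scaleQ)
  then show "x = 0" by simp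
qed

text \<open>Moving one \<open>ad b\<close> across the cyclic product costs a sign, and for even
  \<open>i\<close> an odd number of moves exchanges the exponents \<open>i\<close> and 1. Cyclic
  symmetry exchanges them without a sign, so the value is its own negative.\<close>

lemma cyc_ad_b_a_even:
  assumes "even i"
  shows "cyc (ad_b_a i \<star> ad_b_a 1) = (0 :: (ab, 'k::comm_rat_algebra) series)"
proof -
  have "cyc (ad_b_a 1 \<star> ad_b_a i) = (- cyc (ad_b_a i \<star> ad_b_a 1) :: (ab, 'k) series)"
  proof (cases i)
    case 0
    then show ?thesis using cyc_ad_b_a_shift[of 0 1 0] by simp
  next
    case (Suc j)
    then have "odd j" using assms by simp
    then have "cyc (ad_b_a i \<star> ad_b_a 1) = (- cyc (ad_b_a 1 \<star> ad_b_a i) :: (ab, 'k) series)"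
      using Suc by (simp add: cyc_ad_b_a_shift[of 1 j 1, simplified])
    then show ?thesis by (metis minus_minus)
  qed
  then have "cyc (ad_b_a i \<star> ad_b_a 1) = (- cyc (ad_b_a i \<star> ad_b_a 1) :: (ab, 'k) series)"
    by (simp add: cyc_mult_commute)
  from fun_cong[OF this] show ?thesis by (auto simp: fun_eq_iff intro: neg_self_zero)
qed

text \<open>Paired with \<open>t12\<close>, the terms of even index vanish by symmetry, and those of
  odd index above 1 have coefficient 0. What is left is index 1, whose Bernoulli coefficient is
  \<open>- 1 / 2\<close>.\<close>

lemma cyc_t01_t12: "cyc (t01 \<star> t12) = nc_smult ((- 1 / 2) *\<^sub>Q 1) (cyc (t12 \<star> t12 :: (ab, 'k::comm_rat_algebra) series))"
proof
  fix w :: "ab list"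
  define n where "n = length w + 1"
  define g where "g = (\<Sum>i\<le>n. nc_smult (ber_coeff i *\<^sub>Q 1) (ad_b_a i :: (ab, 'k) series))"
  let ?t01 = "t01 :: (ab, 'k) series" and ?t12 = "t12 :: (ab, 'k) series"
  have t12: "t12 = - (ad_b_a 1 :: (ab, 'k) series)" by (simp add: t12_eq ad_b_a_simps)
  have "(?t01 \<star> ?t12) v = (- g \<star> ?t12) v" if "length v = length w" for v
    by (rule nc_mult_cong_length[of n]) (use that in \<open>simp_all add: t01_eq[of _ n] g_def n_def\<close>)
  then have "cyc (?t01 \<star> ?t12) w = cyc (g \<star> ad_b_a 1) w" by (simp add: cyc_def t12)
  also have "cyc (g \<star> ad_b_a 1) = (\<Sum>i\<le>n. nc_smult (ber_coeff i *\<^sub>Q 1) (cyc (ad_b_a i \<star> ad_b_a 1)))"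
    by (simp only: g_def nc_mult_sum_left cyc_sum nc_smult_mult_left cyc_smult)
  also have "\<dots> = (\<Sum>i\<le>n. if i = 1 then nc_smult ((- 1 / 2) *\<^sub>Q 1) (cyc (ad_b_a 1 \<star> ad_b_a 1)) else 0)"
  proof (rule sum.cong[OF HOL.refl])
    fix i
    show "nc_smult (ber_coeff i *\<^sub>Q 1) (cyc (ad_b_a i \<star> ad_b_a 1)) =
       (if i = 1 then nc_smult ((- 1 / 2) *\<^sub>Q 1) (cyc (ad_b_a 1 \<star> ad_b_a 1)) else (0 :: (ab, 'k) series))"
      using ber_coeff_odd[of i] cyc_ad_b_a_even[of i, where 'k = 'k] by (cases "even i") auto
  qed
  also have "\<dots> = nc_smult ((- 1 / 2) *\<^sub>Q 1) (cyc (?t12 \<star> ?t12))"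
    by (simp add: n_def t12 del: sum.atMost_Suc)
  finally show "cyc (?t01 \<star> ?t12) w = nc_smult ((- 1 / 2) *\<^sub>Q 1) (cyc (?t12 \<star> ?t12)) w" .
qed

section \<open>Polynomials and rational functions\<close>

text \<open>A coordinate with respect to a rational basis containing \<open>c\<close>. Such
  functionals transfer questions about coefficients with possible zero divisors to rational
  polynomials.\<close>

lemma scaleQ_functional:
  fixes c :: "'k::comm_rat_algebra"
  assumes "c \<noteq> 0"
  obtains \<phi> :: "'k \<Rightarrow> rat" where "\<And>x y. \<phi> (x + y) = \<phi> x + \<phi> y" "\<And>q x. \<phi> (q *\<^sub>Q x) = q * \<phi> x" "\<phi> c \<noteq> 0"
proof -
  interpret vs: vector_space "scaleQ :: rat \<Rightarrow> 'k \<Rightarrow> 'k"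
    by unfold_locales (simp_all add: scaleQ_add_right scaleQ_add_left scaleQ_scaleQ scaleQ_one)
  have ind: "vs.independent {c}" using assms by simp
  define S where "S = vs.extend_basis {c}"
  have S: "vs.independent S" "vs.span S = UNIV" "c \<in> S"
    using vs.independent_extend_basis[OF ind] vs.span_extend_basis[OF ind] vs.extend_basis_superset[OF ind]
    by (auto simp: S_def)
  show ?thesis
    by (rule that[of "\<lambda>x. vs.representation S x c"])
      (use S in \<open>simp_all add: vs.representation_add vs.representation_scale vs.representation_basis\<close>)
qed

lemma lookup_map_zero: "\<phi> 0 = 0 \<Longrightarrow> Poly_Mapping.lookup (Poly_Mapping.map \<phi> p) k = \<phi> (Poly_Mapping.lookup p k)"
  by transfer (simp add: when_def)

lemma map_add_functional:
  "(\<And>x y. \<phi> (x + y) = \<phi> x + \<phi> y) \<Longrightarrow> \<phi> 0 = 0 \<Longrightarrow>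
   Poly_Mapping.map \<phi> (p + q) = Poly_Mapping.map \<phi> p + Poly_Mapping.map \<phi> q"
  by (rule poly_mapping_eqI) (simp add: lookup_map_zero lookup_add)

lemma map_single_functional: "\<phi> 0 = 0 \<Longrightarrow> Poly_Mapping.map \<phi> (Poly_Mapping.single m c) = Poly_Mapping.single m (\<phi> c)"
  by (rule poly_mapping_eqI) (simp add: lookup_map_zero lookup_single when_def)

text \<open>Applying a rational functional to the coefficients commutes with multiplication by a
  rational polynomial. A nonzero coefficient of \<open>p\<close> would then contradict the absence
  of zero divisors among rational polynomials.\<close>

lemma mpol_of_mult_eq_0:
  fixes p :: "'k::comm_rat_algebra mpol"
  assumes "mpol_of t * p = 0" "t \<noteq> 0"
  shows "p = 0"
proof (rule ccontr)
  assume "p \<noteq> 0"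
  then obtain m where "Poly_Mapping.lookup p m \<noteq> 0" by (metis poly_mapping_eqI lookup_zero)
  then obtain \<phi> :: "'k \<Rightarrow> rat" where \<phi>: "\<And>x y. \<phi> (x + y) = \<phi> x + \<phi> y" "\<And>q x. \<phi> (q *\<^sub>Q x) = q * \<phi> x"
    "\<phi> (Poly_Mapping.lookup p m) \<noteq> 0" by (rule scaleQ_functional) (rule that)
  have 0: "\<phi> 0 = 0" using \<phi>(1)[of 0 0] by simp
  have map0: "Poly_Mapping.map \<phi> 0 = 0"
    by (rule poly_mapping_eqI) (simp add: lookup_map_zero[where \<phi> = \<phi>, OF 0] 0)
  note lin = map_add_functional[OF \<phi>(1) 0] map_single_functional[of \<phi>, OF 0]
  have "Poly_Mapping.map \<phi> (mpol_of t * q) = t * Poly_Mapping.map \<phi> q" for q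
  proof (induction t rule: mpol_induct)
    case zero
    show ?case by (simp add: map0)
  next
    case (single_add n c t)
    have "Poly_Mapping.map \<phi> (mpol_of (Poly_Mapping.single n c) * q) = Poly_Mapping.single n c * Poly_Mapping.map \<phi> q"
    proof (induction q rule: mpol_induct)
      case zero
      show ?case by (simp add: map0)
    next
      case (single_add n' c' q)
      then show ?case
        by (simp add: distrib_left lin mpol_of_single mult_single mult_scaleQ_left \<phi>(2))
    qed
    then show ?case using single_add by (simp add: distrib_right mpol_of_add lin)
  qed
  from this[of p] have "t * Poly_Mapping.map \<phi> p = 0"
    using assms(1) by (simp add: map0)
  moreover have "Poly_Mapping.map \<phi> p \<noteq> 0"
    using \<phi>(3) by (metis lookup_map_zero[where \<phi> = \<phi>, OF 0] lookup_zero)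
  ultimately show False using assms(2) by simp
qed

text \<open>The extra factor \<open>t\<close> in the definition of the localization cancels, because
  nonzero rational polynomials are regular over \<open>'k\<close> too.\<close>

lemma ratfrac_eq_iff:
  assumes "s \<noteq> 0" "s' \<noteq> 0"
  shows "ratfrac p s = ratfrac p' s' \<longleftrightarrow> mpol_of s' * p = mpol_of s * (p' :: 'k::comm_rat_algebra mpol)"
proof
  assume "ratfrac p s = ratfrac p' s'"
  then have "ratfun_rel (p, s) (p', s')"
    unfolding ratfrac_def using assms Quotient3_rel[OF Quotient3_ratfun, of "(p, s)" "(p', s')"]
    by (simp add: ratfun_rel_refl)
  then obtain t where "t \<noteq> 0" "mpol_of t * (mpol_of s' * p) = mpol_of t * (mpol_of s * p')"
    by (auto simp: ratfun_rel_def)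
  then have "mpol_of t * (mpol_of s' * p - mpol_of s * p') = 0" by (simp add: right_diff_distrib)
  from mpol_of_mult_eq_0[OF this \<open>t \<noteq> 0\<close>] show "mpol_of s' * p = mpol_of s * p'" by simp
next
  assume "mpol_of s' * p = mpol_of s * p'"
  then have "ratfun_rel (p, s) (p', s')" using assms by (intro ratfun_rel_eqI)
  then show "ratfrac p s = ratfrac p' s'"
    unfolding ratfrac_def by (rule Quotient3_rel_abs[OF Quotient3_ratfun])
qed

lemma ratfrac_add: "s \<noteq> 0 \<Longrightarrow> ratfrac p s + ratfrac q s = ratfrac (p + q) s"
proof -
  assume s: "s \<noteq> 0"
  then have "ratfrac p s + ratfrac q s = ratfrac (mpol_of s * p + mpol_of s * q) (s * s)"
    unfolding ratfrac_def by (subst plus_ratfun.abs_eq) (simp_all add: ratfun_rel_refl)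
  also have "\<dots> = ratfrac (p + q) s"
    using s by (subst ratfrac_eq_iff) (simp_all add: mpol_of_mult algebra_simps)
  finally show ?thesis .
qed

lemma ratfrac_0: "s \<noteq> 0 \<Longrightarrow> ratfrac 0 s = 0"
proof -
  assume s: "s \<noteq> 0"
  have "ratfrac (0 :: 'a mpol) s = ratfrac 0 1" using s by (subst ratfrac_eq_iff) simp_all
  then show ?thesis by (simp add: ratfrac_def zero_ratfun_def)
qed

lemma ratfrac_sum: "s \<noteq> 0 \<Longrightarrow> (\<Sum>i\<in>I. ratfrac (p i) s) = ratfrac (\<Sum>i\<in>I. p i) s"
  by (induction I rule: infinite_finite_induct) (simp_all add: ratfrac_0 ratfrac_add)

lemma ratfrac_cancel: "s \<noteq> 0 \<Longrightarrow> q \<noteq> 0 \<Longrightarrow> ratfrac (mpol_of q * p) (q * s) = ratfrac p s"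
  by (subst ratfrac_eq_iff) (simp_all add: mpol_of_mult mult_ac)

subsection \<open>Substitution\<close>

definition mon_subst :: "(nat \<Rightarrow> rat mpol) \<Rightarrow> (nat \<Rightarrow>\<^sub>0 nat) \<Rightarrow> rat mpol" where
  "mon_subst \<sigma> m = (\<Prod>j\<in>Poly_Mapping.keys m. \<sigma> j ^ Poly_Mapping.lookup m j)"

lemma mon_subst_superset: "finite S \<Longrightarrow> Poly_Mapping.keys m \<subseteq> S \<Longrightarrow> mon_subst \<sigma> m = (\<Prod>j\<in>S. \<sigma> j ^ Poly_Mapping.lookup m j)"
  unfolding mon_subst_def by (rule prod.mono_neutral_left) (auto simp: in_keys_iff)

lemma mon_subst_add: "mon_subst \<sigma> (m + n) = mon_subst \<sigma> m * mon_subst \<sigma> n"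
proof -
  let ?S = "Poly_Mapping.keys m \<union> Poly_Mapping.keys n"
  have "Poly_Mapping.keys (m + n) \<subseteq> ?S" by (rule Poly_Mapping.keys_add)
  then have "mon_subst \<sigma> (m + n) = (\<Prod>j\<in>?S. \<sigma> j ^ Poly_Mapping.lookup (m + n) j)" by (intro mon_subst_superset) auto
  also have "\<dots> = mon_subst \<sigma> m * mon_subst \<sigma> n"
    by (simp add: mon_subst_superset[of ?S m] mon_subst_superset[of ?S n] lookup_add power_add prod.distrib)
  finally show ?thesis .
qed

lemma mon_subst_0 [simp]: "mon_subst \<sigma> 0 = 1"
  by (simp add: mon_subst_def)

lemma mon_subst_single: "mon_subst \<sigma> (Poly_Mapping.single j n) = \<sigma> j ^ n"
  by (subst mon_subst_superset[of "{j}"]) auto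

lemma mon_subst_sum: "mon_subst \<sigma> (\<Sum>i\<in>I. m i) = (\<Prod>i\<in>I. mon_subst \<sigma> (m i))"
  by (induction I rule: infinite_finite_induct) (simp_all add: mon_subst_add)

lemma mpol_subst_superset:
  assumes "finite S" "Poly_Mapping.keys p \<subseteq> S"
  shows "mpol_subst \<sigma> p = (\<Sum>m\<in>S. Poly_Mapping.single 0 (Poly_Mapping.lookup p m) * mpol_of (mon_subst \<sigma> m))"
  unfolding mpol_subst_def mon_subst_def[symmetric]
  by (rule sum.mono_neutral_left) (use assms in \<open>auto simp: in_keys_iff\<close>)

lemma mpol_subst_add: "mpol_subst \<sigma> (p + q) = mpol_subst \<sigma> p + mpol_subst \<sigma> q"
proof -
  let ?S = "Poly_Mapping.keys p \<union> Poly_Mapping.keys q"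
  have "Poly_Mapping.keys (p + q) \<subseteq> ?S" by (rule Poly_Mapping.keys_add)
  then show ?thesis
    by (simp add: mpol_subst_superset[of ?S] lookup_add single_add distrib_right sum.distrib)
qed

lemma mpol_subst_0 [simp]: "mpol_subst \<sigma> 0 = 0"
  by (simp add: mpol_subst_def)

lemma mpol_subst_single: "mpol_subst \<sigma> (Poly_Mapping.single m c) = Poly_Mapping.single 0 c * mpol_of (mon_subst \<sigma> m)"
  by (subst mpol_subst_superset[of "{m}"]) auto

lemma mpol_subst_sum: "mpol_subst \<sigma> (\<Sum>i\<in>I. p i) = (\<Sum>i\<in>I. mpol_subst \<sigma> (p i))"
  by (induction I rule: infinite_finite_induct) (simp_all add: mpol_subst_add)

lemma mpol_subst_mult: "mpol_subst \<sigma> (p * q) = mpol_subst \<sigma> p * mpol_subst \<sigma> (q :: 'k::comm_rat_algebra mpol)"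
proof (induction p rule: mpol_induct)
  case (single_add m c p)
  have "mpol_subst \<sigma> (Poly_Mapping.single m c * q) = mpol_subst \<sigma> (Poly_Mapping.single m c) * mpol_subst \<sigma> q"
  proof (induction q rule: mpol_induct)
    case (single_add n d q)
    have "Poly_Mapping.single 0 (c * d) = Poly_Mapping.single 0 c * (Poly_Mapping.single 0 d :: 'k mpol)" by (simp add: mult_single)
    note e = this
    have "mpol_subst \<sigma> (Poly_Mapping.single m c * Poly_Mapping.single n d) = mpol_subst \<sigma> (Poly_Mapping.single (m + n) (c * d))"
      by (simp only: mult_single)
    also have "\<dots> = mpol_subst \<sigma> (Poly_Mapping.single m c) * mpol_subst \<sigma> (Poly_Mapping.single n d)"
      by (simp only: mpol_subst_single mon_subst_add mpol_of_mult e mult_ac)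
    finally have "mpol_subst \<sigma> (Poly_Mapping.single m c * Poly_Mapping.single n d) =
      mpol_subst \<sigma> (Poly_Mapping.single m c) * mpol_subst \<sigma> (Poly_Mapping.single n d)" .
    then show ?case using single_add by (simp only: distrib_left mpol_subst_add)
  qed simp
  then show ?case using single_add by (simp add: distrib_right mpol_subst_add)
qed simp

lemma mpol_of_rat [simp]: "mpol_of p = (p :: rat mpol)"
  by (rule poly_mapping_eqI) (simp add: lookup_mpol_of scaleQ_rat_def)

lemma mpol_subst_mpol_of: "mpol_subst \<sigma> (mpol_of p) = (mpol_of (mpol_subst \<sigma> p) :: 'k::comm_rat_algebra mpol)"
proof (induction p rule: mpol_induct)
  case (single_add m c p)
  then show ?case
    by (simp add: mpol_of_add mpol_subst_add mpol_of_single mpol_subst_single mpol_of_mult)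
qed simp

lemma mpol_subst_1 [simp]: "mpol_subst \<sigma> (1 :: rat mpol) = 1"
  using mpol_subst_single[of \<sigma> 0 "1 :: rat"] by simp

lemma mpol_subst_prod: "mpol_subst \<sigma> (\<Prod>i\<in>I. p i) = (\<Prod>i\<in>I. mpol_subst \<sigma> (p i :: rat mpol))"
  by (induction I rule: infinite_finite_induct) (simp_all add: mpol_subst_mult)

lemma mpol_subst_power: "mpol_subst \<sigma> (p ^ n) = mpol_subst \<sigma> (p :: rat mpol) ^ n"
  by (induction n) (simp_all add: mpol_subst_mult)

lemma mpol_subst_uminus: "mpol_subst \<sigma> (- p) = - mpol_subst \<sigma> (p :: 'k::comm_rat_algebra mpol)"
  using mpol_subst_add[of \<sigma> "- p" p] by (simp add: eq_neg_iff_add_eq_0)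

lemma mpol_subst_var [simp]: "mpol_subst \<sigma> (var_u j) = \<sigma> j"
  by (simp add: var_u_def mpol_subst_single mon_subst_single)

lemma mpol_subst_const: "mpol_subst \<sigma> (Poly_Mapping.single 0 c) = Poly_Mapping.single 0 (c :: 'k::comm_rat_algebra)"
proof -
  have "mpol_of 1 = (Poly_Mapping.single 0 1 :: 'k mpol)" by (simp add: mpol_of_single scaleQ_one flip: single_one)
  then show ?thesis by (simp add: mpol_subst_single mult_single)
qed

lemma mult_mpol_of_1 [simp]: "p * mpol_of 1 = (p :: 'k::comm_rat_algebra mpol)"
  using mpol_of_1_mult[of p] by (simp only: mult.commute)

lemma mpol_subst_comp: "mpol_subst \<rho> (mpol_subst \<sigma> p) = mpol_subst (\<lambda>j. mpol_subst \<rho> (\<sigma> j)) (p :: 'k::comm_rat_algebra mpol)"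
proof (induction p rule: mpol_induct)
  case (single_add m c p)
  have "mpol_subst \<rho> (mon_subst \<sigma> m) = mon_subst (\<lambda>j. mpol_subst \<rho> (\<sigma> j)) m"
    by (simp add: mon_subst_def mpol_subst_prod mpol_subst_power)
  then show ?case using single_add
    by (simp add: mpol_subst_add mpol_subst_single mpol_subst_mult mpol_subst_mpol_of mpol_subst_const)
qed simp

lemma mpol_subst_id: "mpol_subst var_u p = (p :: 'k::comm_rat_algebra mpol)"
proof (induction p rule: mpol_induct)
  case (single_add m c p)
  have "mon_subst var_u m = Poly_Mapping.single m 1"
  proof -
    have "(\<Prod>j\<in>S. var_u j ^ n j) = Poly_Mapping.single (\<Sum>j\<in>S. Poly_Mapping.single j (n j)) 1" if "finite S" for S and n :: "nat \<Rightarrow> nat"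
    proof -
      have "var_u j ^ i = Poly_Mapping.single (Poly_Mapping.single j i) 1" for i j
        by (induction i) (simp_all add: var_u_def mult_single flip: Poly_Mapping.single_add)
      note p = this
      show ?thesis using that by (induction rule: finite_induct) (simp_all add: p mult_single)
    qed
    moreover have "(\<Sum>j\<in>Poly_Mapping.keys m. Poly_Mapping.single j (Poly_Mapping.lookup m j)) = m"
      by (rule poly_mapping_eqI) (auto simp: lookup_sum lookup_single when_def in_keys_iff sum.delta)
    ultimately show ?thesis by (simp add: mon_subst_def)
  qed
  then show ?case using single_add
    by (simp add: mpol_subst_add mpol_subst_single mpol_of_single mult_single scaleQ_one)
qed simp

text \<open>Cross-multiplied equality of fractions survives substitution, so every representative
  with nonvanishing denominators gives the same value.\<close>

lemma ratfun_subst_ratfrac: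
  fixes p :: "'k::comm_rat_algebra mpol"
  assumes "s \<noteq> 0" "mpol_subst \<sigma> s \<noteq> 0"
  shows "ratfun_subst \<sigma> (ratfrac p s) = ratfrac (mpol_subst \<sigma> p) (mpol_subst \<sigma> s)"
  unfolding ratfun_subst_def
proof (rule the_equality)
  show "\<exists>p' s'. s' \<noteq> 0 \<and> mpol_subst \<sigma> s' \<noteq> 0 \<and> ratfrac p s = ratfrac p' s' \<and>
      ratfrac (mpol_subst \<sigma> p) (mpol_subst \<sigma> s) = ratfrac (mpol_subst \<sigma> p') (mpol_subst \<sigma> s')"
    using assms by blast
next
  fix y
  assume "\<exists>p' s'. s' \<noteq> 0 \<and> mpol_subst \<sigma> s' \<noteq> 0 \<and> ratfrac p s = ratfrac p' s' \<and>
      y = ratfrac (mpol_subst \<sigma> p') (mpol_subst \<sigma> s')"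
  then obtain p' s' where *: "s' \<noteq> 0" "mpol_subst \<sigma> s' \<noteq> 0" "ratfrac p s = ratfrac p' s'"
    "y = ratfrac (mpol_subst \<sigma> p') (mpol_subst \<sigma> s')" by blast
  then have "mpol_of s' * p = mpol_of s * p'" using assms(1) by (simp add: ratfrac_eq_iff)
  from arg_cong[OF this, of "mpol_subst \<sigma>"]
  have "mpol_of (mpol_subst \<sigma> s') * mpol_subst \<sigma> p = mpol_of (mpol_subst \<sigma> s) * mpol_subst \<sigma> p'"
    by (simp add: mpol_subst_mult mpol_subst_mpol_of)
  then show "y = ratfrac (mpol_subst \<sigma> p) (mpol_subst \<sigma> s)"
    using * assms(2) by (simp add: ratfrac_eq_iff)
qed

section \<open>Alternality\<close>

definition comps :: "nat \<Rightarrow> nat \<Rightarrow> nat list set" where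
  "comps d r = {ks. length ks = r \<and> 0 \<notin> set ks \<and> sum_list ks = d}"

lemma finite_comps: "finite (comps d r)"
proof (rule finite_subset)
  show "comps d r \<subseteq> {ks. set ks \<subseteq> {..d} \<and> length ks = r}"
    using member_le_sum_list by (fastforce simp: comps_def)
qed (rule finite_lists_length_eq, simp)

definition ma_pol :: "nat \<Rightarrow> (nat, 'k::comm_rat_algebra) series \<Rightarrow> nat \<Rightarrow> 'k mpol" where
  "ma_pol d F r = (\<Sum>ks\<in>comps d r.
     Poly_Mapping.single (\<Sum>i=1..r. Poly_Mapping.single i (ks ! (i - 1) - 1)) ((- 1) ^ (d - r) * F ks))"

lemma ma_c_eq: "ma_c d F r = ratfrac (ma_pol d F r) 1"
  by (simp add: ma_c_def ma_pol_def comps_def)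

lemma mpol_subst_ma_pol:
  "mpol_subst \<sigma> (ma_pol d F r) = (\<Sum>ks\<in>comps d r.
     Poly_Mapping.single 0 ((- 1) ^ (d - r) * F ks) * mpol_of (\<Prod>i<r. \<sigma> (Suc i) ^ (ks ! i - 1)))"
  unfolding ma_pol_def mpol_subst_sum mpol_subst_single mon_subst_sum mon_subst_single
  by (simp add: prod.atLeast1_atMost_eq atLeast0LessThan)

lemma at_args_ratfrac_1:
  "at_args (ratfrac p 1) ls = ratfrac (mpol_subst (\<lambda>j. if 1 \<le> j \<and> j \<le> length ls then ls ! (j - 1) else var_u j) p) 1"
  unfolding at_args_def by (subst ratfun_subst_ratfrac) simp_all

lemma sh_additive: "(\<And>x y. \<phi> (x + y) = \<phi> x + \<phi> y) \<Longrightarrow> sh (\<lambda>w. \<phi> (f w)) u v = \<phi> (sh f u v)"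
  by (induction u v arbitrary: f rule: shuffle.induct) (simp_all add: sh_Cons)

text \<open>A permutation of the variables can be moved to the exponents. After reindexing the
  compositions, the monomial \<open>?E ls\<close> no longer depends on the shuffle, and the shuffle
  sum falls on \<open>F\<close>, where it vanishes by primitivity.\<close>

lemma alternal_ma_c:
  assumes F: "primitive F"
  shows "alternal (ma_c d F)"
  unfolding alternal_def
proof (intro allI impI ballI)
  fix r i :: nat
  assume r: "1 < r" and i: "i \<in> {1..r div 2}"
  let ?u = "[1..<Suc i]" and ?v = "[Suc i..<Suc r]"
  have ms: "mset ?u + mset ?v = mset [1..<Suc r]"
  proof -
    have "[1..<Suc i + (r - i)] = ?u @ [Suc i..<Suc i + (r - i)]" by (rule upt_add_eq_append) simp
    moreover have "Suc i + (r - i) = Suc r" using i by auto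
    ultimately have e: "[1..<Suc r] = ?u @ ?v" by (simp only:)
    show ?thesis unfolding e mset_append ..
  qed
  let ?g = "\<lambda>ls j. ls ! (j - 1) :: nat"
  let ?E = "\<lambda>ls. \<Prod>j\<in>{1..r}. var_u j ^ (?g ls j - 1)"
  have perm: "at_args (ma_c d F r) (map var_u w) = ratfrac (\<Sum>ls\<in>comps d r.
     Poly_Mapping.single 0 ((- 1) ^ (d - r) * F (map (?g ls) w)) * mpol_of (?E ls)) 1"
    if "mset w = mset [1..<Suc r]" for w
  proof -
    have w: "length w = r" "set w = {1..r}" "distinct w"
      using arg_cong[OF that, of size] mset_eq_setD[OF that] mset_eq_imp_distinct_iff[OF that]
      by (simp_all add: atLeastLessThanSuc_atLeastAtMost del: upt_Suc)
    let ?h = "\<lambda>ls. map (?g ls) w"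
    have sub: "?h ` comps d r \<subseteq> comps d r"
    proof safe
      fix ls assume "ls \<in> comps d r"
      then have ls: "length ls = r" "0 \<notin> set ls" "sum_list ls = d" by (auto simp: comps_def)
      have "map (?g ls) [1..<Suc r] = ls"
        using ls by (intro nth_equalityI) (simp_all del: upt_Suc)
      then have "mset (?h ls) = mset ls" using that by (metis mset_map)
      then show "?h ls \<in> comps d r"
        using ls w mset_eq_setD[of "?h ls" ls] sum_mset_sum_list[of "?h ls"] sum_mset_sum_list[of ls]
        unfolding comps_def mem_Collect_eq by (simp only: length_map) simp
    qed
    have inj: "inj_on ?h (comps d r)"
    proof (rule inj_onI)
      fix ls ls' assume *: "ls \<in> comps d r" "ls' \<in> comps d r" "?h ls = ?h ls'"
      then have "ls ! (j - 1) = ls' ! (j - 1)" if "j \<in> {1..r}" for j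
        using that w(2) by auto
      from this[of "Suc _"] show "ls = ls'"
        using * by (intro nth_equalityI) (auto simp: comps_def)
    qed
    have bij: "?h ` comps d r = comps d r" by (rule endo_inj_surj[OF finite_comps sub inj])
    have "(\<Prod>i<r. var_u (w ! i) ^ (?h ls ! i - 1)) = ?E ls" for ls
    proof -
      have "(\<Prod>i<r. var_u (w ! i) ^ (?h ls ! i - 1)) = (\<Prod>i<r. var_u (w ! i) ^ (?g ls (w ! i) - 1))"
        using w by (intro prod.cong) auto
      also have "\<dots> = (\<Prod>j\<in>(!) w ` {..<r}. var_u j ^ (?g ls j - 1))"
        using w by (subst prod.reindex) (auto simp: inj_on_nth)
      also have "(!) w ` {..<r} = {1..r}" using w by (auto simp: set_conv_nth)
      finally show ?thesis .
    qed
    then have "(\<Sum>ls\<in>comps d r. Poly_Mapping.single 0 ((- 1) ^ (d - r) * F (?h ls)) * mpol_of (?E ls)) =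
       (\<Sum>ks\<in>?h ` comps d r. Poly_Mapping.single 0 ((- 1) ^ (d - r) * F ks) * mpol_of (\<Prod>i<r. var_u (w ! i) ^ (ks ! i - 1)))"
      by (subst sum.reindex[OF inj]) simp
    then show ?thesis
      unfolding bij ma_c_eq at_args_ratfrac_1 mpol_subst_ma_pol using w by simp
  qed
  have "(\<Sum>w\<leftarrow>shuffle ?u ?v. at_args (ma_c d F r) (map var_u w)) = sh (\<lambda>w. at_args (ma_c d F r) (map var_u w)) ?u ?v"
    by (simp only: sh_def)
  also have "\<dots> = sh (\<lambda>w. ratfrac (\<Sum>ls\<in>comps d r.
     Poly_Mapping.single 0 ((- 1) ^ (d - r) * F (map (?g ls) w)) * mpol_of (?E ls)) 1) ?u ?v"
    by (rule sh_cong, rule perm) (simp only: ms)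
  also have "\<dots> = ratfrac (sh (\<lambda>w. \<Sum>ls\<in>comps d r.
     Poly_Mapping.single 0 ((- 1) ^ (d - r) * F (map (?g ls) w)) * mpol_of (?E ls)) ?u ?v) 1"
    by (rule sh_additive) (simp add: ratfrac_add)
  also have "sh (\<lambda>w. \<Sum>ls\<in>comps d r.
     Poly_Mapping.single 0 ((- 1) ^ (d - r) * F (map (?g ls) w)) * mpol_of (?E ls)) ?u ?v = 0"
    unfolding sh_sum
  proof (rule sum.neutral, rule ballI)
    fix ls
    have "sh (\<lambda>w. Poly_Mapping.single 0 ((- 1) ^ (d - r) * F (map (?g ls) w)) * mpol_of (?E ls)) ?u ?v =
        Poly_Mapping.single 0 ((- 1) ^ (d - r) * sh F (map (?g ls) ?u) (map (?g ls) ?v)) * mpol_of (?E ls)"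
      unfolding sh_map by (rule sh_additive) (simp add: distrib_left single_add distrib_right)
    also have "sh F (map (?g ls) ?u) (map (?g ls) ?v) = 0"
      by (rule primitiveD(2)[OF F]) (use i r in auto)
    finally show "sh (\<lambda>w. Poly_Mapping.single 0 ((- 1) ^ (d - r) * F (map (?g ls) w)) * mpol_of (?E ls)) ?u ?v = 0" by simp
  qed
  finally show "(\<Sum>w\<leftarrow>shuffle ?u ?v. at_args (ma_c d F r) (map var_u w)) = 0"
    by (simp add: ratfrac_0)
qed

section \<open>Push-neutrality\<close>

text \<open>
  For fixed \<open>r\<close>, \<open>cyc_u\<close> lists \<open>u\<^sub>0 = -u\<^sub>1 - \<dots> - u\<^sub>r, u\<^sub>1, \<dots>, u\<^sub>r\<close> cyclically, and
  \<open>cyc_z\<close> their partial sums, so that \<open>u\<^sub>i = z\<^sub>i - z\<^bsub>i-1\<^esub>\<close>.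
\<close>

definition cyc_u :: "nat \<Rightarrow> nat \<Rightarrow> rat mpol" where
  "cyc_u r i = (if i mod Suc r = 0 then - (\<Sum>k=1..r. var_u k) else var_u (i mod Suc r))"

definition cyc_z :: "nat \<Rightarrow> nat \<Rightarrow> rat mpol" where
  "cyc_z r i = (\<Sum>k=1..i mod Suc r. var_u k)"

lemma cyc_u_Suc: "cyc_u r (Suc i) = cyc_z r (Suc i) - cyc_z r i"
proof (cases "Suc (i mod Suc r) = Suc r")
  case True
  then have "Suc i mod Suc r = 0" by (simp add: mod_Suc)
  then show ?thesis using True by (simp add: cyc_u_def cyc_z_def)
next
  case False
  then have "Suc i mod Suc r = Suc (i mod Suc r)" by (simp add: mod_Suc)
  then show ?thesis by (simp add: cyc_u_def cyc_z_def)
qed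

lemma cyc_u_periodic [simp]: "cyc_u r (i + Suc r) = cyc_u r i" "cyc_u r (Suc r + i) = cyc_u r i"
  by (simp_all only: cyc_u_def mod_add_self1 mod_add_self2)

lemma cyc_z_periodic [simp]: "cyc_z r (i + Suc r) = cyc_z r i" "cyc_z r (Suc r + i) = cyc_z r i"
  by (simp_all only: cyc_z_def mod_add_self1 mod_add_self2)

lemma cyc_u_var: "1 \<le> i \<Longrightarrow> i \<le> r \<Longrightarrow> cyc_u r i = var_u i"
  by (simp add: cyc_u_def)

lemma sum_periodic:
  fixes g :: "nat \<Rightarrow> 'a::ab_group_add"
  assumes "\<And>i. g (i + Suc r) = g i"
  shows "(\<Sum>i\<le>r. g (j + i)) = (\<Sum>i\<le>r. g i)"
proof (induction j)
  case (Suc j)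
  have "(\<Sum>i\<le>r. g (Suc j + i)) + g j = (\<Sum>i\<le>Suc r. g (j + i))"
    by (subst sum.atMost_Suc_shift) (simp add: add.commute)
  also have "\<dots> = (\<Sum>i\<le>r. g (j + i)) + g j" by (simp add: assms[unfolded add_Suc_right])
  finally show ?case using Suc by simp
qed simp

lemma prod_periodic:
  fixes g :: "nat \<Rightarrow> 'a::idom"
  assumes "\<And>i. g (i + Suc r) = g i" "\<And>i. g i \<noteq> 0"
  shows "(\<Prod>i\<le>r. g (j + i)) = (\<Prod>i\<le>r. g i)"
proof (induction j)
  case (Suc j)
  have "(\<Prod>i\<le>r. g (Suc j + i)) * g j = (\<Prod>i\<le>Suc r. g (j + i))"
    by (subst prod.atMost_Suc_shift) (simp add: mult.commute)
  also have "\<dots> = (\<Prod>i\<le>r. g (j + i)) * g j" by (simp add: assms(1)[unfolded add_Suc_right])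
  finally show ?case using Suc assms(2) by simp
qed simp

lemma sum_cyc_u: "(\<Sum>i\<le>r. cyc_u r i) = 0"
  by (simp add: sum.atMost_shift cyc_u_def) (simp add: sum.atLeast1_atMost_eq atLeast0LessThan)

lemma cyc_u_nonzero:
  assumes "r \<ge> 1"
  shows "cyc_u r i \<noteq> 0"
proof -
  have "Poly_Mapping.single k (1::nat) = Poly_Mapping.single 1 1 \<longleftrightarrow> k = 1" for k :: nat
    by (metis lookup_single_eq lookup_single_not_eq one_neq_zero)
  then have "Poly_Mapping.lookup (\<Sum>k=1..r. var_u k) (Poly_Mapping.single 1 1) = 1"
    using assms by (simp add: var_u_def lookup_sum lookup_single when_def)
  then have "- (\<Sum>k=1..r. var_u k) \<noteq> 0" by (metis lookup_zero neg_equal_0_iff_equal one_neq_zero)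
  moreover have "var_u k \<noteq> 0" for k
    unfolding var_u_def by (metis lookup_single_eq lookup_zero one_neq_zero)
  ultimately show ?thesis by (simp add: cyc_u_def)
qed

text \<open>A representation on the sites modulo \<open>r + 1\<close>: b steps from site
  \<open>m\<close> to the next one, and a multiplies by the variable \<open>cyc_z r m\<close> of the
  current site.\<close>

fun word_eval :: "nat \<Rightarrow> nat \<Rightarrow> ab list \<Rightarrow> rat mpol" where
  "word_eval r m [] = 1"
| "word_eval r m (A # w) = cyc_z r m * word_eval r m w"
| "word_eval r m (B # w) = word_eval r (Suc m) w"

abbreviation wdegB :: "ab list \<Rightarrow> nat" where "wdegB w \<equiv> sum_list (map degB w)"

lemma word_eval_append: "word_eval r m (u @ v) = word_eval r m u * word_eval r (m + wdegB u) v"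
  by (induction r m u rule: word_eval.induct) (simp_all add: mult.assoc)

lemma word_eval_periodic: "word_eval r (m + Suc r) w = word_eval r m w"
proof (induction r m w rule: word_eval.induct)
  case (2 r m w)
  then show ?case by (simp only: word_eval.simps cyc_z_periodic)
next
  case (3 r m w)
  then show ?case by (simp only: word_eval.simps add_Suc)
qed simp

definition word_eval_sum :: "nat \<Rightarrow> ab list \<Rightarrow> rat mpol" where
  "word_eval_sum r w = (\<Sum>m\<le>r. word_eval r m w)"

text \<open>A trace over the starting sites. With \<open>r + 1\<close> letters b the path closes up,
  so an a moved to the end meets the same site again, and a b moved to the end merely shifts the
  starting site.\<close>

lemma word_eval_sum_rotate1:
  assumes "wdegB w = Suc r"
  shows "word_eval_sum r (rotate1 w) = word_eval_sum r w"
proof (cases w)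
  case (Cons x v)
  show ?thesis
  proof (cases x)
    case A
    then have "wdegB v = Suc r" using assms Cons by simp
    then have "word_eval r m (v @ [A]) = word_eval r m (A # v)" for m
      unfolding word_eval_append by (simp only: word_eval.simps cyc_z_periodic) simp
    then show ?thesis by (simp add: Cons A word_eval_sum_def)
  next
    case B
    have "(\<Sum>m\<le>r. word_eval r (1 + m) v) = (\<Sum>m\<le>r. word_eval r m v)"
      by (rule sum_periodic) (rule word_eval_periodic)
    then show ?thesis by (simp add: Cons B word_eval_sum_def word_eval_append)
  qed
qed simp

section \<open>Pairing of series with the evaluation of words\<close>

definition cpol :: "'k::comm_rat_algebra \<Rightarrow> rat mpol \<Rightarrow> 'k mpol" where
  "cpol c P = Poly_Mapping.single 0 c * mpol_of P"

lemma cpol_mult: "cpol (c * d) (P * Q) = cpol c P * cpol d Q"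
proof -
  have "Poly_Mapping.single 0 (c * d) = Poly_Mapping.single 0 c * (Poly_Mapping.single 0 d :: 'a mpol)"
    by (simp add: mult_single)
  then show ?thesis by (simp only: cpol_def mpol_of_mult mult_ac)
qed

lemma cpol_add: "cpol (c + d) P = cpol c P + cpol d P" "cpol c (P + Q) = cpol c P + cpol c Q"
  by (simp_all add: cpol_def Poly_Mapping.single_add distrib_right mpol_of_add distrib_left)

lemma cpol_0 [simp]: "cpol 0 P = 0" "cpol c 0 = 0"
  by (simp_all add: cpol_def)

lemma cpol_1: "cpol 1 P = mpol_of P"
proof -
  have "Poly_Mapping.single 0 1 = (mpol_of 1 :: 'a mpol)" by (simp add: mpol_of_single scaleQ_one flip: single_one)
  then show ?thesis by (simp add: cpol_def)
qed

lemma cpol_uminus: "cpol (- c) P = - cpol c P" "cpol c (- P) = - cpol c P"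
  using cpol_add(1)[of "- c" c P] cpol_add(2)[of c "- P" P] by (simp_all add: eq_neg_iff_add_eq_0)

lemma cpol_sum: "cpol (\<Sum>i\<in>I. f i) P = (\<Sum>i\<in>I. cpol (f i) P)" "cpol c (\<Sum>i\<in>I. g i) = (\<Sum>i\<in>I. cpol c (g i))"
  by (induction I rule: infinite_finite_induct; simp add: cpol_add)+

lemma cpol_sign: "cpol c ((- 1) ^ n * P) = cpol ((- 1) ^ n * c) P"
  by (induction n) (simp_all add: cpol_uminus)

lemma mpol_of_uminus: "mpol_of (- P) = - (mpol_of P :: 'k::comm_rat_algebra mpol)"
  using cpol_uminus(2)[of "1 :: 'k" P] by (simp add: cpol_1)

lemma mpol_of_diff: "mpol_of (P - Q) = mpol_of P - (mpol_of Q :: 'k::comm_rat_algebra mpol)"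
  using mpol_of_add[of P "- Q", where 'a = 'k] by (simp add: mpol_of_uminus)

lemma lookup_cpol: "Poly_Mapping.lookup (cpol c P) k = c * (Poly_Mapping.lookup P k *\<^sub>Q 1)"
proof -
  have "Poly_Mapping.lookup (Poly_Mapping.single 0 c * q) k = c * Poly_Mapping.lookup q k" for q :: "'a mpol"
    by (induction q rule: mpol_induct)
      (simp_all add: distrib_left mult_single lookup_add lookup_single when_def)
  then show ?thesis by (simp add: cpol_def lookup_mpol_of)
qed

definition words_of :: "nat \<Rightarrow> nat \<Rightarrow> ab list set" where
  "words_of n q = {w. length w = n \<and> wdegB w = q}"

lemma finite_words_of: "finite (words_of n q)"
  by (rule finite_subset[OF _ finite_lists_length_eq[OF finite_ab, of n]]) (auto simp: words_of_def)

definition pairing :: "nat \<Rightarrow> nat \<Rightarrow> nat \<Rightarrow> nat \<Rightarrow> (ab, 'k::comm_rat_algebra) series \<Rightarrow> 'k mpol" where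
  "pairing r m n q f = (\<Sum>w\<in>words_of n q. cpol (f w) (word_eval r m w))"

lemma pairing_diff: "pairing r m n q (f - g) = pairing r m n q f - pairing r m n q g"
proof -
  have "cpol (f w - g w) P = cpol (f w) P - cpol (g w) P" for w P
    using cpol_add(1)[of "f w" "- g w" P] by (simp add: cpol_uminus)
  then show ?thesis by (simp add: pairing_def sum_subtractf)
qed

text \<open>Homogeneity of \<open>g\<close> in both degrees fixes the point where each word is cut.
  The first part contains \<open>q\<close> letters b, so the second is evaluated from site
  \<open>m + q\<close>.\<close>

lemma pairing_mult:
  fixes f g :: "(ab, 'k::comm_rat_algebra) series"
  assumes g: "homogeneous (\<lambda>_. 1) n' g" "homogeneous degB q' g"
  shows "pairing r m (n + n') (q + q') (f \<star> g) = pairing r m n q f * pairing r (m + q) n' q' g"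
proof -
  let ?t = "\<lambda>w. cpol (f (take n w) * g (drop n w)) (word_eval r m w) :: 'k mpol"
  let ?S = "{w \<in> words_of (n + n') (q + q'). wdegB (drop n w) = q'}"
  have fg: "(f \<star> g) w = f (take n w) * g (drop n w)" if w: "w \<in> words_of (n + n') (q + q')" for w
  proof -
    have "f (take i w) * g (drop i w) = (if i = n then f (take n w) * g (drop n w) else 0)" if "i \<le> length w" for i
    proof (cases "g (drop i w) = 0")
      case False
      then have "length (drop i w) = n'"
        using g(1)[unfolded homogeneous_def, rule_format, of "drop i w"] by (simp add: sum_list_triv)
      then have "i = n" using that w by (simp add: words_of_def)
      then show ?thesis by simp
    qed auto
    then have "(f \<star> g) w = (\<Sum>i\<le>length w. if i = n then f (take n w) * g (drop n w) else 0)"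
      unfolding nc_mult_def by (intro sum.cong HOL.refl) simp
    then show ?thesis using w by (simp add: words_of_def)
  qed
  have "pairing r m (n + n') (q + q') (f \<star> g) = (\<Sum>w\<in>words_of (n + n') (q + q'). ?t w)"
    unfolding pairing_def by (intro sum.cong) (simp_all add: fg)
  also have "\<dots> = (\<Sum>w\<in>?S. ?t w)"
  proof (rule sum.mono_neutral_right[OF finite_words_of])
    show "\<forall>w\<in>words_of (n + n') (q + q') - ?S. ?t w = 0"
    proof
      fix w assume "w \<in> words_of (n + n') (q + q') - ?S"
      then have "g (drop n w) = 0" using g(2) by (auto simp: homogeneous_def)
      then show "?t w = 0" by simp
    qed
  qed auto
  also have "\<dots> = (\<Sum>(u, v)\<in>words_of n q \<times> words_of n' q'. cpol (f u * g v) (word_eval r m (u @ v)))"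
  proof (rule sum.reindex_bij_witness[of _ "\<lambda>(u, v). u @ v" "\<lambda>w. (take n w, drop n w)"])
    fix w assume w: "w \<in> ?S"
    have "wdegB (take n w) + wdegB (drop n w) = wdegB w"
      by (metis append_take_drop_id map_append sum_list_append)
    then show "(take n w, drop n w) \<in> words_of n q \<times> words_of n' q'"
      using w by (auto simp: words_of_def)
  qed (auto simp: words_of_def)
  also have "\<dots> = (\<Sum>(u, v)\<in>words_of n q \<times> words_of n' q'. cpol (f u) (word_eval r m u) * cpol (g v) (word_eval r (m + q) v))"
    by (intro sum.cong HOL.refl) (auto simp: word_eval_append cpol_mult words_of_def)
  also have "\<dots> = pairing r m n q f * pairing r (m + q) n' q' g"
    by (simp add: pairing_def sum_product sum.cartesian_product)
  finally show ?thesis .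
qed

lemma words_of_1: "words_of 1 (degB x) = {[x]}"
proof (rule set_eqI)
  fix w
  show "w \<in> words_of 1 (degB x) \<longleftrightarrow> w \<in> {[x]}"
  proof (cases w)
    case (Cons y v)
    then show ?thesis by (cases v; cases x; cases y) (simp_all add: words_of_def)
  qed (simp add: words_of_def)
qed

lemma pairing_letters:
  "pairing r m 1 0 ser_a = mpol_of (cyc_z r m)" "pairing r m 1 1 ser_b = mpol_of 1"
  using words_of_1[of A] words_of_1[of B]
  by (simp_all add: pairing_def letter_def cpol_1)

lemma letters_homogeneous:
  "homogeneous (\<lambda>_. 1) 1 (letter x)" "homogeneous degB 0 ser_a" "homogeneous degB 1 ser_b"
  by (simp_all add: homogeneous_def letter_def)

lemma pairing_t12: "pairing r m 2 1 t12 = mpol_of (cyc_z r m - cyc_z r (Suc m))"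
proof -
  have "pairing r m (1 + 1) (0 + 1) (ser_a \<star> ser_b :: (ab, 'a) series) = mpol_of (cyc_z r m)"
    by (subst pairing_mult) (simp_all only: letters_homogeneous pairing_letters mult_mpol_of_1)
  moreover have "pairing r m (1 + 1) (1 + 0) (ser_b \<star> ser_a :: (ab, 'a) series) = mpol_of (cyc_z r (m + 1))"
    by (subst pairing_mult) (simp_all only: letters_homogeneous pairing_letters mpol_of_1_mult)
  ultimately show ?thesis
    by (simp add: t12_def ad_eq pairing_diff mpol_of_diff numeral_2_eq_2)
qed

text \<open>On words with one b, multiplication by a from the left and from the right meets the
  sites \<open>m\<close> and \<open>m + 1\<close>; \<open>ad a\<close> thus acts as multiplication
  by the difference of their variables.\<close>

lemma pairing_c_ser:
  "k > 0 \<Longrightarrow> pairing r m k 1 (c_ser k) = (mpol_of ((cyc_z r m - cyc_z r (Suc m)) ^ (k - 1)) :: 'k::comm_rat_algebra mpol)"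
proof (induction k rule: nat_induct_non_zero)
  case 1
  then show ?case using pairing_letters(2) by (simp add: c_ser_simps)
next
  case (Suc k)
  let ?z = "cyc_z r m - cyc_z r (Suc m)"
  have h: "homogeneous (\<lambda>_. 1) k (c_ser k :: (ab, 'k) series)" "homogeneous degB 1 (c_ser k :: (ab, 'k) series)"
    using c_ser_homogeneous[of k, where 'k = 'k] Suc by (simp_all add: c_deg_def max_absorb1)
  have "pairing r m (1 + k) (0 + 1) (ser_a \<star> c_ser k :: (ab, 'k) series) = mpol_of (cyc_z r m) * mpol_of (?z ^ (k - 1))"
    by (subst pairing_mult[OF h]) (simp only: pairing_letters add_0_right Suc)
  moreover have "pairing r m (k + 1) (1 + 0) (c_ser k \<star> ser_a :: (ab, 'k) series) = mpol_of (?z ^ (k - 1)) * mpol_of (cyc_z r (m + 1))"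
    by (subst pairing_mult) (simp_all only: letters_homogeneous pairing_letters Suc)
  moreover have "?z ^ k = cyc_z r m * ?z ^ (k - 1) - ?z ^ (k - 1) * cyc_z r (m + 1)"
    using Suc(1) by (cases k) (simp_all add: algebra_simps)
  ultimately show ?case
    using Suc(1) by (simp only: c_ser_simps(3)[unfolded Suc_eq_plus1 add.commute[of _ 1]] ad_eq pairing_diff mpol_of_mult mpol_of_diff Suc_eq_plus1 add.commute[of k 1]
      add_0_left add_0_right diff_add_inverse diff_add_inverse2)
qed

lemma pairing_c_prod:
  "0 \<notin> set ks \<Longrightarrow> pairing r m (sum_list ks) (length ks) (nc_prod (map c_ser ks)) =
   (mpol_of (\<Prod>i<length ks. (cyc_z r (m + i) - cyc_z r (Suc (m + i))) ^ (ks ! i - 1)) :: 'k::comm_rat_algebra mpol)"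
proof (induction ks arbitrary: m)
  case Nil
  have "words_of 0 0 = {[]}" by (auto simp: words_of_def)
  then show ?case by (simp add: pairing_def nc_one_def cpol_1)
next
  case (Cons k ks)
  have "map c_deg ks = ks" using Cons(2) by (induction ks) (auto simp: c_deg_def)
  then have h: "homogeneous (\<lambda>_. 1) (sum_list ks) (nc_prod (map c_ser ks) :: (ab, 'k) series)"
    "homogeneous degB (length ks) (nc_prod (map c_ser ks) :: (ab, 'k) series)"
    using c_prod_homogeneous[of ks, where 'k = 'k] by simp_all
  have "pairing r m (k + sum_list ks) (1 + length ks) (c_ser k \<star> nc_prod (map c_ser ks) :: (ab, 'k) series) =
     mpol_of ((cyc_z r m - cyc_z r (Suc m)) ^ (k - 1)) *
     mpol_of (\<Prod>i<length ks. (cyc_z r (m + 1 + i) - cyc_z r (Suc (m + 1 + i))) ^ (ks ! i - 1))"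
    using Cons by (subst pairing_mult[OF h]) (simp add: pairing_c_ser[unfolded One_nat_def])
  then show ?case
    by (simp add: mpol_of_mult[symmetric] prod.lessThan_Suc_shift del: prod.lessThan_Suc)
qed

text \<open>The link from series to moulds: started at site \<open>m\<close>, an \<open>i\<close>-th
  factor \<open>c_ser k\<close> evaluates to \<open>(- cyc_u r (m + i)) ^ (k - 1)\<close>, and the
  signs combine to the \<open>(- 1) ^ (d - r)\<close> of \<open>ma_c\<close>.\<close>

lemma pairing_c_component:
  fixes f :: "(ab, 'k::comm_rat_algebra) series"
  assumes f: "f \<in> f2" and r: "r > 0"
  shows "pairing r m d r f = mpol_subst (\<lambda>i. cyc_u r (m + i)) (ma_pol d (c_component f) r)"
proof -
  define F where "F = c_component f"
  have F: "F \<in> lie_c" "f = nc_smult (f [A]) ser_a + nc_subst c_ser F"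
    using c_component[OF f] by (simp_all add: F_def)
  let ?P = "\<lambda>ks. nc_prod (map c_ser ks) :: (ab, 'k) series"
  have fw: "f w = (\<Sum>ks\<in>comps d r. F ks * ?P ks w)" if w: "w \<in> words_of d r" for w
  proof -
    have "ser_a w = (0 :: 'k)" using w r by (auto simp: letter_def words_of_def)
    then have "f w = nc_subst c_ser F w" by (subst F(2)) (simp add: nc_smult_def)
    also have "\<dots> = (\<Sum>ks\<in>bounded_words c_deg (length w). F ks * ?P ks w)" by (rule c_subst_coeff)
    also have "\<dots> = (\<Sum>ks\<in>comps d r. F ks * ?P ks w)"
    proof (rule sum.mono_neutral_right)
      show "finite (bounded_words c_deg (length w))" using finite_bounded_c_deg by (simp add: finite_bounded_def)
      show "comps d r \<subseteq> bounded_words c_deg (length w)"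
      proof
        fix ks assume ks: "ks \<in> comps d r"
        then have "map c_deg ks = ks" by (intro map_idI) (auto simp: comps_def c_deg_def max_def, metis Suc_leI gr0I le_antisym)
        then show "ks \<in> bounded_words c_deg (length w)" using ks w by (simp add: comps_def bounded_words_def words_of_def)
      qed
      show "\<forall>ks\<in>bounded_words c_deg (length w) - comps d r. F ks * ?P ks w = 0"
      proof
        fix ks assume ks: "ks \<in> bounded_words c_deg (length w) - comps d r"
        show "F ks * ?P ks w = 0"
        proof (cases "0 \<in> set ks")
          case True
          then have "\<not> set ks \<subseteq> {1..}" by auto
          then show ?thesis using F(1) lie_series_support[of F "{1..}" "\<lambda>i. i" ks] by (simp add: lie_c_def)
        next
          case False
          then have "?P ks w = 0"
            using c_prod_support[of ks w, where 'k = 'k] ks w by (auto simp: comps_def words_of_def)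
          then show ?thesis by simp
        qed
      qed
    qed
    finally show ?thesis .
  qed
  have "pairing r m d r f = (\<Sum>w\<in>words_of d r. \<Sum>ks\<in>comps d r. cpol (F ks) 1 * cpol (?P ks w) (word_eval r m w))"
    unfolding pairing_def by (intro sum.cong) (simp_all add: fw cpol_sum flip: cpol_mult)
  also have "\<dots> = (\<Sum>ks\<in>comps d r. cpol (F ks) 1 * pairing r m d r (?P ks))"
    unfolding pairing_def sum_distrib_left by (rule sum.swap)
  also have "\<dots> = (\<Sum>ks\<in>comps d r. cpol ((- 1) ^ (d - r) * F ks) (\<Prod>i<r. cyc_u r (m + Suc i) ^ (ks ! i - 1)))"
  proof (rule sum.cong[OF HOL.refl])
    fix ks assume ks: "ks \<in> comps d r"
    then have k: "length ks = r" "0 \<notin> set ks" "sum_list ks = d" by (auto simp: comps_def)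
    have "(\<Sum>i<r. ks ! i - 1) + r = d"
    proof -
      have "(\<Sum>i<r. ks ! i - 1) + (\<Sum>i<r. 1) = (\<Sum>i<r. ks ! i)"
        unfolding sum.distrib[symmetric]
      proof (rule sum.cong[OF HOL.refl])
        fix i assume "i \<in> {..<r}"
        then have "ks ! i \<noteq> 0" using k by (metis lessThan_iff nth_mem)
        then show "ks ! i - 1 + 1 = ks ! i" by simp
      qed
      then show ?thesis using k by (simp add: sum_list_sum_nth atLeast0LessThan)
    qed
    then have e: "(\<Sum>i<r. ks ! i - 1) = d - r" by simp
    have "(\<Prod>i<r. (cyc_z r (m + i) - cyc_z r (Suc (m + i))) ^ (ks ! i - 1)) =
       (\<Prod>i<r. (- 1) ^ (ks ! i - 1) * cyc_u r (m + Suc i) ^ (ks ! i - 1))"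
      by (simp add: cyc_u_Suc flip: power_mult_distrib)
    also have "\<dots> = (- 1) ^ (d - r) * (\<Prod>i<r. cyc_u r (m + Suc i) ^ (ks ! i - 1))"
      unfolding prod.distrib e[symmetric] power_sum ..
    finally show "cpol (F ks) 1 * pairing r m d r (?P ks) = cpol ((- 1) ^ (d - r) * F ks) (\<Prod>i<r. cyc_u r (m + Suc i) ^ (ks ! i - 1))"
      using pairing_c_prod[OF k(2), of r m, where 'k = 'k] k
      by (simp only: cpol_1[symmetric] cpol_mult[symmetric] cpol_sign mult_1_right mult_1_left mult.commute[of "F ks"])
  qed
  also have "\<dots> = mpol_subst (\<lambda>i. cyc_u r (m + i)) (ma_pol d F r)"
    by (simp add: mpol_subst_ma_pol cpol_def)
  finally show ?thesis by (simp add: F_def)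
qed

text \<open>
  The sum over \<open>j\<close> is the pairing of \<open>f t\<^sub>1\<^sub>2\<close> with a rotation-invariant functional.
\<close>

lemma cyc_sum_zero_pol:
  fixes f :: "(ab, 'k::comm_rat_algebra) series"
  assumes f: "f \<in> f2" and cyc: "\<And>w. wdegB w > 2 \<Longrightarrow> cyc (f \<star> t12) w = 0" and r: "r > 1"
  shows "(\<Sum>m\<le>r. mpol_of (cyc_u r m) * mpol_subst (\<lambda>i. cyc_u r (m + i)) (ma_pol d (c_component f) r)) = 0"
proof -
  let ?W = "words_of (d + 2) (r + 1)"
  have "(\<Sum>w\<in>?W. cpol ((f \<star> t12) w) (word_eval_sum r w)) = 0"
  proof (rule poly_mapping_eqI)
    fix k
    have "(\<Sum>w\<in>?W. (f \<star> t12) w * (Poly_Mapping.lookup (word_eval_sum r w) k *\<^sub>Q 1)) = 0"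
    proof (rule sum_cyc_zero[of _ "d + 2"])
      fix w assume w: "w \<in> ?W"
      show "rotate1 w \<in> ?W" using w degB_rotate[of 1 w] by (simp add: words_of_def)
      show "Poly_Mapping.lookup (word_eval_sum r (rotate1 w)) k *\<^sub>Q 1 = Poly_Mapping.lookup (word_eval_sum r w) k *\<^sub>Q 1"
        using w by (simp add: words_of_def word_eval_sum_rotate1)
      show "cyc (f \<star> t12) w = 0" using w r by (intro cyc) (simp add: words_of_def)
    qed (simp_all add: words_of_def)
    then show "Poly_Mapping.lookup (\<Sum>w\<in>?W. cpol ((f \<star> t12) w) (word_eval_sum r w)) k = Poly_Mapping.lookup 0 k"
      by (simp add: lookup_sum lookup_cpol)
  qed
  also have "(\<Sum>w\<in>?W. cpol ((f \<star> t12) w) (word_eval_sum r w)) = (\<Sum>m\<le>r. pairing r m (d + 2) (r + 1) (f \<star> t12))"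
    unfolding pairing_def word_eval_sum_def cpol_sum by (rule sum.swap)
  also have "\<dots> = (\<Sum>m\<le>r. - (mpol_of (cyc_u r m) * mpol_subst (\<lambda>i. cyc_u r (m + i)) (ma_pol d (c_component f) r)))"
  proof (rule sum.cong[OF HOL.refl])
    fix m
    \<comment> \<open>The factor \<open>t12\<close> comes after the \<open>r\<close> letters b of
      \<open>f\<close>. There the next site \<open>m + r + 1\<close> wraps around to
      \<open>m\<close>, and the missing variable \<open>cyc_u r m\<close> appears.\<close>
    have "cyc_z r (m + r) - cyc_z r (Suc (m + r)) = - cyc_u r (m + Suc r)" by (simp add: cyc_u_Suc)
    then have "pairing r (m + r) 2 1 t12 = - (mpol_of (cyc_u r m) :: 'k mpol)"
      by (simp only: pairing_t12 cyc_u_periodic mpol_of_uminus)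
    then show "pairing r m (d + 2) (r + 1) (f \<star> t12) =
      - (mpol_of (cyc_u r m) * mpol_subst (\<lambda>i. cyc_u r (m + i)) (ma_pol d (c_component f) r))"
      using r by (simp only: pairing_mult[OF t12_homogeneous] pairing_c_component[OF f] mult_minus_right mult.commute) simp
  qed
  finally show ?thesis by (simp add: sum_negf)
qed

text \<open>Because \<open>cyc_u r 0, ..., cyc_u r r\<close> add up to 0, the substitution behind
  \<open>push\<close> rotates them by one step. Its iterates are the shifts by \<open>j\<close>,
  under which no linear factor of the denominator becomes 0.\<close>

lemma push_iterate:
  fixes p :: "'k::comm_rat_algebra mpol"
  assumes r: "r \<ge> 1" and P: "P r = ratfrac p (\<Prod>j=1..r. var_u j)"
  defines "\<sigma> \<equiv> \<lambda>j i. if 1 \<le> i \<and> i \<le> r then cyc_u r (j + i) else var_u i"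
  shows "(push ^^ j) P r = ratfrac (mpol_subst (\<sigma> j) p) (\<Prod>i=1..r. cyc_u r (j + i))"
proof (induction j)
  case 0
  have "\<sigma> 0 = var_u" by (simp add: fun_eq_iff \<sigma>_def cyc_u_var)
  moreover have "(\<Prod>i=1..r. cyc_u r (0 + i)) = (\<Prod>i=1..r. var_u i)"
    by (intro prod.cong) (auto simp: cyc_u_var)
  ultimately show ?case by (simp only: funpow_0 P mpol_subst_id)
next
  case (Suc j)
  let ?ls = "map (\<lambda>j. if j < r then var_u (Suc j) else - (\<Sum>i=1..r. var_u i)) [1..<Suc r]"
  have cu1: "cyc_u r (Suc i) = (if i < r then var_u (Suc i) else - (\<Sum>i=1..r. var_u i))" if "i \<le> r" for i
    using that by (simp add: cyc_u_def)
  have \<sigma>1: "(\<lambda>j. if 1 \<le> j \<and> j \<le> length ?ls then ?ls ! (j - 1) else var_u j) = \<sigma> 1"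
    by (rule ext) (simp add: \<sigma>_def cu1 nth_append del: upt_Suc)
  have shift: "mpol_subst (\<sigma> 1) (cyc_u r k) = cyc_u r (Suc k)" for k
  proof (cases "k mod Suc r = 0")
    case True
    have "mpol_subst (\<sigma> 1) (cyc_u r k) = - (\<Sum>i=1..r. cyc_u r (1 + i))"
      using True by (simp add: cyc_u_def[of r k] mpol_subst_uminus mpol_subst_sum \<sigma>_def)
    also have "\<dots> = cyc_u r 1"
    proof -
      have "(\<Sum>i\<le>r. cyc_u r (1 + i)) = 0"
        using sum_periodic[of "cyc_u r" r 1, OF cyc_u_periodic(1)] by (simp only: sum_cyc_u)
      then show ?thesis
        by (simp add: sum.atMost_shift sum.atLeast1_atMost_eq atLeast0LessThan) (metis minus_unique minus_minus)
    qed
    also have "\<dots> = cyc_u r (Suc k)" using True by (simp add: cyc_u_def mod_Suc)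
    finally show ?thesis .
  next
    case False
    then have "mpol_subst (\<sigma> 1) (cyc_u r k) = cyc_u r (Suc (k mod Suc r))"
      using mod_less_divisor[of "Suc r" k] by (simp add: cyc_u_def[of r k] \<sigma>_def)
    also have "\<dots> = cyc_u r (Suc k)" unfolding cyc_u_def by (simp only: mod_Suc_eq)
    finally show ?thesis .
  qed
  have comp: "mpol_subst (\<sigma> 1) (mpol_subst (\<sigma> j) p) = mpol_subst (\<sigma> (Suc j)) p"
  proof -
    have "(\<lambda>i. mpol_subst (\<sigma> 1) (\<sigma> j i)) = \<sigma> (Suc j)"
      using shift by (auto simp: fun_eq_iff \<sigma>_def)
    then show ?thesis by (simp only: mpol_subst_comp)
  qed
  have den: "mpol_subst (\<sigma> 1) (\<Prod>i=1..r. cyc_u r (j + i)) = (\<Prod>i=1..r. cyc_u r (Suc j + i))"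
    using shift by (simp add: mpol_subst_prod)
  have nz: "(\<Prod>i=1..r. cyc_u r (j + i)) \<noteq> 0" for j using cyc_u_nonzero[OF r] by simp
  have "(push ^^ Suc j) P r = at_args ((push ^^ j) P r) ?ls" by (simp add: push_def)
  also have "\<dots> = ratfun_subst (\<sigma> 1) (ratfrac (mpol_subst (\<sigma> j) p) (\<Prod>i=1..r. cyc_u r (j + i)))"
    unfolding at_args_def \<sigma>1 Suc ..
  also have "\<dots> = ratfrac (mpol_subst (\<sigma> (Suc j)) p) (\<Prod>i=1..r. cyc_u r (Suc j + i))"
    using ratfun_subst_ratfrac[of "\<Prod>i=1..r. cyc_u r (j + i)" "\<sigma> 1" "mpol_subst (\<sigma> j) p"] nz[of j] nz[of "Suc j"] by (simp only: den comp not_False_eq_True True_implies_equals)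
  finally show ?case .
qed

text \<open>All iterates are brought over the rotation-invariant denominator \<open>E\<close>, the
  product of all \<open>r + 1\<close> variables; each is expanded by the single factor
  \<open>cyc_u r j\<close> that its own denominator lacks.\<close>

lemma push_neutral_dar_inv_ma:
  fixes f :: "(ab, 'k::comm_rat_algebra) series"
  assumes f: "f \<in> f2" and cyc: "\<And>w. wdegB w > 2 \<Longrightarrow> cyc (f \<star> t12) w = 0" and r: "r > 1"
  shows "push_neutral r (dar_inv (ma d f))"
proof -
  define p where "p = ma_pol d (c_component f) r"
  define \<sigma> where "\<sigma> = (\<lambda>j i. if 1 \<le> i \<and> i \<le> r then cyc_u r (j + i) else var_u i)"
  define E where "E = (\<Prod>i\<le>r. cyc_u r i)"
  have r1: "r \<ge> 1" using r by simp
  have E: "E \<noteq> 0" using cyc_u_nonzero[OF r1] by (simp add: E_def)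
  have "dar_inv (ma d f) r = ratfrac p (\<Prod>j=1..r. var_u j)"
    unfolding dar_inv_def ma_def ma_c_eq using prod_var_u_nonzero[of r]
    by (subst ratfrac_mult) (simp_all add: p_def)
  note P = this
  have push: "(push ^^ j) (dar_inv (ma d f)) r = ratfrac (mpol_subst (\<sigma> j) p) (\<Prod>i=1..r. cyc_u r (j + i))" for j
    unfolding \<sigma>_def by (rule push_iterate[OF r1, of "dar_inv (ma d f)", OF P])
  have "(push ^^ j) (dar_inv (ma d f)) r = ratfrac (mpol_of (cyc_u r j) * mpol_subst (\<sigma> j) p) E" for j
  proof -
    have "cyc_u r j * (\<Prod>i=1..r. cyc_u r (j + i)) = (\<Prod>i\<le>r. cyc_u r (j + i))"
      by (simp add: prod.atMost_shift prod.atLeast1_atMost_eq atLeast0LessThan)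
    also have "\<dots> = E" unfolding E_def by (rule prod_periodic[where g = "cyc_u r", OF cyc_u_periodic(1) cyc_u_nonzero[OF r1]])
    finally show ?thesis
      unfolding push[of j] using ratfrac_cancel[of "\<Prod>i=1..r. cyc_u r (j + i)" "cyc_u r j" "mpol_subst (\<sigma> j) p"] cyc_u_nonzero[OF r1] by simp
  qed
  then have "(\<Sum>j\<le>r. (push ^^ j) (dar_inv (ma d f)) r) = ratfrac (\<Sum>j\<le>r. mpol_of (cyc_u r j) * mpol_subst (\<sigma> j) p) E"
    using E by (simp add: ratfrac_sum)
  also have "(\<Sum>j\<le>r. mpol_of (cyc_u r j) * mpol_subst (\<sigma> j) p) =
    (\<Sum>j\<le>r. mpol_of (cyc_u r j) * mpol_subst (\<lambda>i. cyc_u r (j + i)) p)"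
    by (simp add: p_def mpol_subst_ma_pol \<sigma>_def)
  also have "\<dots> = 0" unfolding p_def by (rule cyc_sum_zero_pol[OF f cyc r])
  finally show ?thesis using E by (simp add: push_neutral_def ratfrac_0)
qed

section \<open>Local solutions of the Knizhnik--Zamolodchikov equation\<close>

definition lin :: "('l \<Rightarrow> 'k::comm_rat_algebra) \<Rightarrow> ('l, 'k) series" where
  "lin p w = (if length w = 1 then p (hd w) else 0)"

lemma lin_mult: "(lin p \<star> f) (x # w) = p x * f w" "(lin p \<star> f) [] = 0"
proof -
  have "(\<lambda>v. lin p (x # v)) = nc_smult (p x) nc_one"
    by (auto simp: fun_eq_iff lin_def nc_smult_def nc_one_def)
  then show "(lin p \<star> f) (x # w) = p x * f w"
    by (simp add: nc_mult_Cons nc_smult_mult_left) (simp add: lin_def nc_smult_def)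
qed (simp add: lin_def)

lemma mult_lin: "(f \<star> lin p) (w @ [x]) = f w * p x" "(f \<star> lin p) [] = 0"
proof -
  show "(f \<star> lin p) (w @ [x]) = f w * p x"
    by (induction w arbitrary: f) (simp_all add: nc_mult_Cons, simp_all add: lin_def)
qed (simp add: lin_def)

lemma lin_mult_hd: "w \<noteq> [] \<Longrightarrow> (lin p \<star> L) w = p (hd w) * L (tl w)"
  by (cases w) (simp_all add: lin_mult)

lemma mult_lin_last: "w \<noteq> [] \<Longrightarrow> (L \<star> lin p) w = L (butlast w) * p (last w)"
  by (cases w rule: rev_cases) (simp_all add: mult_lin)

text \<open>This is \<open>s * L'\<close> for a solution of the form
  \<open>L(s) e^(p log s)\<close>: differentiating the exponential contributes the commutator with
  \<open>p\<close>, and the pole at 1 contributes \<open>s / (s - 1)\<close>, which is regular at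
  0.\<close>

definition kz_rhs :: "('l \<Rightarrow> complex) \<Rightarrow> ('l \<Rightarrow> complex) \<Rightarrow> complex \<Rightarrow> ('l, complex) series \<Rightarrow> ('l, complex) series" where
  "kz_rhs p q s L = lin p \<star> L - L \<star> lin p + nc_smult (s / (s - 1)) (lin q \<star> L)"

lemma kz_rhs_word:
  "w \<noteq> [] \<Longrightarrow> kz_rhs p q s L w =
     p (hd w) * L (tl w) - L (butlast w) * p (last w) + s / (s - 1) * (q (hd w) * L (tl w))"
  by (simp add: kz_rhs_def lin_mult_hd mult_lin_last nc_smult_def)

text \<open>\<open>g s / s\<close> has a removable singularity at 0 and hence a primitive on the
  disc.\<close>

lemma Euler_primitive:
  assumes "g holomorphic_on ball 0 1" "g 0 = 0"
  shows "\<exists>f. f 0 = 0 \<and> (\<forall>s\<in>ball 0 1. \<exists>D. (f has_field_derivative D) (at s) \<and> s * D = g s)"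
proof -
  define k where "k s = (if s = 0 then deriv g 0 else g s / s)" for s
  have "k holomorphic_on ball 0 1"
  proof -
    have "k = (\<lambda>z. if z = 0 then deriv g 0 else (g z - g 0) / (z - 0))"
      by (simp add: fun_eq_iff k_def assms(2))
    then show ?thesis using pole_lemma[OF assms(1), of 0] by simp
  qed
  then obtain f where f: "\<And>s. s \<in> ball 0 1 \<Longrightarrow> (f has_field_derivative k s) (at s within ball 0 1)"
    using holomorphic_convex_primitive'[of "ball 0 1" k] by auto
  have "((\<lambda>s. f s - f 0) has_field_derivative k s) (at s)" if "s \<in> ball 0 1" for s
    using f[OF that] that at_within_open[OF that open_ball] by (auto intro!: derivative_eq_intros)
  moreover have "s * k s = g s" for s using assms(2) by (simp add: k_def)
  ultimately have "\<forall>s\<in>ball 0 1. \<exists>D. ((\<lambda>s. f s - f 0) has_field_derivative D) (at s) \<and> s * D = g s" by blast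
  then show ?thesis by (intro exI[of _ "\<lambda>s. f s - f 0"] conjI) simp_all
qed

text \<open>
  The coefficients of the solution \<open>L(s) e\<^bsup>p log s\<^esup>\<close> of \<open>G' = (p / s + q / (s - 1)) G\<close> that is
  normalized by \<open>L(0) = 1\<close>.
\<close>

function locsol :: "('l \<Rightarrow> complex) \<Rightarrow> ('l \<Rightarrow> complex) \<Rightarrow> 'l list \<Rightarrow> complex \<Rightarrow> complex" where
  "locsol p q w = (if w = [] then (\<lambda>_. 1) else (SOME f. f 0 = 0 \<and>
     (\<forall>s\<in>ball 0 1. \<exists>D. (f has_field_derivative D) (at s) \<and>
       s * D = p (hd w) * locsol p q (tl w) s - locsol p q (butlast w) s * p (last w)
         + s / (s - 1) * (q (hd w) * locsol p q (tl w) s))))"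
  by auto
termination by (relation "Wellfounded.measure (\<lambda>(p, q, w). length w)") auto

declare locsol.simps [simp del]

lemma locsol_Nil [simp]: "locsol p q [] s = 1"
  by (subst locsol.simps) simp

text \<open>The chosen primitives exist because the right-hand side vanishes at 0: for one letter
  the two commutator terms cancel, and for longer words the shorter coefficients vanish there by
  induction.\<close>

lemma locsol_word:
  "(w \<noteq> [] \<longrightarrow> locsol p q w 0 = 0) \<and>
   (\<forall>s\<in>ball 0 1. \<exists>D. (locsol p q w has_field_derivative D) (at s) \<and> s * D = kz_rhs p q s (\<lambda>v. locsol p q v s) w)"
proof (induction "length w" arbitrary: w rule: less_induct)
  case less
  show ?case
  proof (cases "w = []")
    case True
    have "(\<lambda>_. 1) = locsol p q []" by (simp add: fun_eq_iff)
    moreover have "((\<lambda>_. 1 :: complex) has_field_derivative 0) (at s)" for s by simp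
    moreover have "kz_rhs p q s (\<lambda>v. locsol p q v s) [] = 0" for s
      by (simp add: kz_rhs_def lin_def nc_smult_def)
    ultimately show ?thesis using True by (metis mult_zero_right)
  next
    case w: False
    let ?g = "\<lambda>s. p (hd w) * locsol p q (tl w) s - locsol p q (butlast w) s * p (last w)
         + s / (s - 1) * (q (hd w) * locsol p q (tl w) s)"
    have len: "length (tl w) < length w" "length (butlast w) < length w" using w by auto
    have hol: "locsol p q v holomorphic_on ball 0 1" if "length v < length w" for v
      using less[OF that] by (auto simp: holomorphic_on_open)
    have "?g holomorphic_on ball 0 1"
      by (intro holomorphic_intros hol len) auto
    moreover have "?g 0 = 0"
    proof (cases "length w = 1")
      case True
      then obtain x where "w = [x]" by (cases w) auto
      then show ?thesis by simp
    next
      case False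
      then have "tl w \<noteq> []" "butlast w \<noteq> []" using w by (cases w; auto)+
      then show ?thesis using less len by simp
    qed
    ultimately have "\<exists>f. f 0 = 0 \<and> (\<forall>s\<in>ball 0 1. \<exists>D. (f has_field_derivative D) (at s) \<and> s * D = ?g s)"
      by (rule Euler_primitive)
    from someI_ex[OF this] show ?thesis
      using w by (simp add: locsol.simps[of p q w] kz_rhs_word)
  qed
qed

lemma locsol_0: "w \<noteq> [] \<Longrightarrow> locsol p q w 0 = 0"
  using locsol_word by blast

lemma locsol_deriv:
  assumes "s \<in> ball 0 1" "s \<noteq> 0"
  shows "(locsol p q w has_field_derivative kz_rhs p q s (\<lambda>v. locsol p q v s) w / s) (at s)"
proof -
  obtain D where D: "(locsol p q w has_field_derivative D) (at s)" "s * D = kz_rhs p q s (\<lambda>v. locsol p q v s) w"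
    using locsol_word assms(1) by blast
  then have "D = kz_rhs p q s (\<lambda>v. locsol p q v s) w / s" using assms(2) by (auto simp: field_simps)
  with D show ?thesis by simp
qed

lemma locsol_cont: "s \<in> ball 0 1 \<Longrightarrow> isCont (locsol p q w) s"
  using locsol_word by (meson DERIV_isCont)

lemma sh_has_field_derivative:
  assumes "\<And>w. (F w has_field_derivative D w) (at s)"
  shows "((\<lambda>s. sh (\<lambda>w. F w s) u v) has_field_derivative sh D u v) (at s)"
  using assms
proof (induction u v arbitrary: F D rule: shuffle.induct)
  case (3 x xs y ys)
  show ?case unfolding sh_Cons
    by (intro derivative_intros 3(1)[of "\<lambda>w. F (x # w)"] 3(2)[of "\<lambda>w. F (y # w)"] 3(3))
qed simp_all

lemma sh_lin_mult_left: "u \<noteq> [] \<Longrightarrow> v \<noteq> [] \<Longrightarrow>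
  sh (lin p \<star> L) u v = p (hd u) * sh L (tl u) v + p (hd v) * sh L u (tl v)"
  by (cases u; cases v) (simp_all add: sh_Cons lin_mult sh_mult_left)

lemma sh_lin_mult_right: "u \<noteq> [] \<Longrightarrow> v \<noteq> [] \<Longrightarrow>
  sh (L \<star> lin p) u v = sh L (butlast u) v * p (last u) + sh L u (butlast v) * p (last v)"
  by (cases u rule: rev_cases; cases v rule: rev_cases) (simp_all add: sh_snoc mult_lin sh_mult_right)

lemma sh_diff: "sh (f - g) u v = sh f u v - (sh g u v :: 'k::comm_rat_algebra)"
  using sh_add[of "f - g" g u v] by simp

lemma sh_plus: "sh (f + g) u v = sh f u v + (sh g u v :: 'k::comm_rat_algebra)"
  by (simp add: plus_fun_def sh_add)

lemma sh_smult: "sh (nc_smult c f) u v = c * sh f u v"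
  by (simp add: nc_smult_def[abs_def] sh_mult_left)

lemma sh_kz_rhs:
  assumes "u \<noteq> []" "v \<noteq> []"
    and "sh L (tl u) v = L (tl u) * L v" "sh L u (tl v) = L u * L (tl v)"
    and "sh L (butlast u) v = L (butlast u) * L v" "sh L u (butlast v) = L u * L (butlast v)"
  shows "sh (kz_rhs p q s L) u v = kz_rhs p q s L u * L v + L u * kz_rhs p q s L v"
proof -
  have "sh (kz_rhs p q s L) u v = sh (lin p \<star> L) u v - sh (L \<star> lin p) u v + s / (s - 1) * sh (lin q \<star> L) u v"
    by (simp only: kz_rhs_def sh_plus sh_diff sh_smult)
  then show ?thesis
    using assms
    by (simp add: sh_lin_mult_left sh_lin_mult_right kz_rhs_def lin_mult_hd mult_lin_last nc_smult_def algebra_simps)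
qed

text \<open>By induction on the lengths, the difference of the two sides of a shuffle relation has
  derivative 0 for \<open>s \<noteq> 0\<close>. At the origin the equation cannot be divided by
  \<open>s\<close>, so continuity is used; the value at 0 fixes the constant.\<close>

lemma group_like_locsol:
  assumes "s \<in> ball 0 1"
  shows "group_like (\<lambda>w. locsol p q w s)"
proof -
  have "\<forall>s\<in>ball 0 1. sh (\<lambda>w. locsol p q w s) u v = locsol p q u s * locsol p q v s" for u v
  proof (induction "length u + length v" arbitrary: u v rule: less_induct)
    case less
    show ?case
    proof (cases "u = [] \<or> v = []")
      case False
      let ?f = "\<lambda>s. sh (\<lambda>w. locsol p q w s) u v - locsol p q u s * locsol p q v s"
      have "\<exists>c. \<forall>s\<in>ball 0 1. ?f s = c"
      proof -
        have "\<exists>D. (?f has_field_derivative D) (at s)" if "s \<in> ball 0 1" for s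
        proof -
          have "\<exists>D. \<forall>w. (locsol p q w has_field_derivative D w) (at s)"
            using locsol_word that by (intro choice) blast
          then obtain D where D: "\<And>w. (locsol p q w has_field_derivative D w) (at s)" by blast
          show ?thesis
            by (rule exI, rule DERIV_diff[OF sh_has_field_derivative[OF D] DERIV_mult[OF D D]])
        qed
        then have cont: "continuous_on (ball 0 1) ?f"
          by (meson DERIV_isCont continuous_at_imp_continuous_on)
        have der: "DERIV ?f s :> 0" if s: "s \<in> ball 0 1 - {0}" for s
        proof -
        let ?L = "\<lambda>w. locsol p q w s" and ?D = "\<lambda>w. kz_rhs p q s (\<lambda>v. locsol p q v s) w / s"
        have D: "(locsol p q w has_field_derivative ?D w) (at s)" for w
          using s by (intro locsol_deriv) auto
        have IH: "sh ?L u' v' = ?L u' * ?L v'" if "length u' + length v' < length u + length v" for u' v'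
          using less that s by auto
        have l: "length (tl u) < length u" "length (tl v) < length v"
          "length (butlast u) < length u" "length (butlast v) < length v" using False by auto
        have "sh (kz_rhs p q s ?L) u v = kz_rhs p q s ?L u * ?L v + ?L u * kz_rhs p q s ?L v"
          by (rule sh_kz_rhs) (use False IH l in auto)
        note e = this
        have r: "(a * m + l * b) * i = a * i * m + l * (b * i)" for a b l m i :: complex
          by (simp add: algebra_simps)
        have "sh ?D u v = ?D u * ?L v + ?L u * ?D v"
          unfolding divide_inverse sh_mult_right e by (rule r)
        then have "sh ?D u v - (?D u * ?L v + ?D v * ?L u) = 0"
          by (simp only: mult.commute[of "?L u"] diff_self)
        moreover have "(?f has_field_derivative sh ?D u v - (?D u * ?L v + ?D v * ?L u)) (at s)"
          by (intro DERIV_diff sh_has_field_derivative DERIV_mult D)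
        ultimately show "DERIV ?f s :> 0" by (simp only:)
        qed
        show ?thesis
          using DERIV_zero_connected_constant[OF connected_ball open_ball finite.insertI[OF finite.emptyI] cont ballI[OF der]]
          by metis
      qed
      then obtain c where c: "\<And>s. s \<in> ball 0 1 \<Longrightarrow> ?f s = c" by blast
      have "sh (\<lambda>w. locsol p q w 0) u v = sh (\<lambda>w. 0) u v"
        by (rule sh_length_cong) (use False in \<open>auto intro!: locsol_0\<close>)
      then have "c = 0" using c[of 0] False by (simp add: locsol_0)
      then show ?thesis using c by simp
    qed auto
  qed
  then show ?thesis using assms by (simp add: group_like_def)
qed

section \<open>Exponentials and local solutions with a logarithm\<close>

definition expo :: "('l \<Rightarrow> complex) \<Rightarrow> complex \<Rightarrow> ('l, complex) series" where
  "expo p c w = c ^ length w / fact (length w) * prod_list (map p w)"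

lemma expo_Nil [simp]: "expo p c [] = 1"
  by (simp add: expo_def)

lemma sh_one: "sh (\<lambda>_. 1 :: complex) u v = of_nat ((length u + length v) choose length u)"
  by (induction u v rule: shuffle.induct) (simp_all add: sh_Cons)

lemma group_like_expo: "group_like (expo p c)"
  unfolding group_like_def
proof (intro conjI allI)
  fix u v :: "'a list"
  let ?n = "length u + length v"
  have "prod_list (map p w) = prod_list (map p u) * prod_list (map p v)" if "mset w = mset u + mset v" for w
    using that by (metis mset_append mset_map prod_mset_prod_list prod_list.append map_append)
  moreover have "length w = ?n" if "mset w = mset u + mset v" for w
    using that by (metis size_mset size_union)
  ultimately have "sh (expo p c) u v = sh (\<lambda>_. 1 * (c ^ ?n / fact ?n * (prod_list (map p u) * prod_list (map p v)))) u v"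
    by (intro sh_cong) (simp add: expo_def)
  also have "\<dots> = of_nat (?n choose length u) * (c ^ ?n / fact ?n * (prod_list (map p u) * prod_list (map p v)))"
    unfolding sh_mult_right sh_one ..
  also have "(of_nat (?n choose length u) :: complex) = fact ?n / (fact (length u) * fact (length v))"
    by (subst binomial_fact) simp_all
  finally show "sh (expo p c) u v = expo p c u * expo p c v"
    by (simp only: expo_def[of p c u] expo_def[of p c v] power_add) simp
qed simp

lemma expo_add: "expo p (a + b) = expo p a \<star> expo p b"
proof
  fix w :: "'a list"
  define n where "n = length w"
  have "(expo p a \<star> expo p b) w = (\<Sum>i\<le>n. (a ^ i / fact i * (b ^ (n - i) / fact (n - i))) * prod_list (map p w))"
    unfolding nc_mult_def n_def
  proof (rule sum.cong[OF HOL.refl])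
    fix i assume "i \<in> {..length w}"
    moreover have "prod_list (map p w) = prod_list (map p (take i w)) * prod_list (map p (drop i w))"
      by (metis append_take_drop_id map_append prod_list.append)
    ultimately show "expo p a (take i w) * expo p b (drop i w) =
       (a ^ i / fact i * (b ^ (length w - i) / fact (length w - i))) * prod_list (map p w)"
      by (simp add: expo_def)
  qed
  also have "\<dots> = (\<Sum>i\<le>n. a ^ i / fact i * (b ^ (n - i) / fact (n - i))) * prod_list (map p w)"
    by (simp add: sum_distrib_right)
  also have "(\<Sum>i\<le>n. a ^ i / fact i * (b ^ (n - i) / fact (n - i))) = (a + b) ^ n / fact n"
    unfolding binomial_ring sum_divide_distrib
    by (intro sum.cong HOL.refl) (simp add: binomial_fact field_simps)
  finally show "expo p (a + b) w = (expo p a \<star> expo p b) w"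
    by (simp only: expo_def[of p "a + b"] n_def)
qed

lemma expo_0: "expo p 0 = nc_one"
  by (auto simp: fun_eq_iff expo_def nc_one_def)

lemma expo_uminus: "expo (\<lambda>x. - p x) c = expo p (- c)"
proof
  fix w
  have "prod_list (map (\<lambda>x. - p x) w) = (- 1) ^ length w * prod_list (map p w)"
    by (induction w) simp_all
  then show "expo (\<lambda>x. - p x) c w = expo p (- c) w"
    by (simp add: expo_def power_minus[of c])
qed

lemma expo_deriv: "((\<lambda>c. expo p c w) has_field_derivative (lin p \<star> expo p c) w) (at c)"
proof (cases w)
  case Nil
  then show ?thesis by (simp add: lin_def)
next
  case (Cons x v)
  have "((\<lambda>c. c ^ Suc (length v)) has_field_derivative of_nat (Suc (length v)) * c ^ length v) (at c)"
    by (rule DERIV_cong[OF DERIV_power[OF DERIV_ident]]) simp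
  from DERIV_cmult_right[OF DERIV_cdivide[OF this]]
  have "((\<lambda>c. c ^ Suc (length v) / fact (Suc (length v)) * prod_list (map p w)) has_field_derivative
     of_nat (Suc (length v)) * c ^ length v / fact (Suc (length v)) * prod_list (map p w)) (at c)" .
  moreover have "of_nat (Suc (length v)) * c ^ length v / fact (Suc (length v)) * prod_list (map p w) = p x * expo p c v"
    by (simp add: Cons expo_def fact_Suc del: of_nat_Suc)
  ultimately show ?thesis by (simp add: Cons lin_mult expo_def[abs_def])
qed

text \<open>The argument \<open>l\<close> stands for a logarithm of \<open>s\<close>. Kept separate,
  it turns a change of branch into right multiplication by an exponential.\<close>

definition lsol :: "('l \<Rightarrow> complex) \<Rightarrow> ('l \<Rightarrow> complex) \<Rightarrow> complex \<Rightarrow> complex \<Rightarrow> ('l, complex) series" where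
  "lsol p q s l = (\<lambda>w. locsol p q w s) \<star> expo p l"

lemma group_like_lsol: "s \<in> ball 0 1 \<Longrightarrow> group_like (lsol p q s l)"
  unfolding lsol_def by (intro group_like_mult group_like_locsol group_like_expo)

lemma lsol_add: "lsol p q s (l + c) = lsol p q s l \<star> expo p c"
  by (simp add: lsol_def expo_add nc_mult_assoc)

text \<open>Chain rule in a local coordinate \<open>\<sigma>\<close>. The commutator in the equation
  of \<open>locsol\<close> cancels against the derivative of the exponential, leaving left
  multiplication by the connection form.\<close>

lemma lsol_deriv:
  assumes s: "(\<sigma> has_field_derivative \<sigma>') (at t)" and l: "(l has_field_derivative \<sigma>' / \<sigma> t) (at t)"
    and st: "\<sigma> t \<in> ball 0 1" "\<sigma> t \<noteq> 0"
  shows "((\<lambda>t. lsol p q (\<sigma> t) (l t) (x # w)) has_field_derivative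
     \<sigma>' * (p x / \<sigma> t + q x / (\<sigma> t - 1)) * lsol p q (\<sigma> t) (l t) w) (at t)"
proof -
  define L where "L = (\<lambda>w. locsol p q w (\<sigma> t))"
  define E where "E = expo p (l t)"
  define c where "c = \<sigma>' / \<sigma> t"
  have c: "c * (\<sigma> t / (\<sigma> t - 1)) = \<sigma>' / (\<sigma> t - 1)" using st by (simp add: c_def)
  define DL where "DL = nc_smult c (kz_rhs p q (\<sigma> t) L)"
  define DE where "DE = nc_smult c (lin p \<star> E)"
  have DL: "((\<lambda>t. locsol p q v (\<sigma> t)) has_field_derivative DL v) (at t)" for v
    using DERIV_chain2[OF locsol_deriv[OF st] s, of p q v]
    by (simp add: DL_def L_def c_def nc_smult_def mult.commute)
  have DE: "((\<lambda>t. expo p (l t) v) has_field_derivative DE v) (at t)" for v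
    using DERIV_chain2[OF expo_deriv l, of p v] by (simp add: DE_def E_def c_def nc_smult_def mult.commute)
  have "((\<lambda>t. lsol p q (\<sigma> t) (l t) v) has_field_derivative (DL \<star> E + L \<star> DE) v) (at t)" for v
  proof -
    have "((\<lambda>t. \<Sum>i\<le>length v. locsol p q (take i v) (\<sigma> t) * expo p (l t) (drop i v)) has_field_derivative
       (\<Sum>i\<le>length v. DL (take i v) * E (drop i v) + DE (drop i v) * L (take i v))) (at t)"
      unfolding E_def L_def by (intro DERIV_sum DERIV_mult DL DE)
    then show ?thesis
      by (simp add: lsol_def nc_mult_def sum.distrib mult.commute)
  qed
  moreover have "DL \<star> E + L \<star> DE = nc_smult c (lin p \<star> (L \<star> E)) + nc_smult (\<sigma>' / (\<sigma> t - 1)) (lin q \<star> (L \<star> E))"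
  proof -
    have "DL \<star> E + L \<star> DE = nc_smult c ((lin p \<star> L - L \<star> lin p) \<star> E + L \<star> (lin p \<star> E)) +
       nc_smult c (nc_smult (\<sigma> t / (\<sigma> t - 1)) (lin q \<star> L) \<star> E)"
      by (simp add: DL_def DE_def kz_rhs_def nc_smult_mult_left nc_smult_mult_right nc_mult_add_left nc_smult_add add_ac)
    also have "(lin p \<star> L - L \<star> lin p) \<star> E + L \<star> (lin p \<star> E) = lin p \<star> (L \<star> E)"
      by (simp add: nc_mult_diff_left nc_mult_assoc)
    also have "nc_smult c (nc_smult (\<sigma> t / (\<sigma> t - 1)) (lin q \<star> L) \<star> E) = nc_smult (\<sigma>' / (\<sigma> t - 1)) (lin q \<star> (L \<star> E))"
      unfolding c[symmetric] by (simp add: nc_smult_mult_left nc_mult_assoc) (simp add: fun_eq_iff nc_smult_def mult.assoc)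
    finally show ?thesis .
  qed
  ultimately have "((\<lambda>t. lsol p q (\<sigma> t) (l t) (x # w)) has_field_derivative
     (nc_smult c (lin p \<star> (L \<star> E)) + nc_smult (\<sigma>' / (\<sigma> t - 1)) (lin q \<star> (L \<star> E))) (x # w)) (at t)"
    by simp
  moreover have "(nc_smult c (lin p \<star> (L \<star> E)) + nc_smult (\<sigma>' / (\<sigma> t - 1)) (lin q \<star> (L \<star> E))) (x # w) =
     \<sigma>' * (p x / \<sigma> t + q x / (\<sigma> t - 1)) * lsol p q (\<sigma> t) (l t) w"
    by (simp add: nc_smult_def lin_mult lsol_def L_def[symmetric] E_def[symmetric] c_def field_simps)
  ultimately show ?thesis by simp
qed

section \<open>Solutions on regions of the plane and their comparison\<close>

definition kz_form :: "xy \<Rightarrow> complex \<Rightarrow> complex" where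
  "kz_form x t = (case x of X \<Rightarrow> 1 / t | Y \<Rightarrow> 1 / (t - 1))"

definition kz_solution :: "complex set \<Rightarrow> (complex \<Rightarrow> (xy, complex) series) \<Rightarrow> bool" where
  "kz_solution S G \<longleftrightarrow> (\<forall>t\<in>S. G t [] = 1 \<and>
     (\<forall>x w. ((\<lambda>t. G t (x # w)) has_field_derivative kz_form x t * G t w) (at t)))"

lemma kz_solution_subset: "kz_solution S G \<Longrightarrow> T \<subseteq> S \<Longrightarrow> kz_solution T G"
  by (auto simp: kz_solution_def)

text \<open>Where \<open>H - G \<star> C\<close> vanishes at a word, its coefficient at the word
  extended by a first letter has derivative 0, and \<open>C\<close> is chosen to make it vanish at
  \<open>t0\<close>. Induction on words follows.\<close>

lemma kz_solution_unique:
  assumes G: "kz_solution S G" "\<And>t. t \<in> S \<Longrightarrow> group_like (G t)" and H: "kz_solution S H"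
    and S: "open S" "connected S" "S \<noteq> {}"
  obtains C where "C [] = 1" "\<And>t. t \<in> S \<Longrightarrow> H t = G t \<star> C"
proof -
  obtain t0 where t0: "t0 \<in> S" using S by blast
  define C where "C = antipode (G t0) \<star> H t0"
  have C0: "C [] = 1" using H t0 group_like_antipode[OF G(2)[OF t0]]
    by (simp add: C_def kz_solution_def group_like_def)
  have "\<forall>t\<in>S. H t w - (G t \<star> C) w = 0" for w
  proof (induction w)
    case Nil
    then show ?case using G(1) H C0 by (simp add: kz_solution_def)
  next
    case (Cons x w)
    have D: "((\<lambda>t. H t (x # w) - (G t \<star> C) (x # w)) has_field_derivative 0) (at t)" if t: "t \<in> S" for t
    proof -
      have "((\<lambda>t. H t (x # w) - (G t \<star> C) (x # w)) has_field_derivative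
         kz_form x t * H t w - (\<Sum>i\<le>length w. kz_form x t * G t (take i w) * C (drop i w))) (at t)"
      proof -
        have eq: "(G t \<star> C) (x # w) = G t [] * C (x # w) + (\<Sum>i\<le>length w. G t (x # take i w) * C (drop i w))" for t
          by (simp add: nc_mult_Cons) (simp add: nc_mult_def)
        have "((\<lambda>t. G t [] * C (x # w)) has_field_derivative 0) (at t)"
        proof (rule DERIV_cong_ev[THEN iffD1, OF HOL.refl _ HOL.refl])
          show "\<forall>\<^sub>F t in nhds t. C (x # w) = G t [] * C (x # w)"
            using eventually_nhds_in_open[OF S(1) t] by eventually_elim (use G(1) in \<open>simp add: kz_solution_def\<close>)
        qed simp
        moreover have "((\<lambda>t. \<Sum>i\<le>length w. G t (x # take i w) * C (drop i w)) has_field_derivative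
          (\<Sum>i\<le>length w. kz_form x t * G t (take i w) * C (drop i w))) (at t)"
          using G(1) t by (intro DERIV_sum DERIV_cmult_right) (auto simp: kz_solution_def)
        moreover have "((\<lambda>t. H t (x # w)) has_field_derivative kz_form x t * H t w) (at t)"
          using H t by (auto simp: kz_solution_def)
        ultimately have "((\<lambda>t. H t (x # w) - (G t [] * C (x # w) + (\<Sum>i\<le>length w. G t (x # take i w) * C (drop i w))))
          has_field_derivative kz_form x t * H t w - (0 + (\<Sum>i\<le>length w. kz_form x t * G t (take i w) * C (drop i w)))) (at t)"
          by (intro DERIV_diff DERIV_add)
        then show ?thesis unfolding eq by simp
      qed
      moreover have "(\<Sum>i\<le>length w. kz_form x t * G t (take i w) * C (drop i w)) = kz_form x t * (G t \<star> C) w"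
        by (simp add: nc_mult_def sum_distrib_left mult.assoc)
      ultimately show ?thesis using Cons t by simp
    qed
    have "continuous_on S (\<lambda>t. H t (x # w) - (G t \<star> C) (x # w))"
      using D by (auto intro!: continuous_at_imp_continuous_on DERIV_isCont)
    from DERIV_zero_connected_constant[OF S(2,1) finite.emptyI this] D
    obtain c where c: "\<And>t. t \<in> S \<Longrightarrow> H t (x # w) - (G t \<star> C) (x # w) = c" by auto
    have "G t0 \<star> C = H t0"
      unfolding C_def by (simp add: antipode_mult_right[OF G(2)[OF t0]] flip: nc_mult_assoc)
    then have "c = 0" using c[OF t0] by simp
    then show ?case using c by simp
  qed
  then have "H t = G t \<star> C" if "t \<in> S" for t using that by (auto simp: fun_eq_iff)
  with C0 show ?thesis by (rule that)
qed

lemma kz_solution_lsol: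
  assumes "\<And>t. t \<in> S \<Longrightarrow> \<sigma> t \<in> ball 0 1 \<and> \<sigma> t \<noteq> 0"
    and "\<And>t. t \<in> S \<Longrightarrow> (\<sigma> has_field_derivative \<sigma>' t) (at t) \<and> (l has_field_derivative \<sigma>' t / \<sigma> t) (at t)"
    and "\<And>t x. t \<in> S \<Longrightarrow> \<sigma>' t * (p x / \<sigma> t + q x / (\<sigma> t - 1)) = kz_form x t"
  shows "kz_solution S (\<lambda>t. lsol p q (\<sigma> t) (l t))"
  unfolding kz_solution_def
proof (intro ballI conjI allI)
  fix t x w assume t: "t \<in> S"
  show "lsol p q (\<sigma> t) (l t) [] = 1" by (simp add: lsol_def)
  show "((\<lambda>t. lsol p q (\<sigma> t) (l t) (x # w)) has_field_derivative kz_form x t * lsol p q (\<sigma> t) (l t) w) (at t)"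
    using lsol_deriv[of \<sigma> "\<sigma>' t" t l p q x w] assms t by simp
qed

lemma nc_mult_right_cancel:
  assumes "f \<star> n = g \<star> n" "n [] = (1 :: 'k::comm_rat_algebra)"
  shows "f = g"
proof
  fix w
  have 0: "((f - g) \<star> n) w = 0" for w using assms(1) by (simp add: nc_mult_diff_left)
  have "(f - g) w = 0"
  proof (induction "length w" arbitrary: w rule: less_induct)
    case less
    have "((f - g) \<star> n) w = (\<Sum>i\<le>length w. if i = length w then (f - g) w else 0)"
      unfolding nc_mult_def by (intro sum.cong HOL.refl) (use less assms(2) in auto)
    then show ?case using 0 by simp
  qed
  then show "f w = g w" by simp
qed

section \<open>Monodromy\<close>

definition resX :: "xy \<Rightarrow> complex" where "resX x = (if x = X then 1 else 0)"
definition resY :: "xy \<Rightarrow> complex" where "resY x = (if x = Y then 1 else 0)"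

text \<open>Normalized solutions at 0, 1 and \<infinity>. A prime negates the argument of the
  logarithm, which moves the branch cut to the opposite ray.\<close>

definition sol0 :: "complex \<Rightarrow> (xy, complex) series" where "sol0 t = lsol resX resY t (Ln t)"
definition sol0' :: "complex \<Rightarrow> (xy, complex) series" where "sol0' t = lsol resX resY t (Ln (- t))"
definition sol1 :: "complex \<Rightarrow> (xy, complex) series" where "sol1 t = lsol resY resX (1 - t) (Ln (1 - t))"
definition sol1' :: "complex \<Rightarrow> (xy, complex) series" where "sol1' t = lsol resY resX (1 - t) (Ln (t - 1))"
text \<open>In the coordinate \<open>1 / t\<close> the residue at \<infinity> is minus the sum of
  those at 0 and 1, hence -1 for both letters; the pole at \<open>t = 1\<close> keeps the residue
  \<open>resY\<close>.\<close>

definition sol_inf :: "complex \<Rightarrow> (xy, complex) series" where "sol_inf t = lsol (\<lambda>_. - 1) resY (1 / t) (- Ln t)"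
definition sol_inf' :: "complex \<Rightarrow> (xy, complex) series" where "sol_inf' t = lsol (\<lambda>_. - 1) resY (1 / t) (- Ln (- t))"

text \<open>The plane without the ray from 0 through 1 to \<infinity>. It meets the regions around 0
  and \<infinity> in connected sets, which ties both local solutions to one global solution.\<close>

definition slit :: "complex set" where "slit = {t. - t \<notin> \<real>\<^sub>\<le>\<^sub>0}"

lemma slit_iff: "t \<in> slit \<longleftrightarrow> \<not> (Re t \<ge> 0 \<and> Im t = 0)"
  by (simp add: slit_def complex_nonpos_Reals_iff)

lemma kz_form_res: "kz_form x t = resX x / t + resY x / (t - 1)"
  by (cases x) (simp_all add: resX_def resY_def kz_form_def)

lemma kz_solution_sol0: "kz_solution {t. norm t < 1 \<and> t \<notin> \<real>\<^sub>\<le>\<^sub>0} sol0"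
  unfolding sol0_def[abs_def]
  by (rule kz_solution_lsol[where \<sigma>' = "\<lambda>_. 1"])
    (auto simp: kz_form_res divide_inverse intro!: derivative_eq_intros)

lemma kz_solution_sol0': "kz_solution {t. norm t < 1 \<and> - t \<notin> \<real>\<^sub>\<le>\<^sub>0} sol0'"
  unfolding sol0'_def[abs_def]
  by (rule kz_solution_lsol[where \<sigma>' = "\<lambda>_. 1"])
    (auto simp: kz_form_res divide_inverse intro!: derivative_eq_intros)

lemma kz_solution_sol1: "kz_solution {t. norm (1 - t) < 1 \<and> 1 - t \<notin> \<real>\<^sub>\<le>\<^sub>0} sol1"
  unfolding sol1_def[abs_def]
proof (rule kz_solution_lsol[where \<sigma>' = "\<lambda>_. - 1"])
  fix t :: complex and x assume t: "t \<in> {t. norm (1 - t) < 1 \<and> 1 - t \<notin> \<real>\<^sub>\<le>\<^sub>0}"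
  then have nz: "1 - t \<noteq> 0" "t \<noteq> 1" by auto
  then show "1 - t \<in> ball 0 1 \<and> 1 - t \<noteq> 0" using t by simp
  show "((-) 1 has_field_derivative - 1) (at t) \<and> ((\<lambda>t. Ln (1 - t)) has_field_derivative - 1 / (1 - t)) (at t)"
    using t nz by (auto intro!: derivative_eq_intros simp: divide_inverse)
  show "- 1 * (resY x / (1 - t) + resX x / (1 - t - 1)) = kz_form x t"
  proof -
    have "resY x / (1 - t) = - (resY x / (t - 1))" by (metis minus_diff_eq divide_minus_right)
    moreover have "resX x / (1 - t - 1) = - (resX x / t)" by simp
    ultimately show ?thesis by (simp only: kz_form_res) simp
  qed
qed

lemma kz_solution_sol1': "kz_solution {t. norm (1 - t) < 1 \<and> t - 1 \<notin> \<real>\<^sub>\<le>\<^sub>0} sol1'"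
  unfolding sol1'_def[abs_def]
proof (rule kz_solution_lsol[where \<sigma>' = "\<lambda>_. - 1"])
  fix t :: complex and x assume t: "t \<in> {t. norm (1 - t) < 1 \<and> t - 1 \<notin> \<real>\<^sub>\<le>\<^sub>0}"
  then have nz: "1 - t \<noteq> 0" "t \<noteq> 1" by auto
  then show "1 - t \<in> ball 0 1 \<and> 1 - t \<noteq> 0" using t by simp
  have "- 1 / (1 - t) = inverse (t - 1)" using nz by (simp add: field_simps)
  then show "((-) 1 has_field_derivative - 1) (at t) \<and> ((\<lambda>t. Ln (t - 1)) has_field_derivative - 1 / (1 - t)) (at t)"
    using t nz by (auto intro!: derivative_eq_intros)
  show "- 1 * (resY x / (1 - t) + resX x / (1 - t - 1)) = kz_form x t"
  proof -
    have "resY x / (1 - t) = - (resY x / (t - 1))" by (metis minus_diff_eq divide_minus_right)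
    moreover have "resX x / (1 - t - 1) = - (resX x / t)" by simp
    ultimately show ?thesis by (simp only: kz_form_res) simp
  qed
qed

lemma kz_form_inf:
  assumes "norm t > 1"
  shows "- (1 / t\<^sup>2) * (- 1 / (1 / t) + resY x / (1 / t - 1)) = kz_form x t"
proof -
  have nz: "t \<noteq> 0" "t \<noteq> 1" using assms by auto
  show ?thesis
  proof (cases x)
    case X
    then show ?thesis using nz by (simp add: resY_def kz_form_def power2_eq_square)
  next
    case Y
    have "- (1 / t\<^sup>2) * (- 1 / (1 / t) + 1 / (1 / t - 1)) = 1 / (t - 1)"
      using nz by (simp add: divide_simps power2_eq_square) (simp add: algebra_simps)?
    then show ?thesis using Y by (simp add: resY_def kz_form_def)
  qed
qed

lemma kz_solution_sol_inf: "kz_solution {t. norm t > 1 \<and> t \<notin> \<real>\<^sub>\<le>\<^sub>0} sol_inf"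
  unfolding sol_inf_def[abs_def]
proof (rule kz_solution_lsol[where \<sigma>' = "\<lambda>t. - (1 / t\<^sup>2)"])
  fix t :: complex and x assume t: "t \<in> {t. norm t > 1 \<and> t \<notin> \<real>\<^sub>\<le>\<^sub>0}"
  then have nz: "t \<noteq> 0" by auto
  then show "1 / t \<in> ball 0 1 \<and> 1 / t \<noteq> 0" using t by (simp add: norm_divide)
  have "- (1 / t\<^sup>2) / (1 / t) = - inverse t" using nz by (simp add: power2_eq_square field_simps)
  then show "((/) 1 has_field_derivative - (1 / t\<^sup>2)) (at t) \<and> ((\<lambda>t. - Ln t) has_field_derivative - (1 / t\<^sup>2) / (1 / t)) (at t)"
    using t nz by (auto intro!: derivative_eq_intros simp: power2_eq_square divide_simps)
  show "- (1 / t\<^sup>2) * (- 1 / (1 / t) + resY x / (1 / t - 1)) = kz_form x t"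
    using t by (intro kz_form_inf) simp
qed

lemma kz_solution_sol_inf': "kz_solution {t. norm t > 1 \<and> - t \<notin> \<real>\<^sub>\<le>\<^sub>0} sol_inf'"
  unfolding sol_inf'_def[abs_def]
proof (rule kz_solution_lsol[where \<sigma>' = "\<lambda>t. - (1 / t\<^sup>2)"])
  fix t :: complex and x assume t: "t \<in> {t. norm t > 1 \<and> - t \<notin> \<real>\<^sub>\<le>\<^sub>0}"
  then have nz: "t \<noteq> 0" by auto
  then show "1 / t \<in> ball 0 1 \<and> 1 / t \<noteq> 0" using t by (simp add: norm_divide)
  have "- (1 / t\<^sup>2) / (1 / t) = - inverse t" using nz by (simp add: power2_eq_square field_simps)
  then show "((/) 1 has_field_derivative - (1 / t\<^sup>2)) (at t) \<and> ((\<lambda>t. - Ln (- t)) has_field_derivative - (1 / t\<^sup>2) / (1 / t)) (at t)"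
    using t nz by (auto intro!: derivative_eq_intros simp: power2_eq_square divide_simps)
  show "- (1 / t\<^sup>2) * (- 1 / (1 / t) + resY x / (1 / t - 1)) = kz_form x t"
    using t by (intro kz_form_inf) simp
qed

lemma open_slit: "open slit"
proof -
  have "slit = uminus -` (- \<real>\<^sub>\<le>\<^sub>0)" by (auto simp: slit_def)
  then show ?thesis
    using open_vimage[of "- \<real>\<^sub>\<le>\<^sub>0" "uminus :: complex \<Rightarrow> complex"] closed_nonpos_Reals_complex
    by (simp add: open_Compl continuous_on_minus)
qed

lemma closed_segment_slit:
  assumes "a < 0" "x \<in> slit"
  shows "closed_segment (complex_of_real a) x \<subseteq> slit"
proof
  fix y assume "y \<in> closed_segment (complex_of_real a) x"
  then obtain u where u: "0 \<le> u" "u \<le> 1" "y = (1 - u) *\<^sub>R complex_of_real a + u *\<^sub>R x"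
    by (auto simp: closed_segment_def)
  then have y: "Re y = (1 - u) * a + u * Re x" "Im y = u * Im x" by simp_all
  show "y \<in> slit"
  proof (cases "u = 0")
    case True
    then show ?thesis using assms(1) y by (simp add: slit_iff)
  next
    case False
    have "Re y < 0" if "Im x = 0"
    proof -
      have "Re x < 0" using assms(2) that by (simp add: slit_iff)
      then have "u * Re x < 0" using False u by (simp add: mult_pos_neg)
      moreover have "(1 - u) * a \<le> 0" using u assms(1) by (intro mult_nonneg_nonpos) auto
      ultimately show ?thesis using y by simp
    qed
    then show ?thesis using False y by (auto simp: slit_iff)
  qed
qed

text \<open>Primitives exist because the slit plane is starlike. Their constants of integration stay
  unspecified and enter the comparison of solutions through constant right factors, which are
  eliminated.\<close>

primrec global_sol :: "xy list \<Rightarrow> complex \<Rightarrow> complex" where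
  "global_sol [] = (\<lambda>_. 1)"
| "global_sol (x # w) = (SOME f. \<forall>t\<in>slit. (f has_field_derivative kz_form x t * global_sol w t) (at t))"

lemma starlike_slit: "starlike slit"
  unfolding starlike_def
  by (rule bexI[of _ "complex_of_real (- 1)"]) (use closed_segment_slit[of "- 1"] in \<open>auto simp: slit_iff\<close>)

lemma global_sol_deriv:
  "(\<forall>t\<in>slit. ((global_sol (x # w)) has_field_derivative kz_form x t * global_sol w t) (at t))"
proof (induction w arbitrary: x)
  have nz: "t \<noteq> 0 \<and> t \<noteq> 1" if "t \<in> slit" for t using that by (auto simp: slit_iff)
  have form: "kz_form x holomorphic_on slit" for x
    unfolding kz_form_def[abs_def] by (cases x) (auto intro!: holomorphic_intros dest: nz)
  have prim: "\<forall>t\<in>slit. ((global_sol (x # w)) has_field_derivative kz_form x t * global_sol w t) (at t)"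
    if "global_sol w holomorphic_on slit" for x w
  proof -
    have hol: "(\<lambda>t. kz_form x t * global_sol w t) holomorphic_on slit"
      by (intro holomorphic_intros form that)
    have "\<exists>g. \<forall>t\<in>slit. (g has_field_derivative kz_form x t * global_sol w t) (at t)"
      by (rule holomorphic_starlike_primitive[of slit _ "{}"])
        (use hol starlike_slit open_slit in \<open>auto intro: holomorphic_on_imp_continuous_on holomorphic_on_imp_differentiable_at\<close>)
    from someI_ex[OF this] show ?thesis by simp
  qed
  {
    case Nil
    show ?case by (rule prim) simp
  next
    case (Cons y w)
    then have "global_sol (y # w) holomorphic_on slit"
      using open_slit by (auto simp: holomorphic_on_open)
    then show ?case by (rule prim)
  }
qed

lemma kz_solution_global: "kz_solution slit (\<lambda>t w. global_sol w t)"
  using global_sol_deriv by (simp add: kz_solution_def)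

lemma group_like_sols:
  "norm t < 1 \<Longrightarrow> group_like (sol0 t)" "norm t < 1 \<Longrightarrow> group_like (sol0' t)"
  "norm (1 - t) < 1 \<Longrightarrow> group_like (sol1 t)" "norm (1 - t) < 1 \<Longrightarrow> group_like (sol1' t)"
  "norm t > 1 \<Longrightarrow> group_like (sol_inf t)" "norm t > 1 \<Longrightarrow> group_like (sol_inf' t)"
  by (auto simp: sol0_def sol0'_def sol1_def sol1'_def sol_inf_def sol_inf'_def norm_divide divide_less_eq_1 intro!: group_like_lsol)

lemma Ln_neg_half_planes:
  "Im t > 0 \<Longrightarrow> Ln t = Ln (- t) + \<i> * pi" "Im t < 0 \<Longrightarrow> Ln t = Ln (- t) + - (\<i> * pi)"
proof -
  show "Im t > 0 \<Longrightarrow> Ln t = Ln (- t) + \<i> * pi" using Ln_minus[of t] by (cases "t = 0") (auto split: if_splits)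
  show "Im t < 0 \<Longrightarrow> Ln t = Ln (- t) + - (\<i> * pi)" using Ln_minus[of t] by (cases "t = 0") (auto split: if_splits)
qed

lemma sol0_upper:
  "Im t > 0 \<Longrightarrow> sol0 t = sol0' t \<star> expo resX (\<i> * pi)"
  "Im t < 0 \<Longrightarrow> sol0 t = sol0' t \<star> expo resX (- (\<i> * pi))"
  by (simp_all only: sol0_def sol0'_def Ln_neg_half_planes lsol_add)

lemma sol1_upper:
  "Im t > 0 \<Longrightarrow> sol1' t = sol1 t \<star> expo resY (\<i> * pi)"
  "Im t < 0 \<Longrightarrow> sol1' t = sol1 t \<star> expo resY (- (\<i> * pi))"
proof -
  have e: "Ln (1 - t) = Ln (- (t - 1))" by simp
  show "Im t > 0 \<Longrightarrow> sol1' t = sol1 t \<star> expo resY (\<i> * pi)"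
    "Im t < 0 \<Longrightarrow> sol1' t = sol1 t \<star> expo resY (- (\<i> * pi))"
    unfolding sol1_def sol1'_def e using Ln_neg_half_planes[of "t - 1"] by (simp_all only: lsol_add minus_complex.simps one_complex.simps diff_0_right)
qed

lemma sol_inf_upper:
  "Im t > 0 \<Longrightarrow> sol_inf t = sol_inf' t \<star> expo (\<lambda>_. 1) (\<i> * pi)"
  "Im t < 0 \<Longrightarrow> sol_inf t = sol_inf' t \<star> expo (\<lambda>_. 1) (- (\<i> * pi))"
proof -
  have *: "lsol (\<lambda>_. - 1) resY (1 / t) (- (l + c)) = lsol (\<lambda>_. - 1) resY (1 / t) (- l) \<star> expo (\<lambda>_. 1) c" for l c
    using expo_uminus[of "\<lambda>_ :: xy. 1" "- c"] by (simp only: minus_add_distrib lsol_add minus_minus)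
  show "Im t > 0 \<Longrightarrow> sol_inf t = sol_inf' t \<star> expo (\<lambda>_. 1) (\<i> * pi)"
    "Im t < 0 \<Longrightarrow> sol_inf t = sol_inf' t \<star> expo (\<lambda>_. 1) (- (\<i> * pi))"
    unfolding sol_inf_def sol_inf'_def by (simp_all only: Ln_neg_half_planes *)
qed

definition lens :: "complex set" where "lens = ball 0 1 \<inter> ball 1 1"

lemma lens: "t \<in> lens \<Longrightarrow> norm t < 1 \<and> norm (1 - t) < 1 \<and> t \<notin> \<real>\<^sub>\<le>\<^sub>0 \<and> 1 - t \<notin> \<real>\<^sub>\<le>\<^sub>0"
proof -
  assume "t \<in> lens"
  then have t: "norm t < 1" "norm (1 - t) < 1" by (simp_all add: lens_def dist_norm norm_minus_commute)
  moreover have "Re t < 1" using complex_Re_le_cmod[of t] t by simp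
  moreover have "Re (1 - t) < 1" using complex_Re_le_cmod[of "1 - t"] t by simp
  ultimately show ?thesis by (auto simp: complex_nonpos_Reals_iff)
qed

text \<open>In the upper and in the lower half disc around 1, the global solution is compared with
  \<open>sol1\<close> along two routes: through the lens towards 0 and through \<open>?B\<close>
  towards \<infinity>. Each half plane yields one relation between the constants \<open>n\<close>
  and \<open>n'\<close>, and eliminating both gives the loop relation. \<open>\<Phi>\<close> and
  \<open>E\<close> are the connection constants from 0 and \<infinity> to 1.\<close>

lemma monodromy:
  obtains \<Phi> E where "\<Phi> [] = 1" "group_like E" "\<And>t. t \<in> lens \<Longrightarrow> sol0 t = sol1 t \<star> \<Phi>"
    "\<Phi> \<star> expo resX (2 * \<i> * pi) = expo resY (- (\<i> * pi)) \<star> E \<star> expo (\<lambda>_. 1) (2 * \<i> * pi) \<star> antipode E \<star> expo resY (- (\<i> * pi)) \<star> \<Phi>"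
proof -
  let ?N = "\<lambda>t w. global_sol w t"
  let ?e = "\<lambda>p s. expo p (s * (\<i> * pi)) :: (xy, complex) series"
  obtain \<Phi> where \<Phi>: "\<Phi> [] = 1" "\<And>t. t \<in> lens \<Longrightarrow> sol0 t = sol1 t \<star> \<Phi>"
  proof (rule kz_solution_unique[of lens sol1 sol0])
    have "1 / 2 \<in> lens" by (simp add: lens_def dist_norm)
    then show "lens \<noteq> {}" by blast
    show "connected lens" "open lens" by (auto simp: lens_def intro!: convex_connected convex_Int)
    show "kz_solution lens sol1" "kz_solution lens sol0"
      using lens by (auto intro: kz_solution_subset[OF kz_solution_sol1] kz_solution_subset[OF kz_solution_sol0])
  qed (use lens group_like_sols in auto)
  \<comment> \<open>A disc in the overlap of the neighbourhood \<open>norm t > 1\<close> of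
    \<infinity> with the unit disc around 1.\<close>
  let ?B = "ball (3 / 2) (1 / 2) :: complex set"
  have B: "norm t > 1 \<and> norm (1 - t) < 1 \<and> t \<notin> \<real>\<^sub>\<le>\<^sub>0 \<and> t - 1 \<notin> \<real>\<^sub>\<le>\<^sub>0" if "t \<in> ?B" for t
  proof -
    have t: "norm (3 / 2 - t) < 1 / 2" using that by (simp add: dist_norm)
    have "Re (3 / 2 - t) < 1 / 2" using complex_Re_le_cmod[of "3 / 2 - t"] t by linarith
    then have "Re t > 1" by simp
    moreover have "Re t \<le> norm t" by (rule complex_Re_le_cmod)
    moreover have "norm (1 - t) \<le> norm (3 / 2 - t) + norm (1 / 2 :: complex)"
      using norm_triangle_ineq4[of "3 / 2 - t" "1 / 2"] by (simp add: algebra_simps)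
    ultimately show ?thesis using t by (auto simp: complex_nonpos_Reals_iff)
  qed
  obtain E where E: "E [] = 1" "\<And>t. t \<in> ?B \<Longrightarrow> sol_inf t = sol1' t \<star> E"
  proof (rule kz_solution_unique[of ?B sol1' sol_inf])
    show "?B \<noteq> {}" "connected ?B" "open ?B" by auto
    show "kz_solution ?B sol1'" by (rule kz_solution_subset[OF kz_solution_sol1']) (use B in blast)
    show "kz_solution ?B sol_inf" by (rule kz_solution_subset[OF kz_solution_sol_inf]) (use B in blast)
  qed (use B group_like_sols in auto)
  let ?D = "ball 0 1 \<inter> slit"
  have half: "complex_of_real (- 1 / 2) \<in> ?D" by (simp add: slit_iff)
  have "closed_segment (complex_of_real (- 1 / 2)) x \<subseteq> ?D" if "x \<in> ?D" for x
  proof -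
    have "closed_segment (complex_of_real (- 1 / 2)) x \<subseteq> ball 0 1"
      using that by (intro closed_segment_subset) auto
    then show ?thesis using closed_segment_slit[of "- 1 / 2" x] that by auto
  qed
  then have "starlike ?D" using half unfolding starlike_def by blast
  then have conD: "connected ?D" by (rule starlike_imp_connected)
  obtain n where n: "n [] = 1" "\<And>t. t \<in> ?D \<Longrightarrow> ?N t = sol0' t \<star> n"
  proof (rule kz_solution_unique[of ?D sol0' ?N])
    show "?D \<noteq> {}" using half by blast
    show "connected ?D" "open ?D" using conD open_slit by (simp_all add: open_Int)
    have "?D \<subseteq> {t. norm t < 1 \<and> - t \<notin> \<real>\<^sub>\<le>\<^sub>0}" by (auto simp: slit_def)
    then show "kz_solution ?D sol0'" by (rule kz_solution_subset[OF kz_solution_sol0'])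
    show "kz_solution ?D ?N" by (rule kz_solution_subset[OF kz_solution_global]) simp
  qed (use group_like_sols in auto)
  let ?D' = "{t. norm t > 1} \<inter> slit"
  \<comment> \<open>Inversion preserves the slit plane, so the outer region inherits connectedness
    from the starlike inner one.\<close>
  have "?D' = (\<lambda>t. 1 / t) ` ?D"
  proof -
    have inv: "1 / t \<in> slit" if "t \<in> slit" for t
    proof -
      have t: "t \<noteq> 0" using that by (auto simp: slit_iff)
      have "Re (1 / t) = Re t / (norm t)\<^sup>2" "Im (1 / t) = - Im t / (norm t)\<^sup>2"
        by (simp_all add: Re_divide Im_divide cmod_power2)
      then show ?thesis using that t by (auto simp: slit_iff zero_le_divide_iff)
    qed
    have "t \<in> (\<lambda>t. 1 / t) ` ?D" if "t \<in> ?D'" for t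
    proof -
      have "1 / norm t < 1" using that by (subst divide_less_eq) auto
      then show ?thesis using that inv[of t] by (intro image_eqI[of _ _ "1 / t"]) (auto simp: norm_divide)
    qed
    moreover have "1 / t \<in> ?D'" if "t \<in> ?D" for t
    proof -
      have "1 < 1 / norm t" using that by (subst less_divide_eq) (auto simp: slit_iff)
      then show ?thesis using that inv[of t] by (auto simp: norm_divide)
    qed
    ultimately show ?thesis by blast
  qed
  moreover have "continuous_on ?D (\<lambda>t. 1 / t)"
    by (intro continuous_intros) (auto simp: slit_iff)
  ultimately have conD': "connected ?D'" using conD by (metis connected_continuous_image)
  have openD': "open ?D'"
  proof -
    have "{t :: complex. norm t > 1} = norm -` {1<..}" by auto
    then have "open {t :: complex. norm t > 1}" by (simp only:) (intro open_vimage continuous_intros open_greaterThan)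
    then show ?thesis using open_slit by blast
  qed
  have "complex_of_real (- 2) \<in> ?D'" by (simp add: slit_iff)
  then have neD': "?D' \<noteq> {}" by blast
  obtain n' where n': "n' [] = 1" "\<And>t. t \<in> ?D' \<Longrightarrow> ?N t = sol_inf' t \<star> n'"
  proof (rule kz_solution_unique[of ?D' sol_inf' ?N])
    show "?D' \<noteq> {}" "connected ?D'" "open ?D'" by (fact neD' conD' openD')+
    have "?D' \<subseteq> {t. norm t > 1 \<and> - t \<notin> \<real>\<^sub>\<le>\<^sub>0}" by (auto simp: slit_def)
    then show "kz_solution ?D' sol_inf'" by (rule kz_solution_subset[OF kz_solution_sol_inf'])
    show "kz_solution ?D' ?N" by (rule kz_solution_subset[OF kz_solution_global]) simp
  qed (use group_like_sols in auto)
  \<comment> \<open>The sign \<open>s\<close> selects the half plane and governs the change of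
    branch in all three logarithms, so one argument serves both halves.\<close>
  have half_plane: "\<Phi> \<star> ?e resX (- s) \<star> n = ?e resY s \<star> E \<star> ?e (\<lambda>_. 1) (- s) \<star> n'"
    if s: "s = 1 \<or> s = (- 1 :: real)" for s :: real
  proof -
    let ?H = "{t. s * Im t > 0} \<inter> ball 1 1"
    have "{t. s * Im t > 0} = {t. (\<i> * s) \<bullet> t > 0}" by (auto simp: inner_complex_def)
    then have cH: "convex ?H" "open ?H"
      by (simp_all only:) (intro convex_Int open_Int convex_ball open_ball convex_halfspace_gt open_halfspace_gt)+
    have Hs: "t \<in> slit \<and> norm (1 - t) < 1 \<and> 1 - t \<notin> \<real>\<^sub>\<le>\<^sub>0" if "t \<in> ?H" for t
      using that s by (auto simp: slit_iff dist_norm complex_nonpos_Reals_iff)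
    \<comment> \<open>Two points of the half disc, one in the lens and in \<open>?D\<close>, the
      other in \<open>?B\<close> and in \<open>?D'\<close>. The constant \<open>b\<close> is read
      off at each of them.\<close>
    define t1 where "t1 = Complex (1 / 2) (s / 4)"
    define t2 where "t2 = Complex (3 / 2) (s / 4)"
    have sq: "s\<^sup>2 = 1" using s by auto
    have "sqrt ((s / 4)\<^sup>2) < 1 / 2" unfolding real_sqrt_abs using s by auto
    moreover have "sqrt ((1 / 2)\<^sup>2 + (s / 4)\<^sup>2) < 1" "sqrt ((3 / 2)\<^sup>2 + (s / 4)\<^sup>2) > 1"
      using s by (auto simp: power_divide sq real_sqrt_less_iff intro!: real_less_lsqrt real_less_rsqrt simp: power2_eq_square)
    ultimately have sqs: "sqrt ((1 / 2)\<^sup>2 + (s / 4)\<^sup>2) < 1" "sqrt ((3 / 2)\<^sup>2 + (s / 4)\<^sup>2) > 1" "sqrt ((s / 4)\<^sup>2) < 1 / 2" by blast+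
    have t1: "norm t1 < 1" "norm (1 - t1) < 1" "s * Im t1 > 0"
      using sqs s by (auto simp: t1_def cmod_def)
    have t2: "norm (3 / 2 - t2) < 1 / 2" "s * Im t2 > 0"
      using sqs s by (auto simp: t2_def cmod_def)
    have t1_in: "t1 \<in> ?H" "t1 \<in> lens" "t1 \<in> ?D" 
      using t1 s by (auto simp: lens_def dist_norm slit_iff norm_minus_commute)
    have t2B: "t2 \<in> ?B" using t2 by (simp add: dist_norm)
    have t2_in: "t2 \<in> ?H" "t2 \<in> ?D'"
      using t2 B[OF t2B] s by (auto simp: dist_norm slit_iff norm_minus_commute)
    obtain b where b: "b [] = 1" "\<And>t. t \<in> ?H \<Longrightarrow> ?N t = sol1 t \<star> b"
    proof (rule kz_solution_unique[of ?H sol1 ?N])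
      show "?H \<noteq> {}" using t1_in by blast
      show "connected ?H" "open ?H" by (rule convex_connected[OF cH(1)], rule cH(2))
      show "kz_solution ?H sol1" by (rule kz_solution_subset[OF kz_solution_sol1]) (use Hs in blast)
      show "kz_solution ?H ?N" by (rule kz_solution_subset[OF kz_solution_global]) (use Hs in blast)
    qed (use Hs group_like_sols in auto)
    have cancel: "f = g" if "sol1 t \<star> f = sol1 t \<star> g" "t \<in> ?H" for f g t
    proof -
      have "antipode (sol1 t) \<star> (sol1 t \<star> f) = antipode (sol1 t) \<star> (sol1 t \<star> g)" using that(1) by simp
      then show ?thesis
        using antipode_mult_left[OF group_like_sols(3)] Hs[OF that(2)] by (simp flip: nc_mult_assoc)
    qed
    have e0: "?e p (- s) = antipode (?e p s)" "?e p s \<star> ?e p (- s) = nc_one" for p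
    proof -
      show "?e p s \<star> ?e p (- s) = nc_one" by (simp flip: expo_add add: expo_0)
      then have "antipode (?e p s) \<star> (?e p s \<star> ?e p (- s)) = antipode (?e p s)" by simp
      then show "?e p (- s) = antipode (?e p s)"
        by (simp add: antipode_mult_left[OF group_like_expo] flip: nc_mult_assoc)
    qed
    have u0: "sol0 t = sol0' t \<star> ?e resX s" "sol1' t = sol1 t \<star> ?e resY s" "sol_inf t = sol_inf' t \<star> ?e (\<lambda>_. 1) s"
      if "s * Im t > 0" for t
      using s that sol0_upper[of t] sol1_upper[of t] sol_inf_upper[of t] by auto
    have "b = \<Phi> \<star> ?e resX (- s) \<star> n"
    proof (rule cancel[OF _ t1_in(1)])
      have "sol0' t1 = sol0 t1 \<star> ?e resX (- s)"
        by (simp only: u0[OF t1(3)] nc_mult_assoc e0(2) nc_mult_one_right)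
      then show "sol1 t1 \<star> b = sol1 t1 \<star> (\<Phi> \<star> ?e resX (- s) \<star> n)"
        using b(2)[OF t1_in(1)] n(2)[OF t1_in(3)] \<Phi>(2)[OF t1_in(2)] by (simp add: nc_mult_assoc)
    qed
    moreover have "b = ?e resY s \<star> E \<star> ?e (\<lambda>_. 1) (- s) \<star> n'"
    proof (rule cancel[OF _ t2_in(1)])
      have "sol_inf' t2 = sol_inf t2 \<star> ?e (\<lambda>_. 1) (- s)"
        by (simp only: u0[OF t2(2)] nc_mult_assoc e0(2) nc_mult_one_right)
      then show "sol1 t2 \<star> b = sol1 t2 \<star> (?e resY s \<star> E \<star> ?e (\<lambda>_. 1) (- s) \<star> n')"
        using b(2)[OF t2_in(1)] n'(2)[OF t2_in(2)] E(2)[OF t2B] u0(2)[OF t2(2)] by (simp add: nc_mult_assoc)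
    qed
    ultimately show ?thesis by simp
  qed
  have gE: "group_like E"
  proof -
    have B32: "3 / 2 \<in> ?B" by simp
    have g: "group_like (sol1' (3 / 2))" "group_like (sol_inf (3 / 2))" using B[OF B32] group_like_sols by auto
    have "E = antipode (sol1' (3 / 2)) \<star> (sol1' (3 / 2) \<star> E)"
      using antipode_mult_left[OF g(1)] by (simp flip: nc_mult_assoc)
    also have "\<dots> = antipode (sol1' (3 / 2)) \<star> sol_inf (3 / 2)" using E(2)[OF B32] by simp
    finally show ?thesis using g group_like_mult group_like_antipode by metis
  qed
  note EE = antipode_mult_left[OF gE]
  have ee': "expo p a \<star> (expo p c \<star> f) = expo p (a + c) \<star> (f :: (xy, complex) series)" for p a c f
    by (simp add: expo_add nc_mult_assoc)
  note ee = expo_add[symmetric]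
  note e0 = expo_0
  have EE': "antipode E \<star> (E \<star> f) = f" for f by (simp add: EE flip: nc_mult_assoc)
  \<comment> \<open>The relation of the upper half plane is solved for \<open>n'\<close> and
    inserted into that of the lower one, after which \<open>n\<close> cancels on the right.\<close>
  have n'_eq: "n' = ?e (\<lambda>_. 1) 1 \<star> (antipode E \<star> (?e resY (- 1) \<star> (\<Phi> \<star> (?e resX (- 1) \<star> n))))"
    using half_plane[of 1] by (simp add: nc_mult_assoc ee' EE' e0)
  have "\<Phi> \<star> (?e resX 1 \<star> n) = ?e resY (- 1) \<star> (E \<star> (?e (\<lambda>_. 1) 1 \<star> n'))"
    using half_plane[of "- 1"] by (simp add: nc_mult_assoc)
  also have "\<dots> = ?e resY (- 1) \<star> (E \<star> (?e (\<lambda>_. 1) 2 \<star> (antipode E \<star> (?e resY (- 1) \<star> (\<Phi> \<star> (?e resX (- 1) \<star> n))))))"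
    by (subst n'_eq) (simp add: ee' flip: mult_2)
  finally have "(\<Phi> \<star> ?e resX 1) \<star> n = (?e resY (- 1) \<star> E \<star> ?e (\<lambda>_. 1) 2 \<star> antipode E \<star> ?e resY (- 1) \<star> \<Phi> \<star> ?e resX (- 1)) \<star> n"
    by (simp add: nc_mult_assoc)
  from nc_mult_right_cancel[OF this n(1)]
  have "\<Phi> \<star> ?e resX 1 \<star> ?e resX 1 = (?e resY (- 1) \<star> E \<star> ?e (\<lambda>_. 1) 2 \<star> antipode E \<star> ?e resY (- 1) \<star> \<Phi> \<star> ?e resX (- 1)) \<star> ?e resX 1"
    by simp
  then have "\<Phi> \<star> ?e resX 2 = ?e resY (- 1) \<star> E \<star> ?e (\<lambda>_. 1) 2 \<star> antipode E \<star> ?e resY (- 1) \<star> \<Phi>"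
    by (simp add: nc_mult_assoc ee e0 flip: mult_2)
  then show ?thesis using that[OF \<Phi>(1) gE \<Phi>(2)] by (simp add: mult.assoc)
qed

section \<open>Regularized limits\<close>

lemma tendsto_mult_ln_power: "((\<lambda>x::real. x * ln x ^ k) \<longlongrightarrow> 0) (at_right 0)"
proof -
  have "filterlim (\<lambda>x::real. - ln x) at_top (at_right 0)"
    using ln_at_0 by (simp add: filterlim_uminus_at_top)
  from filterlim_compose[OF tendsto_power_div_exp_0 this, of k]
  have "((\<lambda>x::real. (- 1) ^ k * ((- ln x) ^ k / exp (- ln x))) \<longlongrightarrow> (- 1) ^ k * 0) (at_right 0)"
    by (intro tendsto_mult tendsto_const)
  moreover have "eventually (\<lambda>x::real. (- 1) ^ k * ((- ln x) ^ k / exp (- ln x)) = x * ln x ^ k) (at_right 0)"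
    using eventually_at_right_less[of "0::real"]
  proof eventually_elim
    case (elim x)
    have "(- 1) ^ k * (- ln x) ^ k = ln x ^ k" by (simp flip: power_mult_distrib)
    moreover have "exp (- ln x) = 1 / x" using elim by (simp add: exp_minus divide_inverse)
    ultimately show ?case by (metis divide_divide_eq_right div_by_1 mult.commute times_divide_eq_right)
  qed
  ultimately show ?thesis by (simp add: filterlim_cong)
qed

lemma tendsto_of_real_at_right: "((\<lambda>x::real. complex_of_real x) \<longlongrightarrow> 0) (at_right 0)"
  using tendsto_of_real[OF tendsto_ident_at[of "0::real" "{0<..}"], where 'a = complex] by simp

text \<open>For a nonempty prefix, \<open>locsol\<close> is of order \<open>x\<close> and outweighs
  the powers of \<open>ln x\<close>. The remaining term is a pure power of the logarithm whose
  coefficient is assumed to be 0.\<close>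

lemma lsol_tendsto_0:
  assumes "prod_list (map p v) = 0"
  shows "((\<lambda>x. lsol p q (of_real x) (Ln (of_real x)) v) \<longlongrightarrow> 0) (at_right (0::real))"
proof -
  have "((\<lambda>x. locsol p q (take j v) (of_real x) * expo p (Ln (of_real x)) (drop j v)) \<longlongrightarrow> 0) (at_right (0::real))"
    if "j \<le> length v" for j
  proof (cases "j = 0")
    case True
    then show ?thesis using assms by (simp add: expo_def)
  next
    case False
    then have ne: "take j v \<noteq> []" using that assms by auto
    define k where "k = length (drop j v)"
    define a where "a = prod_list (map p (drop j v)) / fact k"
    obtain D where D: "(locsol p q (take j v) has_field_derivative D) (at 0)"
      using locsol_word[of "take j v" p q] by force
    then have "((\<lambda>h. locsol p q (take j v) h / h) \<longlongrightarrow> D) (at 0)"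
      by (simp add: DERIV_def locsol_0[OF ne])
    moreover have "filterlim (\<lambda>x::real. complex_of_real x) (at 0) (at_right 0)"
      unfolding filterlim_at using tendsto_of_real_at_right eventually_at_right_less[of "0::real"]
      by (auto elim: eventually_mono)
    ultimately have "((\<lambda>x::real. locsol p q (take j v) (of_real x) / of_real x) \<longlongrightarrow> D) (at_right 0)"
      by (rule filterlim_compose)
    then have "((\<lambda>x::real. a * ((locsol p q (take j v) (of_real x) / of_real x) * of_real (x * ln x ^ k))) \<longlongrightarrow> a * (D * of_real 0)) (at_right 0)"
      by (intro tendsto_mult tendsto_const tendsto_of_real tendsto_mult_ln_power)
    moreover have "eventually (\<lambda>x::real. a * ((locsol p q (take j v) (of_real x) / of_real x) * of_real (x * ln x ^ k)) =
       locsol p q (take j v) (of_real x) * expo p (Ln (of_real x)) (drop j v)) (at_right 0)"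
      using eventually_at_right_less[of "0::real"]
    proof eventually_elim
      case (elim x)
      then have "complex_of_real x \<noteq> 0" "Ln (complex_of_real x) = complex_of_real (ln x)" by (simp_all add: Ln_of_real)
      then show ?case by (simp add: a_def k_def expo_def)
    qed
    ultimately show ?thesis by (simp add: filterlim_cong)
  qed
  then have "((\<lambda>x. \<Sum>j\<le>length v. locsol p q (take j v) (of_real x) * expo p (Ln (of_real x)) (drop j v)) \<longlongrightarrow> (\<Sum>j\<le>length v. 0)) (at_right (0::real))"
    by (intro tendsto_sum) simp
  then show ?thesis by (simp add: lsol_def nc_mult_def)
qed

lemma locsol_single_0:
  assumes "q x = 0" "s \<in> ball 0 1"
  shows "locsol p q [x] s = 0"
proof -
  have "\<forall>t\<in>ball 0 1 - {0}. (locsol p q [x] has_field_derivative 0) (at t)"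
    using locsol_deriv[of _ p q "[x]"] assms(1) by (auto simp: kz_rhs_word)
  then obtain c where "\<And>t. t \<in> ball 0 1 \<Longrightarrow> locsol p q [x] t = c"
    using DERIV_zero_connected_constant[of "ball 0 1" "{0}" "locsol p q [x]"] locsol_cont
    by (metis connected_ball continuous_at_imp_continuous_on finite.emptyI finite.insertI open_ball)
  then show ?thesis using locsol_0[of "[x]" p q] assms(2) by (metis centre_in_ball list.discI zero_less_one)
qed

lemma eventually_lens:
  "eventually (\<lambda>x::real. complex_of_real x \<in> lens \<and> 1 - complex_of_real x \<in> lens) (at_right 0)"
proof -
  have "eventually (\<lambda>x::real. 0 < x \<and> x < 1) (at_right 0)"
    using eventually_at_right_real[of 0 1] by (auto elim: eventually_mono)
  then show ?thesis
  proof eventually_elim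
    case (elim x)
    have "norm (1 - complex_of_real x) = 1 - x" using elim by (metis abs_of_pos diff_gt_0_iff_gt norm_of_real of_real_1 of_real_diff)
    then show ?case using elim by (simp add: lens_def dist_norm norm_minus_commute)
  qed
qed

text \<open>Nonempty prefixes of a word that begins with \<open>X\<close> begin with
  \<open>X\<close> too and have residue product 0 at the point 1. Their \<open>sol1\<close> factors
  tend to 0, and only the empty prefix survives.\<close>

lemma associator_limit:
  assumes \<Phi>: "\<And>t. t \<in> lens \<Longrightarrow> sol0 t = sol1 t \<star> \<Phi>" and w: "hd w = X" "w \<noteq> []"
  shows "((\<lambda>x::real. sol0 (1 - of_real x) w) \<longlongrightarrow> \<Phi> w) (at_right 0)"
proof -
  have "((\<lambda>x::real. sol1 (1 - of_real x) (take j w) * \<Phi> (drop j w)) \<longlongrightarrow> (if j = 0 then \<Phi> w else 0)) (at_right 0)" for j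
  proof (cases "j = 0")
    case True
    then show ?thesis by (simp add: sol1_def lsol_def)
  next
    case False
    then have "hd (take j w) = X" "take j w \<noteq> []" using w by simp_all
    then have "prod_list (map resY (take j w)) = 0" by (cases "take j w") (simp_all add: resY_def)
    from lsol_tendsto_0[OF this, of resX]
    have "((\<lambda>x::real. sol1 (1 - of_real x) (take j w)) \<longlongrightarrow> 0) (at_right 0)" by (simp add: sol1_def)
    then have "((\<lambda>x::real. sol1 (1 - of_real x) (take j w) * \<Phi> (drop j w)) \<longlongrightarrow> 0 * \<Phi> (drop j w)) (at_right 0)"
      by (intro tendsto_mult tendsto_const)
    then show ?thesis using False by simp
  qed
  then have "((\<lambda>x::real. \<Sum>j\<le>length w. sol1 (1 - of_real x) (take j w) * \<Phi> (drop j w)) \<longlongrightarrow>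
     (\<Sum>j\<le>length w. if j = 0 then \<Phi> w else 0)) (at_right 0)"
    by (intro tendsto_sum)
  moreover have "(\<Sum>j\<le>length w. if j = 0 then \<Phi> w else 0) = \<Phi> w" by simp
  moreover have "eventually (\<lambda>x::real. (\<Sum>j\<le>length w. sol1 (1 - of_real x) (take j w) * \<Phi> (drop j w)) = sol0 (1 - of_real x) w) (at_right 0)"
    using eventually_lens by eventually_elim (simp add: \<Phi> nc_mult_def)
  ultimately show ?thesis by (simp add: filterlim_cong)
qed

text \<open>On single letters the solutions are logarithms: \<open>sol0\<close> at \<open>X\<close>
  is considered near 1 and \<open>sol1\<close> at \<open>Y\<close> near 0, where both tend to
  \<open>Ln 1 = 0\<close>.\<close>

lemma associator_letters:
  assumes \<Phi>: "\<And>t. t \<in> lens \<Longrightarrow> sol0 t = sol1 t \<star> \<Phi>" and nil: "\<Phi> [] = 1"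
  shows "\<Phi> [X] = 0" "\<Phi> [Y] = 0"
proof -
  have Ln0: "((\<lambda>x::real. Ln (1 - of_real x)) \<longlongrightarrow> 0) (at_right 0)"
  proof -
    have "((\<lambda>x::real. Ln (1 - of_real x)) \<longlongrightarrow> Ln (1 - 0)) (at_right 0)"
      by (rule tendsto_Ln[OF tendsto_diff[OF tendsto_const tendsto_of_real_at_right]]) simp
    then show ?thesis by simp
  qed
  have "((\<lambda>x::real. sol0 (1 - of_real x) [X]) \<longlongrightarrow> 0) (at_right 0)"
  proof -
    have "eventually (\<lambda>x::real. Ln (1 - of_real x) = sol0 (1 - of_real x) [X]) (at_right 0)"
      using eventually_lens
      by eventually_elim (simp add: sol0_def lsol_def nc_mult_def expo_def locsol_single_0 lens_def resX_def resY_def)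
    with Ln0 show ?thesis by (simp add: filterlim_cong)
  qed
  with associator_limit[OF \<Phi>, of "[X]"] show "\<Phi> [X] = 0" by (auto intro: tendsto_unique[rotated])
  have "((\<lambda>x::real. sol0 (of_real x) [Y] - Ln (1 - of_real x)) \<longlongrightarrow> 0 - 0) (at_right 0)"
    using lsol_tendsto_0[of resX "[Y]" resY] by (intro tendsto_diff Ln0) (simp add: sol0_def resX_def)
  moreover have "eventually (\<lambda>x::real. sol0 (of_real x) [Y] - Ln (1 - of_real x) = \<Phi> [Y]) (at_right 0)"
    using eventually_lens
    by eventually_elim (simp add: \<Phi> nc_mult_def sol1_def lsol_def expo_def locsol_single_0 lens_def resX_def resY_def nil dist_norm norm_minus_commute)
  ultimately have "((\<lambda>x::real. \<Phi> [Y]) \<longlongrightarrow> 0) (at_right 0)" by (simp add: filterlim_cong)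
  then show "\<Phi> [Y] = 0" by (simp add: tendsto_const_iff)
qed

section \<open>Multiple zeta values as coefficients of the associator\<close>

text \<open>Taylor coefficients at 0 of the multiple polylogarithm of the word: \<open>X\<close>
  integrates against \<open>ds / s\<close> and \<open>Y\<close> against \<open>ds / (1 - s)\<close>.
  Division by 0 yields the constant term 0 of nonempty words.\<close>

primrec wcoef :: "xy list \<Rightarrow> nat \<Rightarrow> real" where
  "wcoef [] n = (if n = 0 then 1 else 0)"
| "wcoef (x # w) n = (case x of X \<Rightarrow> wcoef w n | Y \<Rightarrow> \<Sum>m<n. wcoef w m) / real n"

lemma wcoef_bounds: "0 \<le> wcoef w n \<and> wcoef w n \<le> 1"
proof (induction w arbitrary: n)
  case (Cons x w)
  have "(\<Sum>m<n. wcoef w m) \<le> (\<Sum>m<n. 1)" using Cons by (intro sum_mono) blast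
  moreover have "wcoef w n \<le> real n" if "n > 0"
  proof -
    have "1 \<le> real n" using that by simp
    then show ?thesis using Cons[of n] by linarith
  qed
  ultimately show ?case
    using Cons by (cases "n = 0") (auto split: xy.split intro!: divide_nonneg_nonneg sum_nonneg simp: divide_le_eq)
qed simp

lemma wcoef_0: "w \<noteq> [] \<Longrightarrow> wcoef w 0 = 0"
  by (cases w) simp_all

lemma wcoef_summable:
  assumes "norm (s::complex) < 1"
  shows "summable (\<lambda>n. norm (of_real (wcoef w n) * s ^ n))" "summable (\<lambda>n. of_real (wcoef w n) * s ^ n)"
proof -
  have "summable (\<lambda>n. norm s ^ n)" using assms by (simp add: summable_geometric)
  then show "summable (\<lambda>n. norm (of_real (wcoef w n) * s ^ n))"
  proof (rule summable_comparison_test'[where N = 0])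
    fix n
    have "wcoef w n * norm s ^ n \<le> norm s ^ n"
      using wcoef_bounds[of w n] by (intro mult_left_le_one_le) simp_all
    then show "norm (norm (of_real (wcoef w n) * s ^ n)) \<le> norm s ^ n"
      using wcoef_bounds[of w n] by (simp add: norm_mult norm_power)
  qed
  then show "summable (\<lambda>n. of_real (wcoef w n) * s ^ n)" by (rule summable_norm_cancel)
qed

definition wseries :: "xy list \<Rightarrow> complex \<Rightarrow> complex" where
  "wseries w s = (suminf (\<lambda>n. of_real (wcoef w n) * s ^ n))"

text \<open>The condition on \<open>X\<close> excludes integrating \<open>ds / s\<close> by itself,
  which would give a logarithm. For \<open>Y\<close> the partial sums come from the Cauchy product
  with the geometric series.\<close>

lemma wseries_deriv:
  assumes s: "norm s < 1" "s \<noteq> 0" and w: "x = X \<Longrightarrow> w \<noteq> []"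
  shows "(wseries (x # w) has_field_derivative (case x of X \<Rightarrow> wseries w s / s | Y \<Rightarrow> wseries w s / (1 - s))) (at s)"
proof -
  obtain K :: real where K: "norm s < K" "K < 1" using s dense by blast
  then have nK: "norm s < norm (complex_of_real K)" "norm (complex_of_real K) < 1"
    using norm_ge_zero[of s] by (simp_all del: norm_ge_zero)
  have "(wseries (x # w) has_field_derivative (suminf (\<lambda>n. diffs (\<lambda>n. of_real (wcoef (x # w) n)) n * s ^ n))) (at s)"
    unfolding wseries_def[abs_def] by (rule termdiffs_strong[OF wcoef_summable(2)[OF nK(2)] nK(1)])
  moreover have "(suminf (\<lambda>n. diffs (\<lambda>n. complex_of_real (wcoef (x # w) n)) n * s ^ n)) =
     (case x of X \<Rightarrow> wseries w s / s | Y \<Rightarrow> wseries w s / (1 - s))"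
  proof (cases x)
    case X
    have "s * (suminf (\<lambda>n. of_real (wcoef w (Suc n)) * s ^ n)) = (suminf (\<lambda>n. of_real (wcoef w (Suc n)) * s ^ Suc n))"
    proof -
      have "summable (\<lambda>n. s * (of_real (wcoef w (Suc n)) * s ^ n))"
        using summable_Suc_iff[of "\<lambda>n. of_real (wcoef w n) * s ^ n"] wcoef_summable(2)[OF s(1), of w]
        by (simp add: mult_ac)
      then have "summable (\<lambda>n. of_real (wcoef w (Suc n)) * s ^ n)" using s(2) by (simp add: summable_cmult_iff)
      from suminf_mult[OF this, of s] show ?thesis by (simp add: mult_ac)
    qed
    also have "\<dots> = wseries w s"
      using suminf_split_head[OF wcoef_summable(2)[OF s(1), of w]] X w by (simp add: wseries_def wcoef_0)
    finally have e: "s * suminf (\<lambda>n. of_real (wcoef w (Suc n)) * s ^ n) = wseries w s" .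
    have "diffs (\<lambda>n. complex_of_real (wcoef (x # w) n)) n = of_real (wcoef w (Suc n))" for n
      using X by (simp add: diffs_def del: of_nat_Suc)
    then show ?thesis using X s e by (simp add: nonzero_eq_divide_eq mult.commute)
  next
    case Y
    have "(\<lambda>n. \<Sum>i\<le>n. (of_real (wcoef w i) * s ^ i) * s ^ (n - i)) sums (wseries w s * (suminf (\<lambda>n. s ^ n)))"
      unfolding wseries_def
      by (rule Cauchy_product_sums) (use s wcoef_summable[OF s(1)] in \<open>auto simp: norm_power summable_geometric\<close>)
    moreover have "(\<Sum>i\<le>n. (of_real (wcoef w i) * s ^ i) * s ^ (n - i)) = diffs (\<lambda>n. of_real (wcoef (x # w) n)) n * s ^ n" for n
    proof -
      have "(\<Sum>i\<le>n. (of_real (wcoef w i) * s ^ i) * s ^ (n - i)) = (\<Sum>i\<le>n. of_real (wcoef w i) * s ^ n)"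
        by (rule sum.cong) (simp_all add: mult.assoc flip: power_add)
      then show ?thesis using Y
        by (simp add: diffs_def lessThan_Suc_atMost sum_distrib_right del: of_nat_Suc)
    qed
    ultimately show ?thesis using Y s by (simp add: sums_iff suminf_geometric)
  qed
  ultimately show ?thesis by simp
qed

lemma wseries_0: "w \<noteq> [] \<Longrightarrow> wseries w 0 = 0"
  using powser_zero[of "\<lambda>n. complex_of_real (wcoef w n)"] by (simp add: wseries_def wcoef_0)

lemma wseries_cont:
  assumes "norm s < 1"
  shows "isCont (wseries w) s"
proof -
  obtain K :: real where K: "norm s < K" "K < 1" using assms dense by blast
  then have nK: "norm s < norm (complex_of_real K)" "norm (complex_of_real K) < 1"
    using norm_ge_zero[of s] by (simp_all del: norm_ge_zero)
  show ?thesis unfolding wseries_def[abs_def] by (rule isCont_powser[OF wcoef_summable(2)[OF nK(2)] nK(1)])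
qed

text \<open>A final \<open>Y\<close> has residue 0 at the origin, so the commutator term disappears
  and a plain iterated integral remains. Each \<open>Y\<close> contributes a sign, since its form is
  \<open>1 / (t - 1)\<close> instead of \<open>1 / (1 - t)\<close>.\<close>

lemma locsol_wseries:
  assumes "w = [] \<or> last w = Y" "s \<in> ball 0 1"
  shows "locsol resX resY w s = (- 1) ^ count_list w Y * wseries w s"
  using assms
proof (induction w arbitrary: s)
  case Nil
  have "wseries [] s = 1"
    using sums_single[of 0 "\<lambda>_. 1::complex"] unfolding wseries_def
    by (intro sums_unique[symmetric]) (simp add: if_distrib if_distribR cong: if_cong)
  then show ?case by simp
next
  case (Cons x w)
  have last: "last (x # w) = Y" "w = [] \<or> last w = Y" "x = X \<Longrightarrow> w \<noteq> []" using Cons.prems by (auto split: if_splits)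
  define D where "D t = locsol resX resY (x # w) t - (- 1) ^ count_list (x # w) Y * wseries (x # w) t" for t
  have "(D has_field_derivative 0) (at t)" if t: "t \<in> ball 0 1 - {0}" for t
  proof -
    have t': "norm t < 1" "t \<noteq> 0" "t - 1 \<noteq> 0" "1 - t \<noteq> 0" using t by auto
    have "(D has_field_derivative
      (kz_rhs resX resY t (\<lambda>v. locsol resX resY v t) (x # w) / t - (- 1) ^ count_list (x # w) Y *
       (case x of X \<Rightarrow> wseries w t / t | Y \<Rightarrow> wseries w t / (1 - t)))) (at t)"
      unfolding D_def[abs_def] using t
      by (intro DERIV_diff DERIV_cmult locsol_deriv wseries_deriv last) auto
    moreover have "kz_rhs resX resY t (\<lambda>v. locsol resX resY v t) (x # w) / t - (- 1) ^ count_list (x # w) Y *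
       (case x of X \<Rightarrow> wseries w t / t | Y \<Rightarrow> wseries w t / (1 - t)) = 0"
    proof -
      have l: "locsol resX resY w t = (- 1) ^ count_list w Y * wseries w t" using Cons.IH[OF last(2), of t] t by simp
      have y: "resX (last (x # w)) = 0" using last(1) by (simp add: resX_def)
      show ?thesis
      proof (cases x)
        case X
        then show ?thesis using t' y by (simp add: kz_rhs_word l resX_def resY_def del: last.simps)
      next
        case Y
        have "a / (t - 1) = - (a / (1 - t))" for a by (metis minus_diff_eq divide_minus_right)
        with Y show ?thesis using t' y by (simp add: kz_rhs_word l resX_def resY_def del: last.simps)
      qed
    qed
    ultimately show ?thesis by simp
  qed
  moreover have "continuous_on (ball 0 1) D"
    unfolding D_def[abs_def]
    by (intro continuous_at_imp_continuous_on ballI continuous_intros locsol_cont wseries_cont) auto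
  ultimately obtain c where c: "\<And>t. t \<in> ball 0 1 \<Longrightarrow> D t = c"
    using DERIV_zero_connected_constant[of "ball 0 1" "{0}" D]
    by (metis connected_ball finite.emptyI finite.insertI open_ball)
  have "D 0 = 0" by (simp add: D_def locsol_0 wseries_0 del: wcoef.simps)
  then have "D s = 0" using c[of 0] c[OF Cons.prems(2)] by simp
  then show ?case by (simp add: D_def)
qed

lemma sol0_wseries:
  assumes "last w = Y" "w \<noteq> []" "s \<in> ball 0 1"
  shows "sol0 s w = (- 1) ^ count_list w Y * wseries w s"
proof -
  have "prod_list (map resX (drop j w)) = 0" if "j < length w" for j
  proof -
    have "Y \<in> set (drop j w)" using assms(1) that by (metis drop_eq_Nil last_drop last_in_set linorder_not_less)
    then have "0 \<in> set (map resX (drop j w))" by (force simp: resX_def)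
    then show ?thesis by (simp add: prod_list_zero_iff)
  qed
  then have "sol0 s w = (\<Sum>j\<le>length w. if j = length w then locsol resX resY w s else 0)"
    unfolding sol0_def lsol_def nc_mult_def by (intro sum.cong) (auto simp: expo_def)
  then show ?thesis using locsol_wseries[of w s] assms by simp
qed

text \<open>A converse of Abel's theorem for nonnegative coefficients: the partial sums are bounded
  by the limit, hence the series converges, and each Abel mean is at most its sum.\<close>

lemma sums_from_Abel_limit:
  fixes a :: "nat \<Rightarrow> real"
  assumes a: "\<And>n. 0 \<le> a n" and s: "\<And>x. 0 < x \<Longrightarrow> x < 1 \<Longrightarrow> summable (\<lambda>n. a n * (1 - x) ^ n)"
    and L: "((\<lambda>x. suminf (\<lambda>n. a n * (1 - x) ^ n)) \<longlongrightarrow> L) (at_right 0)"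
  shows "a sums L"
proof -
  have ev: "eventually (\<lambda>x::real. 0 < x \<and> x < 1) (at_right 0)"
    using eventually_at_right_real[of 0 1] by (auto elim: eventually_mono)
  have le: "(\<Sum>n<N. a n) \<le> L" for N
  proof (rule tendsto_le[OF _ L])
    have "((\<lambda>x::real. \<Sum>n<N. a n * (1 - x) ^ n) \<longlongrightarrow> (\<Sum>n<N. a n * (1 - 0) ^ n)) (at_right 0)"
      by (intro tendsto_intros)
    then show "((\<lambda>x::real. \<Sum>n<N. a n * (1 - x) ^ n) \<longlongrightarrow> (\<Sum>n<N. a n)) (at_right 0)" by simp
    show "eventually (\<lambda>x. (\<Sum>n<N. a n * (1 - x) ^ n) \<le> (suminf (\<lambda>n. a n * (1 - x) ^ n))) (at_right 0)"
      using ev by eventually_elim (intro sum_le_suminf s, auto intro!: mult_nonneg_nonneg a)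
  qed simp
  then have sum: "summable a" by (intro summableI_nonneg_bounded[of a L] a)
  have "L \<le> suminf a"
  proof (rule tendsto_le[OF _ tendsto_const L])
    show "eventually (\<lambda>x. (suminf (\<lambda>n. a n * (1 - x) ^ n)) \<le> suminf a) (at_right 0)"
      using ev
    proof eventually_elim
      case (elim x)
      have "a n * (1 - x) ^ n \<le> a n" for n
        using elim a[of n] by (intro mult_left_le power_le_one) auto
      then show ?case using elim by (intro suminf_le s sum) auto
    qed
  qed simp
  moreover have "suminf a \<le> L" by (rule suminf_le_const[OF sum le])
  ultimately show ?thesis using sum by (metis order_antisym summable_sums)
qed

text \<open>The coefficient of the associator is an Abel limit at 1 of a power series with
  nonnegative real coefficients; convergence and reality follow together.\<close>

lemma associator_sums:
  assumes \<Phi>: "\<And>t. t \<in> lens \<Longrightarrow> sol0 t = sol1 t \<star> \<Phi>" and w: "hd w = X" "last w = Y" "w \<noteq> []"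
  shows "(\<lambda>n. wcoef w n) sums Re ((- 1) ^ count_list w Y * \<Phi> w)"
    "(- 1) ^ count_list w Y * \<Phi> w \<in> \<real>"
proof -
  define f :: "real \<Rightarrow> real" where "f x = (suminf (\<lambda>n. wcoef w n * (1 - x) ^ n))" for x
  have sm: "summable (\<lambda>n. wcoef w n * (1 - x) ^ n)" if "0 < x" "x < 1" for x :: real
  proof -
    have "summable (\<lambda>n. norm (of_real (wcoef w n) * (complex_of_real (1 - x)) ^ n))"
    proof (rule wcoef_summable(1))
      show "norm (complex_of_real (1 - x)) < 1" unfolding norm_of_real using that by (auto simp: abs_less_iff)
    qed
    moreover have "norm (of_real (wcoef w n) * (complex_of_real (1 - x)) ^ n) = wcoef w n * (1 - x) ^ n" for n
      using that wcoef_bounds[of w n] unfolding norm_mult norm_power norm_of_real by simp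
    ultimately show ?thesis by simp
  qed
  have ev: "eventually (\<lambda>x::real. 0 < x \<and> x < 1) (at_right 0)"
    using eventually_at_right_real[of 0 1] by (auto elim: eventually_mono)
  have "((\<lambda>x::real. (- 1) ^ count_list w Y * sol0 (1 - of_real x) w) \<longlongrightarrow> (- 1) ^ count_list w Y * \<Phi> w) (at_right 0)"
    by (intro tendsto_mult tendsto_const associator_limit[OF \<Phi> w(1,3)])
  moreover have "eventually (\<lambda>x. (- 1) ^ count_list w Y * sol0 (1 - of_real x) w = complex_of_real (f x)) (at_right 0)"
    using ev eventually_lens
  proof eventually_elim
    case (elim x)
    have "complex_of_real (f x) = wseries w (1 - of_real x)"
      unfolding wseries_def f_def using suminf_of_real[OF sm, of x, where 'a = complex] elim by simp
    moreover have "1 - complex_of_real x \<in> ball 0 1" using elim by (simp add: lens_def)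
    ultimately show ?case using w by (simp add: sol0_wseries flip: mult.assoc power_mult_distrib)
  qed
  ultimately have lim: "((\<lambda>x. complex_of_real (f x)) \<longlongrightarrow> (- 1) ^ count_list w Y * \<Phi> w) (at_right 0)"
    by (simp add: filterlim_cong)
  show "(\<lambda>n. wcoef w n) sums Re ((- 1) ^ count_list w Y * \<Phi> w)"
    using tendsto_Re[OF lim] wcoef_bounds sm by (intro sums_from_Abel_limit) (auto simp: f_def)
  show "(- 1) ^ count_list w Y * \<Phi> w \<in> \<real>"
    using tendsto_Im[OF lim] by (simp add: complex_is_Real_iff tendsto_const_iff)
qed

section \<open>Nested sums and multiple zeta values\<close>

definition decr :: "nat \<Rightarrow> nat \<Rightarrow> nat list set" where
  "decr r N = {ns. length ns = r \<and> sorted_wrt (>) ns \<and> 0 \<notin> set ns \<and> (\<forall>n\<in>set ns. n \<le> N)}"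

lemma decr_Suc: "decr (Suc r) N = (\<Union>n\<in>{1..N}. (#) n ` decr r (n - 1))"
proof (intro equalityI subsetI)
  fix xs assume xs: "xs \<in> decr (Suc r) N"
  then obtain n ns where ns: "xs = n # ns" by (cases xs) (auto simp: decr_def)
  with xs have "n \<in> {1..N}" "ns \<in> decr r (n - 1)" by (fastforce simp: decr_def)+
  with ns show "xs \<in> (\<Union>n\<in>{1..N}. (#) n ` decr r (n - 1))" by blast
next
  fix xs assume "xs \<in> (\<Union>n\<in>{1..N}. (#) n ` decr r (n - 1))"
  then obtain n ns where ns: "xs = n # ns" "n \<in> {1..N}" "ns \<in> decr r (n - 1)" by blast
  then show "xs \<in> decr (Suc r) N" by (fastforce simp: decr_def)
qed

lemma decr_0: "decr 0 N = {[]}"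
  by (auto simp: decr_def)

lemma finite_decr: "finite (decr r N)"
  by (induction r arbitrary: N) (simp_all add: decr_0 decr_Suc)

lemma wcoef_replicate:
  "wcoef (replicate j X @ Y # w) n = (\<Sum>m<n. wcoef w m) / real n ^ Suc j"
  by (induction j) simp_all

lemma sum_decr:
  assumes "0 \<notin> set ks"
  shows "(\<Sum>n\<le>N. wcoef (mzv_word ks) n) = (\<Sum>ns\<in>decr (length ks) N. \<Prod>i<length ks. 1 / real (ns ! i) ^ (ks ! i))"
  using assms
proof (induction ks arbitrary: N)
  case Nil
  then show ?case by (simp add: decr_0 mzv_word_def)
next
  case (Cons k ks)
  let ?f = "\<lambda>ns. \<Prod>i<length ks. 1 / real (ns ! i) ^ (ks ! i)"
  let ?g = "\<lambda>ns. \<Prod>i<length (k # ks). 1 / real (ns ! i) ^ ((k # ks) ! i)"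
  have k: "Suc (k - 1) = k" using Cons.prems by simp
  have w: "mzv_word (k # ks) = replicate (k - 1) X @ Y # mzv_word ks" by (simp add: mzv_word_def)
  have "(\<Sum>n\<le>N. wcoef (mzv_word (k # ks)) n) = (\<Sum>n\<in>{1..N}. wcoef (mzv_word (k # ks)) n)"
    by (rule sum.mono_neutral_right) (auto simp: w wcoef_0 not_less_eq_eq)
  also have "\<dots> = (\<Sum>n\<in>{1..N}. \<Sum>ns\<in>decr (length ks) (n - 1). ?g (n # ns))"
  proof (rule sum.cong[OF HOL.refl])
    fix n assume n: "n \<in> {1..N}"
    then have "{..<n} = {..n - 1}" by auto
    then have "wcoef (mzv_word (k # ks)) n = (\<Sum>ns\<in>decr (length ks) (n - 1). ?f ns) / real n ^ k"
      unfolding w wcoef_replicate k using Cons by simp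
    then show "wcoef (mzv_word (k # ks)) n = (\<Sum>ns\<in>decr (length ks) (n - 1). ?g (n # ns))"
      by (simp add: sum_divide_distrib prod.lessThan_Suc_shift del: prod.lessThan_Suc)
  qed
  also have "\<dots> = (\<Sum>n\<in>{1..N}. \<Sum>ns\<in>(#) n ` decr (length ks) (n - 1). ?g ns)"
    by (rule sum.cong[OF HOL.refl]) (simp add: sum.reindex)
  also have "\<dots> = (\<Sum>ns\<in>decr (length (k # ks)) N. ?g ns)"
    unfolding list.size(4) add_Suc_right add_0_right decr_Suc
    by (rule sum.UNION_disjoint[symmetric]) (auto simp: finite_decr)
  finally show ?case .
qed

text \<open>\<open>mzv\<close> is an unordered sum of nonnegative terms. It is squeezed, because
  every finite index set lies in some truncation \<open>decr r N\<close> and every truncation is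
  itself finite.\<close>

lemma mzv_sums:
  assumes ks: "0 \<notin> set ks" and L: "wcoef (mzv_word ks) sums L"
  shows "mzv ks = L"
proof -
  define r where "r = length ks"
  define S :: "nat list set" where "S = {ns. length ns = r \<and> sorted_wrt (>) ns \<and> 0 \<notin> set ns}"
  define f :: "nat list \<Rightarrow> real" where "f ns = (\<Prod>i<r. 1 / real (ns ! i) ^ (ks ! i))" for ns
  have f0: "f ns \<ge> 0" for ns by (auto simp: f_def intro: prod_nonneg)
  have sum_f: "sum f (decr r N) = (\<Sum>n\<le>N. wcoef (mzv_word ks) n)" for N
    using sum_decr[OF ks, of N] by (simp add: f_def[abs_def] r_def)
  have sum_le: "sum f F \<le> L" if F: "finite F" "F \<subseteq> S" for F :: "nat list set"
  proof -
    have "finite (\<Union> (set ` F))" using F by auto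
    then obtain N where "\<forall>n\<in>\<Union> (set ` F). n \<le> N" using finite_nat_set_iff_bounded_le by auto
    then have "F \<subseteq> decr r N" using F by (auto simp: decr_def S_def)
    then have "sum f F \<le> sum f (decr r N)" by (intro sum_mono2 finite_decr) (auto simp: f0)
    also have "\<dots> \<le> suminf (wcoef (mzv_word ks))"
      unfolding sum_f using L wcoef_bounds by (intro sum_le_suminf) (auto simp: sums_iff)
    finally show ?thesis using L by (simp add: sums_iff)
  qed
  have sm: "f summable_on S"
    by (rule nonneg_bdd_above_summable_on) (auto simp: f0 intro!: bdd_aboveI[of _ L] sum_le)
  have "infsum f S \<le> L" by (rule infsum_le_finite_sums[OF sm sum_le])
  moreover have "(\<Sum>n<N. wcoef (mzv_word ks) n) \<le> infsum f S" for N
  proof -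
    have "(\<Sum>n<N. wcoef (mzv_word ks) n) \<le> (\<Sum>n\<le>N. wcoef (mzv_word ks) n)"
      using wcoef_bounds by (intro sum_mono2) auto
    also have "\<dots> \<le> infsum f S"
      unfolding sum_f[symmetric] by (rule finite_sum_le_infsum[OF sm finite_decr]) (auto simp: f0 decr_def S_def)
    finally show ?thesis .
  qed
  then have "L \<le> infsum f S" using L by (intro LIMSEQ_le_const2[of _ L]) (auto simp: sums_def)
  ultimately show ?thesis by (simp add: mzv_def S_def r_def f_def[abs_def])
qed

section \<open>Shuffle regularization\<close>

lemma sh_single: "sh z [y] w = (\<Sum>i\<le>length w. z (take i w @ y # drop i w) :: 'a::comm_monoid_add)"
proof (induction w arbitrary: z)
  case (Cons x w)
  then show ?case by (simp add: sh_Cons sum.atMost_Suc_shift del: sum.atMost_Suc)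
qed simp

lemma insert_leading:
  "i \<le> length (takeWhile (\<lambda>a. a = y) v) \<Longrightarrow> take i v @ y # drop i v = y # v"
proof (induction v arbitrary: i)
  case (Cons a v)
  then show ?case by (cases i) (auto split: if_splits)
qed simp

lemma takeWhile_take_append:
  "length (takeWhile P v) < i \<Longrightarrow> i \<le> length v \<Longrightarrow> takeWhile P (take i v @ u) = takeWhile P v"
proof (induction v arbitrary: i)
  case (Cons a v)
  then show ?case by (cases i) auto
qed simp

lemma length_takeWhile_append: "length (takeWhile P u) \<le> length (takeWhile P (u @ v))"
  by (induction u) auto

text \<open>Keeps the second summand of the regularization measure from growing: inserting a letter
  other than \<open>x\<close> can at most cut a final block of \<open>x\<close>.\<close>

lemma trailing_insert:
  assumes "x \<noteq> y"
  shows "length (takeWhile (\<lambda>a. a = x) (rev (take i v @ y # drop i v))) \<le> length (takeWhile (\<lambda>a. a = x) (rev (y # v)))"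
proof -
  have "takeWhile (\<lambda>a. a = x) (rev (take i v @ y # drop i v)) = takeWhile (\<lambda>a. a = x) (rev (drop i v))"
    using assms by (simp add: takeWhile_tail)
  moreover have "rev (y # v) = rev (drop i v) @ rev (take i v) @ [y]"
    by (simp flip: rev_append append_assoc)
  ultimately show ?thesis using length_takeWhile_append by metis
qed

text \<open>Among the insertions of \<open>y\<close> into \<open>v\<close>, the \<open>k + 1\<close>
  ones at the leading block of \<open>y\<close> all give \<open>y # v\<close>. The others have one
  leading \<open>y\<close> less.\<close>

lemma lead_step:
  fixes z :: "'l list \<Rightarrow> complex"
  assumes "sh z [y] v = 0"
  defines "k \<equiv> length (takeWhile (\<lambda>a. a = y) v)"
  shows "of_nat (Suc k) * z (y # v) = - (\<Sum>i\<in>{Suc k..length v}. z (take i v @ y # drop i v))"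
proof -
  have kv: "k \<le> length v" by (simp add: k_def length_takeWhile_le)
  have "{..length v} = {..k} \<union> {Suc k..length v}" using kv by auto
  then have "sh z [y] v = (\<Sum>i\<in>{..k}. z (take i v @ y # drop i v)) + (\<Sum>i\<in>{Suc k..length v}. z (take i v @ y # drop i v))"
    unfolding sh_single by (simp add: sum.union_disjoint)
  also have "(\<Sum>i\<in>{..k}. z (take i v @ y # drop i v)) = (\<Sum>i\<in>{..k}. z (y # v))"
    by (rule sum.cong) (auto simp: insert_leading k_def)
  finally show ?thesis using assms(1) by (simp add: eq_neg_iff_add_eq_0 del: of_nat_Suc)
qed

lemma mzv_word_cover:
  "w = [] \<or> last w = Y \<Longrightarrow> \<exists>ks. w = mzv_word ks \<and> 0 \<notin> set ks \<and> (w \<noteq> [] \<longrightarrow> hd w = X \<longrightarrow> hd ks \<ge> 2)"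
proof (induction w)
  case Nil
  show ?case by (rule exI[of _ "[]"]) (simp add: mzv_word_def)
next
  case (Cons x w)
  then obtain ks where ks: "w = mzv_word ks" "0 \<notin> set ks" by (auto split: if_splits)
  show ?case
  proof (cases x)
    case Y
    then show ?thesis using ks by (intro exI[of _ "1 # ks"]) (simp add: mzv_word_def)
  next
    case X
    then have "w \<noteq> []" using Cons.prems by auto
    then obtain k ks' where k: "ks = k # ks'" using ks by (cases ks) (auto simp: mzv_word_def)
    then have "X # replicate (k - 1) X = replicate (Suc k - 1) X" using ks by (cases k) auto
    then show ?thesis using X ks k by (intro exI[of _ "Suc k # ks'"]) (auto simp: mzv_word_def)
  qed
qed

text \<open>The conditions of \<open>zeta_reg\<close> for complex-valued functions, so that
  coefficients of the associator can be tested before they are known to be real.\<close>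

definition mzv_reg :: "(xy list \<Rightarrow> complex) \<Rightarrow> bool" where
  "mzv_reg z \<longleftrightarrow> z [] = 1 \<and> (\<forall>u v. z u * z v = sh z u v) \<and> z [X] = 0 \<and> z [Y] = 0 \<and>
     (\<forall>ks. admissible ks \<longrightarrow> z (mzv_word ks) = of_real (mzv ks))"

lemma mzv_algebra_sum: "(\<And>i. i \<in> I \<Longrightarrow> f i \<in> mzv_algebra) \<Longrightarrow> sum f I \<in> mzv_algebra"
  using mzv_algebra.of_rat[of 0] by (induction I rule: infinite_finite_induct) (auto intro: mzv_algebra.add)

lemma of_rat_complex_real: "(of_rat q :: complex) \<in> \<real>"
  by (cases q) (simp add: of_rat_rat)

lemma mzv_algebra_real: "x \<in> mzv_algebra \<Longrightarrow> x \<in> \<real>"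
  by (induction rule: mzv_algebra.induct) (auto intro: of_rat_complex_real)

lemma mzv_reg_determined_step:
  assumes c: "\<And>i. i \<in> I \<Longrightarrow> \<exists>c\<in>mzv_algebra. \<forall>z. mzv_reg z \<longrightarrow> z (u i) = c"
    and rel: "\<And>z. mzv_reg z \<Longrightarrow> of_nat (Suc k) * z w = - (\<Sum>i\<in>I. z (u i))"
  shows "\<exists>c\<in>mzv_algebra. \<forall>z. mzv_reg z \<longrightarrow> z w = c"
proof -
  obtain C where C: "\<And>i. i \<in> I \<Longrightarrow> C i \<in> mzv_algebra" "\<And>i z. i \<in> I \<Longrightarrow> mzv_reg z \<Longrightarrow> z (u i) = C i"
    using c by metis
  define d where "d = of_rat (- (1 / of_nat (Suc k))) * (\<Sum>i\<in>I. C i)"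
  have "z w = d" if "mzv_reg z" for z
  proof -
    have "of_nat (Suc k) * z w = - (\<Sum>i\<in>I. C i)" using rel[OF that] C(2)[OF _ that] by simp
    then have "z w = - (\<Sum>i\<in>I. C i) / of_nat (Suc k)"
      by (metis nonzero_mult_div_cancel_left of_nat_eq_0_iff nat.distinct(2))
    then show ?thesis by (simp add: d_def of_rat_minus of_rat_divide del: of_nat_Suc)
  qed
  moreover have "d \<in> mzv_algebra" unfolding d_def by (intro mzv_algebra.mult mzv_algebra.of_rat mzv_algebra_sum C)
  ultimately show ?thesis by blast
qed

text \<open>Shuffling with a single letter of value 0 lowers the number of leading \<open>Y\<close>
  plus trailing \<open>X\<close> until convergent words remain. A value in
  \<open>mzv_algebra\<close> common to all solutions gives uniqueness, membership and, with it,
  reality.\<close>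

lemma mzv_reg_determined: "\<exists>c\<in>mzv_algebra. \<forall>z. mzv_reg z \<longrightarrow> z w = c"
proof (induction w rule: measure_induct_rule[where f = "\<lambda>w. length (takeWhile (\<lambda>a. a = Y) w) + length (takeWhile (\<lambda>a. a = X) (rev w))"])
  case (less w)
  consider v where "w = Y # v" | v where "w = v @ [X]" | "w = [] \<or> (hd w = X \<and> last w = Y)"
    by (metis append_butlast_last_id list.exhaust_sel xy.exhaust)
  then show ?case
  proof cases
    case 1
    define k where "k = length (takeWhile (\<lambda>a. a = Y) v)"
    show ?thesis
    proof (rule mzv_reg_determined_step[where I = "{Suc k..length v}" and k = k and u = "\<lambda>i. take i v @ Y # drop i v"])
      fix i assume i: "i \<in> {Suc k..length v}"
      then have "takeWhile (\<lambda>a. a = Y) (take i v @ Y # drop i v) = takeWhile (\<lambda>a. a = Y) v"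
        by (intro takeWhile_take_append) (auto simp: k_def)
      with trailing_insert[of X Y i v]
      show "\<exists>c\<in>mzv_algebra. \<forall>z. mzv_reg z \<longrightarrow> z (take i v @ Y # drop i v) = c"
        by (intro less) (simp add: 1 del: rev.simps rev_append)
    next
      fix z assume "mzv_reg z"
      then have "sh z [Y] v = 0" unfolding mzv_reg_def by (metis mult_zero_left)
      from lead_step[OF this] show "of_nat (Suc k) * z w = - (\<Sum>i\<in>{Suc k..length v}. z (take i v @ Y # drop i v))"
        by (simp only: k_def 1)
    qed
  next
    case 2
    define v' where "v' = rev v"
    define k where "k = length (takeWhile (\<lambda>a. a = X) v')"
    have w: "w = rev (X # v')" by (simp add: 2 v'_def)
    show ?thesis
    proof (rule mzv_reg_determined_step[where I = "{Suc k..length v'}" and k = k and u = "\<lambda>i. rev (take i v' @ X # drop i v')"])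
      fix i assume i: "i \<in> {Suc k..length v'}"
      then have "takeWhile (\<lambda>a. a = X) (take i v' @ X # drop i v') = takeWhile (\<lambda>a. a = X) v'"
        by (intro takeWhile_take_append) (auto simp: k_def)
      with trailing_insert[of Y X i v']
      show "\<exists>c\<in>mzv_algebra. \<forall>z. mzv_reg z \<longrightarrow> z (rev (take i v' @ X # drop i v')) = c"
        by (intro less) (simp add: w del: rev.simps rev_append)
    next
      fix z assume "mzv_reg z"
      then have "sh z (rev [X]) (rev v') = 0" unfolding mzv_reg_def by (metis mult_zero_left rev_singleton_conv)
      then have "sh (\<lambda>w. z (rev w)) [X] v' = 0" unfolding sh_rev .
      from lead_step[OF this]
      show "of_nat (Suc k) * z w = - (\<Sum>i\<in>{Suc k..length v'}. z (rev (take i v' @ X # drop i v')))"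
        by (simp only: k_def w)
    qed
  next
    case 3
    then obtain ks where "w = mzv_word ks" "0 \<notin> set ks" "w \<noteq> [] \<longrightarrow> hd ks \<ge> 2" using mzv_word_cover by blast
    then have "admissible ks" "w = mzv_word ks" by (auto simp: admissible_def mzv_word_def)
    then show ?thesis using mzv_algebra.mzv by (auto simp: mzv_reg_def)
  qed
qed

lemma mzv_reg_algebra: "mzv_reg z \<Longrightarrow> z w \<in> mzv_algebra"
  using mzv_reg_determined[of w] by blast

lemma mzv_reg_unique: "mzv_reg z \<Longrightarrow> mzv_reg z' \<Longrightarrow> z w = z' w"
  using mzv_reg_determined[of w] by blast

lemma of_real_sh: "complex_of_real (sh f u v) = sh (\<lambda>w. of_real (f w)) u v"
proof -
  have "complex_of_real (sum_list (map f l)) = sum_list (map (\<lambda>w. of_real (f w)) l)" for l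
    by (induction l) simp_all
  then show ?thesis by (simp add: sh_def)
qed

text \<open>Existence is supplied by \<open>z\<close>, whose values are real as elements of
  \<open>mzv_algebra\<close>; with uniqueness this resolves the definite description.\<close>

lemma mzv_reg_zeta_reg:
  assumes z: "mzv_reg z"
  shows "z w = of_real (zeta_reg w)"
proof -
  define \<zeta> where "\<zeta> w = Re (z w)" for w
  have \<zeta>: "z w = of_real (\<zeta> w)" for w
    using mzv_algebra_real[OF mzv_reg_algebra[OF z, of w]] by (simp add: \<zeta>_def)
  have iff: "mzv_reg (\<lambda>w. of_real (y w)) \<longleftrightarrow> y [] = 1 \<and> (\<forall>u v. y u * y v = sum_list (map y (shuffle u v))) \<and>
      y [X] = 0 \<and> y [Y] = 0 \<and> (\<forall>ks. admissible ks \<longrightarrow> y (mzv_word ks) = mzv ks)" for y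
    unfolding mzv_reg_def of_real_sh[symmetric] by (simp add: sh_def flip: of_real_mult)
  have "mzv_reg (\<lambda>w. of_real (\<zeta> w))" using z by (simp flip: \<zeta>)
  note cond = this[unfolded iff]
  have "zeta_reg = \<zeta>"
    unfolding zeta_reg_def
  proof (rule the_equality, fact cond)
    fix y assume y: "y [] = 1 \<and> (\<forall>u v. y u * y v = sum_list (map y (shuffle u v))) \<and>
      y [X] = 0 \<and> y [Y] = 0 \<and> (\<forall>ks. admissible ks \<longrightarrow> y (mzv_word ks) = mzv ks)"
    from mzv_reg_unique[OF iff[THEN iffD2, OF y] z] show "y = \<zeta>" by (simp add: \<zeta> fun_eq_iff)
  qed
  then show ?thesis by (simp add: \<zeta>)
qed

lemma last_mzv_word: "ks \<noteq> [] \<Longrightarrow> mzv_word ks \<noteq> [] \<and> last (mzv_word ks) = Y"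
proof (induction ks)
  case (Cons k ks)
  then show ?case by (cases "ks = []") (simp_all add: mzv_word_def)
qed simp

lemma mzv_reg_associator:
  assumes \<Phi>: "\<And>t. t \<in> lens \<Longrightarrow> sol0 t = sol1 t \<star> \<Phi>" and g: "group_like \<Phi>"
  shows "mzv_reg (\<lambda>w. (- 1) ^ count_list w Y * \<Phi> w)"
  unfolding mzv_reg_def
proof (intro conjI allI impI)
  have nil: "\<Phi> [] = 1" using g by (simp add: group_like_def)
  show "(- 1) ^ count_list [] Y * \<Phi> [] = 1" "(- 1) ^ count_list [X] Y * \<Phi> [X] = 0" "(- 1) ^ count_list [Y] Y * \<Phi> [Y] = 0"
    using associator_letters[OF \<Phi> nil] nil by simp_all
  show "(- 1) ^ count_list u Y * \<Phi> u * ((- 1) ^ count_list v Y * \<Phi> v) = sh (\<lambda>w. (- 1) ^ count_list w Y * \<Phi> w) u v" for u v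
  proof -
    have "sh (\<lambda>w. (- 1) ^ count_list w Y * \<Phi> w) u v = sh (\<lambda>w. (- 1) ^ (count_list u Y + count_list v Y) * \<Phi> w) u v"
      by (rule sh_cong) (metis count_mset count_union)
    also have "\<dots> = (- 1) ^ (count_list u Y + count_list v Y) * (\<Phi> u * \<Phi> v)"
      using g by (simp add: sh_mult_left group_like_def)
    finally show ?thesis by (simp add: power_add)
  qed
  fix ks assume ks: "admissible ks"
  show "(- 1) ^ count_list (mzv_word ks) Y * \<Phi> (mzv_word ks) = of_real (mzv ks)"
  proof (cases ks)
    case Nil
    have "wcoef (mzv_word []) sums 1"
    proof -
      have "wcoef [] = (\<lambda>n. if n = 0 then 1 else 0)" by (simp add: fun_eq_iff)
      then show ?thesis using sums_single[of 0 "\<lambda>_. 1::real"] by (simp add: mzv_word_def)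
    qed
    from mzv_sums[OF _ this] show ?thesis using Nil nil by (simp add: mzv_word_def)
  next
    case (Cons k ks')
    let ?w = "mzv_word ks"
    have "hd ?w = X" using ks Cons by (cases "k - 1") (auto simp: mzv_word_def admissible_def)
    moreover have "last ?w = Y" "?w \<noteq> []"
      using Cons last_mzv_word by auto
    ultimately have *: "wcoef ?w sums Re ((- 1) ^ count_list ?w Y * \<Phi> ?w)" "(- 1) ^ count_list ?w Y * \<Phi> ?w \<in> \<real>"
      using associator_sums[OF \<Phi>] by blast+
    from mzv_sums[OF _ *(1)] have "Re ((- 1) ^ count_list ?w Y * \<Phi> ?w) = mzv ks" using ks by (simp add: admissible_def)
    then show ?thesis using *(2) by (metis of_real_Re)
  qed
qed

text \<open>Identifies the analytic connection series with \<open>Phi_KZ\<close>, so that the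
  monodromy relation speaks about multiple zeta values. The square of \<open>2 * pi * \<i>\<close>
  lies in the algebra by Euler's value of \<open>mzv [2]\<close>.\<close>

lemma associator_KZ:
  obtains E where "group_like Phi_KZ" "\<And>w. Phi_KZ w \<in> mzv_algebra" "group_like E"
    "Phi_KZ \<star> expo resX (2 * \<i> * pi) =
       expo resY (- (\<i> * pi)) \<star> E \<star> expo (\<lambda>_. 1) (2 * \<i> * pi) \<star> antipode E \<star> expo resY (- (\<i> * pi)) \<star> Phi_KZ"
    "(2 * pi * \<i>)\<^sup>2 \<in> mzv_algebra"
proof -
  obtain \<Phi> E where \<Phi>: "\<Phi> [] = 1" "group_like E" "\<And>t. t \<in> lens \<Longrightarrow> sol0 t = sol1 t \<star> \<Phi>"
    "\<Phi> \<star> expo resX (2 * \<i> * pi) = expo resY (- (\<i> * pi)) \<star> E \<star> expo (\<lambda>_. 1) (2 * \<i> * pi) \<star> antipode E \<star> expo resY (- (\<i> * pi)) \<star> \<Phi>"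
    by (rule monodromy) blast
  have half: "1 / 2 \<in> lens" by (simp add: lens_def dist_norm)
  have gs: "group_like (sol0 (1 / 2))" "group_like (sol1 (1 / 2))" using lens[OF half] group_like_sols by auto
  have "\<Phi> = antipode (sol1 (1 / 2)) \<star> sol0 (1 / 2)"
    unfolding \<Phi>(3)[OF half] by (simp add: antipode_mult_left[OF gs(2)] flip: nc_mult_assoc)
  then have g: "group_like \<Phi>" using gs group_like_mult group_like_antipode by metis
  note reg = mzv_reg_associator[OF \<Phi>(3) g]
  have KZ: "Phi_KZ = \<Phi>"
  proof
    fix w
    show "Phi_KZ w = \<Phi> w"
    proof -
      have "of_real (zeta_reg w) = (- 1) ^ count_list w Y * \<Phi> w" using mzv_reg_zeta_reg[OF reg, of w] by simp
      then show ?thesis by (simp add: Phi_KZ_def flip: mult.assoc power_mult_distrib)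
    qed
  qed
  have alg: "\<Phi> w \<in> mzv_algebra" for w
  proof -
    have "of_rat ((- 1) ^ count_list w Y) * ((- 1) ^ count_list w Y * \<Phi> w) \<in> mzv_algebra"
      by (intro mzv_algebra.mult mzv_algebra.of_rat mzv_reg_algebra[OF reg])
    then show ?thesis by (simp add: of_rat_power of_rat_minus flip: mult.assoc power_mult_distrib)
  qed
  have "(2 * pi * \<i>)\<^sup>2 \<in> mzv_algebra"
  proof -
    have w: "mzv_word [2] = [X, Y]" by (simp add: mzv_word_def numeral_2_eq_2)
    have "(\<lambda>n. wcoef [X, Y] (Suc n)) sums (pi\<^sup>2 / 6)"
    proof -
      have "wcoef [X, Y] (Suc n) = 1 / (real n + 1)\<^sup>2" for n
        by (simp add: power2_eq_square sum.lessThan_Suc_shift add.commute del: sum.lessThan_Suc)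
      then show ?thesis using inverse_squares_sums by (simp add: add.commute)
    qed
    then have "wcoef (mzv_word [2]) sums (pi\<^sup>2 / 6)"
      unfolding w using sums_Suc[of "wcoef [X, Y]"] by simp
    from mzv_sums[OF _ this] have "complex_of_real (mzv [2]) = (of_real pi)\<^sup>2 / 6" by (simp del: eq_divide_eq_numeral1)
    then have "(2 * pi * \<i>)\<^sup>2 = of_rat (- 24) * of_real (mzv [2])"
      by (simp add: power_mult_distrib of_rat_minus mult.commute)
    then show ?thesis using mzv_algebra.mult[OF mzv_algebra.of_rat mzv_algebra.mzv[of "[2]"], of "- 24"]
      by (simp add: admissible_def)
  qed
  then show ?thesis using that[OF _ _ \<Phi>(2)] g alg \<Phi>(4) unfolding KZ by blast
qed

section \<open>The trace of the associator\<close>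

text \<open>The degree \<open>m\<close> part of the exponential with the scalar left out: for the
  residues its coefficients lie in \<open>mzv_algebra\<close>, and the powers of
  \<open>2 * pi * \<i>\<close> are kept apart.\<close>

definition hexp :: "('l \<Rightarrow> complex) \<Rightarrow> nat \<Rightarrow> ('l, complex) series" where
  "hexp p m w = (if length w = m then prod_list (map p w) / fact m else 0)"

lemma expo_hexp:
  assumes "length v \<le> N"
  shows "expo p c v = (\<Sum>m\<le>N. nc_smult (c ^ m) (hexp p m)) v"
proof -
  have "(\<Sum>m\<le>N. nc_smult (c ^ m) (hexp p m)) v = (\<Sum>m\<le>N. if m = length v then expo p c v else 0)"
    unfolding sum_fun_app by (intro sum.cong HOL.refl) (simp add: nc_smult_def hexp_def expo_def)
  then show ?thesis using assms by simp
qed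

lemma cyc_cong: "(\<And>v. length v = length w \<Longrightarrow> f v = g v) \<Longrightarrow> cyc f w = cyc g w"
  by (simp add: cyc_def)

lemma hexp_0: "hexp p 0 = nc_one"
  by (auto simp: fun_eq_iff hexp_def nc_one_def)

lemma hexp_1: "hexp resX 1 = letter X" "hexp resY 1 = letter Y"
  by (auto simp: fun_eq_iff hexp_def letter_def resX_def resY_def length_Suc_conv split: if_splits)

lemma mzv_algebra_nc_mult:
  "(\<And>w. f w \<in> mzv_algebra) \<Longrightarrow> (\<And>w. g w \<in> mzv_algebra) \<Longrightarrow> (f \<star> g) w \<in> mzv_algebra"
  unfolding nc_mult_def by (intro mzv_algebra_sum mzv_algebra.mult)

lemma mzv_algebra_cyc: "(\<And>w. f w \<in> mzv_algebra) \<Longrightarrow> cyc f w \<in> mzv_algebra"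
  unfolding cyc_def by (intro mzv_algebra_sum)

lemma mzv_algebra_0_1: "0 \<in> mzv_algebra" "1 \<in> mzv_algebra"
  using mzv_algebra.of_rat[of 0] mzv_algebra.of_rat[of 1] by simp_all

lemma mzv_algebra_power: "x \<in> mzv_algebra \<Longrightarrow> x ^ n \<in> mzv_algebra"
  by (induction n) (auto intro: mzv_algebra.mult mzv_algebra_0_1)

lemma mzv_algebra_antipode: "(\<And>w. f w \<in> mzv_algebra) \<Longrightarrow> antipode f w \<in> mzv_algebra"
  unfolding antipode_def scaleQ_complex_def by (intro mzv_algebra.mult mzv_algebra.of_rat)

lemma of_rat_fact: "of_rat (fact n) = (fact n :: complex)"
  by (metis of_nat_fact of_rat_of_nat_eq)

lemma nc_smult_sum: "nc_smult c (\<Sum>i\<in>I. f i) = (\<Sum>i\<in>I. nc_smult c (f i))"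
  by (simp add: fun_eq_iff nc_smult_def sum_fun_app sum_distrib_left)

lemma nc_smult_smult: "nc_smult a (nc_smult b f) = nc_smult (a * b) f"
  by (simp add: fun_eq_iff nc_smult_def mult.assoc)

lemma mzv_algebra_hexp:
  assumes "\<And>x. p x \<in> mzv_algebra"
  shows "hexp p m w \<in> mzv_algebra"
proof -
  have "prod_list (map p w) \<in> mzv_algebra"
    by (induction w) (auto intro: mzv_algebra.mult mzv_algebra_0_1 assms)
  then have "of_rat (1 / of_nat (fact m)) * prod_list (map p w) \<in> mzv_algebra" by (intro mzv_algebra.mult mzv_algebra.of_rat)
  then show ?thesis using mzv_algebra_0_1 by (simp add: hexp_def of_rat_divide of_rat_fact)
qed

lemma mzv_algebra_letter: "letter x w \<in> mzv_algebra"
  using mzv_algebra_0_1 by (simp add: letter_def)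

text \<open>
  Taking traces in the monodromy relation removes the conjugation by the unknown series \<open>E\<close>.
  In real parts only even powers of \<open>2\<pi>\<i>\<close> remain; the lowest one has the coefficient below.
\<close>

lemma cyc_associator_mod:
  fixes w :: "xy list"
  shows "\<exists>y\<in>mzv_algebra. cyc (letter Y \<star> (Phi_KZ \<star> (letter X \<star> antipode Phi_KZ))) w - cyc (letter Y \<star> letter X) w = y * (2 * pi * \<i>)\<^sup>2"
proof -
  obtain E where g: "group_like Phi_KZ" and alg: "\<And>w. Phi_KZ w \<in> mzv_algebra" and gE: "group_like E"
    and mono: "Phi_KZ \<star> expo resX (2 * \<i> * pi) =
       expo resY (- (\<i> * pi)) \<star> E \<star> expo (\<lambda>_. 1) (2 * \<i> * pi) \<star> antipode E \<star> expo resY (- (\<i> * pi)) \<star> Phi_KZ"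
    and pi2: "(2 * pi * \<i>)\<^sup>2 \<in> mzv_algebra"
    by (rule associator_KZ) blast
  define c :: complex where "c = 2 * \<i> * pi"
  define N where "N = length w"
  let ?P = "Phi_KZ" and ?Q = "antipode Phi_KZ"
  have PQ: "?P \<star> ?Q = nc_one" by (rule antipode_mult_right[OF g])
  have c2: "c\<^sup>2 \<in> mzv_algebra" "c\<^sup>2 \<noteq> 0" "(2 * pi * \<i>)\<^sup>2 = c\<^sup>2"
    using pi2 by (simp_all add: c_def power_mult_distrib)
  show ?thesis
  proof (cases "N > 2")
    \<comment> \<open>Up to length 2 only the constant terms 1 of the associator and of its inverse
      enter, and both sides agree exactly.\<close>
    case False
    have P1: "?P [] = 1" "?Q [] = 1" using g group_like_antipode[OF g] by (simp_all add: group_like_def)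
    have "cyc (letter Y \<star> (?P \<star> (letter X \<star> ?Q))) w = cyc (letter Y \<star> letter X) w"
    proof (rule cyc_cong)
      fix v :: "xy list" assume "length v = length w"
      then have "length v \<le> 2" using False N_def by simp
      then consider "v = []" | a where "v = [a]" | a b where "v = [a, b]"
        by (cases v; cases "tl v"; cases "tl (tl v)") auto
      then show "(letter Y \<star> (?P \<star> (letter X \<star> ?Q))) v = (letter Y \<star> letter X) v"
      proof cases
        case (3 a b)
        have "(?P \<star> (letter X \<star> ?Q)) [b] = letter X [b]"
          by (simp add: nc_mult_Cons P1) (simp add: letter_def P1 letter_mult_Cons nc_mult_def)
        then show ?thesis by (simp add: 3 letter_mult_Cons)
      qed (simp_all add: letter_mult_Cons letter_def)
    qed
    then show ?thesis using mzv_algebra_0_1 by (intro bexI[of _ 0]) simp_all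
  next
    case True
    \<comment> \<open>\<open>q m n\<close> is the coefficient of \<open>c ^ (m + n)\<close> when
      both exponentials are expanded by degree.\<close>
    define q where "q m n = cyc (hexp resY m \<star> (?P \<star> (hexp resX n \<star> ?Q))) w" for m n
    have qalg: "q m n \<in> mzv_algebra" for m n
      unfolding q_def
      by (intro mzv_algebra_cyc mzv_algebra_nc_mult mzv_algebra_hexp mzv_algebra_antipode alg)
        (simp_all add: resX_def resY_def mzv_algebra_0_1)
    have hexp_cyc: "cyc (hexp p n :: (xy, complex) series) w = 0" if "n \<noteq> N" for n p
      using that by (simp add: cyc_def hexp_def N_def)
    \<comment> \<open>If one of the two exponentials contributes degree 0, the conjugation
      disappears under the trace, and a homogeneous series of degree different from \<open>N\<close>
      is left.\<close>
    have q0: "q 0 n = 0" if "n \<noteq> N" for n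
    proof -
      have "q 0 n = cyc ((hexp resX n \<star> ?Q) \<star> ?P) w"
        by (simp add: q_def hexp_0 cyc_mult_commute[of ?P])
      then show ?thesis using antipode_mult_left[OF g] hexp_cyc[OF that] by (simp add: nc_mult_assoc)
    qed
    have q0': "q m 0 = 0" if "m \<noteq> N" for m
      using hexp_cyc[OF that] by (simp add: q_def hexp_0 PQ)
    have "?P \<star> (expo resX c \<star> ?Q) = (?P \<star> expo resX c) \<star> ?Q" by (simp add: nc_mult_assoc)
    also have "\<dots> = expo resY (- (\<i> * pi)) \<star> (E \<star> (expo (\<lambda>_. 1) c \<star> (antipode E \<star> expo resY (- (\<i> * pi)))))"
      unfolding c_def mono by (simp add: nc_mult_assoc PQ)
    finally have rel: "?P \<star> (expo resX c \<star> ?Q) = expo resY (- (\<i> * pi)) \<star> (E \<star> (expo (\<lambda>_. 1) c \<star> (antipode E \<star> expo resY (- (\<i> * pi)))))" .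
    \<comment> \<open>The two half turns around 1 undo the full turn; cyclicity brings them
      together.\<close>
    have eY: "expo resY (- (\<i> * pi)) \<star> (expo resY c \<star> (expo resY (- (\<i> * pi)))) = nc_one"
      by (simp add: c_def expo_0 flip: expo_add)
    have "cyc (expo resY c \<star> (?P \<star> (expo resX c \<star> ?Q))) =
      cyc ((expo resY c \<star> (expo resY (- (\<i> * pi)) \<star> (E \<star> (expo (\<lambda>_. 1) c \<star> antipode E)))) \<star> expo resY (- (\<i> * pi)))"
      unfolding rel by (simp add: nc_mult_assoc)
    also have "\<dots> = cyc ((expo resY (- (\<i> * pi)) \<star> (expo resY c \<star> expo resY (- (\<i> * pi)))) \<star> (E \<star> (expo (\<lambda>_. 1) c \<star> antipode E)))"
      unfolding cyc_mult_commute[of _ "expo resY (- (\<i> * pi))"] by (simp add: nc_mult_assoc)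
    also have "\<dots> = cyc (E \<star> (expo (\<lambda>_. 1) c \<star> antipode E))" by (simp add: eY)
    also have "\<dots> = cyc (expo (\<lambda>_. 1) c \<star> (antipode E \<star> E))"
      by (subst cyc_mult_commute) (simp add: nc_mult_assoc)
    also have "\<dots> = cyc (expo (\<lambda>_. 1) c)" by (simp add: antipode_mult_left[OF gE])
    finally have tr: "cyc (expo resY c \<star> (?P \<star> (expo resX c \<star> ?Q))) w = cyc (expo (\<lambda>_. 1) c) w" by simp
    define r :: complex where "r = of_rat (of_nat N / of_nat (fact N))"
    have r: "r \<in> mzv_algebra" by (simp add: r_def mzv_algebra.of_rat)
    have rhs: "cyc (expo (\<lambda>_. 1) c) w = c ^ N * r"
    proof -
      have "prod_list (map (\<lambda>_. 1 :: complex) v) = 1" for v :: "xy list" by (induction v) simp_all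
      then show ?thesis by (simp add: cyc_def expo_def N_def r_def of_rat_divide of_rat_fact)
    qed
    let ?eY = "\<Sum>m\<le>N. nc_smult (c ^ m) (hexp resY m)" and ?eX = "\<Sum>n\<le>N. nc_smult (c ^ n) (hexp resX n)"
    have "cyc (expo resY c \<star> (?P \<star> (expo resX c \<star> ?Q))) w = cyc (?eY \<star> (?P \<star> (?eX \<star> ?Q))) w"
    proof (rule cyc_cong)
      fix v :: "xy list" assume "length v = length w"
      then have v: "length v \<le> N" by (simp add: N_def)
      have 1: "(expo resX c \<star> ?Q) v = (?eX \<star> ?Q) v" if "length v \<le> N" for v
        by (rule nc_mult_cong_length[OF expo_hexp HOL.refl that])
      have 2: "(?P \<star> (expo resX c \<star> ?Q)) v = (?P \<star> (?eX \<star> ?Q)) v" if "length v \<le> N" for v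
        by (rule nc_mult_cong_length[OF HOL.refl 1 that])
      show "(expo resY c \<star> (?P \<star> (expo resX c \<star> ?Q))) v = (?eY \<star> (?P \<star> (?eX \<star> ?Q))) v"
        by (rule nc_mult_cong_length[OF expo_hexp 2 v])
    qed
    also have "\<dots> = (\<Sum>m\<le>N. \<Sum>n\<le>N. c ^ (m + n) * q m n)"
    proof -
      have "?eY \<star> (?P \<star> (?eX \<star> ?Q)) = (\<Sum>m\<le>N. \<Sum>n\<le>N. nc_smult (c ^ (m + n)) (hexp resY m \<star> (?P \<star> (hexp resX n \<star> ?Q))))"
        by (simp only: nc_mult_sum_left nc_mult_sum_right nc_smult_mult_left nc_smult_mult_right nc_smult_sum nc_smult_smult,
            subst sum.swap, simp add: power_add mult.commute)
      then show ?thesis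
        by (simp only: cyc_sum cyc_smult sum_fun_app q_def[symmetric]) (simp add: q_def nc_smult_def)
    qed
    finally have main: "(\<Sum>m\<le>N. \<Sum>n\<le>N. c ^ (m + n) * q m n) = c ^ N * r" using tr rhs by simp
    \<comment> \<open>All \<open>q m n\<close> are real, odd powers of \<open>c\<close> are
      imaginary and even ones real, so real parts keep exactly the even powers.\<close>
    define R where "R k = (if even k then c ^ k else 0)" for k
    have Re_R: "of_real (Re (c ^ k * x)) = R k * x" if x_alg: "x \<in> mzv_algebra" for k x
    proof -
      obtain y where x: "x = of_real y" using mzv_algebra_real[OF x_alg] by (auto elim: Reals_cases)
      have cc: "c ^ 2 = of_real (- 4 * pi\<^sup>2)" by (simp add: c_def power_mult_distrib)
      show ?thesis
      proof (cases "even k")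
        case True
        then have "c ^ k = of_real ((- 4 * pi\<^sup>2) ^ (k div 2))" using cc by (metis dvd_mult_div_cancel of_real_power power_mult)
        then have "c ^ k * x = of_real ((- 4 * pi\<^sup>2) ^ (k div 2) * y)" by (simp add: x)
        then have "of_real (Re (c ^ k * x)) = c ^ k * x" by (simp only: Re_complex_of_real)
        then show ?thesis using True by (simp add: R_def)
      next
        case False
        then have "c ^ k = c * of_real ((- 4 * pi\<^sup>2) ^ (k div 2))"
          using cc by (metis odd_two_times_div_two_succ of_real_power power_mult power_Suc Suc_eq_plus1)
        then have "c ^ k * x = \<i> * of_real (2 * pi * (- 4 * pi\<^sup>2) ^ (k div 2) * y)" by (simp add: x c_def)
        then have "Re (c ^ k * x) = 0" by (simp only: Re_i_times Im_complex_of_real)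
        then show ?thesis using False by (simp add: R_def)
      qed
    qed
    have "(\<Sum>m\<le>N. \<Sum>n\<le>N. R (m + n) * q m n) = of_real (Re (\<Sum>m\<le>N. \<Sum>n\<le>N. c ^ (m + n) * q m n))"
      by (simp only: Re_sum of_real_sum Re_R[OF qalg])
    then have evens: "(\<Sum>m\<le>N. \<Sum>n\<le>N. R (m + n) * q m n) = R N * r" unfolding main Re_R[OF r] .
    \<comment> \<open>Multiples of \<open>c ^ 4\<close> within the algebra: one factor
      \<open>c\<^sup>2\<close> will be cancelled in \<complex>, and the other accounts for the
      congruence.\<close>
    define I where "I = (\<lambda>y. c\<^sup>2 * c\<^sup>2 * y) ` mzv_algebra"
    have I0: "0 \<in> I" using mzv_algebra_0_1 by (force simp: I_def)
    have I_add: "x + y \<in> I" if xy: "x \<in> I" "y \<in> I" for x y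
    proof -
      obtain a b where "x = c\<^sup>2 * c\<^sup>2 * a" "y = c\<^sup>2 * c\<^sup>2 * b" "a \<in> mzv_algebra" "b \<in> mzv_algebra" using xy by (auto simp: I_def)
      then show ?thesis unfolding I_def by (intro image_eqI[of _ _ "a + b"] mzv_algebra.add) (simp_all add: distrib_left)
    qed
    have I_uminus: "- x \<in> I" if x: "x \<in> I" for x
    proof -
      obtain a where "x = c\<^sup>2 * c\<^sup>2 * a" "a \<in> mzv_algebra" using x by (auto simp: I_def)
      then show ?thesis unfolding I_def by (intro image_eqI[of _ _ "- a"] mzv_algebra_uminus) simp_all
    qed
    have I_sum: "sum f S \<in> I" if "\<And>x. x \<in> S \<Longrightarrow> f x \<in> I" for f :: "nat \<times> nat \<Rightarrow> complex" and S
      using that by (induction S rule: infinite_finite_induct) (auto intro: I0 I_add)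
    have R_I: "R k * x \<in> I" if k: "k \<ge> 3" and x: "x \<in> mzv_algebra" for k x
    proof (cases "even k")
      case True
      then obtain j where j: "k = 2 * j" by blast
      with k have "2 \<le> j" by simp
      then obtain i where "j = 2 + i" using le_Suc_ex by blast
      then have i: "j = Suc (Suc i)" by simp
      have "R k * x = (c\<^sup>2) ^ j * x" by (simp add: R_def j flip: power_mult)
      also have "\<dots> = c\<^sup>2 * c\<^sup>2 * ((c\<^sup>2) ^ i * x)" unfolding i power_Suc by (simp only: mult.assoc)
      finally have "R k * x = c\<^sup>2 * c\<^sup>2 * ((c\<^sup>2) ^ i * x)" .
      moreover have "(c\<^sup>2) ^ i * x \<in> mzv_algebra" by (intro mzv_algebra.mult mzv_algebra_power c2 x)
      ultimately show ?thesis by (auto simp: I_def)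
    qed (simp add: R_def I0)
    \<comment> \<open>For \<open>m + n \<ge> 3\<close> the first surviving power is the fourth.
      Below that, apart from \<open>m = n = 1\<close>, one index is 0, and \<open>q\<close> vanishes
      there because \<open>N > 2\<close>.\<close>
    have terms: "R (fst mn + snd mn) * q (fst mn) (snd mn) \<in> I" if mn: "mn \<noteq> (1, 1)" for mn
    proof -
      obtain m n where mn_eq: "mn = (m, n)" by (cases mn)
      consider "m + n \<ge> 3" | "m = 0" "n < 3" | "n = 0" "m < 3" using mn mn_eq by (cases m; cases n; auto; linarith?)
      then show ?thesis
        using R_I[OF _ qalg] q0[of n] q0'[of m] True I0 by cases (auto simp: mn_eq)
    qed
    let ?S = "{..N} \<times> {..N}" and ?f = "\<lambda>mn. R (fst mn + snd mn) * q (fst mn) (snd mn)"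
    have "sum ?f ?S = R N * r" using evens by (simp add: sum.cartesian_product case_prod_beta)
    moreover have "sum ?f ?S = ?f (1, 1) + sum ?f (?S - {(1, 1)})" using True by (intro sum.remove) auto
    ultimately have "c\<^sup>2 * q 1 1 = R N * r + - sum ?f (?S - {(1, 1)})" by (simp add: R_def numeral_2_eq_2 eq_diff_eq)
    also have "\<dots> \<in> I" using True by (intro I_add I_uminus I_sum terms R_I r) auto
    finally obtain y where y: "y \<in> mzv_algebra" "c\<^sup>2 * q 1 1 = c\<^sup>2 * c\<^sup>2 * y" by (auto simp: I_def)
    then have "c\<^sup>2 * q 1 1 = c\<^sup>2 * (y * c\<^sup>2)" by (simp only: mult_ac)
    then have "q 1 1 = y * c\<^sup>2" using c2(2) mult_left_cancel by blast
    moreover have "cyc (letter Y \<star> letter X :: (xy, complex) series) w = 0"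
    proof -
      have "(letter Y \<star> letter X :: (xy, complex) series) v = 0" if "length v = N" for v
        using that True by (cases v) (auto simp: letter_mult_Cons letter_def)
      then show ?thesis by (simp add: cyc_def N_def)
    qed
    ultimately show ?thesis using y(1) c2(3) by (intro bexI[of _ y]) (simp_all add: q_def hexp_1[unfolded One_nat_def])
  qed
qed

section \<open>Passing to the coefficient ring\<close>

text \<open>A ring homomorphism on \<open>mzv_algebra\<close>, where the partial quotient is
  meaningful; hence the membership conditions in what follows.\<close>

definition zcoeff :: "complex \<Rightarrow> coeff" where
  "zcoeff x = 1 \<otimes>\<^sub>Q zbar_of x"

lemma one_tensor_add: "1 \<otimes>\<^sub>Q (a + b) = 1 \<otimes>\<^sub>Q a + (1 :: 'a::comm_rat_algebra) \<otimes>\<^sub>Q (b :: 'b::comm_rat_algebra)"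
  by transfer (simp, subst add_mset_commute, rule tensor_eq.add_right)

lemma one_tensor_mult: "1 \<otimes>\<^sub>Q (a * b) = (1 \<otimes>\<^sub>Q a) * ((1 :: 'a::comm_rat_algebra) \<otimes>\<^sub>Q (b :: 'b::comm_rat_algebra))"
  by transfer (simp add: tensor_times_single tensor_times1_def tensor_eq.refl)

lemma one_tensor_scaleQ: "1 \<otimes>\<^sub>Q (q *\<^sub>Q a) = q *\<^sub>Q ((1 :: 'a::comm_rat_algebra) \<otimes>\<^sub>Q (a :: 'b::comm_rat_algebra))"
  by transfer (simp add: tensor_eq.sym[OF tensor_eq.scale])

lemma one_tensor_one: "1 \<otimes>\<^sub>Q 1 = (1 :: ('a::comm_rat_algebra, 'b::comm_rat_algebra) tensor)"
  by transfer (simp add: tensor_eq.refl)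

lemma zcoeff_add: "x \<in> mzv_algebra \<Longrightarrow> y \<in> mzv_algebra \<Longrightarrow> zcoeff (x + y) = zcoeff x + zcoeff y"
  by (simp add: zcoeff_def zbar_of_def plus_zbar.abs_eq zbar_rel_refl flip: one_tensor_add)

lemma zcoeff_mult: "x \<in> mzv_algebra \<Longrightarrow> y \<in> mzv_algebra \<Longrightarrow> zcoeff (x * y) = zcoeff x * zcoeff y"
  by (simp add: zcoeff_def zbar_of_def times_zbar.abs_eq zbar_rel_refl flip: one_tensor_mult)

lemma zcoeff_scaleQ: "x \<in> mzv_algebra \<Longrightarrow> zcoeff (q *\<^sub>Q x) = q *\<^sub>Q zcoeff x"
  by (simp add: zcoeff_def zbar_of_def scaleQ_zbar.abs_eq zbar_rel_refl scaleQ_complex_def flip: one_tensor_scaleQ)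

lemma zcoeff_1: "zcoeff 1 = 1"
  unfolding zcoeff_def zbar_of_def one_zbar_def[symmetric] by (rule one_tensor_one)

lemma zcoeff_0: "zcoeff 0 = 0"
  using zcoeff_add[of 0 0] mzv_algebra_0_1 by simp

lemma zcoeff_eqI:
  "x \<in> mzv_algebra \<Longrightarrow> y \<in> mzv_algebra \<Longrightarrow> z \<in> mzv_algebra \<Longrightarrow> x - y = z * (2 * pi * \<i>)\<^sup>2 \<Longrightarrow> zcoeff x = zcoeff y"
  unfolding zcoeff_def zbar_of_def by (simp add: Quotient3_rel_abs[OF Quotient3_zbar zbar_relI])

lemma zcoeff_sum: "(\<And>i. i \<in> I \<Longrightarrow> f i \<in> mzv_algebra) \<Longrightarrow> zcoeff (sum f I) = (\<Sum>i\<in>I. zcoeff (f i))"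
  by (induction I rule: infinite_finite_induct) (auto simp: zcoeff_0 zcoeff_add mzv_algebra_sum)

lemma zcoeff_nc_mult:
  "(\<And>w. f w \<in> mzv_algebra) \<Longrightarrow> (\<And>w. g w \<in> mzv_algebra) \<Longrightarrow> (\<lambda>w. zcoeff ((f \<star> g) w)) = (\<lambda>w. zcoeff (f w)) \<star> (\<lambda>w. zcoeff (g w))"
  by (simp add: fun_eq_iff nc_mult_def zcoeff_sum zcoeff_mult mzv_algebra.mult)

lemma zcoeff_cyc: "(\<And>w. f w \<in> mzv_algebra) \<Longrightarrow> zcoeff (cyc f w) = cyc (\<lambda>w. zcoeff (f w)) w"
  by (simp add: cyc_def zcoeff_sum)

lemma zcoeff_letter: "(\<lambda>w. zcoeff (letter x w)) = letter x"
  by (simp add: fun_eq_iff letter_def zcoeff_0 zcoeff_1)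

lemma zcoeff_antipode: "(\<And>w. f w \<in> mzv_algebra) \<Longrightarrow> (\<lambda>w. zcoeff (antipode f w)) = antipode (\<lambda>w. zcoeff (f w))"
  by (simp add: fun_eq_iff antipode_def zcoeff_scaleQ)

lemma zcoeff_group_like:
  assumes "group_like f" "\<And>w. f w \<in> mzv_algebra"
  shows "group_like (\<lambda>w. zcoeff (f w))"
proof -
  have sl: "sum_list (map f l) \<in> mzv_algebra \<and> zcoeff (sum_list (map f l)) = sum_list (map (\<lambda>w. zcoeff (f w)) l)" for l
    by (induction l) (simp_all add: zcoeff_0 zcoeff_add assms(2) mzv_algebra.add mzv_algebra_0_1)
  have "sh (\<lambda>w. zcoeff (f w)) u v = zcoeff (sh f u v)" for u v by (simp add: sh_def sl)
  then show ?thesis using assms by (simp add: group_like_def zcoeff_mult zcoeff_1)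
qed

text \<open>Both parts are substitution instances of facts about series in \<open>X\<close> and
  \<open>Y\<close>: conjugation by a group-like series keeps \<open>letter X\<close> primitive, and
  the congruence of cyclic sums for \<open>Phi_KZ\<close> becomes an equality over
  \<open>coeff\<close>. Replacing \<open>X\<close> by \<open>t01\<close> and \<open>Y\<close> by
  \<open>t12\<close> preserves both.\<close>

lemma
  shows frak_a_f2: "frak_a \<in> f2" and cyc_frak_a: "cyc (frak_a \<star> t12) = cyc (t01 \<star> t12)"
proof -
  obtain E where g: "group_like Phi_KZ" and alg: "\<And>w. Phi_KZ w \<in> mzv_algebra"
    by (rule associator_KZ) blast
  define \<Phi> :: "(xy, coeff) series" where "\<Phi> = (\<lambda>w. zcoeff (Phi_KZ w))"
  define s :: "xy \<Rightarrow> (ab, coeff) series" where "s x = (case x of X \<Rightarrow> t01 | Y \<Rightarrow> t12)" for x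
  have g\<Phi>: "group_like \<Phi>" unfolding \<Phi>_def by (rule zcoeff_group_like[OF g alg])
  have fin: "finite (UNIV :: xy set)"
  proof -
    have "UNIV = {X, Y}" using xy.exhaust by auto
    then show ?thesis by (metis finite.emptyI finite.insertI)
  qed
  have s_lie: "s x \<in> lie_series UNIV (\<lambda>_. 1)" for x
    using t01_f2 t12_f2 unfolding f2_def s_def by (cases x) simp_all
  have ad: "subst_adapted (\<lambda>_. 1) s"
    by (intro subst_adapted_const fin allI primitiveD(1) lie_series_primitive[OF s_lie])
  have inv: "nc_inverse (nc_subst s \<Phi>) = nc_subst s (antipode \<Phi>)"
    by (rule nc_inverse_unique)
      (simp_all add: antipode_mult_left[OF g\<Phi>] antipode_mult_right[OF g\<Phi>] nc_subst_one[OF ad] flip: nc_subst_mult[OF ad])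
  have "frak_a = nc_subst s \<Phi> \<star> t01 \<star> nc_inverse (nc_subst s \<Phi>)"
    unfolding frak_a_def Let_def \<Phi>_def s_def[abs_def] zcoeff_def Phi_KZ_bar_def ..
  also have "t01 = nc_subst s (letter X)" by (simp add: nc_subst_letter[OF ad] s_def)
  finally have fa: "frak_a = nc_subst s (\<Phi> \<star> letter X \<star> antipode \<Phi>)"
    unfolding inv by (simp add: nc_subst_mult[OF ad])
  have "primitive (\<Phi> \<star> letter X \<star> antipode \<Phi>)" by (rule primitive_conj[OF g\<Phi> primitive_letter])
  then have "\<Phi> \<star> letter X \<star> antipode \<Phi> \<in> lie_series UNIV (\<lambda>_. 1)"
    unfolding lie_series_def using primitive_hom_part_lie[OF fin] by blast
  then show "frak_a \<in> f2" unfolding fa f2_def by (rule nc_subst_lie_series[OF fin _ s_lie])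
  define h where "h = letter Y \<star> (\<Phi> \<star> (letter X \<star> antipode \<Phi>)) - letter Y \<star> letter X"
  have "cyc h = 0"
  proof
    fix w
    note algs = mzv_algebra_nc_mult mzv_algebra_antipode mzv_algebra_letter alg
    let ?k = "letter Y \<star> (Phi_KZ \<star> (letter X \<star> antipode Phi_KZ))" and ?l = "letter Y \<star> letter X :: (xy, complex) series"
    have ka: "?k w \<in> mzv_algebra" "?l w \<in> mzv_algebra" for w by (intro algs)+
    have k: "(\<lambda>w. zcoeff (?k w)) = letter Y \<star> (\<Phi> \<star> (letter X \<star> antipode \<Phi>))"
      unfolding \<Phi>_def by (simp add: zcoeff_nc_mult zcoeff_antipode zcoeff_letter algs)
    have l: "(\<lambda>w. zcoeff (?l w)) = letter Y \<star> letter X"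
      by (simp add: zcoeff_nc_mult zcoeff_letter algs)
    obtain y where "y \<in> mzv_algebra" "cyc ?k w - cyc ?l w = y * (2 * pi * \<i>)\<^sup>2" using cyc_associator_mod by blast
    then have "zcoeff (cyc ?k w) = zcoeff (cyc ?l w)"
      by (intro zcoeff_eqI[of _ _ y] mzv_algebra_cyc ka)
    then show "cyc h w = 0 w" unfolding h_def cyc_diff by (simp add: zcoeff_cyc[OF ka(1)] zcoeff_cyc[OF ka(2)] k l)
  qed
  from cyc_nc_subst_zero[OF ad this]
  have "cyc (t12 \<star> frak_a - t12 \<star> t01) = 0"
    by (simp add: h_def fa nc_subst_diff[OF ad] nc_subst_mult[OF ad] nc_subst_letter[OF ad] s_def nc_mult_assoc)
  then have "cyc (t12 \<star> frak_a) = cyc (t12 \<star> t01)" by (simp add: cyc_diff)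
  then show "cyc (frak_a \<star> t12) = cyc (t01 \<star> t12)" by (simp only: cyc_mult_commute[of _ t12])
qed

theorem theorem4p7:
  fixes \<tau> :: complex
  assumes "Im \<tau> > 0"
  shows "(\<forall>d. alternal (ma d (frak_a_tau \<tau>))) \<and>
         (\<forall>d. \<forall>r>1. push_neutral r (dar_inv (ma d (frak_a_tau \<tau>))))"
proof (intro conjI allI impI)
  have f: "frak_a_tau \<tau> \<in> f2" unfolding frak_a_tau_def by (rule g_aut_f2[OF frak_a_f2])
  show "alternal (ma d (frak_a_tau \<tau>))" for d
    unfolding ma_def using c_component(1)[OF f] unfolding lie_c_def by (intro alternal_ma_c lie_series_primitive)
  fix d r :: nat assume "r > 1"
  then show "push_neutral r (dar_inv (ma d (frak_a_tau \<tau>)))"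
  proof (rule push_neutral_dar_inv_ma[OF f, rotated])
    \<comment> \<open>Depth \<open>r > 1\<close> involves words with more than two letters b, which
      lie outside the support of \<open>cyc (t12 \<star> t12)\<close>.\<close>
    fix w assume "wdegB w > 2"
    then show "cyc (frak_a_tau \<tau> \<star> t12) w = 0"
      unfolding frak_a_tau_def by (intro g_aut_cyc[OF cyc_frak_a[unfolded cyc_t01_t12]]) simp
  qed
qed

end
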